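(* Let $M$ be a smooth manifold with a distribution $H\subseteq TM$. For different choices of $H$-adapted exponential maps $\exp:T_HM\to M$, the charts $\psi:T_HM\times[0,1]\to\mathbb{T}_HM$ of the parabolic tangent groupoid $\mathbb{T}_HM$ associated to them have smooth transition functions. In other words, $\mathbb{T}_HM$ has a well-defined structure of smooth manifold (with boundary), independent of the choice of $H$-adapted exponential map.
   Context: $M$ is a smooth manifold of dimension $p+q$, $H\subseteq TM$ is a distribution of rank $p$, $N=TM/H$. An $H$-coordinate chart at $m\in M$ is a coordinate chart $\phi:U\to\mathbb{R}^{p+q}$ with $\phi(m)=0$ such that the first $p$ coordinate vectors at $m$ span $H_m$. Two smooth curves $c_1,c_2$ in $M$, defined near $t=0$ and tangent to $H$ at $t=0$, satisfy $c_1\sim_Hc_2$ if $c_1(0)=c_2(0)$ and, in $H$-coordinates centered at that point, $c_1'(0)=c_2'(0)$ and $c_1''(0)-c_2''(0)\in\mathbb{R}^p\times\{0\}$ (independent of the $H$-coordinates). A class $[c]_H$ is a parabolic arrow at $c(0)$; $T_HM_m$ is the set of parabolic arrows at $m$, and $T_HM=\bigcup_mT_HM_m$. Dilations $\delta_s$ ($s>0$) on $T_HM_m$ are $\delta_s([c]_H)=[c_s]_H$, $c_s(t)=c(st)$. Given $H$-coordinates at $m$, the arrow of the curve $(th,t^2n)$ has Taylor coordinates $(h,n)\in\mathbb{R}^p\times\mathbb{R}^q$; these make $T_HM_m$ a smooth manifold (independently of the $H$-coordinates). A parabolic flow is a smooth local flow $\Phi_t$ on $M$ with $\Phi_0=\mathrm{id}$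 (no one-parameter group property required) such that $m\mapsto\frac{\partial\Phi}{\partial t}(m,0)$ is a section of $H$. $T_HM_m$ is a Lie group under $[\Phi^m]_H\ast[\Psi^m]_H=[(\Phi\circ\Psi)^m]_H$, where $\Phi,\Psi$ are parabolic flows, $\Phi^m(t)=\Phi_t(m)$, and $(\Phi\circ\Psi)_t=\Phi_t\circ\Psi_t$. $\mathrm{Lie}(T_HM_m)=T_0(T_HM_m)$ is identified with $H_m\oplus N_m$ by matching the linear coordinates induced by Taylor coordinates with those given by $\partial_1,\dots,\partial_p$ on $H_m$ and the classes of $\partial_{p+1},\dots,\partial_{p+q}$ on $N_m$ (independent of the $H$-coordinates). The total space $T_HM$ has the smooth structure transported from $H\oplus N$ by the fiberwise Lie exponential maps $H_m\oplus N_m\to T_HM_m$. An $H$-adapted exponential map is a smooth map $\exp:T_HM\to M$, with restrictions $\exp_m:T_HM_m\to M$, such that for each $v\in T_HM_m$ the curve $c(t)=\exp_m(\delta_tv)$ represents $v$, i.e. $[c]_H=v$ in $T_HM_m$ (in particular $\exp_m(0)=m$). The parabolic tangent groupoid is, as a set, the disjoint union $\mathbb{T}_HM=T_HM\sqcup\left(M\times M\times(0,1]\right)$, where $M\times M\times(0,1]$ is to be an open subset with its usual smooth structure. To an $H$-adapted exponential map one associates $\psi:T_HM\times[0,1]\to\mathbb{T}_HM$, $$\psi(m,v,t)=(\exp_m(\delta_tv),m,t)\ \ (t>0),\qquad\psi(m,v,0)=(m,v)\in T_HM_m.$$ It is used as a chart after restriction to a suitable open neighbourhood $W$ of $T_HM\times\{0\}$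 on which it is injective and, for $t>0$, a diffeomorphism onto an open subset of $M\times M\times(0,1]$; in this way $\psi$ induces a smooth structure on an open neighbourhood of $T_HM$ in $\mathbb{T}_HM$, compatible with that of $M\times M\times(0,1]$. *)

theory Defs
  imports "HOL-Analysis.Analysis"
begin

section \<open>Smooth maps between subsets of Euclidean spaces\<close>

primrec Ck_on :: "nat \<Rightarrow> 'a::euclidean_space set \<Rightarrow> ('a \<Rightarrow> 'b::euclidean_space) \<Rightarrow> bool" where
  "Ck_on 0 S f \<longleftrightarrow> continuous_on S f"
| "Ck_on (Suc k) S f \<longleftrightarrow>
     (\<exists>f'. (\<forall>x\<in>S. (f has_derivative f' x) (at x)) \<and> (\<forall>v. Ck_on k S (\<lambda>x. f' x v)))"

text \<open>On a set that is not open (here: at boundary points), smoothness means local extendability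
  to a smooth map on an open set.\<close>

definition smooth_on :: "'a::euclidean_space set \<Rightarrow> ('a \<Rightarrow> 'b::euclidean_space) \<Rightarrow> bool" where
  "smooth_on S f \<longleftrightarrow>
     (\<forall>x\<in>S. \<exists>U g. open U \<and> x \<in> U \<and> (\<forall>k. Ck_on k U g) \<and> (\<forall>y\<in>S \<inter> U. g y = f y))"


section \<open>Smooth manifolds\<close>

text \<open>A manifold is given by an atlas; its underlying set is the union of the chart domains, and
  its topology is the one generated by the charts.  Only the values of a chart on its domain
  matter.  Charts have images that are relatively open in a fixed model set \<open>K\<close>: \<open>K = UNIV\<close> for
  manifolds without boundary, and \<open>K = UNIV \<times> {0..1}\<close> for the manifolds with boundary below.\<close>

type_synonym ('a, 'e) chart = "'a set \<times> ('a \<Rightarrow> 'e)"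
type_synonym ('a, 'e) atlas = "('a, 'e) chart set"

definition points :: "('a, 'e) atlas \<Rightarrow> 'a set" where
  "points A = (\<Union>(U, \<phi>)\<in>A. U)"

definition is_chart :: "'e::euclidean_space set \<Rightarrow> ('a, 'e) chart \<Rightarrow> bool" where
  "is_chart K = (\<lambda>(U, \<phi>). inj_on \<phi> U \<and> openin (top_of_set K) (\<phi> ` U))"

definition smooth_transition ::
    "'e::euclidean_space set \<Rightarrow> ('a, 'e) chart \<Rightarrow> ('a, 'e) chart \<Rightarrow> bool" where
  "smooth_transition K = (\<lambda>(U, \<phi>) (V, \<theta>).
     openin (top_of_set K) (\<phi> ` (U \<inter> V)) \<and> smooth_on (\<phi> ` (U \<inter> V)) (\<theta> \<circ> inv_into U \<phi>))"

definition smooth_atlas :: "'e::euclidean_space set \<Rightarrow> ('a, 'e) atlas \<Rightarrow> bool" where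
  "smooth_atlas K A \<longleftrightarrow> (\<forall>c\<in>A. is_chart K c) \<and> (\<forall>c\<in>A. \<forall>d\<in>A. smooth_transition K c d)"

definition atlas_topology :: "'e::euclidean_space set \<Rightarrow> ('a, 'e) atlas \<Rightarrow> 'a topology" where
  "atlas_topology K A = topology (\<lambda>S.
     S \<subseteq> points A \<and> (\<forall>(U, \<phi>)\<in>A. openin (top_of_set K) (\<phi> ` (S \<inter> U))))"

definition smooth_manifold :: "'e::euclidean_space set \<Rightarrow> ('a, 'e) atlas \<Rightarrow> bool" where
  "smooth_manifold K A \<longleftrightarrow> smooth_atlas K A \<and>
     Hausdorff_space (atlas_topology K A) \<and> second_countable (atlas_topology K A)"

text \<open>The maximal atlas.\<close>

definition smooth_structure :: "'e::euclidean_space set \<Rightarrow> ('a, 'e) atlas \<Rightarrow> ('a, 'e) atlas" where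
  "smooth_structure K A = {c. is_chart K c \<and> fst c \<subseteq> points A \<and>
     (\<forall>d\<in>A. smooth_transition K c d \<and> smooth_transition K d c)}"

definition smooth_map ::
    "'e::euclidean_space set \<Rightarrow> ('a, 'e) atlas \<Rightarrow> 'f::euclidean_space set \<Rightarrow> ('b, 'f) atlas
      \<Rightarrow> ('a \<Rightarrow> 'b) \<Rightarrow> bool" where
  "smooth_map K A L B f \<longleftrightarrow>
     continuous_map (atlas_topology K A) (atlas_topology L B) f \<and>
     (\<forall>(U, \<phi>)\<in>A. \<forall>(V, \<theta>)\<in>B. smooth_on (\<phi> ` (U \<inter> f -` V)) (\<theta> \<circ> f \<circ> inv_into U \<phi>))"

definition diffeomorphism ::
    "'e::euclidean_space set \<Rightarrow> ('a, 'e) atlas \<Rightarrow> 'f::euclidean_space set \<Rightarrow> ('b, 'f) atlas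
      \<Rightarrow> ('a \<Rightarrow> 'b) \<Rightarrow> bool" where
  "diffeomorphism K A L B f \<longleftrightarrow> bij_betw f (points A) (points B) \<and>
     smooth_map K A L B f \<and> smooth_map L B K A (inv_into (points A) f)"

definition sub_atlas :: "('a, 'e) atlas \<Rightarrow> 'a set \<Rightarrow> ('a, 'e) atlas" where
  "sub_atlas A S = (\<lambda>(U, \<phi>). (U \<inter> S, \<phi>)) ` A"

definition prod_atlas :: "('a, 'e) atlas \<Rightarrow> ('b, 'f) atlas \<Rightarrow> ('a \<times> 'b, 'e \<times> 'f) atlas" where
  "prod_atlas A B = {(U \<times> V, map_prod \<phi> \<theta>) |U \<phi> V \<theta>. (U, \<phi>) \<in> A \<and> (V, \<theta>) \<in> B}"

definition interval_atlas :: "real set \<Rightarrow> (real, real) atlas" where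
  "interval_atlas J = {(J, \<lambda>t. t)}"

text \<open>Transport of an atlas along a map that is injective on the chart domains.\<close>

definition transport :: "('a \<Rightarrow> 'b) \<Rightarrow> ('a, 'e) atlas \<Rightarrow> ('b, 'e) atlas" where
  "transport f A = (\<lambda>(U, \<phi>). (f ` U, \<phi> \<circ> inv_into U f)) ` A"


section \<open>Tangent vectors and distributions\<close>

text \<open>Curves defined near \<open>0\<close> are represented by total functions, of which only the germ at \<open>0\<close>
  matters.\<close>

type_synonym 'm curve = "real \<Rightarrow> 'm"

definition smooth_curve :: "('m, 'e::euclidean_space) atlas \<Rightarrow> 'm curve \<Rightarrow> bool" where
  "smooth_curve M c \<longleftrightarrow>
     (\<exists>(U, \<phi>)\<in>M. \<exists>\<epsilon>>0. c ` {-\<epsilon><..<\<epsilon>} \<subseteq> U \<and> smooth_on {-\<epsilon><..<\<epsilon>} (\<phi> \<circ> c))"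

definition velocity :: "('m \<Rightarrow> 'e::euclidean_space) \<Rightarrow> 'm curve \<Rightarrow> 'e" where
  "velocity \<phi> c = vector_derivative (\<phi> \<circ> c) (at 0)"

definition acceleration :: "('m \<Rightarrow> 'e::euclidean_space) \<Rightarrow> 'm curve \<Rightarrow> 'e" where
  "acceleration \<phi> c = vector_derivative (\<lambda>t. vector_derivative (\<phi> \<circ> c) (at t)) (at 0)"

text \<open>Tangent vectors are classes of curves with the same velocity.\<close>

type_synonym 'm tvector = "'m curve set"

definition tangent_vector :: "('m, 'e::euclidean_space) atlas \<Rightarrow> 'm curve \<Rightarrow> 'm tvector" where
  "tangent_vector M c = {c'. smooth_curve M c' \<and> c' 0 = c 0 \<and>
     (\<exists>(U, \<phi>)\<in>M. c 0 \<in> U \<and> velocity \<phi> c' = velocity \<phi> c)}"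

definition tangent_space :: "('m, 'e::euclidean_space) atlas \<Rightarrow> 'm \<Rightarrow> 'm tvector set" where
  "tangent_space M m = {tangent_vector M c |c. smooth_curve M c \<and> c 0 = m}"

text \<open>The coordinates \<open>d\<phi>\<^sub>m(X)\<close> of a tangent vector in a chart \<open>\<phi>\<close>.\<close>

definition tcoord :: "('m \<Rightarrow> 'e::euclidean_space) \<Rightarrow> 'm tvector \<Rightarrow> 'e" where
  "tcoord \<phi> X = the_elem (velocity \<phi> ` X)"

text \<open>A family \<open>F i\<close> (\<open>i \<in> J\<close>) of linearly independent smooth vector fields over a chart domain,
  in the coordinates of the chart.\<close>

definition smooth_frame ::
    "('m, 'e::euclidean_space) chart \<Rightarrow> 'd set \<Rightarrow> ('d \<Rightarrow> 'm \<Rightarrow> 'e) \<Rightarrow> bool" where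
  "smooth_frame = (\<lambda>(U, \<phi>) J F.
     (\<forall>i\<in>J. smooth_on (\<phi> ` U) (F i \<circ> inv_into U \<phi>)) \<and>
     (\<forall>y\<in>U. inj_on (\<lambda>i. F i y) J \<and> independent ((\<lambda>i. F i y) ` J)))"

text \<open>From here on \<open>\<real>\<^sup>p\<^sup>+\<^sup>q\<close> is \<open>real ^ 'd\<close>, with \<open>CARD('d) = p + q\<close>, and \<open>I :: 'd set\<close> is the set of
  the first \<open>p\<close> coordinate indices, so \<open>card I = p\<close> and \<open>card (- I) = q\<close>.\<close>

definition distribution ::
    "('m, real ^ 'd) atlas \<Rightarrow> 'd set \<Rightarrow> ('m \<Rightarrow> 'm tvector set) \<Rightarrow> bool" where
  "distribution M I H \<longleftrightarrow> (\<forall>m\<in>points M. H m \<subseteq> tangent_space M m \<and>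
     (\<exists>(U, \<phi>)\<in>smooth_structure UNIV M. \<exists>F. m \<in> U \<and> smooth_frame (U, \<phi>) I F \<and>
        (\<forall>y\<in>U. tcoord \<phi> ` H y = span ((\<lambda>i. F i y) ` I))))"

definition adapted_frame ::
    "'d set \<Rightarrow> ('m \<Rightarrow> 'm tvector set) \<Rightarrow> ('m, real ^ 'd) chart \<Rightarrow> ('d \<Rightarrow> 'm \<Rightarrow> real ^ 'd) \<Rightarrow> bool"
  where
  "adapted_frame I H = (\<lambda>(U, \<phi>) F. smooth_frame (U, \<phi>) UNIV F \<and>
     (\<forall>y\<in>U. tcoord \<phi> ` H y = span ((\<lambda>i. F i y) ` I)))"

text \<open>\<open>\<real>\<^sup>p \<times> {0}\<close>\<close>

definition horizontal :: "'d set \<Rightarrow> (real ^ 'd) set" where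
  "horizontal I = span ((\<lambda>i. axis i 1) ` I)"

definition H_chart ::
    "('m, real ^ 'd) atlas \<Rightarrow> 'd set \<Rightarrow> ('m \<Rightarrow> 'm tvector set) \<Rightarrow> 'm \<Rightarrow> ('m, real ^ 'd) chart \<Rightarrow> bool"
  where
  "H_chart M I H m = (\<lambda>(U, \<phi>). (U, \<phi>) \<in> smooth_structure UNIV M \<and> m \<in> U \<and> \<phi> m = 0 \<and>
     tcoord \<phi> ` H m = horizontal I)"


section \<open>Parabolic arrows\<close>

type_synonym 'm arrow = "'m curve set"

definition parabolic_curve ::
    "('m, real ^ 'd) atlas \<Rightarrow> ('m \<Rightarrow> 'm tvector set) \<Rightarrow> 'm curve \<Rightarrow> bool" where
  "parabolic_curve M H c \<longleftrightarrow> smooth_curve M c \<and> tangent_vector M c \<in> H (c 0)"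

definition arrow_equiv ::
    "('m, real ^ 'd) atlas \<Rightarrow> 'd set \<Rightarrow> ('m \<Rightarrow> 'm tvector set) \<Rightarrow> 'm curve \<Rightarrow> 'm curve \<Rightarrow> bool"
  where
  "arrow_equiv M I H c1 c2 \<longleftrightarrow>
     parabolic_curve M H c1 \<and> parabolic_curve M H c2 \<and> c1 0 = c2 0 \<and>
     (\<exists>U \<phi>. H_chart M I H (c1 0) (U, \<phi>) \<and> velocity \<phi> c1 = velocity \<phi> c2 \<and>
        acceleration \<phi> c1 - acceleration \<phi> c2 \<in> horizontal I)"

definition arrow ::
    "('m, real ^ 'd) atlas \<Rightarrow> 'd set \<Rightarrow> ('m \<Rightarrow> 'm tvector set) \<Rightarrow> 'm curve \<Rightarrow> 'm arrow" where
  "arrow M I H c = {c'. arrow_equiv M I H c c'}"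

definition THM_at ::
    "('m, real ^ 'd) atlas \<Rightarrow> 'd set \<Rightarrow> ('m \<Rightarrow> 'm tvector set) \<Rightarrow> 'm \<Rightarrow> 'm arrow set" where
  "THM_at M I H m = {arrow M I H c |c. parabolic_curve M H c \<and> c 0 = m}"

definition THM ::
    "('m, real ^ 'd) atlas \<Rightarrow> 'd set \<Rightarrow> ('m \<Rightarrow> 'm tvector set) \<Rightarrow> 'm arrow set" where
  "THM M I H = (\<Union>m\<in>points M. THM_at M I H m)"

definition base_point :: "'m arrow \<Rightarrow> 'm" where
  "base_point v = the_elem ((\<lambda>c. c 0) ` v)"

text \<open>The formula is used for all real \<open>s\<close>, so that \<open>t \<mapsto> \<delta>\<^sub>t v\<close> is defined on a
  two-sided neighbourhood of \<open>0\<close>.\<close>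

definition dilation ::
    "('m, real ^ 'd) atlas \<Rightarrow> 'd set \<Rightarrow> ('m \<Rightarrow> 'm tvector set) \<Rightarrow> real \<Rightarrow> 'm arrow \<Rightarrow> 'm arrow"
  where
  "dilation M I H s v = the_elem ((\<lambda>c. arrow M I H (\<lambda>t. c (s * t))) ` v)"

text \<open>A pair \<open>(h, n) \<in> \<real>\<^sup>p \<times> \<real>\<^sup>q\<close> is the vector with components \<open>h\<close> on \<open>I\<close> and \<open>n\<close> on \<open>- I\<close>;
  the curve below is \<open>(t h, t\<^sup>2 n)\<close>.\<close>

definition taylor_arrow ::
    "('m, real ^ 'd) atlas \<Rightarrow> 'd set \<Rightarrow> ('m \<Rightarrow> 'm tvector set) \<Rightarrow> ('m, real ^ 'd) chart
      \<Rightarrow> real ^ 'd \<Rightarrow> 'm arrow" where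
  "taylor_arrow M I H = (\<lambda>(U, \<phi>) w.
     arrow M I H (\<lambda>t. inv_into U \<phi> (\<chi> i. if i \<in> I then t * w $ i else t\<^sup>2 * w $ i)))"

definition taylor_coord ::
    "('m, real ^ 'd) atlas \<Rightarrow> 'd set \<Rightarrow> ('m \<Rightarrow> 'm tvector set) \<Rightarrow> ('m, real ^ 'd) chart
      \<Rightarrow> 'm arrow \<Rightarrow> real ^ 'd" where
  "taylor_coord M I H c = inv (taylor_arrow M I H c)"


section \<open>The group of parabolic arrows and its exponential map\<close>

definition parabolic_flow ::
    "('m, real ^ 'd) atlas \<Rightarrow> ('m \<Rightarrow> 'm tvector set) \<Rightarrow> (real \<Rightarrow> 'm \<Rightarrow> 'm) \<Rightarrow> bool" where
  "parabolic_flow M H \<Phi> \<longleftrightarrow>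
     (let A = prod_atlas M (interval_atlas UNIV) in
      \<exists>D. openin (atlas_topology UNIV A) D \<and> points M \<times> {0} \<subseteq> D \<and>
        smooth_map UNIV (sub_atlas A D) UNIV M (\<lambda>(m, t). \<Phi> t m)) \<and>
     (\<forall>m\<in>points M. \<Phi> 0 m = m \<and> tangent_vector M (\<lambda>t. \<Phi> t m) \<in> H m)"

definition arrow_mult ::
    "('m, real ^ 'd) atlas \<Rightarrow> 'd set \<Rightarrow> ('m \<Rightarrow> 'm tvector set) \<Rightarrow> 'm \<Rightarrow> 'm arrow \<Rightarrow> 'm arrow
      \<Rightarrow> 'm arrow" where
  "arrow_mult M I H m v w = (THE u. \<exists>\<Phi> \<Psi>. parabolic_flow M H \<Phi> \<and> parabolic_flow M H \<Psi> \<and>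
     v = arrow M I H (\<lambda>t. \<Phi> t m) \<and> w = arrow M I H (\<lambda>t. \<Psi> t m) \<and>
     u = arrow M I H (\<lambda>t. \<Phi> t (\<Psi> t m)))"

text \<open>The fibre \<open>N\<^sub>m = T\<^sub>mM / H\<^sub>m\<close>; its elements are cosets of \<open>H\<^sub>m\<close>.\<close>

definition normal_space ::
    "('m, real ^ 'd) atlas \<Rightarrow> ('m \<Rightarrow> 'm tvector set) \<Rightarrow> 'm \<Rightarrow> 'm tvector set set" where
  "normal_space M H m = tangent_space M m //
     {(X, Y). X \<in> tangent_space M m \<and> Y \<in> tangent_space M m \<and>
        (\<exists>(U, \<phi>)\<in>M. m \<in> U \<and> tcoord \<phi> X - tcoord \<phi> Y \<in> tcoord \<phi> ` H m)}"

text \<open>The linear coordinates \<open>a\<close> on \<open>H\<^sub>m \<oplus> N\<^sub>m\<close> given by a basis \<open>b\<close> of \<open>T\<^sub>mM\<close> (expressed in the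
  chart \<open>\<phi>\<close>) whose members with index in \<open>I\<close> span \<open>H\<^sub>m\<close>: \<open>X = (\<Sum>i\<in>I. a\<^sub>i b\<^sub>i)\<close>, and \<open>Y\<close> is the
  class of \<open>(\<Sum>i\<in>- I. a\<^sub>i b\<^sub>i)\<close>.\<close>

definition HN_coord ::
    "'d set \<Rightarrow> ('m \<Rightarrow> real ^ 'd) \<Rightarrow> ('d \<Rightarrow> real ^ 'd) \<Rightarrow> 'm tvector \<times> 'm tvector set \<Rightarrow> real ^ 'd"
  where
  "HN_coord I \<phi> b = (\<lambda>(X, Y). THE a. tcoord \<phi> X = (\<Sum>i\<in>I. (a $ i) *\<^sub>R b i) \<and>
     (\<exists>Z\<in>Y. tcoord \<phi> Z = (\<Sum>i\<in>- I. (a $ i) *\<^sub>R b i)))"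

definition HN_atlas ::
    "('m, real ^ 'd) atlas \<Rightarrow> 'd set \<Rightarrow> ('m \<Rightarrow> 'm tvector set)
      \<Rightarrow> ('m \<times> 'm tvector \<times> 'm tvector set, (real ^ 'd) \<times> (real ^ 'd)) atlas" where
  "HN_atlas M I H =
     {({(m, X, Y). m \<in> U \<and> X \<in> H m \<and> Y \<in> normal_space M H m},
       \<lambda>(m, X, Y). (\<phi> m, HN_coord I \<phi> (\<lambda>i. F i m) (X, Y))) |U \<phi> F.
      (U, \<phi>) \<in> smooth_structure UNIV M \<and> adapted_frame I H (U, \<phi>) F}"

text \<open>The Lie exponential of \<open>(X, Y) \<in> H\<^sub>m \<oplus> N\<^sub>m\<close>: the value at \<open>1\<close> of the smooth one-parameter
  subgroup \<open>\<gamma>\<close> whose derivative at \<open>0\<close>, in the Taylor coordinates of an \<open>H\<close>-chart, agrees with the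
  coordinates of \<open>(X, Y)\<close> for the coordinate basis of that chart.\<close>

definition lie_exp ::
    "('m, real ^ 'd) atlas \<Rightarrow> 'd set \<Rightarrow> ('m \<Rightarrow> 'm tvector set)
      \<Rightarrow> 'm \<times> 'm tvector \<times> 'm tvector set \<Rightarrow> 'm arrow" where
  "lie_exp M I H = (\<lambda>(m, X, Y). THE v. \<exists>\<gamma> U \<phi>. H_chart M I H m (U, \<phi>) \<and>
     (\<forall>s. \<gamma> s \<in> THM_at M I H m) \<and>
     (\<forall>s t. \<gamma> (s + t) = arrow_mult M I H m (\<gamma> s) (\<gamma> t)) \<and>
     smooth_on UNIV (taylor_coord M I H (U, \<phi>) \<circ> \<gamma>) \<and>
     vector_derivative (taylor_coord M I H (U, \<phi>) \<circ> \<gamma>) (at (0::real)) =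
       HN_coord I \<phi> (\<lambda>i. axis i 1) (X, Y) \<and>
     v = \<gamma> 1)"

definition THM_atlas ::
    "('m, real ^ 'd) atlas \<Rightarrow> 'd set \<Rightarrow> ('m \<Rightarrow> 'm tvector set)
      \<Rightarrow> ('m arrow, (real ^ 'd) \<times> (real ^ 'd)) atlas" where
  "THM_atlas M I H = transport (lie_exp M I H) (HN_atlas M I H)"

definition adapted_exp ::
    "('m, real ^ 'd) atlas \<Rightarrow> 'd set \<Rightarrow> ('m \<Rightarrow> 'm tvector set) \<Rightarrow> ('m arrow \<Rightarrow> 'm) \<Rightarrow> bool" where
  "adapted_exp M I H e \<longleftrightarrow> smooth_map UNIV (THM_atlas M I H) UNIV M e \<and>
     (\<forall>v\<in>THM M I H. arrow M I H (\<lambda>t. e (dilation M I H t v)) = v)"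


section \<open>The parabolic tangent groupoid\<close>

abbreviation bd_model :: "(((real ^ 'd) \<times> (real ^ 'd)) \<times> real) set" where
  "bd_model \<equiv> UNIV \<times> {0..1}"

definition THM_interval ::
    "('m, real ^ 'd) atlas \<Rightarrow> 'd set \<Rightarrow> ('m \<Rightarrow> 'm tvector set)
      \<Rightarrow> ('m arrow \<times> real, ((real ^ 'd) \<times> (real ^ 'd)) \<times> real) atlas" where
  "THM_interval M I H = prod_atlas (THM_atlas M I H) (interval_atlas {0..1})"

definition pair_interval ::
    "('m, real ^ 'd) atlas \<Rightarrow> (('m \<times> 'm) \<times> real, ((real ^ 'd) \<times> (real ^ 'd)) \<times> real) atlas" where
  "pair_interval M = prod_atlas (prod_atlas M M) (interval_atlas {0<..1})"

definition tangent_groupoid ::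
    "('m, real ^ 'd) atlas \<Rightarrow> 'd set \<Rightarrow> ('m \<Rightarrow> 'm tvector set)
      \<Rightarrow> ('m arrow + ('m \<times> 'm) \<times> real) set" where
  "tangent_groupoid M I H = THM M I H <+> ((points M \<times> points M) \<times> {0<..1})"

definition psi_pos ::
    "('m, real ^ 'd) atlas \<Rightarrow> 'd set \<Rightarrow> ('m \<Rightarrow> 'm tvector set) \<Rightarrow> ('m arrow \<Rightarrow> 'm)
      \<Rightarrow> 'm arrow \<times> real \<Rightarrow> ('m \<times> 'm) \<times> real" where
  "psi_pos M I H e = (\<lambda>(v, t). ((e (dilation M I H t v), base_point v), t))"

definition psi ::
    "('m, real ^ 'd) atlas \<Rightarrow> 'd set \<Rightarrow> ('m \<Rightarrow> 'm tvector set) \<Rightarrow> ('m arrow \<Rightarrow> 'm)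
      \<Rightarrow> 'm arrow \<times> real \<Rightarrow> 'm arrow + ('m \<times> 'm) \<times> real" where
  "psi M I H e = (\<lambda>(v, t). if t = 0 then Inl v else Inr (psi_pos M I H e (v, t)))"

text \<open>The neighbourhoods \<open>W\<close> of \<open>T\<^sub>HM \<times> {0}\<close> on which \<open>\<psi>\<close> is used as a chart.\<close>

definition psi_domain ::
    "('m, real ^ 'd) atlas \<Rightarrow> 'd set \<Rightarrow> ('m \<Rightarrow> 'm tvector set) \<Rightarrow> ('m arrow \<Rightarrow> 'm)
      \<Rightarrow> ('m arrow \<times> real) set \<Rightarrow> bool" where
  "psi_domain M I H e W \<longleftrightarrow>
     openin (atlas_topology bd_model (THM_interval M I H)) W \<and> THM M I H \<times> {0} \<subseteq> W \<and>
     inj_on (psi M I H e) W \<and>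
     (let W' = {(v, t) \<in> W. t > 0}; V = psi_pos M I H e ` W' in
        openin (atlas_topology bd_model (pair_interval M)) V \<and>
        diffeomorphism bd_model (sub_atlas (THM_interval M I H) W')
          bd_model (sub_atlas (pair_interval M) V) (psi_pos M I H e))"

text \<open>The structure on the tangent groupoid determined by \<open>\<psi>\<close> on \<open>W\<close>: the usual charts of
  \<open>M \<times> M \<times> (0,1]\<close> together with those that make \<open>\<psi>\<close> a diffeomorphism from \<open>W\<close> onto an open
  subset.\<close>

definition groupoid_atlas ::
    "('m, real ^ 'd) atlas \<Rightarrow> 'd set \<Rightarrow> ('m \<Rightarrow> 'm tvector set) \<Rightarrow> ('m arrow \<Rightarrow> 'm)
      \<Rightarrow> ('m arrow \<times> real) set
      \<Rightarrow> ('m arrow + ('m \<times> 'm) \<times> real, ((real ^ 'd) \<times> (real ^ 'd)) \<times> real) atlas" where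
  "groupoid_atlas M I H e W =
     transport Inr (pair_interval M) \<union>
     transport (psi M I H e) (sub_atlas (THM_interval M I H) W)"

end

theory Submission
  imports Defs
begin

text \<open>For \<open>t > 0\<close> both charts are diffeomorphisms onto open subsets of \<open>M \<times> M \<times> (0,1]\<close>, so the transition
function between them is smooth there.  Everything depends on what happens at \<open>t = 0\<close>, where the two
exponential maps are only known to represent the same arrows, that is, to agree to second order along the
curves \<open>t \<mapsto> \<delta>\<^sub>t v\<close>, and in the second order only modulo \<open>H\<close>.

Coordinates on \<open>T\<^sub>HM\<close>.  Let \<open>(U, \<phi>)\<close> be a chart of \<open>M\<close> and \<open>F\<close> a frame over \<open>U\<close> whose members with index in
\<open>I\<close> span \<open>H\<close>.  An arrow at \<open>m\<close> is given by the velocity and the acceleration of a curve, the latter modulo \<open>H\<close>;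
this does not depend on the chart (\<open>second_order_contact_change\<close>).  Composing flows in coordinates shows that
the product adds velocities, and adds accelerations up to a term that is bilinear in the velocities
(\<open>flow_composition\<close>, \<open>arrow_mult_coord_arrow\<close>).  Hence one-parameter subgroups are quadratic in the parameter
(\<open>one_parameter_subgroup_unique\<close>, \<open>one_parameter_subgroup_exists\<close>), and the Lie exponential of the
vector with components \<open>a\<close> is an explicit arrow \<open>exp_arrow U \<phi> F m a\<close> (\<open>lie_exp_eq\<close>).  The charts
of \<open>T\<^sub>HM\<close> assign \<open>(\<phi> m, a)\<close> to it, and in them \<open>\<delta>\<^sub>t\<close> multiplies the horizontal part of \<open>a\<close> by
\<open>t\<close> and the normal part by \<open>t\<^sup>2\<close> (\<open>dilation_exp_arrow\<close>).

The transition function.  In these coordinates an adapted exponential map is a smooth family of maps \<open>E\<^sub>m\<close>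
from a neighbourhood of \<open>0\<close> in \<open>\<real>\<^sup>p\<^sup>+\<^sup>q\<close> to \<open>M\<close>.  Since \<open>t \<mapsto> E\<^sub>m (\<delta>\<^sub>t a)\<close> represents the arrow with coordinates
\<open>a\<close>, the derivative of \<open>E\<^sub>m\<close> at \<open>0\<close> is invertible (\<open>fibre_derivative_horizontal\<close>).  Given two such maps \<open>E\<close>
and \<open>E'\<close>, put \<open>f = E'\<^sub>m\<inverse> (E\<^sub>m (\<delta>\<^sub>t a))\<close>; the transition function sends \<open>(m, a, t)\<close> to \<open>(m, \<nu>, t)\<close> with
\<open>\<delta>\<^sub>t \<nu> = f\<close>, so \<open>\<nu>\<close> consists of the horizontal part of \<open>f\<close> divided by \<open>t\<close> and the normal part divided by
\<open>t\<^sup>2\<close>.  Because \<open>E\<close> and \<open>E'\<close> represent the same arrows, \<open>f\<close> is \<open>\<delta>\<^sub>t a\<close> up to \<open>O(t\<^sup>2)\<close> in horizontal and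
\<open>O(t\<^sup>3)\<close> in normal directions.  A smooth function that vanishes at \<open>t = 0\<close> is \<open>t\<close> times a smooth function
(\<open>open_smooth_divide_by_variable\<close>); applied once to \<open>f\<close> and once more to the normal part of the quotient, this
shows that \<open>\<nu>\<close> extends smoothly across \<open>t = 0\<close>, with value \<open>a\<close> there (\<open>exp_transition\<close>).

The remaining assertions are formal.  Atlases that are related by smooth transition functions can be glued
(\<open>smooth_atlas_glue\<close>, \<open>diffeomorphism_glue\<close>), which yields the smooth structure on the groupoid and its
independence of the exponential map; a point of \<open>T\<^sub>HM\<close> and a point of \<open>M \<times> M \<times> (0,1]\<close> are separated by their
values of \<open>t\<close> (\<open>Hausdorff_groupoid\<close>).\<close>

section \<open>Calculus of smooth maps on open sets\<close>

lemma Ck_on_subset: "Ck_on k S f \<Longrightarrow> T \<subseteq> S \<Longrightarrow> Ck_on k T f"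
proof (induction k arbitrary: f)
  case 0 then show ?case using continuous_on_subset by auto
next
  case (Suc k) then show ?case by (simp only: Ck_on.simps) blast
qed

lemma Ck_on_SucI:
  assumes "\<And>x. x \<in> S \<Longrightarrow> (f has_derivative f' x) (at x)" "\<And>v. Ck_on k S (\<lambda>x. f' x v)"
  shows "Ck_on (Suc k) S f"
  unfolding Ck_on.simps by (intro exI[of _ f'] conjI ballI allI assms)

lemma Ck_on_cong:
  assumes "open S" "\<And>x. x \<in> S \<Longrightarrow> f x = g x" "Ck_on k S f"
  shows "Ck_on k S g"
  using assms
proof (cases k)
  case 0 then show ?thesis using assms by (simp cong: continuous_on_cong)
next
  case (Suc j)
  with assms(3) obtain f' where f': "\<And>x. x\<in>S \<Longrightarrow> (f has_derivative f' x) (at x)"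
     "\<And>v. Ck_on j S (\<lambda>x. f' x v)" by auto
  have "(g has_derivative f' x) (at x)" if "x \<in> S" for x
    using has_derivative_transform_within_open[OF f'(1)[OF that] assms(1) that] assms(2) by auto
  then show ?thesis using f'(2) Suc by auto
qed

text \<open>The derivative in \<open>Ck_on\<close> is existentially quantified.  Choosing \<open>frechet_derivative\<close> makes the
  derivatives belonging to different open sets agree, which is what local arguments require.\<close>

lemma Ck_on_Suc_frechet:
  assumes "open S"
  shows "Ck_on (Suc k) S f \<longleftrightarrow>
    (\<forall>x\<in>S. (f has_derivative frechet_derivative f (at x)) (at x)) \<and>
    (\<forall>v. Ck_on k S (\<lambda>x. frechet_derivative f (at x) v))"
proof
  assume "Ck_on (Suc k) S f"
  then obtain f' where f': "\<And>x. x\<in>S \<Longrightarrow> (f has_derivative f' x) (at x)"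
     "\<And>v. Ck_on k S (\<lambda>x. f' x v)" by auto
  have eq: "f' x = frechet_derivative f (at x)" if "x \<in> S" for x
    using f'(1)[OF that] by (rule frechet_derivative_at)
  have "Ck_on k S (\<lambda>x. frechet_derivative f (at x) v)" for v
    by (rule Ck_on_cong[OF assms _ f'(2)[of v]]) (simp add: eq)
  then show "(\<forall>x\<in>S. (f has_derivative frechet_derivative f (at x)) (at x)) \<and>
    (\<forall>v. Ck_on k S (\<lambda>x. frechet_derivative f (at x) v))" using f'(1) eq by auto
qed auto

lemma Ck_on_SucD: "Ck_on (Suc k) S f \<Longrightarrow> Ck_on k S f"
proof (induction k arbitrary: f)
  case 0
  then obtain f' where "\<And>x. x \<in> S \<Longrightarrow> (f has_derivative f' x) (at x)" by auto
  then have "\<And>x. x \<in> S \<Longrightarrow> (f has_derivative f' x) (at x within S)"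
    using has_derivative_at_withinI by blast
  then have "continuous_on S f" by (rule has_derivative_continuous_on)
  then show ?case by simp
next
  case (Suc k)
  from Suc.prems obtain f' where f': "\<forall>x\<in>S. (f has_derivative f' x) (at x)"
     "\<And>v. Ck_on (Suc k) S (\<lambda>x. f' x v)" by auto
  have "\<And>v. Ck_on k S (\<lambda>x. f' x v)" by (rule Suc.IH[OF f'(2)])
  with f'(1) show ?case by auto
qed

lemma Ck_on_continuous_on: "Ck_on k S f \<Longrightarrow> continuous_on S f"
  by (induction k) (auto simp del: Ck_on.simps(2) dest: Ck_on_SucD)

lemma Ck_on_local:
  assumes "\<And>x. x \<in> S \<Longrightarrow> \<exists>T. open T \<and> x \<in> T \<and> Ck_on k T f"
  shows "Ck_on k S f"
  using assms
proof (induction k arbitrary: f)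
  case 0
  show ?case
  proof -
    have "continuous (at x) f" if x: "x \<in> S" for x
    proof -
      obtain T where "open T" "x \<in> T" "continuous_on T f" using 0[OF x] by auto
      then show ?thesis by (simp add: continuous_on_eq_continuous_at)
    qed
    then show ?thesis by (simp add: continuous_at_imp_continuous_on)
  qed
next
  case (Suc k)
  have *: "\<exists>T. open T \<and> x \<in> T \<and> (\<forall>x\<in>T. (f has_derivative frechet_derivative f (at x)) (at x)) \<and>
    (\<forall>v. Ck_on k T (\<lambda>x. frechet_derivative f (at x) v))" if "x \<in> S" for x
  proof -
    obtain T where T: "open T" "x \<in> T" "Ck_on (Suc k) T f" using Suc.prems[OF \<open>x \<in> S\<close>] by (elim exE conjE)
    show ?thesis using T(1,2) T(3)[unfolded Ck_on_Suc_frechet[OF T(1)]] by (intro exI[of _ T] conjI) simp_all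
  qed
  show ?case unfolding Ck_on.simps
  proof (intro exI conjI allI ballI)
    show "(f has_derivative frechet_derivative f (at x)) (at x)" if "x \<in> S" for x
      using *[OF that] by blast
    show "Ck_on k S (\<lambda>x. frechet_derivative f (at x) v)" for v
      by (rule Suc.IH) (use * in blast)
  qed
qed

lemma Ck_on_const: "Ck_on k S (\<lambda>x. c)"
proof (induction k arbitrary: c)
  case (Suc k)
  have "\<forall>x\<in>S. ((\<lambda>x. c) has_derivative (\<lambda>v. 0)) (at x)" by simp
  with Suc show ?case unfolding Ck_on.simps by (intro exI[of _ "\<lambda>x v. 0"]) simp
qed simp

lemma Ck_on_linear: assumes "bounded_linear L" shows "Ck_on k S L"
proof (cases k)
  case 0 then show ?thesis using assms by (simp add: linear_continuous_on)
next
  case (Suc j)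
  have "\<forall>x\<in>S. (L has_derivative L) (at x)" using assms by (simp add: bounded_linear_imp_has_derivative)
  then show ?thesis using Suc Ck_on_const unfolding Suc Ck_on.simps by (auto intro!: exI[of _ "\<lambda>x. L"])
qed

lemma Ck_on_add: "Ck_on k S f \<Longrightarrow> Ck_on k S g \<Longrightarrow> Ck_on k S (\<lambda>x. f x + g x)"
proof (induction k arbitrary: f g)
  case 0 then show ?case by (auto intro: continuous_on_add)
next
  case (Suc k)
  obtain f' g' where f': "\<forall>x\<in>S. (f has_derivative f' x) (at x)" "\<And>v. Ck_on k S (\<lambda>x. f' x v)"
   and g': "\<forall>x\<in>S. (g has_derivative g' x) (at x)" "\<And>v. Ck_on k S (\<lambda>x. g' x v)"
    using Suc.prems by auto
  show ?case unfolding Ck_on.simps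
    by (rule exI[of _ "\<lambda>x v. f' x v + g' x v"]) (use f' g' Suc.IH in \<open>auto intro: has_derivative_add\<close>)
qed

lemma Ck_on_sum: "(\<And>i. i \<in> J \<Longrightarrow> Ck_on k S (f i)) \<Longrightarrow> Ck_on k S (\<lambda>x. \<Sum>i\<in>J. f i x)"
proof (induction J rule: infinite_finite_induct)
  case (insert i J)
  then have "Ck_on k S (\<lambda>x. f i x + (\<Sum>i\<in>J. f i x))" by (intro Ck_on_add) auto
  then show ?case using insert by simp
qed (simp_all add: Ck_on_const)

lemma Ck_on_bilinear:
  assumes "bounded_bilinear B"
  shows "Ck_on k S f \<Longrightarrow> Ck_on k S g \<Longrightarrow> Ck_on k S (\<lambda>x. B (f x) (g x))"
proof (induction k arbitrary: f g)
  case 0 then show ?case by (auto intro: bounded_bilinear.continuous_on[OF assms])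
next
  case (Suc k)
  obtain f' g' where f': "\<forall>x\<in>S. (f has_derivative f' x) (at x)" "\<And>v. Ck_on k S (\<lambda>x. f' x v)"
   and g': "\<forall>x\<in>S. (g has_derivative g' x) (at x)" "\<And>v. Ck_on k S (\<lambda>x. g' x v)"
    using Suc.prems by auto
  have "Ck_on k S f" "Ck_on k S g" using Suc.prems Ck_on_SucD by auto
  then show ?case unfolding Ck_on.simps
    by (intro exI[of _ "\<lambda>x v. B (f x) (g' x v) + B (f' x v) (g x)"])
     (use f' g' Suc.IH in \<open>auto intro!: Ck_on_add bounded_bilinear.FDERIV[OF assms]\<close>)
qed

text \<open>The chain rule is expanded in the standard basis, since the induction hypothesis speaks about
  derivatives in a fixed direction, whereas the direction \<open>f' x v\<close> depends on \<open>x\<close>.\<close>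

lemma Ck_on_compose:
  "Ck_on k S f \<Longrightarrow> Ck_on k T g \<Longrightarrow> f ` S \<subseteq> T \<Longrightarrow> Ck_on k S (\<lambda>x. g (f x))"
proof (induction k arbitrary: g)
  case 0 then show ?case by (auto intro: continuous_on_compose2)
next
  case (Suc k)
  obtain f' g' where f': "\<forall>x\<in>S. (f has_derivative f' x) (at x)" "\<And>v. Ck_on k S (\<lambda>x. f' x v)"
   and g': "\<forall>x\<in>T. (g has_derivative g' x) (at x)" "\<And>v. Ck_on k T (\<lambda>x. g' x v)"
    using Suc.prems by auto
  have fk: "Ck_on k S f" by (rule Ck_on_SucD[OF Suc.prems(1)])
  have lin: "linear (g' (f x))" if "x \<in> S" for x
    using g'(1) that Suc.prems(3) has_derivative_linear by blast
  have "((\<lambda>x. g (f x)) has_derivative (\<lambda>v. \<Sum>b\<in>Basis. (f' x v \<bullet> b) *\<^sub>R g' (f x) b)) (at x)"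
    if x: "x \<in> S" for x
  proof -
    have "f x \<in> T" using x Suc.prems(3) by auto
    then have "((\<lambda>x. g (f x)) has_derivative (\<lambda>v. g' (f x) (f' x v))) (at x)"
      using has_derivative_compose[of f "f' x" x UNIV g "g' (f x)"] f'(1) g'(1) x by auto
    moreover have "g' (f x) (f' x v) = (\<Sum>b\<in>Basis. (f' x v \<bullet> b) *\<^sub>R g' (f x) b)" for v
    proof -
      have "g' (f x) (f' x v) = g' (f x) (\<Sum>b\<in>Basis. (f' x v \<bullet> b) *\<^sub>R b)"
        by (simp add: euclidean_representation)
      also have "\<dots> = (\<Sum>b\<in>Basis. (f' x v \<bullet> b) *\<^sub>R g' (f x) b)"
        using lin[OF x] by (simp add: linear_sum linear_scale o_def)
      finally show ?thesis .
    qed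
    ultimately show ?thesis by simp
  qed
  moreover have "Ck_on k S (\<lambda>x. \<Sum>b\<in>Basis. (f' x v \<bullet> b) *\<^sub>R g' (f x) b)" for v
  proof (intro Ck_on_sum Ck_on_bilinear[OF bounded_bilinear_scaleR])
    fix b
    show "Ck_on k S (\<lambda>x. f' x v \<bullet> b)"
      by (intro Ck_on_bilinear[OF bounded_bilinear_inner] f' Ck_on_const)
    show "Ck_on k S (\<lambda>x. g' (f x) b)"
      by (rule Suc.IH[OF fk g'(2) Suc.prems(3)])
  qed
  ultimately show ?case by (rule Ck_on_SucI)
qed

text \<open>On open sets this agrees with \<open>smooth_on\<close>, but it involves no local extensions.\<close>

definition open_smooth :: "'a::euclidean_space set \<Rightarrow> ('a \<Rightarrow> 'b::euclidean_space) \<Rightarrow> bool" where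
  "open_smooth S f \<longleftrightarrow> open S \<and> (\<forall>k. Ck_on k S f)"

lemma open_smooth_open: "open_smooth S f \<Longrightarrow> open S"
  by (simp add: open_smooth_def)

lemma open_smooth_subset: "open_smooth S f \<Longrightarrow> open T \<Longrightarrow> T \<subseteq> S \<Longrightarrow> open_smooth T f"
  unfolding open_smooth_def by (blast intro: Ck_on_subset)

lemma open_smooth_cong:
  "open_smooth S f \<Longrightarrow> (\<And>x. x \<in> S \<Longrightarrow> f x = g x) \<Longrightarrow> open_smooth S g"
  using Ck_on_cong unfolding open_smooth_def by blast

lemma open_smooth_local:
  assumes "\<And>x. x \<in> S \<Longrightarrow> \<exists>T. x \<in> T \<and> T \<subseteq> S \<and> open_smooth T f"
  shows "open_smooth S f"
  unfolding open_smooth_def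
proof (intro conjI allI)
  have *: "\<exists>T. open T \<and> x \<in> T \<and> T \<subseteq> S \<and> (\<forall>k. Ck_on k T f)" if "x \<in> S" for x
    using assms[OF that] unfolding open_smooth_def by auto
  then have "\<forall>x\<in>S. \<exists>T. open T \<and> x \<in> T \<and> T \<subseteq> S" by meson
  then show "open S" using open_subopen by blast
  show "Ck_on k S f" for k
  proof (rule Ck_on_local)
    fix x assume "x \<in> S"
    from *[OF this] show "\<exists>T. open T \<and> x \<in> T \<and> Ck_on k T f" by auto
  qed
qed

lemma open_smooth_const: "open S \<Longrightarrow> open_smooth S (\<lambda>x. c)"
  by (simp add: open_smooth_def Ck_on_const)

lemma open_smooth_linear: "bounded_linear L \<Longrightarrow> open S \<Longrightarrow> open_smooth S L"
  by (simp add: open_smooth_def Ck_on_linear)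

lemma open_smooth_ident: "open S \<Longrightarrow> open_smooth S (\<lambda>x. x)"
  by (simp add: open_smooth_linear)

lemma open_smooth_add:
  "open_smooth S f \<Longrightarrow> open_smooth S g \<Longrightarrow> open_smooth S (\<lambda>x. f x + g x)"
  by (simp add: open_smooth_def Ck_on_add)

lemma open_smooth_sum:
  "open S \<Longrightarrow> (\<And>i. i \<in> J \<Longrightarrow> open_smooth S (f i)) \<Longrightarrow> open_smooth S (\<lambda>x. \<Sum>i\<in>J. f i x)"
  by (simp add: open_smooth_def Ck_on_sum)

lemma open_smooth_bilinear:
  "bounded_bilinear B \<Longrightarrow> open_smooth S f \<Longrightarrow> open_smooth S g \<Longrightarrow> open_smooth S (\<lambda>x. B (f x) (g x))"
  by (simp add: open_smooth_def Ck_on_bilinear)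

lemma open_smooth_scaleR:
  "open_smooth S f \<Longrightarrow> open_smooth S g \<Longrightarrow> open_smooth S (\<lambda>x. f x *\<^sub>R g x)"
  by (rule open_smooth_bilinear[OF bounded_bilinear_scaleR])

lemma open_smooth_mult:
  "open_smooth S f \<Longrightarrow> open_smooth S g \<Longrightarrow> open_smooth S (\<lambda>x. f x * g x :: real)"
  by (rule open_smooth_bilinear[OF bounded_bilinear_mult])

lemma open_smooth_inner:
  "open_smooth S f \<Longrightarrow> open_smooth S g \<Longrightarrow> open_smooth S (\<lambda>x. f x \<bullet> g x)"
  by (rule open_smooth_bilinear[OF bounded_bilinear_inner])

lemma open_smooth_compose:
  "open_smooth S f \<Longrightarrow> open_smooth T g \<Longrightarrow> f ` S \<subseteq> T \<Longrightarrow> open_smooth S (\<lambda>x. g (f x))"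
  using Ck_on_compose unfolding open_smooth_def by blast

lemma open_smooth_linear_compose:
  assumes "bounded_linear L" "open_smooth S f" shows "open_smooth S (\<lambda>x. L (f x))"
  by (rule open_smooth_compose[OF assms(2) open_smooth_linear[OF assms(1) open_UNIV]]) simp

lemma open_smooth_minus: "open_smooth S f \<Longrightarrow> open_smooth S (\<lambda>x. - f x)"
  by (rule open_smooth_linear_compose) (simp_all add: bounded_linear_minus bounded_linear_ident)

lemma open_smooth_diff:
  "open_smooth S f \<Longrightarrow> open_smooth S g \<Longrightarrow> open_smooth S (\<lambda>x. f x - g x)"
  using open_smooth_add[of S f "\<lambda>x. - g x"] open_smooth_minus[of S g] by simp

lemma open_smooth_Pair:
  assumes "open_smooth S f" "open_smooth S g" shows "open_smooth S (\<lambda>x. (f x, g x))"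
proof -
  have "bounded_linear (\<lambda>a. (a, 0))" "bounded_linear (\<lambda>a. (0, a))"
    by (auto intro: bounded_linear_Pair bounded_linear_ident bounded_linear_zero)
  from open_smooth_add[OF open_smooth_linear_compose[OF this(1) assms(1)]
       open_smooth_linear_compose[OF this(2) assms(2)]]
  show ?thesis by simp
qed

lemma open_smooth_fst: "open_smooth S f \<Longrightarrow> open_smooth S (\<lambda>x. fst (f x))"
  and open_smooth_snd: "open_smooth S f \<Longrightarrow> open_smooth S (\<lambda>x. snd (f x))"
  by (rule open_smooth_linear_compose[OF bounded_linear_fst] open_smooth_linear_compose[OF bounded_linear_snd]; simp)+

lemma open_smooth_power:
  "open_smooth S f \<Longrightarrow> open_smooth S (\<lambda>x. (f x :: real) ^ n)"
  by (induction n) (auto simp: open_smooth_open open_smooth_const intro: open_smooth_mult)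

lemmas open_smooth_intros = open_smooth_const open_smooth_ident open_smooth_add open_smooth_diff
  open_smooth_minus open_smooth_sum open_smooth_scaleR open_smooth_mult open_smooth_inner
  open_smooth_Pair open_smooth_fst open_smooth_snd open_smooth_power

lemma open_smooth_continuous_on: "open_smooth S f \<Longrightarrow> continuous_on S f"
  unfolding open_smooth_def using Ck_on_continuous_on by blast

lemma open_smooth_preimage: "open_smooth S f \<Longrightarrow> open T \<Longrightarrow> open (S \<inter> f -` T)"
  using open_smooth_continuous_on open_smooth_open continuous_open_preimage by blast

lemma open_smooth_has_derivative:
  "open_smooth S f \<Longrightarrow> x \<in> S \<Longrightarrow> (f has_derivative frechet_derivative f (at x)) (at x)"
  unfolding open_smooth_def using Ck_on_Suc_frechet by blast

lemma open_smooth_derivative: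
  "open_smooth S f \<Longrightarrow> open_smooth S (\<lambda>x. frechet_derivative f (at x) v)"
  unfolding open_smooth_def using Ck_on_Suc_frechet by blast

lemma open_smooth_derivative_linear:
  "open_smooth S f \<Longrightarrow> x \<in> S \<Longrightarrow> linear (frechet_derivative f (at x))"
  using has_derivative_linear open_smooth_has_derivative by blast

section \<open>Inverse linear maps and the inverse function theorem\<close>

text \<open>Where \<open>f\<close> vanishes, the product rule requires \<open>g\<close> to be continuous only.  This makes it possible to
  differentiate expressions in the inverse of a family of linear maps before that inverse is known to be
  differentiable.\<close>

lemma has_derivative_scaleR_vanishing:
  fixes g :: "'a::euclidean_space \<Rightarrow> 'b::euclidean_space"
  assumes f: "(f has_derivative f') (at x)" and 0: "f x = 0" and g: "isCont g x"
  shows "((\<lambda>y. f y *\<^sub>R g y) has_derivative (\<lambda>u. f' u *\<^sub>R g x)) (at x)"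
proof -
  have bl: "bounded_linear f'" using f has_derivative_bounded_linear by blast
  have lim: "((\<lambda>y. norm (f y - f x - f' (y - x)) / norm (y - x)) \<longlongrightarrow> 0) (at x)"
    using f unfolding has_derivative_iff_norm by blast
  obtain C where C: "\<And>u. norm (f' u) \<le> norm u * C" using bounded_linear.bounded[OF bl] by blast
  have gl: "((\<lambda>y. norm (g y - g x)) \<longlongrightarrow> 0) (at x)"
    using g by (simp add: isCont_def LIM_zero_iff tendsto_norm_zero_iff)
  have gl': "((\<lambda>y. norm (g y)) \<longlongrightarrow> norm (g x)) (at x)"
    using g by (simp add: isCont_def tendsto_norm)
  have T: "((\<lambda>y. norm (f y - f x - f' (y - x)) / norm (y - x) * norm (g y) + C * norm (g y - g x)) \<longlongrightarrow>
      0) (at x)"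
    using tendsto_add[OF tendsto_mult[OF lim gl'] tendsto_mult[OF tendsto_const[of C] gl]] by simp
  have "((\<lambda>y. norm (f y *\<^sub>R g y - f x *\<^sub>R g x - f' (y - x) *\<^sub>R g x) / norm (y - x)) \<longlongrightarrow> 0) (at x)"
  proof (rule Lim_null_comparison[OF _ T])
    show "\<forall>\<^sub>F y in at x. norm (norm (f y *\<^sub>R g y - f x *\<^sub>R g x - f' (y - x) *\<^sub>R g x) / norm (y - x)) \<le>
      norm (f y - f x - f' (y - x)) / norm (y - x) * norm (g y) + C * norm (g y - g x)"
    proof (rule eventually_at_filter[THEN iffD2], rule always_eventually, intro allI impI)
      fix y assume "y \<noteq> x"
      then have n: "norm (y - x) > 0" by simp
      have "f y *\<^sub>R g y - f x *\<^sub>R g x - f' (y - x) *\<^sub>R g x =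
        (f y - f x - f' (y - x)) *\<^sub>R g y + f' (y - x) *\<^sub>R (g y - g x)"
        by (simp add: 0 algebra_simps)
      also have "norm \<dots> \<le> norm (f y - f x - f' (y - x)) * norm (g y) + (norm (y - x) * C) * norm (g y - g x)"
        by (rule norm_triangle_le) (use C[of "y - x"] in \<open>auto intro!: add_mono mult_right_mono\<close>)
      finally show "norm (norm (f y *\<^sub>R g y - f x *\<^sub>R g x - f' (y - x) *\<^sub>R g x) / norm (y - x)) \<le>
        norm (f y - f x - f' (y - x)) / norm (y - x) * norm (g y) + C * norm (g y - g x)"
        using n by (simp add: field_simps)
    qed
  qed
  moreover have "bounded_linear (\<lambda>u. f' u *\<^sub>R g x)"
    using bl bounded_linear_scaleR_const by blast
  ultimately show ?thesis unfolding has_derivative_iff_norm by blast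
qed

lemma linear_Basis_expand:
  "linear L \<Longrightarrow> L v = (\<Sum>b\<in>Basis. (v \<bullet> b) *\<^sub>R L b)"
  by (metis (no_types, lifting) euclidean_representation linear_scale linear_sum sum.cong)

lemma open_smooth_linear_family_apply:
  assumes "\<And>x. x \<in> S \<Longrightarrow> linear (L x)" "\<And>v. open_smooth S (\<lambda>x. L x v)" "open_smooth S g"
  shows "open_smooth S (\<lambda>x. L x (g x))"
proof -
  have o: "open S" by (rule open_smooth_open[OF assms(3)])
  have "open_smooth S (\<lambda>x. \<Sum>b\<in>Basis. (g x \<bullet> b) *\<^sub>R L x b)"
    by (intro open_smooth_sum[OF o] open_smooth_scaleR open_smooth_inner assms(2,3) open_smooth_const[OF o])
  then show ?thesis
    by (rule open_smooth_cong) (rule linear_Basis_expand[OF assms(1), symmetric])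
qed

text \<open>An injective linear map is bounded below, and a perturbation that is small on a basis costs at most half
  of the bound.\<close>

lemma eventually_linear_bounded_below:
  fixes A :: "'a::euclidean_space \<Rightarrow> 'b::euclidean_space \<Rightarrow> 'c::euclidean_space"
  assumes S: "open S" "x0 \<in> S" and lin: "\<And>x. x \<in> S \<Longrightarrow> linear (A x)" and inj: "inj (A x0)"
    and cont: "\<And>v. isCont (\<lambda>x. A x v) x0"
  obtains c where "c > 0" "\<forall>\<^sub>F x in nhds x0. x \<in> S \<and> (\<forall>w. c * norm w \<le> norm (A x w))"
proof -
  obtain c where c: "c > 0" "\<And>w. norm (A x0 w) \<ge> c * norm w"
    using linear_inj_bounded_below_pos[OF lin[OF S(2)]] inj by metis
  define N where "N x = (\<Sum>b\<in>Basis. norm (A x b - A x0 b))" for x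
  have N: "norm (A x w - A x0 w) \<le> N x * norm w" if "x \<in> S" for x w
  proof -
    have "A x w - A x0 w = (\<Sum>b\<in>Basis. (w \<bullet> b) *\<^sub>R (A x b - A x0 b))"
      using linear_Basis_expand[OF lin[OF that], of w] linear_Basis_expand[OF lin[OF S(2)], of w]
      by (simp add: scaleR_diff_right sum_subtractf)
    also have "norm \<dots> \<le> (\<Sum>b\<in>Basis. norm (A x b - A x0 b) * norm w)"
    proof (rule sum_norm_le)
      fix b :: 'b assume b: "b \<in> Basis"
      show "norm ((w \<bullet> b) *\<^sub>R (A x b - A x0 b)) \<le> norm (A x b - A x0 b) * norm w"
        using mult_right_mono[OF Basis_le_norm[OF b, of w], of "norm (A x b - A x0 b)"]
        by (simp add: mult.commute)
    qed
    finally show ?thesis by (simp add: N_def sum_distrib_right)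
  qed
  have "isCont N x0" unfolding N_def by (intro continuous_intros cont)
  then have "(N \<longlongrightarrow> 0) (nhds x0)" unfolding isCont_def tendsto_at_iff_tendsto_nhds by (simp add: N_def)
  then have "\<forall>\<^sub>F x in nhds x0. N x < c / 2" by (rule order_tendstoD) (use c in auto)
  moreover have "\<forall>\<^sub>F x in nhds x0. x \<in> S" using S eventually_nhds_in_open by blast
  ultimately have "\<forall>\<^sub>F x in nhds x0. x \<in> S \<and> (\<forall>w. (c / 2) * norm w \<le> norm (A x w))"
  proof eventually_elim
    case (elim x)
    have "(c / 2) * norm w \<le> norm (A x w)" for w
    proof -
      have "c * norm w \<le> norm (A x0 w)" by (rule c)
      also have "\<dots> \<le> norm (A x w) + norm (A x w - A x0 w)"
        by (metis norm_minus_commute norm_triangle_sub)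
      also have "\<dots> \<le> norm (A x w) + (c / 2) * norm w"
        using N[OF elim(2), of w] elim(1) by (smt (verit) mult_right_mono norm_ge_zero)
      finally show ?thesis by (simp add: field_simps)
    qed
    with elim show ?case by blast
  qed
  with c(1) show ?thesis by (intro that[of "c / 2"]) auto
qed

lemma isCont_inverse_linear_family:
  fixes A :: "'a::euclidean_space \<Rightarrow> 'b::euclidean_space \<Rightarrow> 'b"
  assumes S: "open S" "x0 \<in> S" and lin: "\<And>x. x \<in> S \<Longrightarrow> linear (A x)" and inj: "\<And>x. x \<in> S \<Longrightarrow> inj (A x)"
    and cont: "\<And>v. isCont (\<lambda>x. A x v) x0"
  shows "isCont (\<lambda>x. inv (A x) v) x0"
proof -
  have surj: "surj (A x)" if "x \<in> S" for x using lin inj that linear_injective_imp_surjective by blast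
  have invr: "A x (inv (A x) w) = w" if "x \<in> S" for x w using surj_f_inv_f surj that by metis
  obtain c where c: "c > 0" and ev0: "\<forall>\<^sub>F x in nhds x0. x \<in> S \<and> (\<forall>w. c * norm w \<le> norm (A x w))"
    by (rule eventually_linear_bounded_below[OF S lin inj[OF S(2)] cont])
  from ev0 have "\<forall>\<^sub>F x in at x0. x \<in> S \<and> (\<forall>w. c * norm w \<le> norm (A x w))"
    by (simp add: eventually_nhds_conv_at)
  then have ev: "\<forall>\<^sub>F x in at x0. norm (inv (A x) v - inv (A x0) v) \<le>
     (1 / c) * norm (A x (inv (A x0) v) - A x0 (inv (A x0) v))"
  proof eventually_elim
    case (elim x)
    let ?d = "inv (A x) v - inv (A x0) v"
    have "A x ?d = A x0 (inv (A x0) v) - A x (inv (A x0) v)"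
      using elim S invr by (simp add: linear_diff[OF lin])
    moreover have "c * norm ?d \<le> norm (A x ?d)" using elim by blast
    ultimately have "c * norm ?d \<le> norm (A x (inv (A x0) v) - A x0 (inv (A x0) v))"
      by (simp add: norm_minus_commute)
    from mult_left_mono[OF this, of "1 / c"] show ?case using c(1) by simp
  qed
  have "((\<lambda>x. (1 / c) * norm (A x (inv (A x0) v) - A x0 (inv (A x0) v))) \<longlongrightarrow>
     (1 / c) * norm (A x0 (inv (A x0) v) - A x0 (inv (A x0) v))) (at x0)"
    using cont unfolding isCont_def by (intro tendsto_intros) auto
  then have "((\<lambda>x. inv (A x) v - inv (A x0) v) \<longlongrightarrow> 0) (at x0)"
    by (intro Lim_null_comparison[OF ev]) simp
  then show ?thesis by (simp add: isCont_def LIM_zero_iff)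
qed

text \<open>Put \<open>w\<^sub>0 = A(x\<^sub>0)\<inverse> v\<close>.  Then \<open>A(x)\<inverse> v = w\<^sub>0 - A(x)\<inverse> (A(x) w\<^sub>0 - v)\<close>, where the last factor
  vanishes at \<open>x\<^sub>0\<close>; so the derivative exists and is again an expression in \<open>A\<inverse>\<close> and the derivative of \<open>A\<close>.
  Induction on the order of differentiability does the rest.\<close>

lemma open_smooth_inverse_linear_family:
  fixes A :: "'a::euclidean_space \<Rightarrow> 'b::euclidean_space \<Rightarrow> 'b"
  assumes S: "open S" and lin: "\<And>x. x \<in> S \<Longrightarrow> linear (A x)" and inj: "\<And>x. x \<in> S \<Longrightarrow> inj (A x)"
    and sm: "\<And>v. open_smooth S (\<lambda>x. A x v)"
  shows "open_smooth S (\<lambda>x. inv (A x) v)"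
proof -
  have surj: "surj (A x)" if "x \<in> S" for x using lin inj that linear_injective_imp_surjective by blast
  have invr: "A x (inv (A x) w) = w" if "x \<in> S" for x w using surj_f_inv_f surj that by metis
  have linv: "linear (inv (A x))" if "x \<in> S" for x
    using inj_linear_imp_inv_linear lin inj that by blast
  have cont: "isCont (\<lambda>x. inv (A x) v) x0" if "x0 \<in> S" for x0 v
  proof (rule isCont_inverse_linear_family[OF S that lin inj])
    show "isCont (\<lambda>x. A x v) x0" for v
      using open_smooth_continuous_on[OF sm] that S by (simp add: continuous_on_eq_continuous_at)
  qed
  define A' where "A' b x = frechet_derivative (\<lambda>x. A x b) (at x)" for b x
  have A': "((\<lambda>x. A x b) has_derivative A' b x) (at x)" if "x \<in> S" for x b
    unfolding A'_def using open_smooth_has_derivative[OF sm that] .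
  define W' where "W' v x u = (\<Sum>c\<in>Basis. - ((\<Sum>b\<in>Basis. (inv (A x) v \<bullet> b) *\<^sub>R A' b x u) \<bullet> c) *\<^sub>R inv (A x) c)"
    for v x u
  have der: "((\<lambda>x. inv (A x) v) has_derivative W' v x0) (at x0)" if x0: "x0 \<in> S" for x0 v
  proof -
    define w0 where "w0 = inv (A x0) v"
    define r where "r x = (\<Sum>b\<in>Basis. (w0 \<bullet> b) *\<^sub>R A x b) - v" for x
    have r: "(r has_derivative (\<lambda>u. \<Sum>b\<in>Basis. (w0 \<bullet> b) *\<^sub>R A' b x0 u)) (at x0)"
    proof -
      have "((\<lambda>x. (\<Sum>b\<in>Basis. (w0 \<bullet> b) *\<^sub>R A x b) - v) has_derivative
          (\<lambda>u. (\<Sum>b\<in>Basis. (w0 \<bullet> b) *\<^sub>R A' b x0 u) - 0)) (at x0)"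
      proof (rule has_derivative_diff[OF has_derivative_sum has_derivative_const])
        show "((\<lambda>x. (w0 \<bullet> b) *\<^sub>R A x b) has_derivative (\<lambda>u. (w0 \<bullet> b) *\<^sub>R A' b x0 u)) (at x0)" for b
          by (rule has_derivative_scaleR_right[OF A'[OF x0]])
      qed
      then show ?thesis by (simp add: r_def[abs_def])
    qed
    have rA: "r x = A x w0 - v" if "x \<in> S" for x
      unfolding r_def using linear_Basis_expand[OF lin[OF that], of w0] by argo
    have r0: "r x0 = 0" using rA x0 invr by (simp add: w0_def)
    have "((\<lambda>x. w0 + (\<Sum>c\<in>Basis. (- (r x \<bullet> c)) *\<^sub>R inv (A x) c)) has_derivative
        (\<lambda>u. 0 + (\<Sum>c\<in>Basis. (- ((\<Sum>b\<in>Basis. (w0 \<bullet> b) *\<^sub>R A' b x0 u) \<bullet> c)) *\<^sub>R inv (A x0) c))) (at x0)"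
    proof (rule has_derivative_add[OF has_derivative_const has_derivative_sum])
      fix c
      have "((\<lambda>x. - (r x \<bullet> c)) has_derivative (\<lambda>u. - ((\<Sum>b\<in>Basis. (w0 \<bullet> b) *\<^sub>R A' b x0 u) \<bullet> c))) (at x0)"
        by (rule has_derivative_minus[OF has_derivative_inner_left[OF r]])
      then show "((\<lambda>x. (- (r x \<bullet> c)) *\<^sub>R inv (A x) c) has_derivative
        (\<lambda>u. (- ((\<Sum>b\<in>Basis. (w0 \<bullet> b) *\<^sub>R A' b x0 u) \<bullet> c)) *\<^sub>R inv (A x0) c)) (at x0)"
        by (rule has_derivative_scaleR_vanishing) (use r0 cont[OF x0] in auto)
    qed
    then show ?thesis
    proof (rule has_derivative_transform_within_open[OF _ S x0, THEN has_derivative_eq_rhs])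
      fix x assume x: "x \<in> S"
      have "inv (A x) (r x) = w0 - inv (A x) v"
        using rA[OF x] linear_diff[OF linv[OF x]] inj[OF x] by (simp add: inv_f_f)
      moreover have "inv (A x) (r x) = (\<Sum>c\<in>Basis. (r x \<bullet> c) *\<^sub>R inv (A x) c)"
        by (rule linear_Basis_expand[OF linv[OF x]])
      ultimately show "w0 + (\<Sum>c\<in>Basis. - (r x \<bullet> c) *\<^sub>R inv (A x) c) = inv (A x) v"
        by (simp add: sum_negf)
    qed (simp add: W'_def w0_def fun_eq_iff)
  qed
  have "Ck_on k S (\<lambda>x. inv (A x) v)" for k v
  proof (induction k arbitrary: v)
    case 0 then show ?case using cont by (simp add: continuous_at_imp_continuous_on)
  next
    case (Suc k)
    have "Ck_on k S (\<lambda>x. A' b x u)" for b u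
      using open_smooth_derivative[OF sm] by (simp add: A'_def open_smooth_def)
    then have "Ck_on k S (\<lambda>x. W' v x u)" for u
      unfolding W'_def scaleR_minus_left
      by (intro Ck_on_sum Ck_on_bilinear[OF bounded_bilinear_scaleR] Ck_on_bilinear[OF bounded_bilinear_inner]
            Ck_on_const Suc.IH Ck_on_compose[OF _ Ck_on_linear[where S=UNIV and L=uminus]])
        (auto intro: bounded_linear_minus bounded_linear_ident)
    with der show ?case by (rule Ck_on_SucI)
  qed
  then show ?thesis using S by (simp add: open_smooth_def)
qed

lemma continuous_on_blinfun_family:
  fixes f' :: "'a::euclidean_space \<Rightarrow> 'b::euclidean_space \<Rightarrow> 'c::euclidean_space"
  assumes "\<And>x. x \<in> S \<Longrightarrow> linear (f' x)" "\<And>v. continuous_on S (\<lambda>x. f' x v)"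
  shows "continuous_on S (\<lambda>x. Blinfun (f' x))"
proof (rule continuous_on_blinfun_componentwise)
  fix i :: 'b
  show "continuous_on S (\<lambda>x. blinfun_apply (Blinfun (f' x)) i)"
    by (rule continuous_on_eq[OF assms(2)[of i]])
       (use assms(1) in \<open>simp add: bounded_linear_Blinfun_apply linear_conv_bounded_linear\<close>)
qed

text \<open>The derivative of the continuously differentiable inverse \<open>g\<close> at \<open>y\<close> is the inverse of the derivative of
  \<open>f\<close> at \<open>g y\<close>, so that \<open>g\<close> gains one order of differentiability at a time.\<close>

lemma smooth_inverse_function_theorem:
  fixes f :: "'a::euclidean_space \<Rightarrow> 'a"
  assumes f: "open_smooth U f" and x0: "x0 \<in> U" and inj: "inj (frechet_derivative f (at x0))"
  obtains U' V g where "open U'" "U' \<subseteq> U" "x0 \<in> U'" "f x0 \<in> V" "open_smooth V g"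
    "\<And>x. x \<in> U' \<Longrightarrow> f x \<in> V \<and> g (f x) = x" "\<And>y. y \<in> V \<Longrightarrow> g y \<in> U' \<and> f (g y) = y"
proof -
  let ?D = "\<lambda>x. frechet_derivative f (at x)"
  have lin: "linear (?D x)" if "x \<in> U" for x using f open_smooth_derivative_linear that by blast
  have ap: "blinfun_apply (Blinfun (?D x)) = ?D x" if "x \<in> U" for x
    using lin[OF that] by (simp add: bounded_linear_Blinfun_apply linear_conv_bounded_linear)
  have i: "linear (inv (?D x0))" using inj_linear_imp_inv_linear lin x0 inj by blast
  have "(f has_derivative blinfun_apply (Blinfun (?D x))) (at x)" if "x \<in> U" for x
    using open_smooth_has_derivative[OF f that] ap[OF that] by simp
  moreover have "continuous_on U (\<lambda>x. Blinfun (?D x))"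
    by (rule continuous_on_blinfun_family[OF lin open_smooth_continuous_on[OF open_smooth_derivative[OF f]]])
  moreover have "Blinfun (inv (?D x0)) o\<^sub>L Blinfun (?D x0) = id_blinfun"
    by (rule blinfun_eqI) (use i inj ap[OF x0] in
     \<open>simp add: bounded_linear_Blinfun_apply linear_conv_bounded_linear inv_f_f\<close>)
  ultimately show ?thesis
  proof (rule inverse_function_theorem[OF open_smooth_open[OF f] _ _ x0, of f "\<lambda>x. Blinfun (?D x)" "Blinfun (inv (?D x0))"])
    fix U' V g g'
    assume *: "open U'" "U' \<subseteq> U" "x0 \<in> U'" "open V" "f x0 \<in> V" and hom: "homeomorphism U' V f g"
      and g: "\<And>y. y \<in> V \<Longrightarrow> (g has_derivative (g' y)) (at y)"
      and g': "\<And>y. y \<in> V \<Longrightarrow> g' y = inv (blinfun_apply (Blinfun (?D (g y))))"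
      and bij: "\<And>y. y \<in> V \<Longrightarrow> bij (blinfun_apply (Blinfun (?D (g y))))"
  have h1: "f x \<in> V \<and> g (f x) = x" if "x \<in> U'" for x
    using hom that unfolding homeomorphism_def by blast
  have h2: "g y \<in> U' \<and> f (g y) = y" if "y \<in> V" for y
    using hom that unfolding homeomorphism_def by blast
  have sm: "open_smooth U' (\<lambda>x. inv (?D x) v)" for v
  proof (rule open_smooth_inverse_linear_family[OF *(1)])
    fix x assume x: "x \<in> U'"
    then show "linear (?D x)" using lin *(2) by auto
    show "inj (?D x)" using bij[of "f x"] h1[OF x] ap x *(2) by (auto simp: bij_def)
  next
    show "open_smooth U' (\<lambda>x. ?D x v)" for v
      using open_smooth_subset[OF open_smooth_derivative[OF f]] * by blast
  qed
  have "Ck_on k V g" for k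
  proof (induction k)
    case 0 then show ?case using hom by (simp add: homeomorphism_def)
  next
    case (Suc k)
    have "Ck_on k V (\<lambda>y. inv (?D (g y)) v)" for v
      by (rule Ck_on_compose[OF Suc, of U']) (use sm[of v] h2 in \<open>auto simp: open_smooth_def\<close>)
    moreover have "(g has_derivative inv (?D (g y))) (at y)" if "y \<in> V" for y
      using g[OF that] g'[OF that] ap h2[OF that] *(2) by auto
    ultimately show ?case by (intro Ck_on_SucI)
  qed
  then have "open_smooth V g" using * by (simp add: open_smooth_def)
  then show thesis using that * h1 h2 by blast
  qed
qed

section \<open>Division by a variable\<close>

text \<open>Differentiation under the integral sign: every derivative of the integral is an integral of the same
  form.\<close>

lemma Ck_on_integral:
  fixes F :: "'a::euclidean_space \<times> real \<Rightarrow> 'b::euclidean_space"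
  assumes "open O'" "open S" "S \<times> {0..1} \<subseteq> O'"
  shows "Ck_on k O' F \<Longrightarrow> Ck_on k S (\<lambda>z. integral {0..1} (\<lambda>s. F (z, s)))"
proof (induction k arbitrary: F)
  case 0
  have "continuous_on (S \<times> cbox 0 1) (\<lambda>(z, s). F (z, s))"
    using 0 assms(3) by (auto simp: case_prod_unfold intro: continuous_on_subset)
  from integral_continuous_on_param[OF this] show ?case by simp
next
  case (Suc k)
  obtain F' where F': "\<And>x. x\<in>O' \<Longrightarrow> (F has_derivative F' x) (at x)" "\<And>v. Ck_on k O' (\<lambda>x. F' x v)"
    using Suc.prems by auto
  have C0: "continuous_on O' F" by (rule Ck_on_continuous_on[OF Suc.prems])
  have C1: "continuous_on O' (\<lambda>x. F' x v)" for v
    by (rule Ck_on_continuous_on[OF F'(2)])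
  define G where "G z s v = F' (z, s) (v, 0)" for z s v
  have linG: "linear (G z s)" if "z \<in> S" "s \<in> {0..1}" for z s
  proof -
    have "linear (F' (z, s))" using F'(1)[of "(z,s)"] assms(3) that has_derivative_linear by blast
    then have "linear (F' (z, s) \<circ> (\<lambda>v. (v, 0)))"
      by (intro linear_compose) (simp add: linear_iff)
    then show ?thesis by (simp add: G_def[abs_def] o_def)
  qed
  have ap: "blinfun_apply (Blinfun (G z s)) = G z s" if "z \<in> S" "s \<in> {0..1}" for z s
    using linG[OF that] by (simp add: bounded_linear_Blinfun_apply linear_conv_bounded_linear)
  have der: "((\<lambda>z. integral {0..1} (\<lambda>s. F (z, s))) has_derivative (\<lambda>v. integral {0..1} (\<lambda>s. F' (z, s) (v, 0)))) (at z)"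
    if z: "z \<in> S" for z
  proof -
    obtain r where r: "r > 0" "ball z r \<subseteq> S" using assms(2) z open_contains_ball by blast
    let ?B = "ball z r"
    have cB: "continuous_on (?B \<times> cbox 0 1) (\<lambda>(z, s). Blinfun (G z s))"
    proof -
      have "continuous_on (?B \<times> cbox 0 1) (\<lambda>p. Blinfun (G (fst p) (snd p)))"
      proof (rule continuous_on_blinfun_family)
        show "linear (G (fst p) (snd p))" if "p \<in> ?B \<times> cbox 0 1" for p
          using that r by (intro linG) auto
        show "continuous_on (?B \<times> cbox 0 1) (\<lambda>p. G (fst p) (snd p) v)" for v
          unfolding G_def prod.collapse
          by (rule continuous_on_subset[OF C1]) (use r assms(3) in auto)
      qed
      then show ?thesis by (simp add: case_prod_unfold)
    qed
    have "((\<lambda>z. integral (cbox 0 1) (\<lambda>s. F (z, s))) has_derivative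
        blinfun_apply (integral (cbox 0 1) (\<lambda>s. Blinfun (G z s)))) (at z within ?B)"
    proof (rule leibniz_rule[where f = "\<lambda>z s. F (z, s)" and fx = "\<lambda>z s. Blinfun (G z s)", OF _ _ cB])
      show "((\<lambda>z. F (z, t)) has_derivative blinfun_apply (Blinfun (G x t))) (at x within ?B)"
        if "x \<in> ?B" "t \<in> cbox 0 1" for x t
      proof -
        have xs: "x \<in> S" using that r by auto
        have "((\<lambda>z. F (z, t)) has_derivative (\<lambda>v. F' (x, t) (v, 0))) (at x)"
          using F'(1)[of "(x,t)"] subsetD[OF assms(3), of "(x,t)"] xs that
          by (intro has_derivative_compose[of "\<lambda>z. (z, t)" "\<lambda>v. (v, 0)" x UNIV F])
             (auto intro!: has_derivative_Pair)
        then show ?thesis using ap[OF xs] that by (simp add: G_def[abs_def] has_derivative_at_withinI)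
      qed
      show "(\<lambda>s. F (x, s)) integrable_on cbox 0 1" if "x \<in> ?B" for x
        by (rule integrable_continuous)
           (rule continuous_on_compose2[OF C0], use that r assms(3) in \<open>auto intro!: continuous_intros\<close>)
      show "z \<in> ?B" using r by simp
    qed auto
    then have "((\<lambda>z. integral {0..1} (\<lambda>s. F (z, s))) has_derivative
        blinfun_apply (integral {0..1} (\<lambda>s. Blinfun (G z s)))) (at z)"
      using r by (simp add: at_within_open[of z ?B])
    moreover have "blinfun_apply (integral {0..1} (\<lambda>s. Blinfun (G z s))) v = integral {0..1} (\<lambda>s. F' (z, s) (v, 0))" for v
    proof -
      have "continuous_on {0..1} (\<lambda>s. Blinfun (G z s))"
      proof -
        have "continuous_on {0..1::real} (\<lambda>s. (\<lambda>(z, s). Blinfun (G z s)) (z, s))"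
          by (rule continuous_on_compose2[OF cB]) (use r in \<open>auto intro!: continuous_intros\<close>)
        then show ?thesis by simp
      qed
      then have "(\<lambda>s. Blinfun (G z s)) integrable_on {0..1}"
        by (rule integrable_continuous_real)
      then have "((\<lambda>s. blinfun_apply (Blinfun (G z s)) v) has_integral
          blinfun_apply (integral {0..1} (\<lambda>s. Blinfun (G z s))) v) {0..1}"
        using has_integral_linear[OF integrable_integral, of "\<lambda>s. Blinfun (G z s)" "{0..1}" "\<lambda>b. blinfun_apply b v"]
        by (simp add: o_def bounded_linear_apply_blinfun blinfun.bounded_linear_left)
      then have "blinfun_apply (integral {0..1} (\<lambda>s. Blinfun (G z s))) v = integral {0..1} (\<lambda>s. blinfun_apply (Blinfun (G z s)) v)"
        by (simp add: integral_unique)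
      also have "\<dots> = integral {0..1} (\<lambda>s. F' (z, s) (v, 0))"
        by (rule integral_cong) (use ap z in \<open>auto simp: G_def\<close>)
      finally show ?thesis .
    qed
    then have "blinfun_apply (integral {0..1} (\<lambda>s. Blinfun (G z s))) = (\<lambda>v. integral {0..1} (\<lambda>s. F' (z, s) (v, 0)))"
      by auto
    ultimately show ?thesis by simp
  qed
  show ?case unfolding Ck_on.simps
  proof (intro exI conjI ballI allI)
    show "((\<lambda>z. integral {0..1} (\<lambda>s. F (z, s))) has_derivative (\<lambda>v. integral {0..1} (\<lambda>s. F' (z, s) (v, 0)))) (at z)"
      if "z \<in> S" for z using der[OF that] .
    show "Ck_on k S (\<lambda>z. integral {0..1} (\<lambda>s. F' (z, s) (v, 0)))" for v
      by (rule Suc.IH[OF F'(2)])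
  qed
qed

text \<open>Hadamard's lemma: \<open>f(z, t) = t \<integral>\<^sub>0\<^sup>1 \<partial>\<^sub>t f(z, s t) ds\<close>.\<close>

lemma open_smooth_divide_by_variable:
  fixes f :: "'a::euclidean_space \<times> real \<Rightarrow> 'b::euclidean_space"
  assumes f: "open_smooth (B \<times> {-r<..<r}) f" and B: "open B" and 0: "\<forall>z\<in>B. f (z, 0) = 0"
  obtains g where "open_smooth (B \<times> {-r<..<r}) g"
    "\<forall>z\<in>B. \<forall>t\<in>{-r<..<r}. f (z, t) = t *\<^sub>R g (z, t)"
proof -
  let ?S = "B \<times> {-r<..<r}"
  have oS: "open ?S" using B by (intro open_Times) auto
  define f1 where "f1 p = frechet_derivative f (at p) (0, 1)" for p
  have f1: "open_smooth ?S f1" unfolding f1_def[abs_def] by (rule open_smooth_derivative[OF f])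
  \<comment> \<open>The map \<open>((z, t), s) \<mapsto> (z, s t)\<close>.\<close>
  define \<mu> where "\<mu> q = (fst (fst q), snd q * snd (fst q))" for q :: "('a \<times> real) \<times> real"
  define O' where "O' = \<mu> -` ?S"
  have mu: "open_smooth UNIV \<mu>" unfolding \<mu>_def by (intro open_smooth_intros open_UNIV)
  have O': "open O'" using open_smooth_preimage[OF mu oS] by (simp add: O'_def)
  have F: "open_smooth O' (\<lambda>q. f1 (\<mu> q))"
    by (rule open_smooth_compose[OF open_smooth_subset[OF mu O'] f1]) (auto simp: O'_def)
  have scale: "s * t \<in> {-r<..<r}" if "t \<in> {-r<..<r}" "s \<in> {0..1}" for s t :: real
  proof -
    have "\<bar>s * t\<bar> \<le> \<bar>t\<bar>" using that(2) by (simp add: abs_mult mult_left_le_one_le)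
    then show ?thesis using that(1) by auto
  qed
  have sub: "?S \<times> {0..1} \<subseteq> O'" using scale by (auto simp: O'_def \<mu>_def)
  define g where "g p = integral {0..1} (\<lambda>s. f1 (\<mu> (p, s)))" for p
  have "open_smooth ?S g"
    unfolding open_smooth_def g_def[abs_def]
  proof (intro conjI oS allI)
    show "Ck_on k ?S (\<lambda>p. integral {0..1} (\<lambda>s. f1 (\<mu> (p, s))))" for k
      by (rule Ck_on_integral[OF O' oS sub, of k "\<lambda>q. f1 (\<mu> q)"]) (use F in \<open>simp add: open_smooth_def\<close>)
  qed
  moreover have "\<forall>z\<in>B. \<forall>t\<in>{-r<..<r}. f (z, t) = t *\<^sub>R g (z, t)"
  proof (intro ballI)
    fix z t assume z: "z \<in> B" and t: "t \<in> {-r<..<r}"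
    have "((\<lambda>s. f (z, s * t)) has_vector_derivative t *\<^sub>R f1 (z, s * t)) (at s within {0..1})" if s: "s \<in> {0..1}" for s
    proof -
      have p: "(z, s * t) \<in> ?S" using scale[OF t s] z by auto
      have d: "(f has_derivative frechet_derivative f (at (z, s * t))) (at (z, s * t))"
        by (rule open_smooth_has_derivative[OF f p])
      have "((\<lambda>s. (z, s * t)) has_derivative (\<lambda>h. (0, h * t))) (at s)"
        by (auto intro!: derivative_eq_intros)
      from has_derivative_compose[OF this d]
      have "((\<lambda>s. f (z, s * t)) has_derivative (\<lambda>h. frechet_derivative f (at (z, s * t)) (0, h * t))) (at s)" .
      moreover have "frechet_derivative f (at (z, s * t)) (0, h * t) = h *\<^sub>R (t *\<^sub>R f1 (z, s * t))" for h
        using linear_scale[OF open_smooth_derivative_linear[OF f p], of "h * t" "(0, 1)"]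
        by (simp add: f1_def)
      ultimately show ?thesis
        by (simp add: has_vector_derivative_def has_derivative_at_withinI)
    qed
    from fundamental_theorem_of_calculus[OF zero_le_one this]
    have "((\<lambda>s. t *\<^sub>R f1 (z, s * t)) has_integral (f (z, t) - f (z, 0))) {0..1}" by simp
    from integral_unique[OF this] show "f (z, t) = t *\<^sub>R g (z, t)" using bspec[OF 0 z] by (simp add: g_def \<mu>_def)
  qed
  ultimately show ?thesis by (rule that)
qed

section \<open>A bump function\<close>

text \<open>The factor \<open>t\<^sup>-\<^sup>n\<close> makes the family closed under differentiation up to linear combinations; the member
  \<open>n = 0\<close> is the usual function \<open>e\<^sup>-\<^sup>1\<^sup>/\<^sup>t\<close>.\<close>

definition flat_exp :: "nat \<Rightarrow> real \<Rightarrow> real" where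
  "flat_exp n t = (if t > 0 then inverse t ^ n * exp (- inverse t) else 0)"

lemma flat_exp_tendsto_0: "(flat_exp n \<longlongrightarrow> 0) (at 0)"
proof -
  have "((\<lambda>t. inverse t ^ n / exp (inverse t)) \<longlongrightarrow> 0) (at_right (0::real))"
    by (rule filterlim_compose[OF tendsto_power_div_exp_0 filterlim_inverse_at_top_right])
  then have "(flat_exp n \<longlongrightarrow> 0) (at_right 0)"
    by (rule Lim_transform_eventually)
      (auto simp: flat_exp_def eventually_at_filter exp_minus field_simps)
  moreover have "(flat_exp n \<longlongrightarrow> 0) (at_left 0)"
    by (rule tendsto_eventually) (auto simp: flat_exp_def eventually_at_filter)
  ultimately show ?thesis using filterlim_at_split by blast
qed

lemma flat_exp_derivative:
  "(flat_exp n has_real_derivative (flat_exp (n + 2) t - n * flat_exp (n + 1) t)) (at t)"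
proof (cases "t = 0")
  case True
  have "((\<lambda>h. flat_exp (n + 1) h) \<longlongrightarrow> 0) (at 0)" by (rule flat_exp_tendsto_0)
  then have "((\<lambda>h. (flat_exp n (0 + h) - flat_exp n 0) / h) \<longlongrightarrow> 0) (at 0)"
    by (rule Lim_transform_eventually) (auto simp: flat_exp_def eventually_at_filter field_simps)
  then show ?thesis unfolding True DERIV_def by (simp add: flat_exp_def)
next
  case False
  show ?thesis
  proof (cases "t > 0")
    case True
    have "((\<lambda>t. inverse t ^ n * exp (- inverse t)) has_real_derivative
        (flat_exp (n + 2) t - n * flat_exp (n + 1) t)) (at t)"
    proof -
      have i: "(inverse has_real_derivative - (inverse t * inverse t)) (at t)"
        using True DERIV_inverse[of t UNIV] by (simp add: numeral_2_eq_2)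
      have e: "((\<lambda>t. exp (- inverse t)) has_real_derivative exp (- inverse t) * (- (- (inverse t * inverse t)))) (at t)"
        by (rule DERIV_chain2[OF DERIV_exp DERIV_minus[OF i]])
      show ?thesis
        by (rule DERIV_cong[OF DERIV_mult[OF DERIV_power[OF i, of n] e]])
          (cases n; simp add: flat_exp_def True algebra_simps del: power_inverse)
    qed
    then show ?thesis
      by (rule has_field_derivative_transform_within_open[of _ _ _ "{0<..}"])
         (use True in \<open>auto simp: flat_exp_def\<close>)
  next
    case neg: False
    have "((\<lambda>t. 0) has_real_derivative 0) (at t)" by simp
    then have "(flat_exp n has_real_derivative 0) (at t)"
      by (rule has_field_derivative_transform_within_open[of _ _ _ "{..<0}"])
         (use neg False in \<open>auto simp: flat_exp_def\<close>)
    then show ?thesis using neg by (simp add: flat_exp_def)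
  qed
qed

lemma open_smooth_flat_exp: "open_smooth UNIV (flat_exp n)"
proof -
  have "Ck_on k UNIV (flat_exp n)" for k
  proof (induction k arbitrary: n)
    case 0
    have "isCont (flat_exp n) t" for t using flat_exp_derivative DERIV_isCont by blast
    then show ?case by (simp add: continuous_at_imp_continuous_on)
  next
    case (Suc k)
    have "(flat_exp n has_derivative (\<lambda>v. v * (flat_exp (n + 2) t + (- real n) * flat_exp (n + 1) t))) (at t)" for t
      using flat_exp_derivative[of n t] by (simp add: has_field_derivative_def mult.commute[of _ "_ - _"] mult_commute_abs)
    moreover have "Ck_on k UNIV (\<lambda>t. v * (flat_exp (n + 2) t + (- real n) * flat_exp (n + 1) t))" for v
      by (intro Ck_on_bilinear[OF bounded_bilinear_mult] Ck_on_add Ck_on_const Suc.IH)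
    ultimately show ?case
      unfolding Ck_on.simps by (intro exI[of _ "\<lambda>t v. v * (flat_exp (n + 2) t + (- real n) * flat_exp (n + 1) t)"]) auto
  qed
  then show ?thesis by (simp add: open_smooth_def)
qed

lemma bump_function:
  fixes x0 :: "'a::euclidean_space"
  assumes "r > 0"
  obtains \<rho> :: "'a \<Rightarrow> real" where "open_smooth UNIV \<rho>" "\<rho> x0 = 1" "\<And>x. x \<notin> ball x0 r \<Longrightarrow> \<rho> x = 0"
proof
  let ?c = "flat_exp 0 (r\<^sup>2)"
  let ?chi = "\<lambda>x. flat_exp 0 (r\<^sup>2 - (x - x0) \<bullet> (x - x0)) * inverse ?c"
  have c: "?c \<noteq> 0" using assms by (simp add: flat_exp_def)
  have "open_smooth UNIV (\<lambda>x. flat_exp 0 (r\<^sup>2 - (x - x0) \<bullet> (x - x0)))"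
    by (rule open_smooth_compose[OF _ open_smooth_flat_exp]) (auto intro!: open_smooth_intros)
  then show "open_smooth UNIV ?chi"
    by (intro open_smooth_mult open_smooth_const) auto
  show "?chi x0 = 1" using c by simp
  show "?chi x = 0" if "x \<notin> ball x0 r" for x
  proof -
    have "r \<le> norm (x - x0)" using that by (simp add: dist_norm norm_minus_commute)
    then have "r\<^sup>2 \<le> (norm (x - x0))\<^sup>2" using assms by (intro power_mono) auto
    then show ?thesis by (simp add: flat_exp_def power2_norm_eq_inner)
  qed
qed

section \<open>Smooth maps between manifolds, one point at a time\<close>

text \<open>Smoothness at a single point, in given charts.  The inclusion \<open>K \<inter> S \<subseteq> snd c ` fst c\<close> says that the domain of
  \<open>c\<close> is a neighbourhood of \<open>p\<close>; with it, maps can be composed without shrinking any chart.\<close>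

definition smooth_near :: "'e::euclidean_space set \<Rightarrow> ('a, 'e) chart \<Rightarrow> ('b, 'f::euclidean_space) chart
    \<Rightarrow> ('a \<Rightarrow> 'b) \<Rightarrow> 'a \<Rightarrow> bool" where
  "smooth_near K c d f p \<longleftrightarrow> p \<in> fst c \<and> (\<exists>S h. open_smooth S h \<and> snd c p \<in> S \<and> K \<inter> S \<subseteq> snd c ` fst c \<and>
     (\<forall>z\<in>fst c. snd c z \<in> S \<longrightarrow> f z \<in> fst d \<and> snd d (f z) = h (snd c z)))"

lemma smooth_onE:
  assumes "smooth_on S f" "x \<in> S"
  obtains U g where "open_smooth U g" "x \<in> U" "\<And>y. y \<in> S \<Longrightarrow> y \<in> U \<Longrightarrow> g y = f y"
proof -
  from assms have "\<exists>U g. open U \<and> x \<in> U \<and> (\<forall>k. Ck_on k U g) \<and> (\<forall>y\<in>S \<inter> U. g y = f y)"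
    unfolding smooth_on_def by (rule bspec)
  then obtain U g where "open U" "x \<in> U" "\<forall>k. Ck_on k U g" "\<forall>y\<in>S \<inter> U. g y = f y" by (elim exE conjE)
  then show ?thesis by (intro that[of U g]) (auto simp: open_smooth_def)
qed

lemma smooth_onI:
  assumes "\<And>x. x \<in> S \<Longrightarrow> \<exists>U g. open_smooth U g \<and> x \<in> U \<and> (\<forall>y\<in>S \<inter> U. g y = f y)"
  shows "smooth_on S f"
  unfolding smooth_on_def
proof
  fix x assume "x \<in> S"
  from assms[OF this] obtain U g where "open_smooth U g" "x \<in> U" "\<forall>y\<in>S \<inter> U. g y = f y" by (elim exE conjE)
  then show "\<exists>U g. open U \<and> x \<in> U \<and> (\<forall>k. Ck_on k U g) \<and> (\<forall>y\<in>S \<inter> U. g y = f y)"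
    by (intro exI[of _ U] exI[of _ g]) (simp add: open_smooth_def)
qed

lemma smooth_on_open_iff: "open S \<Longrightarrow> smooth_on S f \<longleftrightarrow> open_smooth S f"
proof
  assume S: "open S" and f: "smooth_on S f"
  show "open_smooth S f"
  proof (rule open_smooth_local)
    fix x assume x: "x \<in> S"
    obtain U g where g: "open_smooth U g" and U: "x \<in> U" and gf: "\<And>y. y \<in> S \<Longrightarrow> y \<in> U \<Longrightarrow> g y = f y"
      by (fact smooth_onE[OF f x])
    have o: "open (S \<inter> U)" using S open_smooth_open[OF g] by blast
    have "open_smooth (S \<inter> U) f"
      by (rule open_smooth_cong[OF open_smooth_subset[OF g o]]) (use gf in auto)
    then show "\<exists>T. x \<in> T \<and> T \<subseteq> S \<and> open_smooth T f"
      using x U by (intro exI[of _ "S \<inter> U"]) simp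
  qed
next
  assume "open S" "open_smooth S f"
  then show "smooth_on S f" by (intro smooth_onI exI[of _ S] exI[of _ f]) auto
qed

lemma smooth_nearE:
  assumes "smooth_near K c d f p"
  obtains S h where "p \<in> fst c" "open_smooth S h" "snd c p \<in> S" "K \<inter> S \<subseteq> snd c ` fst c"
    "\<And>z. z \<in> fst c \<Longrightarrow> snd c z \<in> S \<Longrightarrow> f z \<in> fst d \<and> snd d (f z) = h (snd c z)"
  using assms unfolding smooth_near_def by blast

lemma smooth_nearI:
  assumes "p \<in> fst c" "open_smooth S h" "snd c p \<in> S" "K \<inter> S \<subseteq> snd c ` fst c"
    "\<And>z. z \<in> fst c \<Longrightarrow> snd c z \<in> S \<Longrightarrow> f z \<in> fst d \<and> snd d (f z) = h (snd c z)"
  shows "smooth_near K c d f p"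
  unfolding smooth_near_def using assms by blast

lemma smooth_near_mem: "smooth_near K c d f p \<Longrightarrow> p \<in> fst c \<and> f p \<in> fst d"
  unfolding smooth_near_def by blast

lemma smooth_near_compose:
  assumes "smooth_near K c d f p" "smooth_near L d e g (f p)"
  shows "smooth_near K c e (\<lambda>z. g (f z)) p"
proof -
  obtain S h where S: "p \<in> fst c" "open_smooth S h" "snd c p \<in> S" "K \<inter> S \<subseteq> snd c ` fst c"
    "\<And>z. z \<in> fst c \<Longrightarrow> snd c z \<in> S \<Longrightarrow> f z \<in> fst d \<and> snd d (f z) = h (snd c z)"
    by (fact smooth_nearE[OF assms(1)])
  obtain T k where T0: "f p \<in> fst d" and T: "open_smooth T k" "snd d (f p) \<in> T"
    and T1: "L \<inter> T \<subseteq> snd d ` fst d" and T2: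
    "\<And>z. z \<in> fst d \<Longrightarrow> snd d z \<in> T \<Longrightarrow> g z \<in> fst e \<and> snd e (g z) = k (snd d z)"
    by (fact smooth_nearE[OF assms(2)])
  show ?thesis
  proof (rule smooth_nearI)
    have o: "open (S \<inter> h -` T)" by (rule open_smooth_preimage[OF S(2) open_smooth_open[OF T(1)]])
    show "open_smooth (S \<inter> h -` T) (\<lambda>x. k (h x))"
      by (rule open_smooth_compose[OF open_smooth_subset[OF S(2) o] T(1)]) auto
    show "snd c p \<in> S \<inter> h -` T" using S T by auto
    show "K \<inter> (S \<inter> h -` T) \<subseteq> snd c ` fst c" using S by auto
    show "g (f z) \<in> fst e \<and> snd e (g (f z)) = k (h (snd c z))"
      if "z \<in> fst c" "snd c z \<in> S \<inter> h -` T" for z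
      using S(5)[of z] T2[of "f z"] that by auto
  qed (use S in auto)
qed

lemma smooth_near_cong:
  assumes "smooth_near K c d f p" "open N" "snd c p \<in> N"
    "\<And>z. z \<in> fst c \<Longrightarrow> snd c z \<in> N \<Longrightarrow> f z = g z"
  shows "smooth_near K c d g p"
proof -
  obtain S h where S: "p \<in> fst c" "open_smooth S h" "snd c p \<in> S" "K \<inter> S \<subseteq> snd c ` fst c"
    "\<And>z. z \<in> fst c \<Longrightarrow> snd c z \<in> S \<Longrightarrow> f z \<in> fst d \<and> snd d (f z) = h (snd c z)"
    by (fact smooth_nearE[OF assms(1)])
  have "open (S \<inter> N)" using open_smooth_open[OF S(2)] assms(2) by blast
  then have o: "open_smooth (S \<inter> N) h" by (rule open_smooth_subset[OF S(2)]) auto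
  show ?thesis
  proof (rule smooth_nearI[OF S(1) o])
    show "g z \<in> fst d \<and> snd d (g z) = h (snd c z)" if "z \<in> fst c" "snd c z \<in> S \<inter> N" for z
      using S(5)[of z] assms(4)[of z] that by auto
  qed (use S assms(3) in auto)
qed

lemma is_chart_simps: "is_chart K c \<longleftrightarrow> inj_on (snd c) (fst c) \<and> openin (top_of_set K) (snd c ` fst c)"
  by (cases c) (simp add: is_chart_def)

lemma is_chart_open:
  assumes "is_chart K c" obtains T where "open T" "snd c ` fst c = K \<inter> T"
  using assms unfolding is_chart_simps openin_open by blast

lemma is_chart_subset: "is_chart K c \<Longrightarrow> snd c ` fst c \<subseteq> K"
  unfolding is_chart_simps using openin_imp_subset by blast

lemma smooth_near_ident: assumes "is_chart K c" "p \<in> fst c" shows "smooth_near K c c (\<lambda>z. z) p"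
proof -
  obtain T where "open T" "snd c ` fst c = K \<inter> T" by (rule is_chart_open[OF assms(1)])
  then show ?thesis using assms(2)
    by (intro smooth_nearI[where S = T and h = "\<lambda>x. x"]) (auto intro: open_smooth_ident)
qed

lemma smooth_transition_imp_near:
  assumes t: "smooth_transition K c d" and c: "is_chart K c" and p: "p \<in> fst c" "p \<in> fst d"
  shows "smooth_near K c d (\<lambda>z. z) p"
proof -
  obtain U \<phi> V \<theta> where cd: "c = (U, \<phi>)" "d = (V, \<theta>)" by fastforce
  have o: "openin (top_of_set K) (\<phi> ` (U \<inter> V))" and s: "smooth_on (\<phi> ` (U \<inter> V)) (\<theta> \<circ> inv_into U \<phi>)"
    using t by (auto simp: smooth_transition_def cd)
  have inj: "inj_on \<phi> U" using c by (simp add: is_chart_simps cd)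
  obtain T where T: "open T" "\<phi> ` (U \<inter> V) = K \<inter> T" using o unfolding openin_open by blast
  have m: "\<phi> p \<in> \<phi> ` (U \<inter> V)" using p cd by auto
  obtain S g where g: "open_smooth S g" and S: "\<phi> p \<in> S"
     "\<And>y. y \<in> \<phi> ` (U \<inter> V) \<Longrightarrow> y \<in> S \<Longrightarrow> g y = (\<theta> \<circ> inv_into U \<phi>) y"
    by (fact smooth_onE[OF s m])
  have oS: "open S" by (rule open_smooth_open[OF g])
  show ?thesis
  proof (rule smooth_nearI)
    show "open_smooth (S \<inter> T) g" by (rule open_smooth_subset[OF g]) (use oS T(1) in auto)
    show "K \<inter> (S \<inter> T) \<subseteq> snd c ` fst c" using T cd by auto
    show "z \<in> fst d \<and> snd d z = g (snd c z)" if z: "z \<in> fst c" "snd c z \<in> S \<inter> T" for z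
    proof -
      have "\<phi> z \<in> \<phi> ` (U \<inter> V)" using z is_chart_subset[OF c] T cd by auto
      moreover from this have "z \<in> V" using inj z cd by (auto simp: inj_on_def)
      ultimately show ?thesis using S(2)[of "\<phi> z"] z cd inj by auto
    qed
  qed (use p cd S T in auto)
qed

lemma smooth_transitionI:
  assumes c: "is_chart K c" and n: "\<And>p. p \<in> fst c \<Longrightarrow> p \<in> fst d \<Longrightarrow> smooth_near K c d (\<lambda>z. z) p"
  shows "smooth_transition K c d"
proof -
  obtain U \<phi> V \<theta> where cd: "c = (U, \<phi>)" "d = (V, \<theta>)" by fastforce
  have inj: "inj_on \<phi> U" using c by (simp add: is_chart_simps cd)
  have "openin (top_of_set K) (\<phi> ` (U \<inter> V))"
  proof (subst openin_subopen, intro ballI)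
    fix y assume "y \<in> \<phi> ` (U \<inter> V)"
    then obtain p where p: "p \<in> U" "p \<in> V" "y = \<phi> p" by blast
    obtain S h where S: "open_smooth S h" "\<phi> p \<in> S" "K \<inter> S \<subseteq> \<phi> ` U"
      "\<And>z. z \<in> U \<Longrightarrow> \<phi> z \<in> S \<Longrightarrow> z \<in> V \<and> \<theta> z = h (\<phi> z)"
      using n[of p] p by (auto simp: cd elim!: smooth_nearE)
    have "K \<inter> S \<subseteq> \<phi> ` (U \<inter> V)" using S by blast
    moreover have "openin (top_of_set K) (K \<inter> S)" using open_smooth_open[OF S(1)] by blast
    moreover have "y \<in> K \<inter> S" using is_chart_subset[OF c] p S cd by auto
    ultimately show "\<exists>T. openin (top_of_set K) T \<and> y \<in> T \<and> T \<subseteq> \<phi> ` (U \<inter> V)" by blast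
  qed
  moreover have "smooth_on (\<phi> ` (U \<inter> V)) (\<theta> \<circ> inv_into U \<phi>)"
  proof (rule smooth_onI)
    fix y assume "y \<in> \<phi> ` (U \<inter> V)"
    then obtain p where p: "p \<in> U" "p \<in> V" "y = \<phi> p" by blast
    obtain S h where S: "open_smooth S h" "\<phi> p \<in> S" "K \<inter> S \<subseteq> \<phi> ` U"
      "\<And>z. z \<in> U \<Longrightarrow> \<phi> z \<in> S \<Longrightarrow> z \<in> V \<and> \<theta> z = h (\<phi> z)"
      using n[of p] p by (auto simp: cd elim!: smooth_nearE)
    show "\<exists>S g. open_smooth S g \<and> y \<in> S \<and> (\<forall>y\<in>\<phi> ` (U \<inter> V) \<inter> S. g y = (\<theta> \<circ> inv_into U \<phi>) y)"
      using S p inj by (intro exI[of _ S] exI[of _ h]) auto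
  qed
  ultimately show ?thesis by (simp add: smooth_transition_def cd)
qed

lemma smooth_atlasD:
  assumes "smooth_atlas K A" "c \<in> A"
  shows "is_chart K c" and "d \<in> A \<Longrightarrow> p \<in> fst c \<Longrightarrow> p \<in> fst d \<Longrightarrow> smooth_near K c d (\<lambda>z. z) p"
proof -
  show ch: "is_chart K c" using assms unfolding smooth_atlas_def by blast
  assume d: "d \<in> A" "p \<in> fst c" "p \<in> fst d"
  have "smooth_transition K c d" using assms d unfolding smooth_atlas_def by blast
  then show "smooth_near K c d (\<lambda>z. z) p" using ch d(2,3) by (rule smooth_transition_imp_near)
qed

lemma smooth_atlasI:
  assumes "\<And>c. c \<in> A \<Longrightarrow> is_chart K c"
    "\<And>c d p. c \<in> A \<Longrightarrow> d \<in> A \<Longrightarrow> p \<in> fst c \<Longrightarrow> p \<in> fst d \<Longrightarrow> smooth_near K c d (\<lambda>z. z) p"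
  shows "smooth_atlas K A"
  unfolding smooth_atlas_def
proof (intro conjI ballI)
  fix c d assume "c \<in> A" "d \<in> A"
  then show "smooth_transition K c d" using assms by (intro smooth_transitionI) auto
qed (use assms in auto)

lemma points_iff: "p \<in> points A \<longleftrightarrow> (\<exists>c\<in>A. p \<in> fst c)"
  unfolding points_def by (auto simp: case_prod_unfold)

lemma smooth_near_change_charts:
  assumes "smooth_atlas K A" "smooth_atlas L B" "smooth_near K c d f p"
    "c \<in> A" "d \<in> B" "c' \<in> A" "d' \<in> B" "p \<in> fst c'" "f p \<in> fst d'"
  shows "smooth_near K c' d' f p"
proof -
  have m: "p \<in> fst c" "f p \<in> fst d" using smooth_near_mem[OF assms(3)] by auto
  have 1: "smooth_near K c' c (\<lambda>z. z) p" by (rule smooth_atlasD(2)[OF assms(1)]) (use assms m in auto)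
  have 2: "smooth_near L d d' (\<lambda>z. z) (f p)" by (rule smooth_atlasD(2)[OF assms(2)]) (use assms m in auto)
  show ?thesis using smooth_near_compose[OF smooth_near_compose[OF 1 assms(3)] 2] .
qed

section \<open>The topology of an atlas\<close>

lemma openin_atlas_topology:
  assumes "\<And>c. c \<in> A \<Longrightarrow> is_chart K c"
  shows "openin (atlas_topology K A) S \<longleftrightarrow>
    S \<subseteq> points A \<and> (\<forall>c\<in>A. openin (top_of_set K) (snd c ` (S \<inter> fst c)))"
proof -
  let ?P = "\<lambda>S. S \<subseteq> points A \<and> (\<forall>c\<in>A. openin (top_of_set K) (snd c ` (S \<inter> fst c)))"
  have "istopology ?P"
    unfolding istopology_def
  proof (intro conjI allI impI)
    fix S T assume S: "?P S" and T: "?P T"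
    show "S \<inter> T \<subseteq> points A" using S by blast
    show "\<forall>c\<in>A. openin (top_of_set K) (snd c ` (S \<inter> T \<inter> fst c))"
    proof
      fix c assume c: "c \<in> A"
      have "inj_on (snd c) (fst c)" using assms[OF c] by (simp add: is_chart_simps)
      then have "snd c ` (S \<inter> T \<inter> fst c) = snd c ` (S \<inter> fst c) \<inter> snd c ` (T \<inter> fst c)"
        by (auto simp: inj_on_def)
      then show "openin (top_of_set K) (snd c ` (S \<inter> T \<inter> fst c))"
        using S T c by auto
    qed
  next
    fix \<U> assume U: "\<forall>S\<in>\<U>. ?P S"
    then show "\<Union>\<U> \<subseteq> points A" by blast
    show "\<forall>c\<in>A. openin (top_of_set K) (snd c ` (\<Union>\<U> \<inter> fst c))"
    proof
      fix c assume c: "c \<in> A"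
      have "snd c ` (\<Union>\<U> \<inter> fst c) = (\<Union>S\<in>\<U>. snd c ` (S \<inter> fst c))" by blast
      then show "openin (top_of_set K) (snd c ` (\<Union>\<U> \<inter> fst c))" using U c by auto
    qed
  qed
  moreover have "atlas_topology K A = topology ?P"
    unfolding atlas_topology_def by (rule arg_cong[of _ _ topology]) (auto simp: fun_eq_iff case_prod_unfold)
  ultimately show ?thesis by (simp add: topology_inverse')
qed

definition chart_nbhd :: "('a, 'e::euclidean_space) chart \<Rightarrow> 'a set \<Rightarrow> 'a \<Rightarrow> bool" where
  "chart_nbhd c S p \<longleftrightarrow> p \<in> fst c \<and> (\<exists>T. open T \<and> snd c p \<in> T \<and> (\<forall>z\<in>fst c. snd c z \<in> T \<longrightarrow> z \<in> S))"

lemma chart_nbhd_near: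
  assumes "smooth_near K c d f p" "chart_nbhd d S (f p)"
  shows "chart_nbhd c {z \<in> fst c. f z \<in> S} p"
proof -
  obtain T where T: "open T" "snd d (f p) \<in> T" "\<And>z. z\<in>fst d \<Longrightarrow> snd d z \<in> T \<Longrightarrow> z \<in> S"
    using assms(2) unfolding chart_nbhd_def by blast
  obtain N h where N: "p \<in> fst c" "open_smooth N h" "snd c p \<in> N" "K \<inter> N \<subseteq> snd c ` fst c"
    "\<And>z. z \<in> fst c \<Longrightarrow> snd c z \<in> N \<Longrightarrow> f z \<in> fst d \<and> snd d (f z) = h (snd c z)"
    by (fact smooth_nearE[OF assms(1)])
  have "open (N \<inter> h -` T)" by (rule open_smooth_preimage[OF N(2) T(1)])
  then show ?thesis unfolding chart_nbhd_def using N T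
    by (intro conjI exI[of _ "N \<inter> h -` T"]) auto
qed

lemma chart_nbhd_mono: "chart_nbhd c S p \<Longrightarrow> S \<subseteq> T \<Longrightarrow> chart_nbhd c T p"
  unfolding chart_nbhd_def by blast

lemma chart_nbhd_mem: "chart_nbhd c S p \<Longrightarrow> p \<in> S"
  unfolding chart_nbhd_def by blast

lemma chart_nbhd_Int: "chart_nbhd c S p \<Longrightarrow> chart_nbhd c T p \<Longrightarrow> chart_nbhd c (S \<inter> T) p"
proof -
  assume "chart_nbhd c S p" "chart_nbhd c T p"
  then obtain N N' where "p \<in> fst c" "open N" "snd c p \<in> N" "\<forall>z\<in>fst c. snd c z \<in> N \<longrightarrow> z \<in> S"
    "open N'" "snd c p \<in> N'" "\<forall>z\<in>fst c. snd c z \<in> N' \<longrightarrow> z \<in> T" unfolding chart_nbhd_def by blast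
  then show ?thesis unfolding chart_nbhd_def by (intro conjI exI[of _ "N \<inter> N'"]) auto
qed

lemma chart_nbhd_congE:
  assumes "chart_nbhd c {z. P z} p"
  obtains N where "open N" "snd c p \<in> N" "\<And>z. z \<in> fst c \<Longrightarrow> snd c z \<in> N \<Longrightarrow> P z"
  using assms unfolding chart_nbhd_def by blast

lemma chart_nbhd_change:
  assumes "smooth_atlas K A" "c \<in> A" "d \<in> A" "chart_nbhd d S p" "p \<in> fst c"
  shows "chart_nbhd c S p"
proof -
  have "p \<in> fst d" using assms(4) by (simp add: chart_nbhd_def)
  then have "smooth_near K c d (\<lambda>z. z) p" using smooth_atlasD(2)[OF assms(1)] assms by blast
  from chart_nbhd_near[OF this assms(4)] show ?thesis by (rule chart_nbhd_mono) auto
qed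

text \<open>Charts of a smooth atlas are compatible, so openness at a point can be tested in any one chart
  around it.\<close>

lemma openin_atlas_iff:
  assumes A: "smooth_atlas K A"
  shows "openin (atlas_topology K A) S \<longleftrightarrow> (\<forall>p\<in>S. \<exists>c\<in>A. chart_nbhd c S p)" (is "?L \<longleftrightarrow> ?R")
    and "openin (atlas_topology K A) S \<Longrightarrow> c \<in> A \<Longrightarrow> p \<in> S \<Longrightarrow> p \<in> fst c \<Longrightarrow> chart_nbhd c S p"
proof -
  note ch = smooth_atlasD(1)[OF A]
  have 1: "chart_nbhd c S p" if S: ?L and p: "p \<in> S" "c \<in> A" "p \<in> fst c" for c p
  proof -
    have "openin (top_of_set K) (snd c ` (S \<inter> fst c))" using S p openin_atlas_topology[OF ch] by blast
    then obtain T where T: "open T" "snd c ` (S \<inter> fst c) = K \<inter> T" unfolding openin_open by blast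
    have "z \<in> S" if z: "z \<in> fst c" "snd c z \<in> T" for z
    proof -
      have "snd c z \<in> snd c ` (S \<inter> fst c)" using T z is_chart_subset[OF ch[OF p(2)]] by auto
      then show ?thesis using ch[OF p(2)] z unfolding is_chart_simps by (auto simp: inj_on_def)
    qed
    then show ?thesis using T p unfolding chart_nbhd_def by blast
  qed
  then show "openin (atlas_topology K A) S \<Longrightarrow> c \<in> A \<Longrightarrow> p \<in> S \<Longrightarrow> p \<in> fst c \<Longrightarrow> chart_nbhd c S p" .
  show "?L \<longleftrightarrow> ?R"
  proof
    assume L: ?L
    then have "S \<subseteq> points A" using openin_atlas_topology[OF ch] by blast
    then show ?R using 1[OF L] points_iff by (metis subsetD)
  next
    assume R: ?R
    have "S \<subseteq> points A" using R unfolding chart_nbhd_def points_iff subset_iff by blast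
    moreover have "openin (top_of_set K) (snd c ` (S \<inter> fst c))" if c: "c \<in> A" for c
    proof (subst openin_subopen, intro ballI)
      fix y assume "y \<in> snd c ` (S \<inter> fst c)"
      then obtain p where p: "p \<in> S" "p \<in> fst c" "y = snd c p" by blast
      have "chart_nbhd c S p" using chart_nbhd_change[OF A c] R p by blast
      then obtain T where T: "open T" "snd c p \<in> T" "\<And>z. z\<in>fst c \<Longrightarrow> snd c z \<in> T \<Longrightarrow> z \<in> S"
        unfolding chart_nbhd_def by blast
      obtain T' where T': "open T'" "snd c ` fst c = K \<inter> T'" by (rule is_chart_open[OF ch[OF c]])
      have "K \<inter> (T \<inter> T') \<subseteq> snd c ` (S \<inter> fst c)"
      proof
        fix x assume x: "x \<in> K \<inter> (T \<inter> T')"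
        then obtain z where "z \<in> fst c" "x = snd c z" using T'(2) by blast
        then show "x \<in> snd c ` (S \<inter> fst c)" using T(3)[of z] x by auto
      qed
      moreover have "openin (top_of_set K) (K \<inter> (T \<inter> T'))" using T T' by blast
      moreover have "y \<in> K \<inter> (T \<inter> T')" using T T' p by auto
      ultimately show "\<exists>T. openin (top_of_set K) T \<and> y \<in> T \<and> T \<subseteq> snd c ` (S \<inter> fst c)" by blast
    qed
    ultimately show ?L using openin_atlas_topology[OF ch] by blast
  qed
qed

lemma chart_nbhd_domain: "p \<in> fst c \<Longrightarrow> chart_nbhd c (fst c) p"
  unfolding chart_nbhd_def by blast

lemma openin_chart_domain:
  assumes "smooth_atlas K A" "c \<in> A" shows "openin (atlas_topology K A) (fst c)"
  unfolding openin_atlas_iff(1)[OF assms(1)] using chart_nbhd_domain[of _ c] assms(2) by blast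

lemma openin_chart_preimage:
  assumes "smooth_atlas K A" "c \<in> A" "open T"
  shows "openin (atlas_topology K A) {z \<in> fst c. snd c z \<in> T}"
proof -
  have "chart_nbhd c {z \<in> fst c. snd c z \<in> T} p" if "p \<in> {z \<in> fst c. snd c z \<in> T}" for p
    using that assms(3) unfolding chart_nbhd_def by blast
  then show ?thesis unfolding openin_atlas_iff(1)[OF assms(1)] using assms(2) by blast
qed

lemma topspace_atlas: assumes "smooth_atlas K A" shows "topspace (atlas_topology K A) = points A"
proof
  show "topspace (atlas_topology K A) \<subseteq> points A"
    using openin_atlas_topology[OF smooth_atlasD(1)[OF assms], where S = "topspace (atlas_topology K A)"] by auto
  show "points A \<subseteq> topspace (atlas_topology K A)"
    using openin_chart_domain[OF assms] openin_subset points_iff by (metis subsetD subsetI)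
qed

text \<open>Continuity comes for free on the right: \<open>smooth_near\<close> includes that a neighbourhood of \<open>p\<close> is mapped into
  the domain of the target chart.\<close>

lemma smooth_map_iff:
  assumes A: "smooth_atlas K A" and B: "smooth_atlas L B"
  shows "smooth_map K A L B f \<longleftrightarrow> (\<forall>p\<in>points A. \<exists>c\<in>A. \<exists>d\<in>B. smooth_near K c d f p)" (is "?L \<longleftrightarrow> ?R")
    and "smooth_map K A L B f \<Longrightarrow> c \<in> A \<Longrightarrow> d \<in> B \<Longrightarrow> p \<in> fst c \<Longrightarrow> f p \<in> fst d \<Longrightarrow> smooth_near K c d f p"
proof -
  have 1: "smooth_near K c d f p" if L: ?L and cd: "c \<in> A" "d \<in> B" "p \<in> fst c" "f p \<in> fst d" for c d p
  proof -
    obtain U \<phi> V \<theta> where e: "c = (U, \<phi>)" "d = (V, \<theta>)" by fastforce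
    have s: "smooth_on (\<phi> ` (U \<inter> f -` V)) (\<theta> \<circ> f \<circ> inv_into U \<phi>)"
      using L cd unfolding smooth_map_def e by blast
    have cm: "continuous_map (atlas_topology K A) (atlas_topology L B) f" using L by (simp add: smooth_map_def)
    have pA: "p \<in> points A" using cd unfolding points_iff by blast
    have "openin (atlas_topology K A) {x \<in> points A. f x \<in> V}"
      using openin_continuous_map_preimage[OF cm openin_chart_domain[OF B cd(2)]] topspace_atlas[OF A] e by simp
    from openin_atlas_iff(2)[OF A this cd(1) _ cd(3)] obtain T where
      T: "open T" "\<phi> p \<in> T" "\<And>z. z \<in> U \<Longrightarrow> \<phi> z \<in> T \<Longrightarrow> f z \<in> V"
      using pA cd e unfolding chart_nbhd_def by auto
    have ch: "is_chart K c" using smooth_atlasD(1)[OF A cd(1)] .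
    obtain T' where T': "open T'" "\<phi> ` U = K \<inter> T'" using is_chart_open[OF ch] e by auto
    have inj: "inj_on \<phi> U" using ch e by (simp add: is_chart_simps)
    have m: "\<phi> p \<in> \<phi> ` (U \<inter> f -` V)" using cd e by auto
    obtain S g where g: "open_smooth S g" and S: "\<phi> p \<in> S"
      "\<And>y. y \<in> \<phi> ` (U \<inter> f -` V) \<Longrightarrow> y \<in> S \<Longrightarrow> g y = (\<theta> \<circ> f \<circ> inv_into U \<phi>) y"
      by (fact smooth_onE[OF s m])
    have oS: "open S" by (rule open_smooth_open[OF g])
    show ?thesis
    proof (rule smooth_nearI)
      show "open_smooth (S \<inter> T \<inter> T') g" by (rule open_smooth_subset[OF g]) (use oS T(1) T'(1) in auto)
      show "snd c p \<in> S \<inter> T \<inter> T'" using S T T' cd e by auto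
      show "K \<inter> (S \<inter> T \<inter> T') \<subseteq> snd c ` fst c" using T' e by auto
      show "f z \<in> fst d \<and> snd d (f z) = g (snd c z)" if "z \<in> fst c" "snd c z \<in> S \<inter> T \<inter> T'" for z
        using S(2)[of "\<phi> z"] T(3)[of z] that e inj by auto
    qed (use cd in auto)
  qed
  then show "smooth_map K A L B f \<Longrightarrow> c \<in> A \<Longrightarrow> d \<in> B \<Longrightarrow> p \<in> fst c \<Longrightarrow> f p \<in> fst d \<Longrightarrow> smooth_near K c d f p" .
  show "?L \<longleftrightarrow> ?R"
  proof
    assume L: ?L
    show ?R
    proof
      fix p assume p: "p \<in> points A"
      then obtain c where c: "c \<in> A" "p \<in> fst c" unfolding points_iff by blast
      have "f p \<in> points B"
        using L p topspace_atlas[OF A] topspace_atlas[OF B] unfolding smooth_map_def continuous_map_def by auto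
      then obtain d where "d \<in> B" "f p \<in> fst d" unfolding points_iff by blast
      with 1[OF L c(1) _ c(2)] c show "\<exists>c\<in>A. \<exists>d\<in>B. smooth_near K c d f p" by blast
    qed
  next
    assume R: ?R
    have fB: "f p \<in> points B" if "p \<in> points A" for p
      using R that smooth_near_mem points_iff by metis
    have n: "smooth_near K c d f p" if "c \<in> A" "d \<in> B" "p \<in> fst c" "f p \<in> fst d" for c d p
      using R that smooth_near_change_charts[OF A B] points_iff by metis
    have "continuous_map (atlas_topology K A) (atlas_topology L B) f"
      unfolding continuous_map_def topspace_atlas[OF A] topspace_atlas[OF B]
    proof (intro conjI allI impI)
      show "f \<in> points A \<rightarrow> points B" using fB by blast
      fix T assume T: "openin (atlas_topology L B) T"
      show "openin (atlas_topology K A) {x \<in> points A. f x \<in> T}"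
        unfolding openin_atlas_iff(1)[OF A]
      proof
        fix p assume p: "p \<in> {x \<in> points A. f x \<in> T}"
        then obtain c where c: "c \<in> A" "p \<in> fst c" unfolding points_iff by blast
        obtain d where d: "d \<in> B" "chart_nbhd d T (f p)" using T p openin_atlas_iff(1)[OF B] by blast
        have "smooth_near K c d f p" using n c d unfolding chart_nbhd_def by blast
        from chart_nbhd_near[OF this d(2)] have "chart_nbhd c {z \<in> fst c. f z \<in> T} p" .
        then have "chart_nbhd c {x \<in> points A. f x \<in> T} p"
          by (rule chart_nbhd_mono) (use c in \<open>auto simp: points_iff\<close>)
        then show "\<exists>c\<in>A. chart_nbhd c {x \<in> points A. f x \<in> T} p" using c by blast
      qed
    qed
    moreover have "smooth_on (\<phi> ` (U \<inter> f -` V)) (\<theta> \<circ> f \<circ> inv_into U \<phi>)"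
      if cd: "(U, \<phi>) \<in> A" "(V, \<theta>) \<in> B" for U \<phi> V \<theta>
    proof (rule smooth_onI)
      fix y assume "y \<in> \<phi> ` (U \<inter> f -` V)"
      then obtain p where p: "p \<in> U" "f p \<in> V" "y = \<phi> p" by blast
      have inj: "inj_on \<phi> U" using smooth_atlasD(1)[OF A cd(1)] by (simp add: is_chart_simps)
      have nn: "smooth_near K (U, \<phi>) (V, \<theta>) f p" using n[OF cd] p by auto
      obtain S h where "p \<in> U" and S: "open_smooth S h" "\<phi> p \<in> S" and "K \<inter> S \<subseteq> \<phi> ` U"
        and S3: "\<And>z. z \<in> U \<Longrightarrow> \<phi> z \<in> S \<Longrightarrow> f z \<in> V \<and> \<theta> (f z) = h (\<phi> z)"
        by (fact smooth_nearE[OF nn, unfolded fst_conv snd_conv])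
      show "\<exists>S g. open_smooth S g \<and> y \<in> S \<and>
        (\<forall>y\<in>\<phi> ` (U \<inter> f -` V) \<inter> S. g y = (\<theta> \<circ> f \<circ> inv_into U \<phi>) y)"
        using S S3 p inj by (intro exI[of _ S] exI[of _ h]) auto
    qed
    ultimately show ?L by (auto simp: smooth_map_def)
  qed
qed

section \<open>Open submanifolds, products, transported atlases\<close>

lemma openin_chart_image:
  assumes "smooth_atlas K A" "openin (atlas_topology K A) S" "c \<in> A"
  obtains T where "open T" "snd c ` (fst c \<inter> S) = K \<inter> T"
    "\<And>z. z \<in> fst c \<Longrightarrow> snd c z \<in> T \<longleftrightarrow> z \<in> S"
proof -
  note ch = smooth_atlasD(1)[OF assms(1)]
  have "openin (top_of_set K) (snd c ` (S \<inter> fst c))"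
    using assms openin_atlas_topology[OF ch] by blast
  then obtain T where T: "open T" "snd c ` (fst c \<inter> S) = K \<inter> T" unfolding openin_open by (auto simp: Int_commute)
  have "snd c z \<in> T \<longleftrightarrow> z \<in> S" if z: "z \<in> fst c" for z
  proof -
    have "snd c z \<in> T \<longleftrightarrow> snd c z \<in> snd c ` (fst c \<inter> S)"
      using T z is_chart_subset[OF ch[OF assms(3)]] by auto
    also have "\<dots> \<longleftrightarrow> z \<in> S" using ch[OF assms(3)] z unfolding is_chart_simps by (auto simp: inj_on_def)
    finally show ?thesis .
  qed
  with T show ?thesis by (rule that)
qed

lemma smooth_near_restrict_source:
  assumes A: "smooth_atlas K A" "openin (atlas_topology K A) S" "c \<in> A" and p: "p \<in> S"
  shows "smooth_near K (fst c \<inter> S, snd c) d f p \<longleftrightarrow> smooth_near K c d f p" (is "?L \<longleftrightarrow> ?R")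
proof -
  obtain T where T: "open T" "snd c ` (fst c \<inter> S) = K \<inter> T"
    "\<And>z. z \<in> fst c \<Longrightarrow> snd c z \<in> T \<longleftrightarrow> z \<in> S" by (fact openin_chart_image[OF A])
  have sub: "snd c ` fst c \<subseteq> K" by (rule is_chart_subset[OF smooth_atlasD(1)[OF A(1,3)]])
  show ?thesis
  proof
    assume ?L
    then obtain N h where N: "p \<in> fst c" "open_smooth N h" "snd c p \<in> N" "K \<inter> N \<subseteq> snd c ` (fst c \<inter> S)"
      "\<And>z. z \<in> fst c \<inter> S \<Longrightarrow> snd c z \<in> N \<Longrightarrow> f z \<in> fst d \<and> snd d (f z) = h (snd c z)"
      by (auto elim!: smooth_nearE)
    show ?R
    proof (rule smooth_nearI[OF N(1) N(2) N(3)])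
      show "K \<inter> N \<subseteq> snd c ` fst c" using N(4) by blast
      fix z assume z: "z \<in> fst c" "snd c z \<in> N"
      then have "snd c z \<in> K \<inter> T" using N(4) T(2) sub by blast
      then show "f z \<in> fst d \<and> snd d (f z) = h (snd c z)" using N(5) T(3) z by blast
    qed
  next
    assume ?R
    then obtain N h where N: "p \<in> fst c" "open_smooth N h" "snd c p \<in> N" "K \<inter> N \<subseteq> snd c ` fst c"
      "\<And>z. z \<in> fst c \<Longrightarrow> snd c z \<in> N \<Longrightarrow> f z \<in> fst d \<and> snd d (f z) = h (snd c z)"
      by (auto elim!: smooth_nearE)
    have "open (N \<inter> T)" using T open_smooth_open[OF N(2)] by blast
    then show ?L
      by (intro smooth_nearI[OF _ open_smooth_subset[OF N(2), of "N \<inter> T"]]) (use N T p in auto)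
  qed
qed

lemma smooth_near_restrict_target:
  assumes B: "smooth_atlas L B" "openin (atlas_topology L B) T" "d \<in> B"
  shows "smooth_near K c (fst d \<inter> T, snd d) f p \<longleftrightarrow> smooth_near K c d f p \<and> f p \<in> T" (is "?L \<longleftrightarrow> ?R")
proof
  assume ?L then show ?R unfolding smooth_near_def by auto
next
  assume R: ?R
  obtain O' where "open O'" "snd d ` (fst d \<inter> T) = L \<inter> O'"
    and T2: "\<And>z. z \<in> fst d \<Longrightarrow> snd d z \<in> O' \<longleftrightarrow> z \<in> T"
    by (fact openin_chart_image[OF B])
  note T = \<open>open O'\<close> T2
  obtain N h where N: "p \<in> fst c" "open_smooth N h" "snd c p \<in> N" "K \<inter> N \<subseteq> snd c ` fst c"
      "\<And>z. z \<in> fst c \<Longrightarrow> snd c z \<in> N \<Longrightarrow> f z \<in> fst d \<and> snd d (f z) = h (snd c z)"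
    using R by (auto elim!: smooth_nearE)
  have "open (N \<inter> h -` O')" by (rule open_smooth_preimage[OF N(2) T(1)])
  moreover have "h (snd c p) \<in> O'" using N(5)[OF N(1,3)] T(2)[of "f p"] R by auto
  moreover have "f z \<in> T" if "z \<in> fst c" "snd c z \<in> N" "h (snd c z) \<in> O'" for z
    using N(5)[OF that(1,2)] T(2)[of "f z"] that by auto
  ultimately show ?L
    by (intro smooth_nearI[OF N(1) open_smooth_subset[OF N(2), of "N \<inter> h -` O'"]]) (use N in auto)
qed

lemma sub_atlas_iff: "c \<in> sub_atlas A S \<longleftrightarrow> (\<exists>a\<in>A. c = (fst a \<inter> S, snd a))"
  unfolding sub_atlas_def by (auto simp: case_prod_unfold)

lemma points_sub_atlas: "points (sub_atlas A S) = points A \<inter> S"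
  unfolding points_def sub_atlas_def by auto

lemma Bex_sub_atlas: "(\<exists>c\<in>sub_atlas A S. P c) \<longleftrightarrow> (\<exists>a\<in>A. P (fst a \<inter> S, snd a))"
  unfolding sub_atlas_def by force

lemma sub_atlas_points: "sub_atlas A (points A) = A"
proof -
  have 1: "(fst c \<inter> points A, snd c) = c" if "c \<in> A" for c
  proof -
    have "fst c \<subseteq> points A" unfolding points_iff subset_iff using that by blast
    then show ?thesis by (simp add: Int_absorb2)
  qed
  show ?thesis
  proof (intro set_eqI iffI)
    fix c assume "c \<in> sub_atlas A (points A)"
    then obtain a where "a \<in> A" "c = (fst a \<inter> points A, snd a)" unfolding sub_atlas_iff by (elim bexE)
    then show "c \<in> A" using 1 by simp
  next
    fix c assume "c \<in> A"
    then show "c \<in> sub_atlas A (points A)" unfolding sub_atlas_iff using 1[of c] by (intro bexI[of _ c]) simp_all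
  qed
qed

lemma smooth_atlas_sub_atlas:
  assumes A: "smooth_atlas K A" "openin (atlas_topology K A) S" shows "smooth_atlas K (sub_atlas A S)"
proof (rule smooth_atlasI)
  fix c assume "c \<in> sub_atlas A S"
  then obtain a where a: "a \<in> A" "c = (fst a \<inter> S, snd a)" unfolding sub_atlas_iff by blast
  obtain T where T: "open T" "snd a ` (fst a \<inter> S) = K \<inter> T" by (rule openin_chart_image[OF A a(1)])
  then show "is_chart K c"
    using smooth_atlasD(1)[OF A(1) a(1)] a unfolding is_chart_simps by (auto simp: inj_on_def)
next
  fix c d p assume cd: "c \<in> sub_atlas A S" "d \<in> sub_atlas A S" "p \<in> fst c" "p \<in> fst d"
  then obtain a b where a: "a \<in> A" "c = (fst a \<inter> S, snd a)" and b: "b \<in> A" "d = (fst b \<inter> S, snd b)"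
    unfolding sub_atlas_iff by blast
  have "smooth_near K a b (\<lambda>z. z) p" by (rule smooth_atlasD(2)[OF A(1)]) (use a b cd in auto)
  then have "smooth_near K a d (\<lambda>z. z) p"
    using smooth_near_restrict_target[OF A b(1), of K a "\<lambda>z. z" p] cd b by auto
  then show "smooth_near K c d (\<lambda>z. z) p"
    using smooth_near_restrict_source[OF A a(1), of p d "\<lambda>z. z"] cd a by auto
qed

lemma smooth_map_sub_atlas_iff:
  assumes A: "smooth_atlas K A" "openin (atlas_topology K A) S"
    and B: "smooth_atlas L B" "openin (atlas_topology L B) T"
  shows "smooth_map K (sub_atlas A S) L (sub_atlas B T) f \<longleftrightarrow>
      (\<forall>p\<in>S. f p \<in> T \<and> (\<exists>c\<in>A. \<exists>d\<in>B. smooth_near K c d f p))" (is "?L \<longleftrightarrow> ?R")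
    and "smooth_map K (sub_atlas A S) L (sub_atlas B T) f \<Longrightarrow> c \<in> A \<Longrightarrow> d \<in> B \<Longrightarrow> p \<in> S \<Longrightarrow>
      p \<in> fst c \<Longrightarrow> f p \<in> fst d \<Longrightarrow> f p \<in> T \<and> smooth_near K c d f p"
proof -
  have SA: "S \<subseteq> points A" using openin_subset[OF A(2)] topspace_atlas[OF A(1)] by simp
  note sA = smooth_atlas_sub_atlas[OF A] and sB = smooth_atlas_sub_atlas[OF B]
  have eq: "smooth_near K (fst a \<inter> S, snd a) (fst b \<inter> T, snd b) f p \<longleftrightarrow> f p \<in> T \<and> smooth_near K a b f p"
    if "a \<in> A" "b \<in> B" "p \<in> S" for a b p
    by (subst smooth_near_restrict_target[OF B that(2)], subst smooth_near_restrict_source[OF A that(1) that(3)])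
      (rule conj_commute)
  have pts: "points (sub_atlas A S) = S" using SA by (auto simp: points_sub_atlas)
  show iff: "?L \<longleftrightarrow> ?R"
    unfolding smooth_map_iff(1)[OF sA sB] pts
  proof (rule ball_cong[OF refl])
    fix p assume p: "p \<in> S"
    show "(\<exists>c\<in>sub_atlas A S. \<exists>d\<in>sub_atlas B T. smooth_near K c d f p) \<longleftrightarrow>
      f p \<in> T \<and> (\<exists>c\<in>A. \<exists>d\<in>B. smooth_near K c d f p)"
      unfolding Bex_sub_atlas using eq[OF _ _ p] by auto
  qed
  assume L: ?L and c: "c \<in> A" "d \<in> B" "p \<in> S" "p \<in> fst c" "f p \<in> fst d"
  from L[unfolded iff] c(3) obtain c' d' where
    "f p \<in> T" "c' \<in> A" "d' \<in> B" "smooth_near K c' d' f p" by blast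
  then show "f p \<in> T \<and> smooth_near K c d f p"
    using smooth_near_change_charts[OF A(1) B(1)] c by blast
qed

lemma prod_atlas_iff:
  "e \<in> prod_atlas A B \<longleftrightarrow> (\<exists>c\<in>A. \<exists>d\<in>B. e = (fst c \<times> fst d, map_prod (snd c) (snd d)))"
proof
  assume "e \<in> prod_atlas A B"
  then obtain U \<phi> V \<theta> where "e = (U \<times> V, map_prod \<phi> \<theta>)" "(U, \<phi>) \<in> A" "(V, \<theta>) \<in> B"
    unfolding prod_atlas_def by blast
  then show "\<exists>c\<in>A. \<exists>d\<in>B. e = (fst c \<times> fst d, map_prod (snd c) (snd d))"
    by (intro bexI[of _ "(U, \<phi>)"] bexI[of _ "(V, \<theta>)"]) auto
next
  assume "\<exists>c\<in>A. \<exists>d\<in>B. e = (fst c \<times> fst d, map_prod (snd c) (snd d))"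
  then obtain c d where "c \<in> A" "d \<in> B" "e = (fst c \<times> fst d, map_prod (snd c) (snd d))" by blast
  then show "e \<in> prod_atlas A B" unfolding prod_atlas_def
    by (intro CollectI exI[of _ "fst c"] exI[of _ "snd c"] exI[of _ "fst d"] exI[of _ "snd d"]) auto
qed

lemma points_prod_atlas: "points (prod_atlas A B) = points A \<times> points B"
proof (rule set_eqI)
  fix x
  have "x \<in> points (prod_atlas A B) \<longleftrightarrow> (\<exists>c\<in>A. \<exists>d\<in>B. x \<in> fst c \<times> fst d)"
    unfolding points_iff
  proof
    assume "\<exists>c\<in>A. \<exists>d\<in>B. x \<in> fst c \<times> fst d"
    then obtain c d where cd: "c \<in> A" "d \<in> B" "x \<in> fst c \<times> fst d" by blast
    show "\<exists>c\<in>prod_atlas A B. x \<in> fst c"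
      by (rule bexI[of _ "(fst c \<times> fst d, map_prod (snd c) (snd d))"])
        (unfold prod_atlas_iff, use cd in auto)
  next
    assume "\<exists>c\<in>prod_atlas A B. x \<in> fst c"
    then show "\<exists>c\<in>A. \<exists>d\<in>B. x \<in> fst c \<times> fst d" by (metis prod_atlas_iff fst_conv)
  qed
  then show "x \<in> points (prod_atlas A B) \<longleftrightarrow> x \<in> points A \<times> points B"
    unfolding mem_Times_iff points_iff by blast
qed

lemma is_chart_prod:
  assumes "is_chart K c" "is_chart L d"
  shows "is_chart (K \<times> L) (fst c \<times> fst d, map_prod (snd c) (snd d))"
  using assms unfolding is_chart_simps fst_conv snd_conv map_prod_image
  by (auto intro!: map_prod_inj_on) (simp add: openin_Times flip: subtopology_Times euclidean_product_topology)

lemma smooth_near_prod: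
  assumes "smooth_near K c c' f p" "smooth_near L d d' g q"
  shows "smooth_near (K \<times> L) (fst c \<times> fst d, map_prod (snd c) (snd d))
    (fst c' \<times> fst d', map_prod (snd c') (snd d')) (map_prod f g) (p, q)"
proof -
  obtain S h where S: "p \<in> fst c" "open_smooth S h" "snd c p \<in> S" "K \<inter> S \<subseteq> snd c ` fst c"
    "\<And>z. z \<in> fst c \<Longrightarrow> snd c z \<in> S \<Longrightarrow> f z \<in> fst c' \<and> snd c' (f z) = h (snd c z)"
    by (fact smooth_nearE[OF assms(1)])
  obtain T k where T: "q \<in> fst d" "open_smooth T k" "snd d q \<in> T" "L \<inter> T \<subseteq> snd d ` fst d"
    "\<And>z. z \<in> fst d \<Longrightarrow> snd d z \<in> T \<Longrightarrow> g z \<in> fst d' \<and> snd d' (g z) = k (snd d z)"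
    by (fact smooth_nearE[OF assms(2)])
  have o: "open (S \<times> T)" using open_smooth_open[OF S(2)] open_smooth_open[OF T(2)] by (rule open_Times)
  show ?thesis
  proof (rule smooth_nearI)
    have "open_smooth (S \<times> T) (\<lambda>x. h (fst x))"
      by (rule open_smooth_compose[OF open_smooth_fst[OF open_smooth_ident[OF o]] S(2)]) auto
    moreover have "open_smooth (S \<times> T) (\<lambda>x. k (snd x))"
      by (rule open_smooth_compose[OF open_smooth_snd[OF open_smooth_ident[OF o]] T(2)]) auto
    ultimately show "open_smooth (S \<times> T) (\<lambda>x. (h (fst x), k (snd x)))" by (rule open_smooth_Pair)
    show "K \<times> L \<inter> S \<times> T \<subseteq> snd (fst c \<times> fst d, map_prod (snd c) (snd d)) ` fst (fst c \<times> fst d, map_prod (snd c) (snd d))"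
      using S(4) T(4) by (auto simp: map_prod_image)
  qed (use S T in auto)
qed

lemma smooth_atlas_prod:
  assumes A: "smooth_atlas K A" and B: "smooth_atlas L B" shows "smooth_atlas (K \<times> L) (prod_atlas A B)"
proof (rule smooth_atlasI)
  fix e assume "e \<in> prod_atlas A B"
  then show "is_chart (K \<times> L) e"
    unfolding prod_atlas_iff using is_chart_prod smooth_atlasD(1)[OF A] smooth_atlasD(1)[OF B] by blast
next
  fix e e' x assume e: "e \<in> prod_atlas A B" "e' \<in> prod_atlas A B" "x \<in> fst e" "x \<in> fst e'"
  then obtain c d c' d' where *: "c \<in> A" "d \<in> B" "e = (fst c \<times> fst d, map_prod (snd c) (snd d))"
     "c' \<in> A" "d' \<in> B" "e' = (fst c' \<times> fst d', map_prod (snd c') (snd d'))"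
    unfolding prod_atlas_iff by blast
  obtain p q where x: "x = (p, q)" by fastforce
  have "smooth_near K c c' (\<lambda>z. z) p" by (rule smooth_atlasD(2)[OF A]) (use e * x in auto)
  moreover have "smooth_near L d d' (\<lambda>z. z) q" by (rule smooth_atlasD(2)[OF B]) (use e * x in auto)
  ultimately have "smooth_near (K \<times> L) e e' (map_prod (\<lambda>z. z) (\<lambda>z. z)) x"
    unfolding * x by (rule smooth_near_prod)
  then show "smooth_near (K \<times> L) e e' (\<lambda>z. z) x" by (simp add: map_prod_def)
qed

lemma smooth_atlas_interval:
  assumes "openin (top_of_set L) J" shows "smooth_atlas L (interval_atlas J)"
proof -
  have "is_chart L (J, \<lambda>t. t)" using assms by (simp add: is_chart_simps)
  then show ?thesis
    by (intro smooth_atlasI) (auto simp: interval_atlas_def intro: smooth_near_ident)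
qed

lemma points_interval: "points (interval_atlas J) = J"
  by (simp add: points_def interval_atlas_def)

lemma transport_iff:
  "c \<in> transport f A \<longleftrightarrow> (\<exists>a\<in>A. c = (f ` fst a, snd a \<circ> inv_into (fst a) f))"
  unfolding transport_def by (auto simp: case_prod_unfold)

lemma points_transport: "points (transport f A) = f ` points A"
  unfolding points_def transport_def by force

lemma is_chart_transport:
  assumes "is_chart K c" "inj_on f (fst c)"
  shows "is_chart K (f ` fst c, snd c \<circ> inv_into (fst c) f)"
proof -
  have "(snd c \<circ> inv_into (fst c) f) ` f ` fst c = snd c ` fst c"
    using assms(2) by (auto simp: image_image)
  moreover have "inj_on (snd c \<circ> inv_into (fst c) f) (f ` fst c)"
    using assms unfolding is_chart_simps by (auto simp: inj_on_def)
  ultimately show ?thesis using assms(1) by (simp add: is_chart_simps)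
qed

text \<open>Identifying points of two manifolds along injections \<open>\<psi>\<close> and \<open>\<eta>\<close> into a common set turns a
  smooth map \<open>g\<close> with \<open>\<eta> \<circ> g = \<psi>\<close> into a change of charts.\<close>

lemma smooth_near_transport:
  assumes g: "smooth_near K c d g p" and i: "inj_on \<psi> (fst c)" "inj_on \<eta> (fst d)"
    and N: "open N" "snd c p \<in> N" "\<And>z. z \<in> fst c \<Longrightarrow> snd c z \<in> N \<Longrightarrow> \<eta> (g z) = \<psi> z"
  shows "smooth_near K (\<psi> ` fst c, snd c \<circ> inv_into (fst c) \<psi>) (\<eta> ` fst d, snd d \<circ> inv_into (fst d) \<eta>)
    (\<lambda>z. z) (\<psi> p)"
proof -
  obtain S h where S: "p \<in> fst c" "open_smooth S h" "snd c p \<in> S" "K \<inter> S \<subseteq> snd c ` fst c"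
    "\<And>z. z \<in> fst c \<Longrightarrow> snd c z \<in> S \<Longrightarrow> g z \<in> fst d \<and> snd d (g z) = h (snd c z)"
    by (fact smooth_nearE[OF g])
  have o: "open (S \<inter> N)" using open_smooth_open[OF S(2)] N(1) by blast
  show ?thesis
  proof (rule smooth_nearI[OF _ open_smooth_subset[OF S(2) o]])
    have "(snd c \<circ> inv_into (fst c) \<psi>) ` \<psi> ` fst c = snd c ` fst c"
      using i by (auto simp: image_image)
    then show "K \<inter> (S \<inter> N) \<subseteq> snd (\<psi> ` fst c, snd c \<circ> inv_into (fst c) \<psi>) `
        fst (\<psi> ` fst c, snd c \<circ> inv_into (fst c) \<psi>)" using S by auto
    fix w assume w: "w \<in> fst (\<psi> ` fst c, snd c \<circ> inv_into (fst c) \<psi>)"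
      "snd (\<psi> ` fst c, snd c \<circ> inv_into (fst c) \<psi>) w \<in> S \<inter> N"
    then obtain z where z: "z \<in> fst c" "w = \<psi> z" by auto
    then have zi: "snd c z \<in> S" "snd c z \<in> N" "inv_into (fst c) \<psi> w = z" using w i by auto
    have gz: "g z \<in> fst d" "snd d (g z) = h (snd c z)" "w = \<eta> (g z)" using S(5) N(3) z zi by auto
    then have "inv_into (fst d) \<eta> w = g z" using i by auto
    then show "w \<in> fst (\<eta> ` fst d, snd d \<circ> inv_into (fst d) \<eta>) \<and>
        snd (\<eta> ` fst d, snd d \<circ> inv_into (fst d) \<eta>) w = h (snd (\<psi> ` fst c, snd c \<circ> inv_into (fst c) \<psi>) w)"
      using gz zi by auto
  qed (use S N i in auto)
qed

lemma smooth_atlas_transport: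
  assumes A: "smooth_atlas K A" and i: "inj_on \<psi> (points A)" shows "smooth_atlas K (transport \<psi> A)"
proof (rule smooth_atlasI)
  have ic: "inj_on \<psi> (fst c)" if "c \<in> A" for c
    using inj_on_subset[OF i] that points_iff by (metis subsetI)
  { fix e assume "e \<in> transport \<psi> A"
    then show "is_chart K e" unfolding transport_iff using is_chart_transport smooth_atlasD(1)[OF A] ic by blast }
  fix e e' w assume e: "e \<in> transport \<psi> A" "e' \<in> transport \<psi> A" "w \<in> fst e" "w \<in> fst e'"
  then obtain c d where cd: "c \<in> A" "e = (\<psi> ` fst c, snd c \<circ> inv_into (fst c) \<psi>)"
    "d \<in> A" "e' = (\<psi> ` fst d, snd d \<circ> inv_into (fst d) \<psi>)" unfolding transport_iff by blast
  then obtain p q where p: "p \<in> fst c" "w = \<psi> p" "q \<in> fst d" "w = \<psi> q" using e by auto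
  have "p = q" using i p cd points_iff by (metis inj_onD)
  then have "smooth_near K c d (\<lambda>z. z) p" using smooth_atlasD(2)[OF A] cd p by blast
  from smooth_near_transport[OF this ic[OF cd(1)] ic[OF cd(3)] open_UNIV]
  show "smooth_near K e e' (\<lambda>z. z) w" using cd p by simp
qed

section \<open>Maximal atlases\<close>

lemma smooth_structureI:
  assumes "is_chart K c" "fst c \<subseteq> points A"
    "\<And>d p. d \<in> A \<Longrightarrow> p \<in> fst c \<Longrightarrow> p \<in> fst d \<Longrightarrow> smooth_near K c d (\<lambda>z. z) p \<and> smooth_near K d c (\<lambda>z. z) p"
    "\<And>d. d \<in> A \<Longrightarrow> is_chart K d"
  shows "c \<in> smooth_structure K A"
  unfolding smooth_structure_def
proof (intro CollectI conjI ballI)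
  fix d assume d: "d \<in> A"
  show "smooth_transition K c d"
    using assms(3)[OF d] by (intro smooth_transitionI assms(1)) simp
  show "smooth_transition K d c"
    using assms(3)[OF d] by (intro smooth_transitionI assms(4)[OF d]) simp
qed (use assms in auto)

lemma smooth_atlas_smooth_structure:
  assumes A: "smooth_atlas K A"
  shows "smooth_atlas K (smooth_structure K A)" "A \<subseteq> smooth_structure K A"
    "points (smooth_structure K A) = points A"
proof -
  show sub: "A \<subseteq> smooth_structure K A"
    using A by (auto simp: smooth_structure_def smooth_atlas_def points_def)
  have pt: "fst c \<subseteq> points A" if "c \<in> smooth_structure K A" for c
    using that by (simp add: smooth_structure_def)
  show "points (smooth_structure K A) = points A"
  proof (intro subset_antisym subsetI)
    fix p assume "p \<in> points A"
    then show "p \<in> points (smooth_structure K A)" using sub by (auto simp: points_iff)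
  next
    fix p assume "p \<in> points (smooth_structure K A)"
    then show "p \<in> points A" using pt unfolding points_iff[of _ "smooth_structure K A"] by blast
  qed
  have ch: "is_chart K c" if "c \<in> smooth_structure K A" for c
    using that by (simp add: smooth_structure_def)
  show "smooth_atlas K (smooth_structure K A)"
  proof (rule smooth_atlasI[OF ch])
    fix c d p assume c: "c \<in> smooth_structure K A" "d \<in> smooth_structure K A" "p \<in> fst c" "p \<in> fst d"
    then have "p \<in> points A" using pt by blast
    then obtain a where a: "a \<in> A" "p \<in> fst a" unfolding points_iff by blast
    have t: "smooth_transition K c a" "smooth_transition K a d"
      using c(1,2) a(1) by (simp_all add: smooth_structure_def)
    have "smooth_near K c a (\<lambda>z. z) p"
      by (rule smooth_transition_imp_near[OF t(1) ch[OF c(1)] c(3) a(2)])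
    moreover have "smooth_near K a d (\<lambda>z. z) p"
      by (rule smooth_transition_imp_near[OF t(2) smooth_atlasD(1)[OF A a(1)] a(2) c(4)])
    ultimately show "smooth_near K c d (\<lambda>z. z) p" by (rule smooth_near_compose)
  qed
qed

text \<open>A change from a chart compatible with \<open>A\<close> to a chart of \<open>B\<close> factors, near any given point, through a
  chart of \<open>A\<close>.\<close>

lemma smooth_structure_eq:
  fixes A B :: "('a, 'e::euclidean_space) atlas"
  assumes AB: "smooth_atlas K (A \<union> B)" and pts: "points A = points B"
  shows "smooth_structure K A = smooth_structure K B"
proof -
  have main: "smooth_structure K A \<subseteq> smooth_structure K B"
    if AB: "smooth_atlas K (A \<union> B)" and pts: "points A = points B" for A B :: "('a, 'e) atlas"
  proof
    have A: "smooth_atlas K A" using AB by (auto simp: smooth_atlas_def)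
    fix c assume c: "c \<in> smooth_structure K A"
    note S = smooth_atlas_smooth_structure[OF A]
    show "c \<in> smooth_structure K B"
    proof (rule smooth_structureI)
      show "is_chart K c" "fst c \<subseteq> points B" using c pts by (auto simp: smooth_structure_def)
      show "is_chart K d" if "d \<in> B" for d using smooth_atlasD(1)[OF AB] that by blast
      fix d p assume d: "d \<in> B" "p \<in> fst c" "p \<in> fst d"
      then have "p \<in> points B" unfolding points_iff by blast
      then have "p \<in> points A" using pts by simp
      then obtain a where a: "a \<in> A" "p \<in> fst a" unfolding points_iff by blast
      have aS: "a \<in> smooth_structure K A" using S(2) a by blast
      have 1: "smooth_near K c a (\<lambda>z. z) p" "smooth_near K a c (\<lambda>z. z) p"
        by (rule smooth_atlasD(2)[OF S(1) c aS d(2) a(2)], rule smooth_atlasD(2)[OF S(1) aS c a(2) d(2)])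
      have 2: "smooth_near K a d (\<lambda>z. z) p" "smooth_near K d a (\<lambda>z. z) p"
        by (rule smooth_atlasD(2)[OF AB _ _ a(2) d(3)], use a d in auto)
          (rule smooth_atlasD(2)[OF AB _ _ d(3) a(2)], use a d in auto)
      show "smooth_near K c d (\<lambda>z. z) p \<and> smooth_near K d c (\<lambda>z. z) p"
        using smooth_near_compose[OF 1(1) 2(1)] smooth_near_compose[OF 2(2) 1(2)] by blast
    qed
  qed
  show ?thesis using main[OF AB pts] main[of B A] AB pts by (simp add: Un_commute)
qed

lemma openin_atlas_extend:
  assumes AB: "smooth_atlas K B" "A \<subseteq> B" and pts: "points A = points B"
  shows "atlas_topology K A = atlas_topology K B"
proof -
  have A: "smooth_atlas K A" using AB by (auto simp: smooth_atlas_def)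
  have "openin (atlas_topology K A) S \<longleftrightarrow> openin (atlas_topology K B) S" for S
    unfolding openin_atlas_iff(1)[OF A] openin_atlas_iff(1)[OF AB(1)]
  proof (rule ball_cong[OF refl], rule iffI)
    fix p assume p: "\<exists>c\<in>B. chart_nbhd c S p"
    then have "p \<in> points B" unfolding points_iff chart_nbhd_def by blast
    then have "p \<in> points A" using pts by simp
    then obtain a where "a \<in> A" "p \<in> fst a" unfolding points_iff by blast
    then show "\<exists>c\<in>A. chart_nbhd c S p" using p chart_nbhd_change[OF AB(1)] AB(2) by blast
  qed (use AB in blast)
  then show ?thesis by (simp add: topology_eq)
qed

section \<open>Hausdorff and second countable atlases\<close>

text \<open>Points in a common chart domain are separated by that chart.\<close>

lemma Hausdorff_atlasI:
  assumes A: "smooth_atlas K A" and sep: "\<And>p q. p \<in> points A \<Longrightarrow> q \<in> points A \<Longrightarrow> p \<noteq> q \<Longrightarrow>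
     (\<exists>c\<in>A. p \<in> fst c \<and> q \<in> fst c) \<or>
     (\<exists>S T. openin (atlas_topology K A) S \<and> openin (atlas_topology K A) T \<and> p \<in> S \<and> q \<in> T \<and> disjnt S T)"
  shows "Hausdorff_space (atlas_topology K A)"
  unfolding Hausdorff_space_def topspace_atlas[OF A]
proof (intro allI impI, elim conjE)
  fix p q assume pq: "p \<in> points A" "q \<in> points A" "p \<noteq> q"
  { fix c assume c: "c \<in> A" "p \<in> fst c" "q \<in> fst c"
    then have "snd c p \<noteq> snd c q" using smooth_atlasD(1)[OF A c(1)] pq unfolding is_chart_simps
      by (auto simp: inj_on_def)
    then obtain S T where ST: "open S" "open T" "snd c p \<in> S" "snd c q \<in> T" "S \<inter> T = {}"
      using hausdorff by metis
    have "openin (atlas_topology K A) {z \<in> fst c. snd c z \<in> S}" "openin (atlas_topology K A) {z \<in> fst c. snd c z \<in> T}"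
      using openin_chart_preimage[OF A c(1)] ST by auto
    moreover have "disjnt {z \<in> fst c. snd c z \<in> S} {z \<in> fst c. snd c z \<in> T}" using ST by (auto simp: disjnt_def)
    ultimately have "\<exists>S T. openin (atlas_topology K A) S \<and> openin (atlas_topology K A) T \<and> p \<in> S \<and> q \<in> T \<and> disjnt S T"
      using c ST by blast }
  then show "\<exists>S T. openin (atlas_topology K A) S \<and> openin (atlas_topology K A) T \<and> p \<in> S \<and> q \<in> T \<and> disjnt S T"
    using sep[OF pq] by blast
qed

lemma second_countable_atlasI:
  assumes A: "smooth_atlas K A" and B: "B \<subseteq> A" "countable B" "points A \<subseteq> points B"
  shows "second_countable (atlas_topology K (A :: ('a, 'e::euclidean_space) atlas))"
proof -
  obtain \<B> :: "'e set set" where C: "countable \<B>" "\<And>T. T \<in> \<B> \<Longrightarrow> open T"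
    "\<And>S. open S \<Longrightarrow> \<exists>U. U \<subseteq> \<B> \<and> S = \<Union>U" using univ_second_countable by metis
  let ?B = "(\<lambda>(c, T). {z \<in> fst c. snd c z \<in> T}) ` (B \<times> \<B>)"
  show ?thesis unfolding second_countable_def
  proof (intro exI[of _ ?B] conjI ballI allI impI)
    show "countable ?B" using B C by blast
    show "openin (atlas_topology K A) V" if "V \<in> ?B" for V
      using that openin_chart_preimage[OF A] C(2) B(1) by auto
    fix S p assume "openin (atlas_topology K A) S \<and> p \<in> S"
    then have S: "openin (atlas_topology K A) S" "p \<in> S" by auto
    have "p \<in> points A" using S openin_subset[OF S(1)] topspace_atlas[OF A] by auto
    then have "p \<in> points B" using B by blast
    then obtain c where c: "c \<in> B" "p \<in> fst c" unfolding points_iff by blast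
    then obtain T where T: "open T" "snd c p \<in> T" "\<And>z. z \<in> fst c \<Longrightarrow> snd c z \<in> T \<Longrightarrow> z \<in> S"
      using openin_atlas_iff(2)[OF A S(1) _ S(2), of c] B(1) unfolding chart_nbhd_def by blast
    obtain T' where T': "T' \<in> \<B>" "snd c p \<in> T'" "T' \<subseteq> T" using C(3)[OF T(1)] T(2) by auto
    have "{z \<in> fst c. snd c z \<in> T'} \<in> ?B" using c T' by force
    moreover have "p \<in> {z \<in> fst c. snd c z \<in> T'}" using c T' by auto
    moreover have "{z \<in> fst c. snd c z \<in> T'} \<subseteq> S" using T T' by auto
    ultimately show "\<exists>V\<in>?B. p \<in> V \<and> V \<subseteq> S" by (intro bexI[of _ "{z \<in> fst c. snd c z \<in> T'}"] conjI)
  qed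
qed

lemma countable_subcover:
  assumes A: "smooth_atlas K A" and sc: "second_countable (atlas_topology K A)"
    and F: "\<And>U. U \<in> F \<Longrightarrow> openin (atlas_topology K A) U" "points A \<subseteq> \<Union>F"
  obtains F' where "countable F'" "F' \<subseteq> F" "points A \<subseteq> \<Union>F'"
proof -
  have "\<Union>F = topspace (atlas_topology K A)"
    using F openin_subset topspace_atlas[OF A] by (metis Union_least subset_antisym)
  then show ?thesis
    using second_countable_imp_Lindelof_space[OF sc] F(1) that topspace_atlas[OF A]
    unfolding Lindelof_space_def by (metis order_refl)
qed

text \<open>For smooth atlases this is equivalent to second countability, since the model is a subset of a Euclidean
  space; unlike the latter it visibly passes to products, open subsets, transports and unions of atlases.\<close>

definition countably_covered :: "('a, 'e) atlas \<Rightarrow> bool" where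
  "countably_covered A \<longleftrightarrow> (\<exists>B\<subseteq>A. countable B \<and> points A \<subseteq> points B)"

lemma countably_covered_prod:
  assumes "countably_covered A" "countably_covered B" shows "countably_covered (prod_atlas A B)"
proof -
  obtain A' B' where A': "A' \<subseteq> A" "countable A'" "points A \<subseteq> points A'"
    and B': "B' \<subseteq> B" "countable B'" "points B \<subseteq> points B'" using assms unfolding countably_covered_def by blast
  have "prod_atlas A' B' \<subseteq> (\<lambda>(c, d). (fst c \<times> fst d, map_prod (snd c) (snd d))) ` (A' \<times> B')"
  proof
    fix e assume "e \<in> prod_atlas A' B'"
    then obtain c d where "c \<in> A'" "d \<in> B'" "e = (fst c \<times> fst d, map_prod (snd c) (snd d))"
      unfolding prod_atlas_iff by blast
    then show "e \<in> (\<lambda>(c, d). (fst c \<times> fst d, map_prod (snd c) (snd d))) ` (A' \<times> B')"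
      by (intro image_eqI[of _ _ "(c, d)"]) auto
  qed
  then have "countable (prod_atlas A' B')" using A' B' by (meson countable_SIGMA countable_image countable_subset)
  moreover have "prod_atlas A' B' \<subseteq> prod_atlas A B" using A' B' unfolding prod_atlas_def by blast
  moreover have "points (prod_atlas A B) \<subseteq> points (prod_atlas A' B')"
    using A' B' unfolding points_prod_atlas by blast
  ultimately show ?thesis unfolding countably_covered_def by blast
qed

lemma countably_covered_interval: "countably_covered (interval_atlas J)"
  unfolding countably_covered_def interval_atlas_def by blast

lemma countably_covered_transport: assumes "countably_covered A" shows "countably_covered (transport f A)"
proof -
  obtain A' where A': "A' \<subseteq> A" "countable A'" "points A \<subseteq> points A'" using assms unfolding countably_covered_def by blast
  then show ?thesis unfolding countably_covered_def
    by (intro exI[of _ "transport f A'"]) (auto simp: points_transport, auto simp: transport_def)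
qed

lemma countably_covered_sub: assumes "countably_covered A" shows "countably_covered (sub_atlas A S)"
proof -
  obtain A' where A': "A' \<subseteq> A" "countable A'" "points A \<subseteq> points A'" using assms unfolding countably_covered_def by blast
  then show ?thesis unfolding countably_covered_def
    by (intro exI[of _ "sub_atlas A' S"]) (auto simp: points_sub_atlas, auto simp: sub_atlas_def)
qed

lemma points_Un: "points (A \<union> B) = points A \<union> points B"
  by (auto simp: points_def)

lemma countably_covered_Un:
  assumes "countably_covered A" "countably_covered B" shows "countably_covered (A \<union> B)"
proof -
  obtain A' B' where A': "A' \<subseteq> A" "countable A'" "points A \<subseteq> points A'"
    and B': "B' \<subseteq> B" "countable B'" "points B \<subseteq> points B'" using assms unfolding countably_covered_def by blast
  then show ?thesis unfolding countably_covered_def by (intro exI[of _ "A' \<union> B'"]) (auto simp: points_Un)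
qed

lemma second_countable_covered:
  "smooth_atlas K A \<Longrightarrow> countably_covered A \<Longrightarrow> second_countable (atlas_topology K A)"
  unfolding countably_covered_def using second_countable_atlasI by blast

lemma countably_covered_second_countable:
  assumes A: "smooth_atlas K A" and sc: "second_countable (atlas_topology K A)"
  shows "countably_covered A"
proof -
  have cov: "points A \<subseteq> \<Union>(fst ` A)" unfolding points_def by (auto simp: case_prod_unfold)
  obtain F' where F': "countable F'" "F' \<subseteq> fst ` A" "points A \<subseteq> \<Union>F'"
    by (rule countable_subcover[OF A sc _ cov]) (use openin_chart_domain[OF A] in auto)
  obtain B where B: "countable B" "B \<subseteq> A" "F' = fst ` B" using F' by (metis countable_subset_image)
  have "points B = \<Union>(fst ` B)" unfolding points_def by (auto simp: case_prod_unfold)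
  then have "points A \<subseteq> points B" using F'(3) B(3) by simp
  then show ?thesis using B unfolding countably_covered_def by blast
qed

lemma openin_prod_atlas:
  assumes A: "smooth_atlas K A" and B: "smooth_atlas L B"
    and S: "openin (atlas_topology K A) S" and T: "openin (atlas_topology L B) T"
  shows "openin (atlas_topology (K \<times> L) (prod_atlas A B)) (S \<times> T)"
  unfolding openin_atlas_iff(1)[OF smooth_atlas_prod[OF A B]]
proof
  fix p assume p: "p \<in> S \<times> T"
  have "fst p \<in> S" "snd p \<in> T" using p by auto
  then obtain c d where cd: "c \<in> A" "chart_nbhd c S (fst p)" "d \<in> B" "chart_nbhd d T (snd p)"
    using S T unfolding openin_atlas_iff(1)[OF A] openin_atlas_iff(1)[OF B] by blast
  obtain N where N: "fst p \<in> fst c" "open N" "snd c (fst p) \<in> N" "\<forall>z\<in>fst c. snd c z \<in> N \<longrightarrow> z \<in> S"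
    using cd(2) unfolding chart_nbhd_def by blast
  obtain N' where N': "snd p \<in> fst d" "open N'" "snd d (snd p) \<in> N'" "\<forall>z\<in>fst d. snd d z \<in> N' \<longrightarrow> z \<in> T"
    using cd(4) unfolding chart_nbhd_def by blast
  have "chart_nbhd (fst c \<times> fst d, map_prod (snd c) (snd d)) (S \<times> T) p"
    unfolding chart_nbhd_def using N N'
    by (intro conjI exI[of _ "N \<times> N'"]) (auto simp: open_Times mem_Times_iff)
  then show "\<exists>c\<in>prod_atlas A B. chart_nbhd c (S \<times> T) p" using cd(1,3) prod_atlas_iff by blast
qed

lemma openin_points: "smooth_atlas K A \<Longrightarrow> openin (atlas_topology K A) (points A)"
  using topspace_atlas openin_topspace by metis

lemma Hausdorff_atlasE:
  assumes A: "smooth_atlas K A" and h: "Hausdorff_space (atlas_topology K A)"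
    and p: "p \<in> points A" "q \<in> points A" "p \<noteq> q"
  obtains S T where "openin (atlas_topology K A) S" "openin (atlas_topology K A) T" "p \<in> S" "q \<in> T" "disjnt S T"
proof -
  have "\<exists>S T. openin (atlas_topology K A) S \<and> openin (atlas_topology K A) T \<and> p \<in> S \<and> q \<in> T \<and> disjnt S T"
    using h[unfolded Hausdorff_space_def topspace_atlas[OF A], THEN spec, THEN spec, of p q] p by simp
  then show ?thesis using that by (elim exE conjE)
qed

lemma Hausdorff_prod_atlas:
  assumes A: "smooth_atlas K A" "Hausdorff_space (atlas_topology K A)"
    and B: "smooth_atlas L B" "Hausdorff_space (atlas_topology L B)"
  shows "Hausdorff_space (atlas_topology (K \<times> L) (prod_atlas A B))"
proof (rule Hausdorff_atlasI[OF smooth_atlas_prod[OF A(1) B(1)]])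
  fix p q assume pq: "p \<in> points (prod_atlas A B)" "q \<in> points (prod_atlas A B)" "p \<noteq> q"
  let ?T = "atlas_topology (K \<times> L) (prod_atlas A B)"
  have "\<exists>S T. openin ?T S \<and> openin ?T T \<and> p \<in> S \<and> q \<in> T \<and> disjnt S T"
  proof (cases "fst p = fst q")
    case False
    obtain S T where ST: "openin (atlas_topology K A) S" "openin (atlas_topology K A) T"
      "fst p \<in> S" "fst q \<in> T" "disjnt S T"
      by (rule Hausdorff_atlasE[OF A _ _ False]) (use pq in \<open>auto simp: points_prod_atlas\<close>)
    show ?thesis
      by (rule exI[of _ "S \<times> points B"], rule exI[of _ "T \<times> points B"])
        (use ST pq openin_prod_atlas[OF A(1) B(1) ST(1) openin_points[OF B(1)]]
          openin_prod_atlas[OF A(1) B(1) ST(2) openin_points[OF B(1)]]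
          in \<open>auto simp: points_prod_atlas mem_Times_iff disjnt_def\<close>)
  next
    case True
    then have ne: "snd p \<noteq> snd q" using pq(3) by (auto simp: prod_eq_iff)
    obtain S T where ST: "openin (atlas_topology L B) S" "openin (atlas_topology L B) T"
      "snd p \<in> S" "snd q \<in> T" "disjnt S T"
      by (rule Hausdorff_atlasE[OF B _ _ ne]) (use pq in \<open>auto simp: points_prod_atlas\<close>)
    show ?thesis
      by (rule exI[of _ "points A \<times> S"], rule exI[of _ "points A \<times> T"])
        (use ST pq openin_prod_atlas[OF A(1) B(1) openin_points[OF A(1)] ST(1)]
          openin_prod_atlas[OF A(1) B(1) openin_points[OF A(1)] ST(2)]
          in \<open>auto simp: points_prod_atlas mem_Times_iff disjnt_def\<close>)
  qed
  then show "(\<exists>c\<in>prod_atlas A B. p \<in> fst c \<and> q \<in> fst c) \<or>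
     (\<exists>S T. openin ?T S \<and> openin ?T T \<and> p \<in> S \<and> q \<in> T \<and> disjnt S T)" by (rule disjI2)
qed

lemma Hausdorff_interval:
  assumes "openin (top_of_set L) J" shows "Hausdorff_space (atlas_topology L (interval_atlas J))"
  by (rule Hausdorff_atlasI[OF smooth_atlas_interval[OF assms]])
    (auto simp: interval_atlas_def points_def)

section \<open>Gluing manifolds along smooth transition functions\<close>

text \<open>The maps \<open>\<psi>\<close> on \<open>S\<close> and \<open>\<eta>\<close> on \<open>T\<close> go into a common set, where they identify points of \<open>S\<close> with points of
  \<open>T\<close>.  Near \<open>p\<close> this identification is the smooth map \<open>g\<close>.\<close>

definition glued_at ::
    "'e::euclidean_space set \<Rightarrow> ('a, 'e) atlas \<Rightarrow> 'a set \<Rightarrow> ('a \<Rightarrow> 'c) \<Rightarrow>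
      ('b, 'e) atlas \<Rightarrow> 'b set \<Rightarrow> ('b \<Rightarrow> 'c) \<Rightarrow> 'a \<Rightarrow> bool" where
  "glued_at K A S \<psi> B T \<eta> p \<longleftrightarrow>
     (\<exists>c\<in>A. \<exists>d\<in>B. \<exists>g. smooth_near K c d g p \<and> chart_nbhd c {z \<in> S. g z \<in> T \<and> \<eta> (g z) = \<psi> z} p)"

lemma glued_atI:
  "c \<in> A \<Longrightarrow> d \<in> B \<Longrightarrow> smooth_near K c d g p \<Longrightarrow> chart_nbhd c {z \<in> S. g z \<in> T \<and> \<eta> (g z) = \<psi> z} p \<Longrightarrow>
   glued_at K A S \<psi> B T \<eta> p"
  unfolding glued_at_def by (intro bexI exI conjI)

lemma glued_atE:
  assumes "glued_at K A S \<psi> B T \<eta> p"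
  obtains c d g where "c \<in> A" "d \<in> B" "smooth_near K c d g p"
    "chart_nbhd c {z \<in> S. g z \<in> T \<and> \<eta> (g z) = \<psi> z} p"
  using assms unfolding glued_at_def by (elim bexE exE conjE)

text \<open>The identifications of \<open>S\<close> with \<open>T\<close> and of \<open>T\<close> with \<open>R\<close> compose.  This compares two charts of the
  groupoid at \<open>t > 0\<close>, with \<open>M \<times> M \<times> (0,1]\<close> in the middle.\<close>

lemma glued_at_trans:
  assumes B: "smooth_atlas K B" and g1: "glued_at K A S \<psi> B T \<eta> p"
    and g2: "\<And>q. q \<in> T \<Longrightarrow> \<eta> q = \<psi> p \<Longrightarrow> glued_at K B T \<eta> C R \<xi> q" and C: "smooth_atlas K C"
  shows "glued_at K A S \<psi> C R \<xi> p"
proof -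
  obtain c d g where c: "c \<in> A" "d \<in> B" "smooth_near K c d g p"
    "chart_nbhd c {z \<in> S. g z \<in> T \<and> \<eta> (g z) = \<psi> z} p" by (rule glued_atE[OF g1])
  have gp: "g p \<in> T" "\<eta> (g p) = \<psi> p" using chart_nbhd_mem[OF c(4)] by auto
  obtain d' e f where d: "d' \<in> B" "e \<in> C" "smooth_near K d' e f (g p)"
    "chart_nbhd d' {z \<in> T. f z \<in> R \<and> \<xi> (f z) = \<eta> z} (g p)" by (rule glued_atE[OF g2[OF gp]])
  have gd: "g p \<in> fst d" "f (g p) \<in> fst e" using smooth_near_mem[OF c(3)] smooth_near_mem[OF d(3)] by auto
  have near: "smooth_near K d e f (g p)"
    by (rule smooth_near_change_charts[OF B C d(3) d(1) d(2) c(2) d(2) gd])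
  have nb: "chart_nbhd d {z \<in> T. f z \<in> R \<and> \<xi> (f z) = \<eta> z} (g p)"
    by (rule chart_nbhd_change[OF B c(2) d(1) d(4) gd(1)])
  show ?thesis
  proof (rule glued_atI[OF c(1) d(2) smooth_near_compose[OF c(3) near]])
    show "chart_nbhd c {z \<in> S. f (g z) \<in> R \<and> \<xi> (f (g z)) = \<psi> z} p"
      by (rule chart_nbhd_mono[OF chart_nbhd_Int[OF c(4) chart_nbhd_near[OF c(3) nb]]]) auto
  qed
qed

locale gluing =
  fixes K :: "'e::euclidean_space set" and A :: "('a, 'e) atlas" and S :: "'a set" and \<psi> :: "'a \<Rightarrow> 'c"
    and B :: "('b, 'e) atlas" and T :: "'b set" and \<eta> :: "'b \<Rightarrow> 'c"
  assumes A: "smooth_atlas K A" "openin (atlas_topology K A) S" "inj_on \<psi> S"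
    and B: "smooth_atlas K B" "openin (atlas_topology K B) T" "inj_on \<eta> T"
    and glued: "\<And>p. p \<in> S \<Longrightarrow> \<psi> p \<in> \<eta> ` T \<Longrightarrow> glued_at K A S \<psi> B T \<eta> p"
begin

lemma openin_overlap: "openin (atlas_topology K A) {p \<in> S. \<psi> p \<in> \<eta> ` T}"
  unfolding openin_atlas_iff(1)[OF A(1)]
proof
  fix p assume p: "p \<in> {p \<in> S. \<psi> p \<in> \<eta> ` T}"
  obtain c d g where c: "c \<in> A" "d \<in> B" "smooth_near K c d g p"
    "chart_nbhd c {z \<in> S. g z \<in> T \<and> \<eta> (g z) = \<psi> z} p" by (rule glued_atE[OF glued]) (use p in auto)
  have "chart_nbhd c {p \<in> S. \<psi> p \<in> \<eta> ` T} p"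
  proof (rule chart_nbhd_mono[OF c(4)], rule subsetI)
    fix z assume "z \<in> {z \<in> S. g z \<in> T \<and> \<eta> (g z) = \<psi> z}"
    then show "z \<in> {p \<in> S. \<psi> p \<in> \<eta> ` T}" using imageI[of "g z" T \<eta>] by simp
  qed
  then show "\<exists>c\<in>A. chart_nbhd c {p \<in> S. \<psi> p \<in> \<eta> ` T} p" using c(1) by (rule bexI)
qed

text \<open>By injectivity of \<open>\<eta>\<close>, the local representatives \<open>g\<close> are restrictions of one map.\<close>

lemma smooth_near_transition:
  assumes p: "p \<in> S" "\<psi> p \<in> \<eta> ` T"
  obtains c d where "c \<in> A" "d \<in> B" "smooth_near K c d (inv_into T \<eta> \<circ> \<psi>) p"
proof -
  obtain c d g where c: "c \<in> A" "d \<in> B" "smooth_near K c d g p"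
    "chart_nbhd c {z \<in> S. g z \<in> T \<and> \<eta> (g z) = \<psi> z} p" by (rule glued_atE[OF glued[OF p]])
  obtain N where N: "open N" "snd c p \<in> N"
    "\<And>z. z \<in> fst c \<Longrightarrow> snd c z \<in> N \<Longrightarrow> z \<in> S \<and> g z \<in> T \<and> \<eta> (g z) = \<psi> z" by (rule chart_nbhd_congE[OF c(4)]) blast
  have "smooth_near K c d (inv_into T \<eta> \<circ> \<psi>) p"
  proof (rule smooth_near_cong[OF c(3) N(1,2)])
    fix z assume "z \<in> fst c" "snd c z \<in> N"
    then have "g z \<in> T" "\<eta> (g z) = \<psi> z" using N(3) by auto
    then show "g z = (inv_into T \<eta> \<circ> \<psi>) z" using inv_into_f_f[OF B(3), of "g z"] by simp
  qed
  then show ?thesis by (rule that[OF c(1,2)])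
qed

lemma smooth_near_transported:
  assumes c': "c' \<in> transport \<psi> (sub_atlas A S)" "d' \<in> transport \<eta> (sub_atlas B T)" and w: "w \<in> fst c'" "w \<in> fst d'"
  shows "smooth_near K c' d' (\<lambda>z. z) w"
proof -
  obtain c where c: "c \<in> A" "c' = (\<psi> ` (fst c \<inter> S), snd c \<circ> inv_into (fst c \<inter> S) \<psi>)"
    using c'(1) unfolding transport_iff Bex_sub_atlas by auto
  obtain d where d: "d \<in> B" "d' = (\<eta> ` (fst d \<inter> T), snd d \<circ> inv_into (fst d \<inter> T) \<eta>)"
    using c'(2) unfolding transport_iff Bex_sub_atlas by auto
  obtain p where p: "p \<in> fst c" "p \<in> S" "w = \<psi> p" using w(1) c(2) by auto
  obtain q where q: "q \<in> fst d" "q \<in> T" "w = \<eta> q" using w(2) d(2) by auto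
  have pT: "\<psi> p \<in> \<eta> ` T" using q p(3) by auto
  obtain c0 d0 g where 0: "c0 \<in> A" "d0 \<in> B" "smooth_near K c0 d0 g p"
    "chart_nbhd c0 {z \<in> S. g z \<in> T \<and> \<eta> (g z) = \<psi> z} p" by (rule glued_atE[OF glued[OF p(2) pT]])
  have gp: "g p \<in> T" "\<eta> (g p) = \<psi> p" using chart_nbhd_mem[OF 0(4)] by auto
  then have gq: "g p = q" using inj_onD[OF B(3), of "g p" q] q(2,3) p(3) by simp
  have gd: "g p \<in> fst d" using gq q by simp
  have near: "smooth_near K c d g p"
    by (rule smooth_near_change_charts[OF A(1) B(1) 0(3) 0(1) 0(2) c(1) d(1) p(1) gd])
  obtain N where N: "open N" "snd c p \<in> N" "\<And>z. z \<in> fst c \<Longrightarrow> snd c z \<in> N \<Longrightarrow> z \<in> S \<and> g z \<in> T \<and> \<eta> (g z) = \<psi> z"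
    by (rule chart_nbhd_congE[OF chart_nbhd_change[OF A(1) c(1) 0(1) 0(4) p(1)]]) blast
  have near': "smooth_near K (fst c \<inter> S, snd c) (fst d \<inter> T, snd d) g p"
    unfolding smooth_near_restrict_source[OF A(1,2) c(1) p(2)] smooth_near_restrict_target[OF B(1,2) d(1)]
    using near gp by simp
  have "smooth_near K (\<psi> ` fst (fst c \<inter> S, snd c), snd (fst c \<inter> S, snd c) \<circ> inv_into (fst (fst c \<inter> S, snd c)) \<psi>)
    (\<eta> ` fst (fst d \<inter> T, snd d), snd (fst d \<inter> T, snd d) \<circ> inv_into (fst (fst d \<inter> T, snd d)) \<eta>) (\<lambda>z. z) (\<psi> p)"
  proof (rule smooth_near_transport[OF near' _ _ N(1)])
    show "inj_on \<psi> (fst (fst c \<inter> S, snd c))" using inj_on_subset[OF A(3)] by simp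
    show "inj_on \<eta> (fst (fst d \<inter> T, snd d))" using inj_on_subset[OF B(3)] by simp
  qed (use N in auto)
  then show ?thesis unfolding c(2) d(2) p(3) by simp
qed

end

lemma smooth_atlas_glue:
  assumes "gluing K A S \<psi> B T \<eta>" "gluing K B T \<eta> A S \<psi>"
  shows "smooth_atlas K (transport \<psi> (sub_atlas A S) \<union> transport \<eta> (sub_atlas B T))"
proof -
  interpret g: gluing K A S \<psi> B T \<eta> by fact
  interpret g': gluing K B T \<eta> A S \<psi> by fact
  have TA: "smooth_atlas K (transport \<psi> (sub_atlas A S))"
    by (rule smooth_atlas_transport[OF smooth_atlas_sub_atlas[OF g.A(1,2)]])
      (rule inj_on_subset[OF g.A(3)], simp add: points_sub_atlas)
  have TB: "smooth_atlas K (transport \<eta> (sub_atlas B T))"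
    by (rule smooth_atlas_transport[OF smooth_atlas_sub_atlas[OF g.B(1,2)]])
      (rule inj_on_subset[OF g.B(3)], simp add: points_sub_atlas)
  show ?thesis
  proof (rule smooth_atlasI)
    show "is_chart K c" if "c \<in> transport \<psi> (sub_atlas A S) \<union> transport \<eta> (sub_atlas B T)" for c
      using that smooth_atlasD(1)[OF TA] smooth_atlasD(1)[OF TB] by (elim UnE)
    show "smooth_near K c d (\<lambda>z. z) w"
      if "c \<in> transport \<psi> (sub_atlas A S) \<union> transport \<eta> (sub_atlas B T)"
        "d \<in> transport \<psi> (sub_atlas A S) \<union> transport \<eta> (sub_atlas B T)" "w \<in> fst c" "w \<in> fst d" for c d w
      using that(1,2)
    proof (elim UnE)
      assume "c \<in> transport \<psi> (sub_atlas A S)" "d \<in> transport \<psi> (sub_atlas A S)"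
      then show ?thesis using smooth_atlasD(2)[OF TA _ _ that(3,4)] by simp
    next
      assume "c \<in> transport \<eta> (sub_atlas B T)" "d \<in> transport \<eta> (sub_atlas B T)"
      then show ?thesis using smooth_atlasD(2)[OF TB _ _ that(3,4)] by simp
    next
      assume "c \<in> transport \<psi> (sub_atlas A S)" "d \<in> transport \<eta> (sub_atlas B T)"
      then show ?thesis by (rule g.smooth_near_transported[OF _ _ that(3,4)])
    next
      assume "c \<in> transport \<eta> (sub_atlas B T)" "d \<in> transport \<psi> (sub_atlas A S)"
      then show ?thesis by (rule g'.smooth_near_transported[OF _ _ that(3,4)])
    qed
  qed
qed

lemma diffeomorphism_glue:
  assumes "gluing K A S \<psi> B T \<eta>" "gluing K B T \<eta> A S \<psi>"
  defines "D \<equiv> {p \<in> S. \<psi> p \<in> \<eta> ` T}" and "E \<equiv> {q \<in> T. \<eta> q \<in> \<psi> ` S}"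
  shows "diffeomorphism K (sub_atlas A D) K (sub_atlas B E) (inv_into T \<eta> \<circ> \<psi>)"
proof -
  interpret g: gluing K A S \<psi> B T \<eta> by fact
  interpret g': gluing K B T \<eta> A S \<psi> by fact
  let ?f = "inv_into T \<eta> \<circ> \<psi>" and ?g = "inv_into S \<psi> \<circ> \<eta>"
  have oD: "openin (atlas_topology K A) D" unfolding D_def by (rule g.openin_overlap)
  have oE: "openin (atlas_topology K B) E" unfolding E_def by (rule g'.openin_overlap)
  have "S \<subseteq> points A" "T \<subseteq> points B"
    using openin_subset[OF g.A(2)] openin_subset[OF g.B(2)] topspace_atlas g.A(1) g.B(1) by metis+
  then have pts: "points (sub_atlas A D) = D" "points (sub_atlas B E) = E"
    unfolding points_sub_atlas D_def E_def by auto
  have f: "?f p \<in> E \<and> \<eta> (?f p) = \<psi> p" if p: "p \<in> D" for p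
  proof -
    have "\<psi> p \<in> \<eta> ` T" "p \<in> S" using p by (auto simp: D_def)
    then show ?thesis using inv_into_into[of "\<psi> p" \<eta> T] f_inv_into_f[of "\<psi> p" \<eta> T] by (simp add: E_def)
  qed
  have g: "?g q \<in> D \<and> \<psi> (?g q) = \<eta> q" if q: "q \<in> E" for q
  proof -
    have "\<eta> q \<in> \<psi> ` S" "q \<in> T" using q by (auto simp: E_def)
    then show ?thesis using inv_into_into[of "\<eta> q" \<psi> S] f_inv_into_f[of "\<eta> q" \<psi> S] by (simp add: D_def)
  qed
  have gf: "?g (?f p) = p" if p: "p \<in> D" for p
    by (rule inj_onD[OF g.A(3)]) (use f[OF p] g[of "?f p"] p in \<open>auto simp: D_def\<close>)
  have fg: "?f (?g q) = q" if q: "q \<in> E" for q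
    by (rule inj_onD[OF g.B(3)]) (use g[OF q] f[of "?g q"] q in \<open>auto simp: E_def\<close>)
  have bij: "bij_betw ?f D E"
    by (rule bij_betw_byWitness[of D ?g]) (use f g gf fg in auto)
  have sf: "smooth_map K (sub_atlas A D) K (sub_atlas B E) ?f"
    unfolding smooth_map_sub_atlas_iff(1)[OF g.A(1) oD g.B(1) oE]
  proof
    fix p assume p: "p \<in> D"
    obtain c d where "c \<in> A" "d \<in> B" "smooth_near K c d ?f p"
      by (rule g.smooth_near_transition) (use p in \<open>auto simp: D_def\<close>)
    then have "\<exists>c\<in>A. \<exists>d\<in>B. smooth_near K c d ?f p" by (intro bexI)
    then show "?f p \<in> E \<and> (\<exists>c\<in>A. \<exists>d\<in>B. smooth_near K c d ?f p)" using f[OF p] by (intro conjI) simp_all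
  qed
  have inv: "inv_into D ?f q = ?g q" if q: "q \<in> E" for q
    using inv_into_f_eq[OF bij_betw_imp_inj_on[OF bij] conjunct1[OF g[OF q]] fg[OF q]] .
  have sg: "smooth_map K (sub_atlas B E) K (sub_atlas A D) (inv_into D ?f)"
    unfolding smooth_map_sub_atlas_iff(1)[OF g.B(1) oE g.A(1) oD]
  proof
    fix q assume q: "q \<in> E"
    obtain c d where cd: "c \<in> B" "d \<in> A" "smooth_near K c d ?g q"
      by (rule g'.smooth_near_transition) (use q in \<open>auto simp: E_def\<close>)
    have "q \<in> fst c" using smooth_near_mem[OF cd(3)] by simp
    then have "chart_nbhd c E q" by (rule openin_atlas_iff(2)[OF g.B(1) oE cd(1) q])
    then obtain N where N: "open N" "snd c q \<in> N" "\<forall>z\<in>fst c. snd c z \<in> N \<longrightarrow> z \<in> E"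
      unfolding chart_nbhd_def by blast
    have "smooth_near K c d (inv_into D ?f) q"
      by (rule smooth_near_cong[OF cd(3) N(1,2)]) (use inv N(3) in metis)
    then have "\<exists>c\<in>B. \<exists>d\<in>A. smooth_near K c d (inv_into D ?f) q" using cd(1,2) by (intro bexI)
    then show "inv_into D ?f q \<in> D \<and> (\<exists>c\<in>B. \<exists>d\<in>A. smooth_near K c d (inv_into D ?f) q)"
      using g[OF q] inv[OF q] by (intro conjI) simp_all
  qed
  show ?thesis unfolding diffeomorphism_def pts using bij sf sg by blast
qed

lemma smooth_atlas_Un_pairwise:
  assumes "smooth_atlas K (A \<union> B)" "smooth_atlas K (A \<union> C)" "smooth_atlas K (B \<union> C)"
  shows "smooth_atlas K (A \<union> B \<union> C)"
proof (rule smooth_atlasI)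
  show "is_chart K c" if "c \<in> A \<union> B \<union> C" for c
    using that smooth_atlasD(1)[OF assms(1), of c] smooth_atlasD(1)[OF assms(2), of c] by auto
  show "smooth_near K c d (\<lambda>z. z) p" if "c \<in> A \<union> B \<union> C" "d \<in> A \<union> B \<union> C" "p \<in> fst c" "p \<in> fst d" for c d p
    using that(1,2) smooth_atlasD(2)[OF assms(1) _ _ that(3,4)] smooth_atlasD(2)[OF assms(2) _ _ that(3,4)]
      smooth_atlasD(2)[OF assms(3) _ _ that(3,4)] by auto
qed

lemma openin_transport_image:
  assumes A: "smooth_atlas K A" "openin (atlas_topology K A) S" "inj_on \<psi> S"
    and G: "smooth_atlas K G" "transport \<psi> (sub_atlas A S) \<subseteq> G"
    and P: "openin (atlas_topology K A) P" "P \<subseteq> S"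
  shows "openin (atlas_topology K G) (\<psi> ` P)"
  unfolding openin_atlas_iff(1)[OF G(1)]
proof
  fix w assume "w \<in> \<psi> ` P"
  then obtain x where x: "x \<in> P" "w = \<psi> x" by blast
  obtain c where c: "c \<in> A" "chart_nbhd c P x" using P(1) x(1) unfolding openin_atlas_iff(1)[OF A(1)] by blast
  obtain N where N: "x \<in> fst c" "open N" "snd c x \<in> N" "\<forall>z\<in>fst c. snd c z \<in> N \<longrightarrow> z \<in> P"
    using c(2) unfolding chart_nbhd_def by blast
  let ?c = "(\<psi> ` (fst c \<inter> S), snd c \<circ> inv_into (fst c \<inter> S) \<psi>)"
  have cG: "?c \<in> G" using c(1) G(2) unfolding subset_iff transport_iff Bex_sub_atlas by auto
  have inv: "inv_into (fst c \<inter> S) \<psi> (\<psi> y) = y" if "y \<in> fst c \<inter> S" for y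
    by (rule inv_into_f_f[OF inj_on_subset[OF A(3)] that]) blast
  have xS: "x \<in> fst c \<inter> S" using N(1) x(1) P(2) by blast
  have "chart_nbhd ?c (\<psi> ` P) w" unfolding chart_nbhd_def
  proof (intro conjI exI[of _ N])
    show "w \<in> fst ?c" using xS x(2) by simp
    show "open N" by fact
    show "snd ?c w \<in> N" using N(3) inv[OF xS] x(2) by simp
    show "\<forall>z\<in>fst ?c. snd ?c z \<in> N \<longrightarrow> z \<in> \<psi> ` P" using N(4) inv by auto
  qed
  then show "\<exists>c\<in>G. chart_nbhd c (\<psi> ` P) w" using cG by (rule bexI)
qed

section \<open>Second-order jets of curves\<close>

text \<open>The velocity \<open>u\<close> and the acceleration \<open>w\<close> of a curve at parameter \<open>0\<close>; the curve is differentiable near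
  \<open>0\<close>, so that these are the iterated derivatives and not just Taylor coefficients.\<close>

definition has_jet :: "(real \<Rightarrow> 'e::euclidean_space) \<Rightarrow> 'e \<Rightarrow> 'e \<Rightarrow> bool" where
  "has_jet c u w \<longleftrightarrow> (\<exists>S h. open S \<and> 0 \<in> S \<and> (\<forall>t\<in>S. (c has_vector_derivative h t) (at t)) \<and>
     h 0 = u \<and> (h has_vector_derivative w) (at 0))"

lemma has_jetI:
  assumes "open S" "0 \<in> S" "\<And>t. t \<in> S \<Longrightarrow> (c has_vector_derivative h t) (at t)"
    "h 0 = u" "(h has_vector_derivative w) (at 0)"
  shows "has_jet c u w"
  unfolding has_jet_def by (intro exI[of _ S] exI[of _ h] conjI ballI assms)

lemma has_jetE:
  assumes "has_jet c u w"
  obtains S h where "open S" "0 \<in> S" "\<forall>t\<in>S. (c has_vector_derivative h t) (at t)"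
    "h 0 = u" "(h has_vector_derivative w) (at 0)"
  using assms unfolding has_jet_def by (elim exE conjE)

lemma has_jet_cong:
  assumes "has_jet c u w" "open N" "0 \<in> N" "\<And>t. t \<in> N \<Longrightarrow> c t = c' t"
  shows "has_jet c' u w"
proof -
  obtain S h where S: "open S" "0 \<in> S" "\<forall>t\<in>S. (c has_vector_derivative h t) (at t)"
    "h 0 = u" "(h has_vector_derivative w) (at 0)" by (rule has_jetE[OF assms(1)])
  show ?thesis
  proof (rule has_jetI[of "S \<inter> N" _ h])
    fix t assume t: "t \<in> S \<inter> N"
    show "(c' has_vector_derivative h t) (at t)"
      by (rule has_vector_derivative_transform_within_open[of c _ _ "S \<inter> N"])
        (use S t assms in auto)
  qed (use S assms in auto)
qed

lemma has_jet_derivatives: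
  assumes "has_jet c u w"
  shows "vector_derivative c (at 0) = u" "vector_derivative (\<lambda>t. vector_derivative c (at t)) (at 0) = w"
proof -
  obtain S h where S: "open S" "0 \<in> S" "\<forall>t\<in>S. (c has_vector_derivative h t) (at t)"
    "h 0 = u" "(h has_vector_derivative w) (at 0)" by (rule has_jetE[OF assms])
  have eq: "vector_derivative c (at t) = h t" if "t \<in> S" for t
    using S(3) that vector_derivative_at by blast
  show "vector_derivative c (at 0) = u" using eq S by simp
  have "((\<lambda>t. vector_derivative c (at t)) has_vector_derivative w) (at 0)"
    by (rule has_vector_derivative_transform_within_open[OF S(5) S(1,2)]) (simp add: eq)
  then show "vector_derivative (\<lambda>t. vector_derivative c (at t)) (at 0) = w" by (rule vector_derivative_at)
qed

lemma has_jet_unique: "has_jet c u w \<Longrightarrow> has_jet c u' w' \<Longrightarrow> u = u' \<and> w = w'"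
  using has_jet_derivatives by metis

lemma has_jet_continuous:
  assumes "has_jet c u w" "open N" "c 0 \<in> N"
  obtains S where "open S" "0 \<in> S" "\<forall>t\<in>S. c t \<in> N"
proof -
  obtain S h where S: "open S" "0 \<in> S" "\<forall>t\<in>S. (c has_vector_derivative h t) (at t)"
    "h 0 = u" "(h has_vector_derivative w) (at 0)" by (rule has_jetE[OF assms(1)])
  have "continuous_on S c"
    using S(3) has_vector_derivative_continuous continuous_at_imp_continuous_on by blast
  then have "open (S \<inter> c -` N)" using S(1) assms(2) continuous_open_preimage by blast
  then show ?thesis by (rule that) (use S assms in auto)
qed

lemma has_vector_derivative_compose_linear:
  assumes "(f has_derivative f') (at (c t))" "(c has_vector_derivative v) (at t)"
  shows "((\<lambda>t. f (c t)) has_vector_derivative f' v) (at t)"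
proof -
  have "((\<lambda>t. f (c t)) has_derivative (\<lambda>h. f' (h *\<^sub>R v))) (at t)"
    by (rule has_derivative_compose[OF assms(2)[unfolded has_vector_derivative_def] assms(1)])
  moreover have "linear f'" using assms(1) has_derivative_linear by blast
  ultimately show ?thesis by (simp add: has_vector_derivative_def linear_scale)
qed

lemma has_jet_smooth:
  assumes "open_smooth S c" "0 \<in> S" shows "\<exists>u w. has_jet c u w"
proof -
  define h where "h t = frechet_derivative c (at t) 1" for t
  have hs: "open_smooth S h" unfolding h_def by (rule open_smooth_derivative[OF assms(1)])
  have d: "(f has_vector_derivative frechet_derivative f (at t) 1) (at t)"
    if "open_smooth S f" "t \<in> S" for f :: "real \<Rightarrow> 'a" and t
    using open_smooth_has_derivative[OF that] has_vector_derivative_compose_linear[of f _ "\<lambda>x. x" t 1]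
    by (simp add: has_vector_derivative_id[unfolded id_def] has_vector_derivative_def)
  have "has_jet c (h 0) (frechet_derivative h (at 0) 1)"
    by (rule has_jetI[of S _ h]) (use assms d[OF assms(1)] d[OF hs] h_def open_smooth_open in auto)
  then show ?thesis by blast
qed

lemma has_jet_reparam:
  assumes "has_jet c u w" shows "has_jet (\<lambda>t. c (s * t)) (s *\<^sub>R u) (s\<^sup>2 *\<^sub>R w)"
proof -
  obtain S h where S: "open S" "0 \<in> S" "\<forall>t\<in>S. (c has_vector_derivative h t) (at t)"
    "h 0 = u" "(h has_vector_derivative w) (at 0)" by (rule has_jetE[OF assms(1)])
  have lin: "((\<lambda>t. s * t) has_vector_derivative s) (at t)" for t
    by (auto intro!: derivative_eq_intros simp: has_vector_derivative_def)
  have comp: "((\<lambda>t. g (s * t)) has_vector_derivative s *\<^sub>R v) (at t)"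
    if "(g has_vector_derivative v) (at (s * t))" for g :: "real \<Rightarrow> 'a" and v t
    using vector_diff_chain_at[OF lin that] by (simp add: o_def)
  have "continuous_on UNIV (\<lambda>t. s * t)" by (intro continuous_intros)
  then have o: "open ((\<lambda>t. s * t) -` S)" using S(1) by (simp add: open_vimage)
  show ?thesis
  proof (rule has_jetI[OF o, of _ "\<lambda>t. s *\<^sub>R h (s * t)"])
    show "((\<lambda>t. c (s * t)) has_vector_derivative s *\<^sub>R h (s * t)) (at t)" if "t \<in> (\<lambda>t. s * t) -` S" for t
      by (rule comp) (use that S in auto)
    have "((\<lambda>t. s *\<^sub>R h (s * t)) has_vector_derivative s *\<^sub>R (s *\<^sub>R w)) (at 0)"
      by (rule bounded_linear.has_vector_derivative[OF bounded_linear_scaleR_right comp]) (use S in simp)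
    then show "((\<lambda>t. s *\<^sub>R h (s * t)) has_vector_derivative s\<^sup>2 *\<^sub>R w) (at 0)"
      by (simp add: power2_eq_square)
  qed (use S in auto)
qed

lemma has_jet_add:
  assumes "has_jet c u w" "has_jet c' u' w'" shows "has_jet (\<lambda>t. c t + c' t) (u + u') (w + w')"
proof -
  obtain S h where S: "open S" "0 \<in> S" "\<forall>t\<in>S. (c has_vector_derivative h t) (at t)"
    "h 0 = u" "(h has_vector_derivative w) (at 0)" by (rule has_jetE[OF assms(1)])
  obtain S' h' where S': "open S'" "0 \<in> S'" "\<forall>t\<in>S'. (c' has_vector_derivative h' t) (at t)"
    "h' 0 = u'" "(h' has_vector_derivative w') (at 0)" by (rule has_jetE[OF assms(2)])
  show ?thesis
    by (rule has_jetI[of "S \<inter> S'" _ "\<lambda>t. h t + h' t"])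
      (use S S' in \<open>auto intro: has_vector_derivative_add\<close>)
qed

lemma has_jet_scaleR_variable:
  assumes "has_jet c u w" shows "has_jet (\<lambda>t. t *\<^sub>R c t) (c 0) (2 *\<^sub>R u)"
proof -
  obtain S h where S: "open S" "0 \<in> S" "\<forall>t\<in>S. (c has_vector_derivative h t) (at t)"
    "h 0 = u" "(h has_vector_derivative w) (at 0)" by (rule has_jetE[OF assms(1)])
  have p: "((\<lambda>t. t *\<^sub>R g t) has_vector_derivative (t *\<^sub>R v + g t)) (at t)"
    if "(g has_vector_derivative v) (at t)" for g :: "real \<Rightarrow> 'a" and v t
    using has_vector_derivative_scaleR[of "\<lambda>t. t" 1 t UNIV g v] that by simp
  show ?thesis
  proof (rule has_jetI[OF S(1,2), of _ "\<lambda>t. t *\<^sub>R h t + c t"])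
    show "((\<lambda>t. t *\<^sub>R c t) has_vector_derivative t *\<^sub>R h t + c t) (at t)" if "t \<in> S" for t
      using p S(3) that by blast
    have "((\<lambda>t. t *\<^sub>R h t + c t) has_vector_derivative ((0 *\<^sub>R w + h 0) + h 0)) (at 0)"
      by (intro has_vector_derivative_add p S) (use S in auto)
    then show "((\<lambda>t. t *\<^sub>R h t + c t) has_vector_derivative 2 *\<^sub>R u) (at 0)"
      using S(4) by (simp add: scaleR_2)
  qed simp
qed

lemma has_jet_const: "has_jet (\<lambda>t. x) 0 0"
  by (rule has_jetI[of UNIV _ "\<lambda>t. 0"]) auto

lemma has_jet_quadratic: "has_jet (\<lambda>t. x + t *\<^sub>R u + (t\<^sup>2 / 2) *\<^sub>R w) u w"
proof -
  have 1: "has_jet (\<lambda>t. t *\<^sub>R u) u 0" using has_jet_scaleR_variable[OF has_jet_const[of u]] by simp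
  have 2: "has_jet (\<lambda>t. t *\<^sub>R t *\<^sub>R ((1 / 2) *\<^sub>R w)) 0 w"
    using has_jet_scaleR_variable[OF has_jet_scaleR_variable[OF has_jet_const[of "(1 / 2) *\<^sub>R w"]]] by simp
  show ?thesis using has_jet_add[OF has_jet_add[OF has_jet_const[of x] 1] 2]
    by (simp add: power2_eq_square)
qed

lemma has_jet_linear:
  assumes "bounded_linear L" "has_jet c u w" shows "has_jet (\<lambda>t. L (c t)) (L u) (L w)"
proof -
  obtain S h where S: "open S" "0 \<in> S" "\<forall>t\<in>S. (c has_vector_derivative h t) (at t)"
    "h 0 = u" "(h has_vector_derivative w) (at 0)" by (rule has_jetE[OF assms(2)])
  show ?thesis
    by (rule has_jetI[OF S(1,2), of _ "\<lambda>t. L (h t)"])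
      (use S bounded_linear.has_vector_derivative[OF assms(1)] in auto)
qed

lemma has_jet_Pair_ident:
  assumes "has_jet c u w" shows "has_jet (\<lambda>t. (c t, t)) (u, 1) (w, 0)"
proof -
  obtain S h where S: "open S" "0 \<in> S" "\<forall>t\<in>S. (c has_vector_derivative h t) (at t)"
    "h 0 = u" "(h has_vector_derivative w) (at 0)" by (rule has_jetE[OF assms])
  show ?thesis
  proof (rule has_jetI[OF S(1,2), of _ "\<lambda>t. (h t, 1)"])
    show "((\<lambda>t. (c t, t)) has_vector_derivative (h t, 1)) (at t)" if "t \<in> S" for t
      using S(3) that by (auto intro!: has_vector_derivative_Pair)
    show "((\<lambda>t. (h t, 1::real)) has_vector_derivative (w, 0)) (at 0)"
      using S(5) by (auto intro!: has_vector_derivative_Pair)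
  qed (use S in auto)
qed

lemma has_jet_const_Pair:
  assumes "has_jet c u w" shows "has_jet (\<lambda>t. (x, c t)) (0, u) (0, w)"
proof -
  have "has_jet (\<lambda>t. (x, 0) + (0, c t)) (0 + (0, u)) (0 + (0, w))"
    by (rule has_jet_add[OF has_jet_const has_jet_linear[OF _ assms]])
      (intro bounded_linear_Pair bounded_linear_zero bounded_linear_ident)
  then show ?thesis by simp
qed

text \<open>The second derivative of \<open>f\<close> at \<open>x\<close>, as a quadratic form in \<open>u\<close>.\<close>

definition second_derivative :: "('a::euclidean_space \<Rightarrow> 'b::euclidean_space) \<Rightarrow> 'a \<Rightarrow> 'a \<Rightarrow> 'b" where
  "second_derivative f x u =
     (\<Sum>b\<in>Basis. (u \<bullet> b) *\<^sub>R frechet_derivative (\<lambda>y. frechet_derivative f (at y) b) (at x) u)"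

text \<open>The chain rule to second order.\<close>

lemma has_jet_compose:
  assumes f: "open_smooth T f" and c: "has_jet c u w" and x: "c 0 \<in> T"
  shows "has_jet (\<lambda>t. f (c t)) (frechet_derivative f (at (c 0)) u)
     (frechet_derivative f (at (c 0)) w + second_derivative f (c 0) u)"
proof -
  obtain S h where S: "open S" "0 \<in> S" "\<forall>t\<in>S. (c has_vector_derivative h t) (at t)"
    "h 0 = u" "(h has_vector_derivative w) (at 0)" by (rule has_jetE[OF c])
  obtain S' where S': "open S'" "0 \<in> S'" "\<forall>t\<in>S'. c t \<in> T"
    by (rule has_jet_continuous[OF c open_smooth_open[OF f] x])
  define D where "D b y = frechet_derivative f (at y) b" for b y
  have D: "open_smooth T (D b)" for b unfolding D_def by (rule open_smooth_derivative[OF f])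
  define k where "k t = (\<Sum>b\<in>Basis. (h t \<bullet> b) *\<^sub>R D b (c t))" for t
  have lin: "linear (frechet_derivative f (at y))" if "y \<in> T" for y
    by (rule open_smooth_derivative_linear[OF f that])
  have kD: "k t = frechet_derivative f (at (c t)) (h t)" if "t \<in> S'" for t
    using linear_Basis_expand[OF lin[OF bspec[OF S'(3) that]], of "h t"] by (simp add: k_def D_def)
  show ?thesis
  proof (rule has_jetI[of "S \<inter> S'" _ k])
    fix t assume t: "t \<in> S \<inter> S'"
    have "((\<lambda>t. f (c t)) has_vector_derivative frechet_derivative f (at (c t)) (h t)) (at t)"
      by (rule has_vector_derivative_compose_linear[OF open_smooth_has_derivative[OF f]]) (use S S' t in auto)
    then show "((\<lambda>t. f (c t)) has_vector_derivative k t) (at t)" using kD t by simp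
  next
    show "k 0 = frechet_derivative f (at (c 0)) u" using kD S S' by simp
    have Dc: "((\<lambda>t. D b (c t)) has_vector_derivative frechet_derivative (D b) (at (c 0)) u) (at 0)" for b
      by (rule has_vector_derivative_compose_linear[where c = c and t = 0, OF open_smooth_has_derivative[OF D x]]) (use S in auto)
    have hb: "((\<lambda>t. h t \<bullet> b) has_real_derivative w \<bullet> b) (at 0)" for b
      using bounded_linear.has_vector_derivative[OF bounded_linear_inner_left[of b] S(5)]
      by (simp add: has_real_derivative_iff_has_vector_derivative)
    have "(k has_vector_derivative (\<Sum>b\<in>Basis. (h 0 \<bullet> b) *\<^sub>R frechet_derivative (D b) (at (c 0)) u
        + (w \<bullet> b) *\<^sub>R D b (c 0))) (at 0)"
      unfolding k_def
    proof (rule has_vector_derivative_sum)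
      fix b
      show "((\<lambda>t. (h t \<bullet> b) *\<^sub>R D b (c t)) has_vector_derivative
         (h 0 \<bullet> b) *\<^sub>R frechet_derivative (D b) (at (c 0)) u + (w \<bullet> b) *\<^sub>R D b (c 0)) (at 0)"
        using has_vector_derivative_scaleR[OF hb Dc] .
    qed
    moreover have "(\<Sum>b\<in>Basis. (h 0 \<bullet> b) *\<^sub>R frechet_derivative (D b) (at (c 0)) u
        + (w \<bullet> b) *\<^sub>R D b (c 0)) = frechet_derivative f (at (c 0)) w + second_derivative f (c 0) u"
      using linear_Basis_expand[OF lin[OF x], of w] S(4)
      by (simp add: sum.distrib second_derivative_def D_def[abs_def])
    ultimately show "(k has_vector_derivative frechet_derivative f (at (c 0)) w + second_derivative f (c 0) u) (at 0)"
      by simp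
  qed (use S S' in auto)
qed

lemma second_derivative_scale:
  assumes "open_smooth T f" "x \<in> T"
  shows "second_derivative f x (s *\<^sub>R u) = s\<^sup>2 *\<^sub>R second_derivative f x u"
proof -
  have "linear (frechet_derivative (\<lambda>y. frechet_derivative f (at y) b) (at x))" for b
    by (rule open_smooth_derivative_linear[OF open_smooth_derivative[OF assms(1)] assms(2)])
  then show ?thesis
    by (simp add: second_derivative_def linear_scale scaleR_sum_right power2_eq_square mult_ac)
qed

text \<open>Additivity carries differentiability at \<open>0\<close> to all points, with the same derivative everywhere.\<close>

lemma additive_differentiable_linear:
  fixes f :: "real \<Rightarrow> 'a::real_normed_vector"
  assumes add: "\<And>s t. f (s + t) = f s + f t" and d: "(f has_vector_derivative p) (at 0)"
  shows "f s = s *\<^sub>R p"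
proof -
  have f0: "f 0 = 0" using add[of 0 0] by simp
  have "((\<lambda>x. f x - x *\<^sub>R p) has_vector_derivative 0) (at x)" for x
  proof -
    have sh: "((\<lambda>y. y - x) has_vector_derivative 1) (at x)"
      by (auto intro!: derivative_eq_intros)
    have "((f \<circ> (\<lambda>y. y - x)) has_vector_derivative 1 *\<^sub>R p) (at x)"
      by (rule vector_diff_chain_at[OF sh]) (use d in simp)
    then have "((\<lambda>y. f x + (f \<circ> (\<lambda>y. y - x)) y) has_vector_derivative 0 + 1 *\<^sub>R p) (at x)"
      by (intro has_vector_derivative_add has_vector_derivative_const)
    moreover have "f x + (f \<circ> (\<lambda>y. y - x)) y = f y" for y using add[of x "y - x"] by simp
    ultimately have "(f has_vector_derivative p) (at x)" by simp
    moreover have "((\<lambda>y. y *\<^sub>R p) has_vector_derivative p) (at x)"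
      using has_vector_derivative_scaleR[of "\<lambda>y. y" 1 x UNIV "\<lambda>y. p" 0] by simp
    ultimately show ?thesis using has_vector_derivative_diff by fastforce
  qed
  then obtain c where "\<And>x. x \<in> UNIV \<Longrightarrow> f x - x *\<^sub>R p = c"
    using has_vector_derivative_zero_constant[of UNIV "\<lambda>x. f x - x *\<^sub>R p"] by auto
  then show ?thesis using f0 by (metis UNIV_I eq_iff_diff_eq_0 scaleR_zero_left)
qed

section \<open>Frames\<close>

text \<open>The linear map that takes the standard basis to \<open>b\<close>, that is, components with respect to \<open>b\<close> to
  vectors.\<close>

definition frame_map :: "('d \<Rightarrow> real ^ 'd) \<Rightarrow> real ^ 'd \<Rightarrow> real ^ 'd" where
  "frame_map b a = (\<Sum>i\<in>UNIV. (a $ i) *\<^sub>R b i)"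

lemma linear_frame_map: "linear (frame_map b)"
  unfolding frame_map_def[abs_def]
  by (intro linear_compose_sum ballI) (auto simp: linear_iff algebra_simps)

lemma frame_map_axis: "frame_map b (axis i 1) = b i"
  by (simp add: frame_map_def axis_def if_distrib[of "\<lambda>x. x *\<^sub>R _"] cong: if_cong)

lemma inj_frame_map_iff:
  fixes b :: "'d::finite \<Rightarrow> real ^ 'd"
  shows "inj (frame_map b) \<longleftrightarrow> inj b \<and> independent (range b)"
proof
  assume i: "inj (frame_map b)"
  have "inj b" using i unfolding inj_def by (metis axis_eq_axis frame_map_axis zero_neq_one)
  have eq: "range b = frame_map b ` range (\<lambda>i. axis i 1)"
    by (auto simp: frame_map_axis image_image)
  have "independent (range (\<lambda>i::'d. axis i (1::real)))"
    by (rule independent_mono[OF independent_Basis]) (auto simp: axis_in_Basis_iff)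
  then have "independent (range b)"
    unfolding eq by (rule linear_independent_injective_image[OF linear_frame_map _ inj_on_subset[OF i subset_UNIV]])
  with \<open>inj b\<close> show "inj b \<and> independent (range b)" by blast
next
  assume b: "inj b \<and> independent (range b)"
  have "a = 0" if "frame_map b a = 0" for a
  proof -
    have "(\<Sum>v\<in>range b. (a $ inv b v) *\<^sub>R v) = 0"
      using that b by (simp add: frame_map_def sum.reindex)
    then have "a $ inv b v = 0" if "v \<in> range b" for v
      using b independentD[of "range b" "range b" "\<lambda>v. a $ inv b v" v] that by auto
    then have "a $ i = 0" for i using b by (metis inv_f_f rangeI)
    then show ?thesis by (simp add: vec_eq_iff)
  qed
  then show "inj (frame_map b)" using linear_injective_0[OF linear_frame_map] by blast
qed

lemma span_image_frame: "span (b ` I) = frame_map b ` horizontal I"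
  unfolding horizontal_def
  by (simp add: linear_span_image[OF linear_frame_map, symmetric] image_image frame_map_axis)

lemma horizontal_iff: "a \<in> horizontal I \<longleftrightarrow> (\<forall>i. i \<notin> I \<longrightarrow> a $ i = 0)"
proof
  assume "a \<in> horizontal I"
  then show "\<forall>i. i \<notin> I \<longrightarrow> a $ i = 0"
    unfolding horizontal_def
    by (induction rule: span_induct_alt) (auto simp: axis_def split: if_splits)
next
  assume a: "\<forall>i. i \<notin> I \<longrightarrow> a $ i = 0"
  have "a = (\<Sum>i\<in>UNIV. (a $ i) *\<^sub>R axis i 1)"
    using basis_expansion[of a] by (simp add: scalar_mult_eq_scaleR)
  also have "\<dots> = (\<Sum>i\<in>I. (a $ i) *\<^sub>R axis i 1)"
    by (rule sum.mono_neutral_right) (use a in auto)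
  also have "\<dots> \<in> horizontal I"
    unfolding horizontal_def by (intro span_sum span_scale span_base) auto
  finally show "a \<in> horizontal I" .
qed

lemma subspace_horizontal: "subspace (horizontal I)"
  by (simp add: horizontal_def)

text \<open>The projection to \<open>\<real>\<^sup>p \<times> {0}\<close>.  The complementary projection to \<open>{0} \<times> \<real>\<^sup>q\<close> is \<open>hor_part (- I)\<close>.\<close>

definition hor_part :: "'d set \<Rightarrow> real ^ 'd \<Rightarrow> real ^ 'd" where
  "hor_part I a = (\<chi> i. if i \<in> I then a $ i else 0)"

lemma hor_part_nth [simp]: "hor_part I a $ i = (if i \<in> I then a $ i else 0)"
  by (simp add: hor_part_def)

lemma linear_hor_part: "linear (hor_part I)"
  by (auto simp: linear_iff vec_eq_iff)

lemma hor_part_in_horizontal: "hor_part I a \<in> horizontal I"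
  by (simp add: horizontal_iff)

lemma hor_part_Compl: "hor_part (- I) a = a - hor_part I a"
  by (simp add: vec_eq_iff)

lemma hor_part_horizontal: "a \<in> horizontal I \<longleftrightarrow> hor_part I a = a"
  by (auto simp: horizontal_iff vec_eq_iff)

lemma frame_map_hor_part: "frame_map b (hor_part I a) = (\<Sum>i\<in>I. (a $ i) *\<^sub>R b i)"
proof -
  have "(\<Sum>i\<in>UNIV. (hor_part I a $ i) *\<^sub>R b i) = (\<Sum>i\<in>I. (hor_part I a $ i) *\<^sub>R b i)"
    by (rule sum.mono_neutral_right) auto
  then show ?thesis by (simp add: frame_map_def)
qed

lemma inverse_linear:
  fixes L :: "'a::euclidean_space \<Rightarrow> 'a"
  assumes "linear L" "inj L"
  shows "linear (inv L)" "\<And>v. L (inv L v) = v" "\<And>v. inv L (L v) = v" "bij L"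
proof -
  have "surj L" using assms linear_injective_imp_surjective by blast
  then show "\<And>v. L (inv L v) = v" "bij L" using assms(2) by (auto simp: surj_f_inv_f bij_def)
  show "linear (inv L)" using inj_linear_imp_inv_linear assms by blast
  show "\<And>v. inv L (L v) = v" using assms(2) by (simp add: inv_f_f)
qed

text \<open>An independent family that does not exhaust the space can be completed by enumerating the missing members of
  a basis containing it.\<close>

lemma extend_to_frame:
  fixes b :: "'d::finite \<Rightarrow> real ^ 'd"
  assumes "inj_on b I" "independent (b ` I)"
  obtains b' where "\<And>i. i \<in> I \<Longrightarrow> b' i = b i" "inj (frame_map b')"
proof -
  obtain B where B: "b ` I \<subseteq> B" "independent B" "UNIV \<subseteq> span B"
    by (rule maximal_independent_subset_extend[OF subset_UNIV assms(2)])
  have fB: "finite B" using B(2) independent_imp_finite by blast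
  have cB: "card B = CARD('d)"
    using basis_card_eq_dim[of B UNIV] B by (simp add: dim_UNIV)
  have "card (B - b ` I) = card (- I)"
    using B(1) fB assms(1) cB
    by (simp add: card_Diff_subset card_image finite_subset Compl_eq_Diff_UNIV)
  then obtain g where g: "bij_betw g (- I) (B - b ` I)"
    using finite_same_card_bij[of "- I" "B - b ` I"] fB by auto
  define b' where "b' i = (if i \<in> I then b i else g i)" for i
  have rg: "range b' = B"
  proof -
    have "range b' = b' ` I \<union> b' ` (- I)" by (metis Compl_partition image_Un)
    also have "\<dots> = b ` I \<union> g ` (- I)" by (auto simp: b'_def)
    also have "\<dots> = B" using g B(1) by (auto simp: bij_betw_def)
    finally show ?thesis .
  qed
  then have "inj b'" using cB by (metis eq_card_imp_inj_on finite)
  then have "inj (frame_map b')" using inj_frame_map_iff rg B(2) by metis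
  moreover have "b' i = b i" if "i \<in> I" for i using that by (simp add: b'_def)
  ultimately show ?thesis using that by blast
qed

lemma frame_map_axis_id: "frame_map (\<lambda>i. axis i 1) = (\<lambda>a. a)"
  by (rule ext) (simp add: frame_map_def basis_expansion scalar_mult_eq_scaleR[symmetric])

lemma bounded_linear_hor_part: "bounded_linear (hor_part I)"
  using linear_hor_part linear_conv_bounded_linear by blast

lemma hor_part_idem [simp]: "hor_part I (hor_part I a) = hor_part I a"
  "hor_part (- I) (hor_part I a) = 0" "hor_part I (hor_part (- I) a) = 0"
  by (simp_all add: vec_eq_iff)

lemma hor_part_split: "hor_part I a + hor_part (- I) a = a"
  by (simp add: vec_eq_iff)

lemma hor_part_Compl_eq_0_iff: "hor_part (- I) a = 0 \<longleftrightarrow> a \<in> horizontal I"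
  by (auto simp: horizontal_iff vec_eq_iff)

text \<open>The dilation \<open>\<delta>\<^sub>t\<close> in the coordinates of \<open>T\<^sub>HM\<close>; see \<open>dilation_exp_arrow\<close>.\<close>

definition parabolic_dilation :: "'d set \<Rightarrow> real \<Rightarrow> real ^ 'd \<Rightarrow> real ^ 'd" where
  "parabolic_dilation I t a = t *\<^sub>R hor_part I a + t\<^sup>2 *\<^sub>R hor_part (- I) a"

lemma hor_part_dilation:
  "hor_part I (parabolic_dilation I t a) = t *\<^sub>R hor_part I a"
  "hor_part (- I) (parabolic_dilation I t a) = t\<^sup>2 *\<^sub>R hor_part (- I) a"
  by (simp_all add: parabolic_dilation_def vec_eq_iff)

lemma parabolic_dilation_0 [simp]: "parabolic_dilation I 0 a = 0"
  by (simp add: parabolic_dilation_def)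

lemma has_jet_dilation: "has_jet (\<lambda>t. parabolic_dilation I t a) (hor_part I a) (2 *\<^sub>R hor_part (- I) a)"
  using has_jet_quadratic[of 0 "hor_part I a" "2 *\<^sub>R hor_part (- I) a"] by (simp add: parabolic_dilation_def)

lemma open_smooth_dilation:
  "open S \<Longrightarrow> open_smooth S (\<lambda>p::('a::euclidean_space \<times> (real ^ 'd)) \<times> real. parabolic_dilation I (snd p) (snd (fst p)))"
  unfolding parabolic_dilation_def
  by (intro open_smooth_add open_smooth_scaleR open_smooth_power open_smooth_snd open_smooth_fst
      open_smooth_ident open_smooth_linear_compose[OF bounded_linear_hor_part])

section \<open>Curves and tangent vectors\<close>

abbreviation line_chart :: "(real, real) chart" where "line_chart \<equiv> (UNIV, \<lambda>t. t)"

lemma smooth_curve_iff: "smooth_curve M c \<longleftrightarrow> (\<exists>d\<in>M. smooth_near UNIV line_chart d c 0)"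
proof
  assume "smooth_curve M c"
  then obtain U \<phi> e where *: "(U, \<phi>) \<in> M" "e > 0" "c ` {-e<..<e} \<subseteq> U" "smooth_on {-e<..<e} (\<phi> \<circ> c)"
    unfolding smooth_curve_def by blast
  have m: "(0::real) \<in> {-e<..<e}" using *(2) by simp
  obtain S h where h: "open_smooth S h" and S: "0 \<in> S" and S2: "\<And>y. y \<in> {-e<..<e} \<Longrightarrow> y \<in> S \<Longrightarrow> h y = (\<phi> \<circ> c) y"
    by (fact smooth_onE[OF *(4) m])
  have o: "open_smooth (S \<inter> {-e<..<e}) h"
    by (rule open_smooth_subset[OF h]) (use open_smooth_open[OF h] in auto)
  have "smooth_near UNIV line_chart (U, \<phi>) c 0"
    by (rule smooth_nearI[OF _ o]) (use S S2 *(3) m in auto)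
  then show "\<exists>d\<in>M. smooth_near UNIV line_chart d c 0" using *(1) by blast
next
  assume "\<exists>d\<in>M. smooth_near UNIV line_chart d c 0"
  then obtain d where d: "d \<in> M" and n: "smooth_near UNIV line_chart d c 0" by blast
  obtain S h where "0 \<in> fst line_chart" and S: "open_smooth S h" "snd line_chart 0 \<in> S"
    and "UNIV \<inter> S \<subseteq> snd line_chart ` fst line_chart"
    and S3: "\<And>z. z \<in> fst line_chart \<Longrightarrow> snd line_chart z \<in> S \<Longrightarrow> c z \<in> fst d \<and> snd d (c z) = h (snd line_chart z)"
    by (fact smooth_nearE[OF n])
  obtain U \<phi> where d': "d = (U, \<phi>)" by fastforce
  obtain e where e: "e > 0" "ball 0 e \<subseteq> S"
    using openE[OF open_smooth_open[OF S(1)], of 0] S(2) by auto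
  then have sub: "{-e<..<e} \<subseteq> S" by (simp add: ball_eq_greaterThanLessThan)
  have sm: "smooth_on {-e<..<e} (\<phi> \<circ> c)"
    by (rule smooth_onI, rule exI[of _ S], rule exI[of _ h]) (use S S3 sub d' in auto)
  have im: "c ` {-e<..<e} \<subseteq> U" using S3 sub d' by auto
  show "smooth_curve M c"
    unfolding smooth_curve_def
    by (rule bexI[of _ "(U, \<phi>)"]) (use e im sm d d' in auto)
qed

locale distributed_manifold =
  fixes M :: "('m, real ^ 'd) atlas" and I :: "'d set" and H :: "'m \<Rightarrow> 'm tvector set"
  assumes manifold: "smooth_manifold UNIV M" and distribution: "distribution M I H"
begin

abbreviation "SM \<equiv> smooth_structure UNIV M"

lemma atlas_M: "smooth_atlas UNIV M"
  using manifold by (simp add: smooth_manifold_def)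

lemmas atlas_SM = smooth_atlas_smooth_structure(1)[OF atlas_M]

lemmas M_SM = smooth_atlas_smooth_structure(2)[OF atlas_M]

lemmas points_SM = smooth_atlas_smooth_structure(3)[OF atlas_M]

lemma chart_at: assumes "m \<in> points M" obtains U \<phi> where "(U, \<phi>) \<in> SM" "m \<in> U"
proof -
  have "m \<in> points SM" using assms points_SM by simp
  then obtain c where "c \<in> SM" "m \<in> fst c" unfolding points_iff by blast
  then show ?thesis using that[of "fst c" "snd c"] by simp
qed

lemma chart_points: "(U, \<phi>) \<in> SM \<Longrightarrow> U \<subseteq> points M"
  by (simp add: smooth_structure_def)

lemma chart_inj: "(U, \<phi>) \<in> SM \<Longrightarrow> inj_on \<phi> U" and chart_image_open: "(U, \<phi>) \<in> SM \<Longrightarrow> open (\<phi> ` U)"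
  by (simp_all add: smooth_structure_def is_chart_def)

lemma chart_transition:
  assumes "(U, \<phi>) \<in> SM" "(V, \<theta>) \<in> SM" "m \<in> U" "m \<in> V"
  obtains S h where "open_smooth S h" "\<phi> m \<in> S" "S \<subseteq> \<phi> ` U"
    "\<forall>z\<in>U. \<phi> z \<in> S \<longrightarrow> z \<in> V \<and> \<theta> z = h (\<phi> z)"
proof -
  have "smooth_near UNIV (U, \<phi>) (V, \<theta>) (\<lambda>z. z) m"
    by (rule smooth_atlasD(2)[OF atlas_SM assms(1,2)]) (use assms in auto)
  then obtain S h where "open_smooth S h" "snd (U, \<phi>) m \<in> S" "UNIV \<inter> S \<subseteq> snd (U, \<phi>) ` fst (U, \<phi>)"
     "\<forall>z\<in>fst (U, \<phi>). snd (U, \<phi>) z \<in> S \<longrightarrow> z \<in> fst (V, \<theta>) \<and> snd (V, \<theta>) z = h (snd (U, \<phi>) z)"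
    unfolding smooth_near_def by (elim exE conjE)
  then show ?thesis by (intro that[of S h]) simp_all
qed

lemma compatible_chartI:
  assumes c: "is_chart UNIV c" and d: "d \<in> SM" and sub: "fst c \<subseteq> fst d"
    and n: "\<And>p. p \<in> fst c \<Longrightarrow> smooth_near UNIV c d (\<lambda>z. z) p" "\<And>p. p \<in> fst c \<Longrightarrow> smooth_near UNIV d c (\<lambda>z. z) p"
  shows "c \<in> SM"
proof (rule smooth_structureI[OF c])
  show "fst c \<subseteq> points M" using sub d by (auto simp: smooth_structure_def)
  show "is_chart UNIV e" if "e \<in> M" for e by (rule smooth_atlasD(1)[OF atlas_M that])
  fix e p assume e: "e \<in> M" "p \<in> fst c" "p \<in> fst e"
  have eS: "e \<in> SM" using e M_SM by blast
  have pd: "p \<in> fst d" using e sub by blast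
  have 1: "smooth_near UNIV d e (\<lambda>z. z) p" by (rule smooth_atlasD(2)[OF atlas_SM d eS pd e(3)])
  have 2: "smooth_near UNIV e d (\<lambda>z. z) p" by (rule smooth_atlasD(2)[OF atlas_SM eS d e(3) pd])
  show "smooth_near UNIV c e (\<lambda>z. z) p \<and> smooth_near UNIV e c (\<lambda>z. z) p"
    using smooth_near_compose[OF n(1)[OF e(2)] 1] smooth_near_compose[OF 2 n(2)[OF e(2)]] by simp
qed

lemma restrict_chart:
  assumes c: "(U, \<phi>) \<in> SM" and T: "open T"
  shows "({z \<in> U. \<phi> z \<in> T}, \<phi>) \<in> SM"
proof (rule compatible_chartI[OF _ c])
  have o: "open (\<phi> ` U)" and i: "inj_on \<phi> U" using chart_image_open[OF c] chart_inj[OF c] .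
  have im: "\<phi> ` {z \<in> U. \<phi> z \<in> T} = \<phi> ` U \<inter> T" by auto
  have o2: "open (\<phi> ` U \<inter> T)" using o T by blast
  show "is_chart UNIV ({z \<in> U. \<phi> z \<in> T}, \<phi>)"
    using i o2 by (auto simp: is_chart_def im inj_on_def)
  fix p assume p: "p \<in> fst ({z \<in> U. \<phi> z \<in> T}, \<phi>)"
  show "smooth_near UNIV ({z \<in> U. \<phi> z \<in> T}, \<phi>) (U, \<phi>) (\<lambda>z. z) p"
    by (rule smooth_nearI[OF p open_smooth_ident[OF o2]]) (use p in auto)
  show "smooth_near UNIV (U, \<phi>) ({z \<in> U. \<phi> z \<in> T}, \<phi>) (\<lambda>z. z) p"
    by (rule smooth_nearI[OF _ open_smooth_ident[OF o2]]) (use p in auto)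
qed auto

lemma affine_chart:
  assumes c: "(U, \<phi>) \<in> SM" and A: "linear A" "inj A"
  shows "(U, \<lambda>z. inv A (\<phi> z - x0)) \<in> SM"
proof (rule compatible_chartI[OF _ c])
  have o: "open (\<phi> ` U)" and i: "inj_on \<phi> U" using chart_image_open[OF c] chart_inj[OF c] .
  note A' = inverse_linear[OF A]
  have bA: "bounded_linear A" "bounded_linear (inv A)" using A A' by (simp_all add: linear_conv_bounded_linear)
  have s1: "open_smooth S (\<lambda>y. A y + x0)" if "open S" for S
    by (intro open_smooth_add open_smooth_linear bA that open_smooth_const)
  have s2: "open_smooth S (\<lambda>x. inv A (x - x0))" if "open S" for S
    by (rule open_smooth_linear_compose[OF bA(2)]) (intro open_smooth_diff open_smooth_ident open_smooth_const that)
  have im: "(\<lambda>z. inv A (\<phi> z - x0)) ` U = UNIV \<inter> (\<lambda>y. A y + x0) -` (\<phi> ` U)"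
  proof (rule set_eqI)
    fix y
    have "y \<in> (\<lambda>z. inv A (\<phi> z - x0)) ` U \<longleftrightarrow> (\<exists>z\<in>U. A y = \<phi> z - x0)"
      using A'(2,3) by (auto simp: image_iff) (metis A'(3))
    also have "\<dots> \<longleftrightarrow> A y + x0 \<in> \<phi> ` U" by (auto simp: image_iff algebra_simps)
    finally show "y \<in> (\<lambda>z. inv A (\<phi> z - x0)) ` U \<longleftrightarrow> y \<in> UNIV \<inter> (\<lambda>y. A y + x0) -` (\<phi> ` U)" by simp
  qed
  have o2: "open ((\<lambda>z. inv A (\<phi> z - x0)) ` U)"
    unfolding im by (rule open_smooth_preimage[OF s1 o]) simp
  have ia: "inj (inv A)" using A'(2) by (metis injI)
  have "inj_on (\<lambda>z. inv A (\<phi> z - x0)) U"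
    using i by (auto simp: inj_on_def inj_eq[OF ia])
  then show "is_chart UNIV (U, \<lambda>z. inv A (\<phi> z - x0))" using o2 by (auto simp: is_chart_def)
  fix p assume p: "p \<in> fst (U, \<lambda>z. inv A (\<phi> z - x0))"
  show "smooth_near UNIV (U, \<lambda>z. inv A (\<phi> z - x0)) (U, \<phi>) (\<lambda>z. z) p"
    by (rule smooth_nearI[OF p s1[OF o2]]) (use p A' in auto)
  show "smooth_near UNIV (U, \<phi>) (U, \<lambda>z. inv A (\<phi> z - x0)) (\<lambda>z. z) p"
    by (rule smooth_nearI[OF _ s2[OF o]]) (use p in auto)
qed auto

lemma smooth_curve_near:
  assumes "smooth_curve M c" "(U, \<phi>) \<in> SM" "c 0 \<in> U"
  shows "smooth_near UNIV line_chart (U, \<phi>) c 0"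
proof -
  obtain d where d: "d \<in> M" "smooth_near UNIV line_chart d c 0" using assms(1) smooth_curve_iff by blast
  have "smooth_near UNIV d (U, \<phi>) (\<lambda>z. z) (c 0)"
    by (rule smooth_atlasD(2)[OF atlas_SM _ assms(2)]) (use d M_SM smooth_near_mem[OF d(2)] assms in auto)
  from smooth_near_compose[OF d(2) this] show ?thesis by simp
qed

lemma smooth_curveI:
  assumes "(U, \<phi>) \<in> SM" "smooth_near UNIV line_chart (U, \<phi>) c 0" shows "smooth_curve M c"
proof -
  have m: "c 0 \<in> U" using smooth_near_mem[OF assms(2)] by simp
  then have "c 0 \<in> points M" using chart_points assms(1) by blast
  then obtain d where d: "d \<in> M" "c 0 \<in> fst d" unfolding points_iff by blast
  have "smooth_near UNIV (U, \<phi>) d (\<lambda>z. z) (c 0)"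
    by (rule smooth_atlasD(2)[OF atlas_SM assms(1)]) (use d M_SM m in auto)
  from smooth_near_compose[OF assms(2) this] show ?thesis using d smooth_curve_iff by blast
qed

lemma smooth_curve_coords:
  assumes "smooth_curve M c" "(U, \<phi>) \<in> SM" "c 0 \<in> U"
  obtains S h where "open_smooth S h" "0 \<in> S" "\<forall>t\<in>S. c t \<in> U \<and> \<phi> (c t) = h t"
proof -
  obtain S h where "open_smooth S h" "snd line_chart 0 \<in> S"
     "\<forall>z\<in>fst line_chart. snd line_chart z \<in> S \<longrightarrow> c z \<in> fst (U, \<phi>) \<and> snd (U, \<phi>) (c z) = h (snd line_chart z)"
    using smooth_curve_near[OF assms] unfolding smooth_near_def by (elim exE conjE)
  then show ?thesis by (intro that[of S h]) simp_all
qed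

lemma smooth_curve_jet:
  assumes "smooth_curve M c" "(U, \<phi>) \<in> SM" "c 0 \<in> U"
  shows "has_jet (\<phi> \<circ> c) (velocity \<phi> c) (acceleration \<phi> c)"
proof -
  obtain S h where S: "open_smooth S h" "0 \<in> S" "\<forall>t\<in>S. c t \<in> U \<and> \<phi> (c t) = h t"
    by (rule smooth_curve_coords[OF assms])
  obtain u w where "has_jet h u w" using has_jet_smooth[OF S(1,2)] by blast
  then have j: "has_jet (\<phi> \<circ> c) u w"
    by (rule has_jet_cong[OF _ open_smooth_open[OF S(1)] S(2)]) (use S(3) in simp)
  then show ?thesis using has_jet_derivatives[OF j] by (simp add: velocity_def acceleration_def)
qed

lemma jet_velocity: "has_jet (\<phi> \<circ> c) u w \<Longrightarrow> velocity \<phi> c = u \<and> acceleration \<phi> c = w"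
  using has_jet_derivatives[of "\<phi> \<circ> c" u w] by (simp add: velocity_def acceleration_def)

definition quad_curve :: "'m set \<Rightarrow> ('m \<Rightarrow> real ^ 'd) \<Rightarrow> 'm \<Rightarrow> real ^ 'd \<Rightarrow> real ^ 'd \<Rightarrow> 'm curve" where
  "quad_curve U \<phi> m u w = (\<lambda>t. inv_into U \<phi> (\<phi> m + t *\<^sub>R u + (t\<^sup>2 / 2) *\<^sub>R w))"

lemma smooth_curve_inv_chart:
  assumes c: "(U, \<phi>) \<in> SM" and g: "open_smooth T g" "0 \<in> T" "g 0 \<in> \<phi> ` U"
  shows "smooth_curve M (\<lambda>t. inv_into U \<phi> (g t))" "inv_into U \<phi> (g 0) \<in> U"
    "has_jet g u w \<Longrightarrow> has_jet (\<phi> \<circ> (\<lambda>t. inv_into U \<phi> (g t))) u w"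
proof -
  have o: "open (T \<inter> g -` (\<phi> ` U))" by (rule open_smooth_preimage[OF g(1) chart_image_open[OF c]])
  have s: "open_smooth (T \<inter> g -` (\<phi> ` U)) g" by (rule open_smooth_subset[OF g(1) o]) auto
  show "smooth_curve M (\<lambda>t. inv_into U \<phi> (g t))"
    by (rule smooth_curveI[OF c], rule smooth_nearI[OF _ s]) (use g in \<open>auto intro: inv_into_into simp: f_inv_into_f\<close>)
  show "inv_into U \<phi> (g 0) \<in> U" using g by (simp add: inv_into_into)
  show "has_jet (\<phi> \<circ> (\<lambda>t. inv_into U \<phi> (g t))) u w" if "has_jet g u w"
    by (rule has_jet_cong[OF that o]) (use g in \<open>auto simp: f_inv_into_f\<close>)
qed

lemma quad_curve:
  assumes c: "(U, \<phi>) \<in> SM" "m \<in> U"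
  shows "smooth_curve M (quad_curve U \<phi> m u w)" "quad_curve U \<phi> m u w 0 = m"
    "has_jet (\<phi> \<circ> quad_curve U \<phi> m u w) u w"
    "velocity \<phi> (quad_curve U \<phi> m u w) = u" "acceleration \<phi> (quad_curve U \<phi> m u w) = w"
proof -
  let ?g = "\<lambda>t::real. \<phi> m + t *\<^sub>R u + (t\<^sup>2 / 2) *\<^sub>R w"
  have "open_smooth UNIV (\<lambda>t::real. \<phi> m + t *\<^sub>R u + (t\<^sup>2 * (1 / 2)) *\<^sub>R w)"
    by (intro open_smooth_intros open_UNIV)
  then have g: "open_smooth UNIV ?g" by simp
  have g0: "?g 0 \<in> \<phi> ` U" using c by simp
  note * = smooth_curve_inv_chart[OF c(1) g UNIV_I g0]
  show "smooth_curve M (quad_curve U \<phi> m u w)" using *(1) by (simp add: quad_curve_def)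
  show "quad_curve U \<phi> m u w 0 = m" using c chart_inj by (simp add: quad_curve_def)
  show j: "has_jet (\<phi> \<circ> quad_curve U \<phi> m u w) u w" using *(3)[OF has_jet_quadratic] by (simp add: quad_curve_def)
  show "velocity \<phi> (quad_curve U \<phi> m u w) = u" "acceleration \<phi> (quad_curve U \<phi> m u w) = w"
    using jet_velocity[OF j] by auto
qed

text \<open>The effect of a change of coordinates on the jets of curves through \<open>m\<close>: \<open>L\<close> is the derivative and \<open>Q\<close> the
  second derivative of the transition map.  What matters about \<open>Q\<close> is that it is homogeneous of degree two and
  applied to the velocity.\<close>

definition jet_change :: "'m \<Rightarrow> ('m \<Rightarrow> real ^ 'd) \<Rightarrow> ('m \<Rightarrow> real ^ 'd) \<Rightarrow>
    (real ^ 'd \<Rightarrow> real ^ 'd) \<Rightarrow> (real ^ 'd \<Rightarrow> real ^ 'd) \<Rightarrow> bool" where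
  "jet_change m \<phi> \<theta> L Q \<longleftrightarrow> linear L \<and> (\<forall>s u. Q (s *\<^sub>R u) = s\<^sup>2 *\<^sub>R Q u) \<and>
     (\<forall>c u w. smooth_curve M c \<longrightarrow> c 0 = m \<longrightarrow> has_jet (\<phi> \<circ> c) u w \<longrightarrow> has_jet (\<theta> \<circ> c) (L u) (L w + Q u))"

lemma jet_changeD:
  assumes "jet_change m \<phi> \<theta> L Q"
  shows "linear L" "Q (s *\<^sub>R u) = s\<^sup>2 *\<^sub>R Q u"
    "smooth_curve M c \<Longrightarrow> c 0 = m \<Longrightarrow> has_jet (\<phi> \<circ> c) u w \<Longrightarrow> has_jet (\<theta> \<circ> c) (L u) (L w + Q u)"
  using assms unfolding jet_change_def by blast+

lemma jet_change_velocity: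
  assumes "jet_change m \<phi> \<theta> L Q" "smooth_curve M c" "c 0 = m" "(U, \<phi>) \<in> SM" "m \<in> U"
  shows "velocity \<theta> c = L (velocity \<phi> c)" "acceleration \<theta> c = L (acceleration \<phi> c) + Q (velocity \<phi> c)"
proof -
  have "has_jet (\<phi> \<circ> c) (velocity \<phi> c) (acceleration \<phi> c)"
    by (rule smooth_curve_jet[OF assms(2,4)]) (use assms in simp)
  from jet_velocity[OF jet_changeD(3)[OF assms(1-3) this]]
  show "velocity \<theta> c = L (velocity \<phi> c)" "acceleration \<theta> c = L (acceleration \<phi> c) + Q (velocity \<phi> c)"
    by auto
qed

lemma chart_transition_jet:
  assumes c: "(U, \<phi>) \<in> SM" "m \<in> U" and S: "open_smooth S h" "\<phi> m \<in> S"
    "\<forall>z\<in>U. \<phi> z \<in> S \<longrightarrow> z \<in> V \<and> \<theta> z = h (\<phi> z)"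
  shows "jet_change m \<phi> \<theta> (frechet_derivative h (at (\<phi> m))) (second_derivative h (\<phi> m))"
  unfolding jet_change_def
proof (intro conjI allI impI)
  show "linear (frechet_derivative h (at (\<phi> m)))" by (rule open_smooth_derivative_linear[OF S(1,2)])
  show "second_derivative h (\<phi> m) (s *\<^sub>R u) = s\<^sup>2 *\<^sub>R second_derivative h (\<phi> m) u" for s u
    by (rule second_derivative_scale[OF S(1,2)])
  fix c u w assume sc: "smooth_curve M c" "c 0 = m" and j: "has_jet (\<phi> \<circ> c) u w"
  have j': "has_jet (\<lambda>t. h ((\<phi> \<circ> c) t)) (frechet_derivative h (at (\<phi> m)) u)
      (frechet_derivative h (at (\<phi> m)) w + second_derivative h (\<phi> m) u)"
    using has_jet_compose[OF S(1) j] sc S(2) by simp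
  obtain T g where T: "open_smooth T g" "0 \<in> T" "\<forall>t\<in>T. c t \<in> U \<and> \<phi> (c t) = g t"
    by (rule smooth_curve_coords[OF sc(1) c(1)]) (use sc c in auto)
  obtain N where N: "open N" "0 \<in> N" "\<forall>t\<in>N. (\<phi> \<circ> c) t \<in> S"
    by (rule has_jet_continuous[OF j open_smooth_open[OF S(1)]]) (use sc S in auto)
  show "has_jet (\<theta> \<circ> c) (frechet_derivative h (at (\<phi> m)) u)
      (frechet_derivative h (at (\<phi> m)) w + second_derivative h (\<phi> m) u)"
    by (rule has_jet_cong[OF j', of "T \<inter> N"]) (use N T S(3) open_smooth_open[OF T(1)] in auto)
qed

lemma change_of_chart:
  assumes c: "(U, \<phi>) \<in> SM" "(V, \<theta>) \<in> SM" "m \<in> U" "m \<in> V"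
  obtains L Q where "jet_change m \<phi> \<theta> L Q"
proof -
  obtain S h where S: "open_smooth S h" "\<phi> m \<in> S" "S \<subseteq> \<phi> ` U"
    "\<forall>z\<in>U. \<phi> z \<in> S \<longrightarrow> z \<in> V \<and> \<theta> z = h (\<phi> z)" by (rule chart_transition[OF c])
  show ?thesis by (rule that[OF chart_transition_jet[OF c(1,3) S(1,2,4)]])
qed

text \<open>The change of coordinates in the opposite direction provides a left inverse of \<open>L\<close>.\<close>

lemma jet_change_inj:
  assumes c: "(U, \<phi>) \<in> SM" "(V, \<theta>) \<in> SM" "m \<in> U" "m \<in> V" and L: "jet_change m \<phi> \<theta> L Q"
  shows "inj L"
proof -
  obtain L' Q' where L': "jet_change m \<theta> \<phi> L' Q'" by (rule change_of_chart[OF c(2,1,4,3)])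
  have "L' (L u) = u" for u
  proof -
    note q = quad_curve[OF c(1,3), of u 0]
    have "velocity \<phi> (quad_curve U \<phi> m u 0) = L' (velocity \<theta> (quad_curve U \<phi> m u 0))"
      by (rule jet_change_velocity[OF L' q(1,2) c(2,4)])
    also have "velocity \<theta> (quad_curve U \<phi> m u 0) = L (velocity \<phi> (quad_curve U \<phi> m u 0))"
      by (rule jet_change_velocity[OF L q(1,2) c(1,3)])
    finally show ?thesis using q(4) by simp
  qed
  then show ?thesis by (metis injI)
qed

subsection \<open>Tangent vectors\<close>

lemma tangent_vector_eq:
  assumes c: "smooth_curve M c" "(U, \<phi>) \<in> SM" "c 0 \<in> U"
  shows "tangent_vector M c = {c'. smooth_curve M c' \<and> c' 0 = c 0 \<and> velocity \<phi> c' = velocity \<phi> c}"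
proof -
  have eq: "velocity \<theta> c' = velocity \<theta> c \<longleftrightarrow> velocity \<phi> c' = velocity \<phi> c"
    if c': "smooth_curve M c'" "c' 0 = c 0" "(V, \<theta>) \<in> SM" "c 0 \<in> V" for c' V \<theta>
  proof -
    obtain L Q where L: "jet_change (c 0) \<phi> \<theta> L Q"
      by (rule change_of_chart[OF c(2) c'(3) c(3) c'(4)])
    have i: "inj L" by (rule jet_change_inj[OF c(2) c'(3) c(3) c'(4) L])
    have "velocity \<theta> c = L (velocity \<phi> c)"
      by (rule jet_change_velocity[OF L c(1) refl c(2,3)])
    moreover have "velocity \<theta> c' = L (velocity \<phi> c')"
      by (rule jet_change_velocity[OF L c'(1,2) c(2,3)])
    ultimately show ?thesis using i by (simp add: inj_eq)
  qed
  have "c 0 \<in> points M" using c chart_points by blast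
  then obtain a where a: "a \<in> M" "c 0 \<in> fst a" unfolding points_iff by blast
  show ?thesis
  proof (intro set_eqI iffI)
    fix c' assume "c' \<in> tangent_vector M c"
    then obtain V \<theta> where *: "smooth_curve M c'" "c' 0 = c 0" "(V, \<theta>) \<in> M" "c 0 \<in> V" "velocity \<theta> c' = velocity \<theta> c"
      unfolding tangent_vector_def by blast
    have "(V, \<theta>) \<in> SM" using * M_SM by blast
    then show "c' \<in> {c'. smooth_curve M c' \<and> c' 0 = c 0 \<and> velocity \<phi> c' = velocity \<phi> c}"
      using eq[of c' V \<theta>] * by simp
  next
    fix c' assume "c' \<in> {c'. smooth_curve M c' \<and> c' 0 = c 0 \<and> velocity \<phi> c' = velocity \<phi> c}"
    then have *: "smooth_curve M c'" "c' 0 = c 0" "velocity \<phi> c' = velocity \<phi> c" by auto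
    have "velocity (snd a) c' = velocity (snd a) c"
      using eq[of c' "fst a" "snd a"] * a M_SM by auto
    then show "c' \<in> tangent_vector M c" unfolding tangent_vector_def
      using * a by (auto intro!: bexI[of _ a] split: prod.split)
  qed
qed

lemma tcoord_tangent_vector:
  assumes c: "smooth_curve M c" "(U, \<phi>) \<in> SM" "c 0 \<in> U"
  shows "tcoord \<phi> (tangent_vector M c) = velocity \<phi> c"
proof -
  have "velocity \<phi> ` tangent_vector M c = {velocity \<phi> c}"
    unfolding tangent_vector_eq[OF c] using c(1) by auto
  then show ?thesis by (simp add: tcoord_def)
qed

lemma tangent_spaceE:
  assumes "X \<in> tangent_space M m" obtains c where "smooth_curve M c" "c 0 = m" "X = tangent_vector M c"
  using assms unfolding tangent_space_def by blast

lemma tcoord_inj: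
  assumes "(U, \<phi>) \<in> SM" "m \<in> U" "X \<in> tangent_space M m" "Y \<in> tangent_space M m" "tcoord \<phi> X = tcoord \<phi> Y"
  shows "X = Y"
proof -
  obtain c where c: "smooth_curve M c" "c 0 = m" "X = tangent_vector M c" by (rule tangent_spaceE[OF assms(3)])
  obtain d where d: "smooth_curve M d" "d 0 = m" "Y = tangent_vector M d" by (rule tangent_spaceE[OF assms(4)])
  have cm: "c 0 \<in> U" and dm: "d 0 \<in> U" using c d assms by auto
  show ?thesis
    using tangent_vector_eq[OF c(1) assms(1) cm] tangent_vector_eq[OF d(1) assms(1) dm] assms(5) c d
      tcoord_tangent_vector[OF c(1) assms(1) cm] tcoord_tangent_vector[OF d(1) assms(1) dm] by simp
qed

lemma tcoord_surj:
  assumes "(U, \<phi>) \<in> SM" "m \<in> U" obtains X where "X \<in> tangent_space M m" "tcoord \<phi> X = u"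
proof -
  note q = quad_curve[OF assms, of u 0]
  have "tcoord \<phi> (tangent_vector M (quad_curve U \<phi> m u 0)) = u"
    using tcoord_tangent_vector[OF q(1) assms(1)] q assms by simp
  then show ?thesis using that q unfolding tangent_space_def by blast
qed

lemma tcoord_change:
  assumes c: "(U, \<phi>) \<in> SM" "(V, \<theta>) \<in> SM" "m \<in> U" "m \<in> V"
    and L: "jet_change m \<phi> \<theta> L Q"
    and X: "X \<in> tangent_space M m"
  shows "tcoord \<theta> X = L (tcoord \<phi> X)"
proof -
  obtain d where d: "smooth_curve M d" "d 0 = m" "X = tangent_vector M d" by (rule tangent_spaceE[OF X])
  show ?thesis using jet_change_velocity(1)[OF L d(1,2) c(1,3)] d c
      tcoord_tangent_vector[OF d(1) c(1)] tcoord_tangent_vector[OF d(1) c(2)] by simp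
qed

lemma H_tangent: "m \<in> points M \<Longrightarrow> H m \<subseteq> tangent_space M m"
  using distribution by (auto simp: distribution_def)

lemma tcoord_H_change:
  assumes c: "(U, \<phi>) \<in> SM" "(V, \<theta>) \<in> SM" "m \<in> U" "m \<in> V"
    and L: "jet_change m \<phi> \<theta> L Q"
  shows "tcoord \<theta> ` H m = L ` tcoord \<phi> ` H m"
proof -
  have "m \<in> points M" using c chart_points by blast
  then have "tcoord \<theta> X = L (tcoord \<phi> X)" if "X \<in> H m" for X
    using tcoord_change[OF c L] H_tangent that by blast
  then show ?thesis by (force simp: image_image)
qed

lemma subspace_H:
  assumes c: "(U, \<phi>) \<in> SM" "m \<in> U" shows "subspace (tcoord \<phi> ` H m)"
proof -
  have "m \<in> points M" using c chart_points by blast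
  then obtain V \<theta> F where F: "(V, \<theta>) \<in> SM" "m \<in> V" "\<forall>y\<in>V. tcoord \<theta> ` H y = span ((\<lambda>i. F i y) ` I)"
    using distribution unfolding distribution_def by fast
  obtain L Q where L: "jet_change m \<theta> \<phi> L Q" by (rule change_of_chart[OF F(1) c(1) F(2) c(2)])
  have "tcoord \<phi> ` H m = L ` tcoord \<theta> ` H m" by (rule tcoord_H_change[OF F(1) c(1) F(2) c(2) L])
  then show ?thesis using F by (simp add: linear_subspace_image[OF jet_changeD(1)[OF L]])
qed

lemma mem_H_iff:
  assumes "(U, \<phi>) \<in> SM" "m \<in> U" "X \<in> tangent_space M m"
  shows "X \<in> H m \<longleftrightarrow> tcoord \<phi> X \<in> tcoord \<phi> ` H m"
proof -
  have "H m \<subseteq> tangent_space M m" using assms chart_points H_tangent by blast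
  then show ?thesis using tcoord_inj[OF assms(1,2,3)] by (auto simp: subset_iff)
qed

lemma parabolic_curve_iff:
  assumes "(U, \<phi>) \<in> SM" "c 0 \<in> U"
  shows "parabolic_curve M H c \<longleftrightarrow> smooth_curve M c \<and> velocity \<phi> c \<in> tcoord \<phi> ` H (c 0)"
proof -
  have "tangent_vector M c \<in> H (c 0) \<longleftrightarrow> velocity \<phi> c \<in> tcoord \<phi> ` H (c 0)" if "smooth_curve M c"
  proof -
    have t: "tangent_vector M c \<in> tangent_space M (c 0)" using that unfolding tangent_space_def by blast
    show ?thesis using mem_H_iff[OF assms t] tcoord_tangent_vector[OF that assms] by simp
  qed
  then show ?thesis by (auto simp: parabolic_curve_def)
qed

section \<open>Adapted frames and H-charts\<close>

text \<open>The definition of a distribution provides a frame of \<open>H\<close> in some chart around \<open>m\<close>.  It is carried over to the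
  given chart and completed at \<open>m\<close> by constant vectors; by \<open>eventually_linear_bounded_below\<close> the
  completed family is a frame near \<open>m\<close> as well.\<close>

lemma adapted_frame_exists:
  assumes V: "(V, \<theta>) \<in> SM" "m \<in> V"
  obtains T F where "open T" "\<theta> m \<in> T" "T \<subseteq> \<theta> ` V" "adapted_frame I H ({z \<in> V. \<theta> z \<in> T}, \<theta>) F"
proof -
  have "m \<in> points M" using V chart_points by blast
  from bspec[OF distribution[unfolded distribution_def] this]
  have "\<exists>c\<in>SM. \<exists>F. m \<in> fst c \<and> smooth_frame (fst c, snd c) I F \<and>
      (\<forall>y\<in>fst c. tcoord (snd c) ` H y = span ((\<lambda>i. F i y) ` I))"
    by (simp add: case_prod_unfold)
  then obtain c F0 where c: "c \<in> SM" "m \<in> fst c" "smooth_frame (fst c, snd c) I F0"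
      "\<forall>y\<in>fst c. tcoord (snd c) ` H y = span ((\<lambda>i. F0 i y) ` I)"
    by (elim bexE exE conjE)
  define U \<phi> where "U = fst c" and "\<phi> = snd c"
  have U: "(U, \<phi>) \<in> SM" "m \<in> U" and sf: "smooth_frame (U, \<phi>) I F0"
    and HF: "\<forall>y\<in>U. tcoord \<phi> ` H y = span ((\<lambda>i. F0 i y) ` I)"
    using c by (simp_all add: U_def \<phi>_def)
  obtain S k where S: "open_smooth S k" "\<theta> m \<in> S" "S \<subseteq> \<theta> ` V"
    "\<forall>z\<in>V. \<theta> z \<in> S \<longrightarrow> z \<in> U \<and> \<phi> z = k (\<theta> z)" by (rule chart_transition[OF V(1) U(1) V(2) U(2)])
  obtain S' h where S': "open_smooth S' h" "\<phi> m \<in> S'" "S' \<subseteq> \<phi> ` U"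
    "\<forall>z\<in>U. \<phi> z \<in> S' \<longrightarrow> z \<in> V \<and> \<theta> z = h (\<phi> z)" by (rule chart_transition[OF U(1) V(1) U(2) V(2)])
  define T0 where "T0 = S \<inter> k -` S'"
  have T0: "open T0" unfolding T0_def by (rule open_smooth_preimage[OF S(1) open_smooth_open[OF S'(1)]])
  have kT: "open_smooth T0 k" by (rule open_smooth_subset[OF S(1) T0]) (auto simp: T0_def)
  have "\<phi> m = k (\<theta> m)" using S(2,4) V(2) by simp
  then have mT: "\<theta> m \<in> T0" using S(2) S'(2) by (simp add: T0_def)
  have in_U: "z \<in> U" "\<phi> z = k (\<theta> z)" "k (\<theta> z) \<in> S'" if "z \<in> V" "\<theta> z \<in> T0" for z
    using that S(4) by (auto simp: T0_def)
  define L where "L x = frechet_derivative h (at x)" for x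
  have jc: "jet_change z \<phi> \<theta> (L (\<phi> z)) (second_derivative h (\<phi> z))" if "z \<in> V" "\<theta> z \<in> T0" for z
    unfolding L_def by (rule chart_transition_jet[OF U(1) in_U(1)[OF that] S'(1) _ S'(4)]) (use in_U[OF that] in simp)
  have Linj: "inj (L (\<phi> z))" if "z \<in> V" "\<theta> z \<in> T0" for z
    by (rule jet_change_inj[OF U(1) V(1) in_U(1)[OF that] that(1) jc[OF that]])
  have HL: "tcoord \<theta> ` H z = span ((\<lambda>i. L (\<phi> z) (F0 i z)) ` I)" if z: "z \<in> V" "\<theta> z \<in> T0" for z
  proof -
    have "tcoord \<theta> ` H z = L (\<phi> z) ` span ((\<lambda>i. F0 i z) ` I)"
      using tcoord_H_change[OF U(1) V(1) in_U(1)[OF z] z(1) jc[OF z]] bspec[OF HF in_U(1)[OF z]] by simp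
    also have "\<dots> = span (L (\<phi> z) ` (\<lambda>i. F0 i z) ` I)"
      by (rule linear_span_image[OF jet_changeD(1)[OF jc[OF z]], symmetric])
    finally show ?thesis by (simp add: image_image)
  qed
  have indep0: "inj_on (\<lambda>i. F0 i y) I" "independent ((\<lambda>i. F0 i y) ` I)" if "y \<in> U" for y
    using sf that by (auto simp: smooth_frame_def)
  have i1: "inj_on (\<lambda>i. L (\<phi> m) (F0 i m)) I"
    using comp_inj_on[OF indep0(1)[OF U(2)] inj_on_subset[OF Linj[OF V(2) mT] subset_UNIV]] by (simp add: o_def)
  have i2: "independent ((\<lambda>i. L (\<phi> m) (F0 i m)) ` I)"
    using linear_independent_injective_image[OF jet_changeD(1)[OF jc[OF V(2) mT]] indep0(2)[OF U(2)]
        inj_on_subset[OF Linj[OF V(2) mT] subset_UNIV]] by (simp add: image_image)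
  obtain b where b: "\<And>i. i \<in> I \<Longrightarrow> b i = L (\<phi> m) (F0 i m)" and binj: "inj (frame_map b)"
    by (fact extend_to_frame[OF i1 i2])
  define G where "G i x = F0 i (inv_into U \<phi> x)" for i x
  have G: "open_smooth (\<phi> ` U) (G i)" if "i \<in> I" for i
    using sf that
    by (simp add: smooth_frame_def G_def[abs_def] o_def smooth_on_open_iff[OF chart_image_open[OF U(1)]])
  have GF: "G i (\<phi> z) = F0 i z" if "z \<in> U" for i z
    using that chart_inj[OF U(1)] by (simp add: G_def)
  \<comment> \<open>For indices outside \<open>I\<close> the constant vectors \<open>b i\<close> complete the basis at \<open>m\<close>.\<close>
  define Fx where "Fx i x = (if i \<in> I then L (k x) (G i (k x)) else b i)" for i x
  have Fx: "open_smooth T0 (Fx i)" for i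
  proof (cases "i \<in> I")
    case True
    have "open_smooth T0 (\<lambda>x. \<Sum>c\<in>Basis. (G i (k x) \<bullet> c) *\<^sub>R L (k x) c)"
    proof (rule open_smooth_sum[OF T0], rule open_smooth_scaleR)
      fix c
      have "open_smooth T0 (\<lambda>x. G i (k x))"
        by (rule open_smooth_compose[OF kT G[OF True]]) (use S' in \<open>auto simp: T0_def\<close>)
      then show "open_smooth T0 (\<lambda>x. G i (k x) \<bullet> c)"
        by (rule open_smooth_inner[OF _ open_smooth_const[OF T0]])
      show "open_smooth T0 (\<lambda>x. L (k x) c)"
        unfolding L_def by (rule open_smooth_compose[OF kT open_smooth_derivative[OF S'(1)]]) (auto simp: T0_def)
    qed
    then show ?thesis
    proof (rule open_smooth_cong)
      fix x assume "x \<in> T0"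
      then have "linear (L (k x))" unfolding L_def
        by (intro open_smooth_derivative_linear[OF S'(1)]) (auto simp: T0_def)
      from linear_Basis_expand[OF this, of "G i (k x)"]
      show "(\<Sum>c\<in>Basis. (G i (k x) \<bullet> c) *\<^sub>R L (k x) c) = Fx i x" using True by (simp add: Fx_def)
    qed
  next
    case False
    then show ?thesis using open_smooth_const[OF T0] by (simp add: Fx_def[abs_def])
  qed
  define A where "A x = frame_map (\<lambda>i. Fx i x)" for x
  have A0: "inj (A (\<theta> m))"
  proof -
    have "(\<lambda>i. Fx i (\<theta> m)) = b"
      using in_U[OF V(2) mT] b GF[of m] by (auto simp: Fx_def fun_eq_iff)
    then show ?thesis using binj by (simp add: A_def)
  qed
  have Asm: "open_smooth T0 (\<lambda>x. A x v)" for v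
    unfolding A_def frame_map_def by (intro open_smooth_sum T0 open_smooth_scaleR open_smooth_const Fx)
  have Ac: "isCont (\<lambda>x. A x v) (\<theta> m)" for v
    using open_smooth_continuous_on[OF Asm] mT T0 by (simp add: continuous_on_eq_continuous_at)
  obtain e where e: "e > 0" "\<forall>\<^sub>F x in nhds (\<theta> m). x \<in> T0 \<and> (\<forall>w. e * norm w \<le> norm (A x w))"
    by (rule eventually_linear_bounded_below[OF T0 mT _ A0 Ac]) (simp add: A_def linear_frame_map)
  then obtain T where T: "open T" "\<theta> m \<in> T" "\<forall>x\<in>T. x \<in> T0 \<and> (\<forall>w. e * norm w \<le> norm (A x w))"
    unfolding eventually_nhds by blast
  have Ainj: "inj (A x)" if "x \<in> T" for x
  proof -
    have "w = 0" if "A x w = 0" for w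
    proof -
      have "e * norm w \<le> 0" using T(3) \<open>x \<in> T\<close> that by (metis norm_zero)
      then show "w = 0" using e(1) by (simp add: mult_le_0_iff)
    qed
    then show ?thesis using linear_injective_0[of "A x"] linear_frame_map by (auto simp: A_def)
  qed
  define F where "F i y = Fx i (\<theta> y)" for i y
  let ?V = "{z \<in> V. \<theta> z \<in> T}"
  have TV: "T \<subseteq> \<theta> ` V" using T(3) S(3) by (auto simp: T0_def)
  have im: "\<theta> ` ?V = T" using TV by auto
  show ?thesis
  proof (rule that[OF T(1,2) TV, of F])
    have "smooth_on (\<theta> ` ?V) (F i \<circ> inv_into ?V \<theta>)" for i
    proof -
      have "open_smooth T (Fx i)" by (rule open_smooth_subset[OF Fx T(1)]) (use T in auto)
      then have "open_smooth T (F i \<circ> inv_into ?V \<theta>)"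
      proof (rule open_smooth_cong)
        fix x assume "x \<in> T"
        then have "x \<in> \<theta> ` ?V" using im by simp
        then have "\<theta> (inv_into ?V \<theta> x) = x" by (rule f_inv_into_f)
        then show "Fx i x = (F i \<circ> inv_into ?V \<theta>) x" by (simp add: F_def)
      qed
      then show ?thesis by (simp add: smooth_on_open_iff[OF T(1)] im)
    qed
    moreover have "inj_on (\<lambda>i. F i y) UNIV \<and> independent ((\<lambda>i. F i y) ` UNIV)" if "y \<in> ?V" for y
      using Ainj[of "\<theta> y"] that inj_frame_map_iff[of "\<lambda>i. F i y"] by (simp add: A_def F_def)
    moreover have "tcoord \<theta> ` H y = span ((\<lambda>i. F i y) ` I)" if y: "y \<in> ?V" for y
    proof -
      have yT: "y \<in> V" "\<theta> y \<in> T0" using y T(3) by auto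
      have "(\<lambda>i. F i y) ` I = (\<lambda>i. L (\<phi> y) (F0 i y)) ` I"
        using in_U[OF yT] GF[of y] by (intro image_cong) (auto simp: F_def Fx_def)
      then show ?thesis using HL[OF yT] by simp
    qed
    ultimately show "adapted_frame I H (?V, \<theta>) F"
      by (auto simp: adapted_frame_def smooth_frame_def)
  qed
qed

lemma adapted_frameD:
  assumes "(U, \<phi>) \<in> SM" "adapted_frame I H (U, \<phi>) F"
  shows "y \<in> U \<Longrightarrow> inj (frame_map (\<lambda>i. F i y))"
    "y \<in> U \<Longrightarrow> tcoord \<phi> ` H y = frame_map (\<lambda>i. F i y) ` horizontal I"
    "open_smooth (\<phi> ` U) (\<lambda>x. F i (inv_into U \<phi> x))"
  using assms(2) smooth_on_open_iff[OF chart_image_open[OF assms(1)], of "F i \<circ> inv_into U \<phi>"]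
    inj_frame_map_iff[of "\<lambda>i. F i y"]
  by (auto simp: adapted_frame_def smooth_frame_def span_image_frame o_def)

lemma frame_map_mem_H_iff:
  assumes "(U, \<phi>) \<in> SM" "adapted_frame I H (U, \<phi>) F" "y \<in> U"
  shows "frame_map (\<lambda>i. F i y) a \<in> tcoord \<phi> ` H y \<longleftrightarrow> a \<in> horizontal I"
  using adapted_frameD(1,2)[OF assms] by (simp add: inj_image_mem_iff)

lemma jet_change_affine:
  assumes "(U, \<phi>) \<in> SM" "m \<in> U" and A: "linear A" "inj A"
  shows "jet_change m \<phi> (\<lambda>z. inv A (\<phi> z - x0)) (inv A) (\<lambda>u. 0)"
  unfolding jet_change_def
proof (intro conjI allI impI)
  show l: "linear (inv A)" using inverse_linear[OF A] by simp
  fix c u w assume j: "has_jet (\<phi> \<circ> c) u w"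
  have "has_jet (\<lambda>t. inv A ((\<phi> \<circ> c) t + (- x0))) (inv A (u + 0)) (inv A (w + 0))"
    by (rule has_jet_linear[OF _ has_jet_add[OF j has_jet_const]]) (use l in \<open>simp add: linear_conv_bounded_linear\<close>)
  then show "has_jet ((\<lambda>z. inv A (\<phi> z - x0)) \<circ> c) (inv A u) (inv A w + 0)" by (simp add: o_def)
qed simp

text \<open>An affine map takes \<open>m\<close> to the origin and the adapted frame at \<open>m\<close> to the standard basis.\<close>

lemma H_chart_affine:
  assumes c: "(U, \<phi>) \<in> SM" "m \<in> U" and F: "adapted_frame I H (U, \<phi>) F"
  shows "H_chart M I H m (U, \<lambda>z. inv (frame_map (\<lambda>i. F i m)) (\<phi> z - \<phi> m))"
proof -
  let ?A = "frame_map (\<lambda>i. F i m)"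
  have A: "linear ?A" "inj ?A" using adapted_frameD(1)[OF c(1) F c(2)] linear_frame_map by auto
  note A' = inverse_linear[OF A]
  have ch: "(U, \<lambda>z. inv ?A (\<phi> z - \<phi> m)) \<in> SM" by (rule affine_chart[OF c(1) A])
  have "tcoord (\<lambda>z. inv ?A (\<phi> z - \<phi> m)) ` H m = inv ?A ` tcoord \<phi> ` H m"
    by (rule tcoord_H_change[OF c(1) ch c(2) c(2) jet_change_affine[OF c A]])
  also have "\<dots> = horizontal I"
    using adapted_frameD(2)[OF c(1) F c(2)] A'(3) by (simp add: image_image)
  finally show ?thesis using ch c A' by (simp add: H_chart_def linear_0)
qed

lemma H_chart_exists:
  assumes "m \<in> points M" obtains U \<phi> where "H_chart M I H m (U, \<phi>)"
proof -
  obtain V \<theta> where V: "(V, \<theta>) \<in> SM" "m \<in> V" by (rule chart_at[OF assms])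
  obtain T F where T: "open T" "\<theta> m \<in> T" "T \<subseteq> \<theta> ` V" "adapted_frame I H ({z \<in> V. \<theta> z \<in> T}, \<theta>) F"
    by (rule adapted_frame_exists[OF V])
  show ?thesis
    by (rule that[OF H_chart_affine[OF restrict_chart[OF V(1) T(1)] _ T(4)]]) (use V T in simp)
qed

section \<open>Parabolic arrows in coordinates\<close>

lemma parabolic_curve_points: "parabolic_curve M H c \<Longrightarrow> c 0 \<in> points M"
proof -
  assume "parabolic_curve M H c"
  then obtain d where d: "d \<in> M" "smooth_near UNIV line_chart d c 0"
    unfolding parabolic_curve_def smooth_curve_iff by blast
  then show ?thesis using smooth_near_mem[OF d(2)] unfolding points_iff by blast
qed

lemma parabolic_smooth: "parabolic_curve M H c \<Longrightarrow> smooth_curve M c"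
  by (simp add: parabolic_curve_def)

text \<open>Accelerations change by the linear map \<open>L\<close> and by a term that depends on the velocity alone.  For curves
  with the same velocity this term cancels in the difference, and \<open>L\<close> preserves \<open>H\<close>.\<close>

lemma second_order_contact_change:
  assumes ch: "(U, \<phi>) \<in> SM" "m \<in> U" "(V, \<theta>) \<in> SM" "m \<in> V"
    and c: "smooth_curve M c1" "c1 0 = m" "smooth_curve M c2" "c2 0 = m"
    and eq: "velocity \<phi> c1 = velocity \<phi> c2" "acceleration \<phi> c1 - acceleration \<phi> c2 \<in> tcoord \<phi> ` H m"
  shows "velocity \<theta> c1 = velocity \<theta> c2 \<and> acceleration \<theta> c1 - acceleration \<theta> c2 \<in> tcoord \<theta> ` H m"
proof -
  obtain L Q where L: "jet_change m \<phi> \<theta> L Q" by (rule change_of_chart[OF ch(1,3,2,4)])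
  have "acceleration \<theta> c1 - acceleration \<theta> c2 = L (acceleration \<phi> c1 - acceleration \<phi> c2)"
    using jet_change_velocity(2)[OF L c(1,2) ch(1,2)] jet_change_velocity(2)[OF L c(3,4) ch(1,2)] eq(1)
    by (simp add: linear_diff[OF jet_changeD(1)[OF L]])
  then have "acceleration \<theta> c1 - acceleration \<theta> c2 \<in> tcoord \<theta> ` H m"
    using eq(2) tcoord_H_change[OF ch(1,3,2,4) L] by simp
  moreover have "velocity \<theta> c1 = velocity \<theta> c2"
    using jet_change_velocity(1)[OF L c(1,2) ch(1,2)] jet_change_velocity(1)[OF L c(3,4) ch(1,2)] eq(1) by simp
  ultimately show ?thesis by simp
qed

lemma arrow_equiv_iff:
  assumes ch: "(U, \<phi>) \<in> SM" "ca 0 \<in> U"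
  shows "arrow_equiv M I H ca cb \<longleftrightarrow> parabolic_curve M H ca \<and> parabolic_curve M H cb \<and> ca 0 = cb 0 \<and>
     velocity \<phi> ca = velocity \<phi> cb \<and> acceleration \<phi> ca - acceleration \<phi> cb \<in> tcoord \<phi> ` H (ca 0)"
    (is "?L \<longleftrightarrow> ?R")
proof
  assume ?L
  then obtain V \<theta> where p: "parabolic_curve M H ca" "parabolic_curve M H cb" "ca 0 = cb 0"
    and V: "H_chart M I H (ca 0) (V, \<theta>)" "velocity \<theta> ca = velocity \<theta> cb"
      "acceleration \<theta> ca - acceleration \<theta> cb \<in> horizontal I"
    unfolding arrow_equiv_def by blast
  have V': "(V, \<theta>) \<in> SM" "ca 0 \<in> V" "tcoord \<theta> ` H (ca 0) = horizontal I"
    using V(1) by (auto simp: H_chart_def)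
  have "velocity \<phi> ca = velocity \<phi> cb \<and> acceleration \<phi> ca - acceleration \<phi> cb \<in> tcoord \<phi> ` H (ca 0)"
    using second_order_contact_change[OF V'(1,2) ch parabolic_smooth[OF p(1)] refl parabolic_smooth[OF p(2)]
        p(3)[symmetric] V(2)] V V' by simp
  then show ?R using p by blast
next
  assume R: ?R
  then have p: "parabolic_curve M H ca" "parabolic_curve M H cb" "ca 0 = cb 0" by auto
  obtain V \<theta> where V: "H_chart M I H (ca 0) (V, \<theta>)"
    by (rule H_chart_exists[OF parabolic_curve_points[OF p(1)]])
  have V': "(V, \<theta>) \<in> SM" "ca 0 \<in> V" "tcoord \<theta> ` H (ca 0) = horizontal I"
    using V(1) by (auto simp: H_chart_def)
  have "velocity \<theta> ca = velocity \<theta> cb \<and> acceleration \<theta> ca - acceleration \<theta> cb \<in> tcoord \<theta> ` H (ca 0)"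
    using second_order_contact_change[OF ch V'(1,2) parabolic_smooth[OF p(1)] refl parabolic_smooth[OF p(2)]
        p(3)[symmetric]] R by auto
  then show ?L unfolding arrow_equiv_def using p V V'(3) by auto
qed

lemma arrow_equiv_refl: assumes "parabolic_curve M H c" shows "arrow_equiv M I H c c"
proof -
  obtain U \<phi> where U: "(U, \<phi>) \<in> SM" "c 0 \<in> U" by (rule chart_at[OF parabolic_curve_points[OF assms]])
  show ?thesis using arrow_equiv_iff[where ca = c and cb = c, OF U] assms subspace_0[OF subspace_H[OF U]] by simp
qed

lemma arrow_self: "parabolic_curve M H c \<Longrightarrow> c \<in> arrow M I H c"
  using arrow_equiv_refl by (simp add: arrow_def)

lemma arrow_eq_iff:
  assumes c: "parabolic_curve M H ca" "parabolic_curve M H cb"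
    and U: "(U, \<phi>) \<in> SM" "ca 0 \<in> U"
  shows "arrow M I H ca = arrow M I H cb \<longleftrightarrow> ca 0 = cb 0 \<and>
     velocity \<phi> ca = velocity \<phi> cb \<and> acceleration \<phi> ca - acceleration \<phi> cb \<in> tcoord \<phi> ` H (ca 0)"
    (is "?L \<longleftrightarrow> ?R")
proof
  assume ?L
  then have "arrow_equiv M I H ca cb" using arrow_self[OF c(2)] by (auto simp: arrow_def)
  then show ?R unfolding arrow_equiv_iff[where ca = ca and cb = cb, OF U] by blast
next
  assume R: ?R
  then have U2: "cb 0 \<in> U" using U by simp
  note sub = subspace_H[OF U]
  have "arrow_equiv M I H ca d \<longleftrightarrow> arrow_equiv M I H cb d" for d
  proof -
    have "acceleration \<phi> ca - acceleration \<phi> d \<in> tcoord \<phi> ` H (ca 0) \<longleftrightarrow>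
        acceleration \<phi> cb - acceleration \<phi> d \<in> tcoord \<phi> ` H (ca 0)"
    proof
      assume "acceleration \<phi> ca - acceleration \<phi> d \<in> tcoord \<phi> ` H (ca 0)"
      from subspace_diff[OF sub this R[THEN conjunct2, THEN conjunct2]]
      show "acceleration \<phi> cb - acceleration \<phi> d \<in> tcoord \<phi> ` H (ca 0)" by simp
    next
      assume "acceleration \<phi> cb - acceleration \<phi> d \<in> tcoord \<phi> ` H (ca 0)"
      from subspace_add[OF sub this R[THEN conjunct2, THEN conjunct2]]
      show "acceleration \<phi> ca - acceleration \<phi> d \<in> tcoord \<phi> ` H (ca 0)" by simp
    qed
    then show ?thesis
      using arrow_equiv_iff[where ca = ca and cb = d, OF U]
        arrow_equiv_iff[where ca = cb and cb = d, OF U(1) U2] R c by auto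
  qed
  then show ?L by (simp add: arrow_def)
qed

text \<open>Arrows are described by velocity and acceleration in an arbitrary chart around \<open>m\<close>, not only in \<open>H\<close>-charts,
  because a single chart has to serve all points of its domain.\<close>

definition coord_arrow :: "'m set \<Rightarrow> ('m \<Rightarrow> real ^ 'd) \<Rightarrow> 'm \<Rightarrow> real ^ 'd \<Rightarrow> real ^ 'd \<Rightarrow> 'm arrow" where
  "coord_arrow U \<phi> m u w = arrow M I H (quad_curve U \<phi> m u w)"

lemma quad_curve_parabolic:
  assumes "(U, \<phi>) \<in> SM" "m \<in> U" "u \<in> tcoord \<phi> ` H m"
  shows "parabolic_curve M H (quad_curve U \<phi> m u w)"
  using parabolic_curve_iff[of U \<phi> "quad_curve U \<phi> m u w"] quad_curve[OF assms(1,2)] assms by simp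

lemma arrow_eq_coord_arrow:
  assumes "(U, \<phi>) \<in> SM" "c 0 = m" "m \<in> U" "parabolic_curve M H c"
  shows "arrow M I H c = coord_arrow U \<phi> m (velocity \<phi> c) (acceleration \<phi> c)"
    "velocity \<phi> c \<in> tcoord \<phi> ` H m"
proof -
  have m: "c 0 \<in> U" using assms by simp
  show v: "velocity \<phi> c \<in> tcoord \<phi> ` H m" using parabolic_curve_iff[where c = c, OF assms(1) m] assms by simp
  note q = quad_curve[OF assms(1,3), of "velocity \<phi> c" "acceleration \<phi> c"]
  show "arrow M I H c = coord_arrow U \<phi> m (velocity \<phi> c) (acceleration \<phi> c)"
    unfolding coord_arrow_def
    using arrow_eq_iff[where ca = c, OF assms(4) quad_curve_parabolic[OF assms(1,3) v] assms(1) m] q assms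
      subspace_0[OF subspace_H[OF assms(1,3)]] by simp
qed

lemma coord_arrow_eq_iff:
  assumes "(U, \<phi>) \<in> SM" "m \<in> U" "u \<in> tcoord \<phi> ` H m" "u' \<in> tcoord \<phi> ` H m"
  shows "coord_arrow U \<phi> m u w = coord_arrow U \<phi> m u' w' \<longleftrightarrow> u = u' \<and> w - w' \<in> tcoord \<phi> ` H m"
  unfolding coord_arrow_def
  using arrow_eq_iff[OF quad_curve_parabolic[OF assms(1-3)] quad_curve_parabolic[OF assms(1,2,4)] assms(1)]
    quad_curve[OF assms(1,2)] assms(2) by simp

lemma THM_at_iff:
  assumes "(U, \<phi>) \<in> SM" "m \<in> U"
  shows "v \<in> THM_at M I H m \<longleftrightarrow> (\<exists>u\<in>tcoord \<phi> ` H m. \<exists>w. v = coord_arrow U \<phi> m u w)"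
proof
  assume "v \<in> THM_at M I H m"
  then obtain c where "parabolic_curve M H c" "c 0 = m" "v = arrow M I H c" unfolding THM_at_def by blast
  then show "\<exists>u\<in>tcoord \<phi> ` H m. \<exists>w. v = coord_arrow U \<phi> m u w"
    using arrow_eq_coord_arrow[OF assms(1) _ assms(2)] by blast
next
  assume "\<exists>u\<in>tcoord \<phi> ` H m. \<exists>w. v = coord_arrow U \<phi> m u w"
  then show "v \<in> THM_at M I H m"
    unfolding THM_at_def coord_arrow_def using quad_curve_parabolic[OF assms] quad_curve(2)[OF assms] by blast
qed

lemma base_point_arrow: assumes "parabolic_curve M H c" shows "base_point (arrow M I H c) = c 0"
proof -
  have "d 0 = c 0" if "d \<in> arrow M I H c" for d
    using that by (simp add: arrow_def arrow_equiv_def)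
  then have "(\<lambda>d. d 0) ` arrow M I H c = (\<lambda>d. c 0) ` arrow M I H c" by (rule image_cong[OF refl])
  also have "\<dots> = {c 0}" using arrow_self[OF assms] by blast
  finally have "(\<lambda>c. c 0) ` arrow M I H c = {c 0}" .
  then show ?thesis by (simp add: base_point_def)
qed

lemma base_point_THM_at: "v \<in> THM_at M I H m \<Longrightarrow> base_point v = m"
  using base_point_arrow by (auto simp: THM_at_def)

lemma THM_at_points: "v \<in> THM_at M I H m \<Longrightarrow> m \<in> points M"
  using parabolic_curve_points by (auto simp: THM_at_def)

lemma THM_iff: "v \<in> THM M I H \<longleftrightarrow> v \<in> THM_at M I H (base_point v)"
proof
  assume "v \<in> THM M I H"
  then obtain m where "v \<in> THM_at M I H m" by (auto simp: THM_def)
  then show "v \<in> THM_at M I H (base_point v)" using base_point_THM_at by metis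
next
  assume "v \<in> THM_at M I H (base_point v)"
  then show "v \<in> THM M I H" using THM_at_points by (auto simp: THM_def)
qed

lemma parabolic_curve_reparam:
  assumes p: "parabolic_curve M H c" and U: "(U, \<phi>) \<in> SM" "c 0 \<in> U"
  shows "parabolic_curve M H (\<lambda>t. c (s * t))" "velocity \<phi> (\<lambda>t. c (s * t)) = s *\<^sub>R velocity \<phi> c"
    "acceleration \<phi> (\<lambda>t. c (s * t)) = s\<^sup>2 *\<^sub>R acceleration \<phi> c"
proof -
  have "open_smooth UNIV (\<lambda>t::real. s * t)" by (intro open_smooth_intros open_UNIV)
  then have "smooth_near UNIV line_chart line_chart (\<lambda>t. s * t) 0"
    by (intro smooth_nearI[where S = UNIV and h = "\<lambda>t. s * t"]) auto
  moreover have "smooth_near UNIV line_chart (U, \<phi>) c (s * 0)"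
    using smooth_curve_near[OF parabolic_smooth[OF p] U] by simp
  ultimately have "smooth_near UNIV line_chart (U, \<phi>) (\<lambda>t. c (s * t)) 0"
    by (rule smooth_near_compose)
  then have sc: "smooth_curve M (\<lambda>t. c (s * t))" by (rule smooth_curveI[OF U(1)])
  have "has_jet (\<lambda>t. (\<phi> \<circ> c) (s * t)) (s *\<^sub>R velocity \<phi> c) (s\<^sup>2 *\<^sub>R acceleration \<phi> c)"
    by (rule has_jet_reparam[OF smooth_curve_jet[OF parabolic_smooth[OF p] U]])
  then have j: "has_jet (\<phi> \<circ> (\<lambda>t. c (s * t))) (s *\<^sub>R velocity \<phi> c) (s\<^sup>2 *\<^sub>R acceleration \<phi> c)"
    by (simp add: o_def)
  show v: "velocity \<phi> (\<lambda>t. c (s * t)) = s *\<^sub>R velocity \<phi> c"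
    "acceleration \<phi> (\<lambda>t. c (s * t)) = s\<^sup>2 *\<^sub>R acceleration \<phi> c" using jet_velocity[OF j] by auto
  have "velocity \<phi> c \<in> tcoord \<phi> ` H (c 0)" using parabolic_curve_iff[where c = c, OF U] p by blast
  from subspace_scale[OF subspace_H[OF U] this, of s]
  show "parabolic_curve M H (\<lambda>t. c (s * t))"
    using parabolic_curve_iff[of U \<phi> "\<lambda>t. c (s * t)"] U sc v by simp
qed

lemma dilation_arrow:
  assumes p: "parabolic_curve M H c"
  shows "dilation M I H s (arrow M I H c) = arrow M I H (\<lambda>t. c (s * t))"
proof -
  obtain U \<phi> where U: "(U, \<phi>) \<in> SM" "c 0 \<in> U" by (rule chart_at[OF parabolic_curve_points[OF p]])
  have eq: "arrow M I H (\<lambda>t. d (s * t)) = arrow M I H (\<lambda>t. c (s * t))" if d: "d \<in> arrow M I H c" for d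
  proof -
    have e: "parabolic_curve M H d" "c 0 = d 0" "velocity \<phi> c = velocity \<phi> d"
      "acceleration \<phi> c - acceleration \<phi> d \<in> tcoord \<phi> ` H (c 0)"
      using d arrow_equiv_iff[where ca = c and cb = d, OF U] by (auto simp: arrow_def)
    have Ud: "d 0 \<in> U" using e U by simp
    note rc = parabolic_curve_reparam[OF p U, of s] and rd = parabolic_curve_reparam[OF e(1) U(1) Ud, of s]
    have U': "(\<lambda>t. c (s * t)) 0 \<in> U" using U by simp
    have "s\<^sup>2 *\<^sub>R (acceleration \<phi> c - acceleration \<phi> d) \<in> tcoord \<phi> ` H (c 0)"
      by (rule subspace_scale[OF subspace_H[OF U] e(4)])
    then have "arrow M I H (\<lambda>t. c (s * t)) = arrow M I H (\<lambda>t. d (s * t))"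
      using arrow_eq_iff[OF rc(1) rd(1) U(1) U'] rc rd e by (simp add: scaleR_diff_right)
    then show ?thesis by simp
  qed
  have "(\<lambda>d. arrow M I H (\<lambda>t. d (s * t))) ` arrow M I H c = (\<lambda>d. arrow M I H (\<lambda>t. c (s * t))) ` arrow M I H c"
    by (rule image_cong[OF refl eq])
  also have "\<dots> = {arrow M I H (\<lambda>t. c (s * t))}"
    using arrow_self[OF p] by (simp add: image_constant_conv) blast
  finally have "(\<lambda>d. arrow M I H (\<lambda>t. d (s * t))) ` arrow M I H c = {arrow M I H (\<lambda>t. c (s * t))}" .
  then show ?thesis by (simp add: dilation_def)
qed

lemma dilation_coord_arrow:
  assumes U: "(U, \<phi>) \<in> SM" "m \<in> U" and u: "u \<in> tcoord \<phi> ` H m"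
  shows "dilation M I H s (coord_arrow U \<phi> m u w) = coord_arrow U \<phi> m (s *\<^sub>R u) (s\<^sup>2 *\<^sub>R w)"
proof -
  let ?q = "quad_curve U \<phi> m u w"
  note q = quad_curve[OF U, of u w] and p = quad_curve_parabolic[OF U u, of w]
  have m: "?q 0 \<in> U" using q U by simp
  note r = parabolic_curve_reparam[OF p U(1) m, of s]
  have "arrow M I H (\<lambda>t. ?q (s * t)) = coord_arrow U \<phi> m (s *\<^sub>R u) (s\<^sup>2 *\<^sub>R w)"
    using arrow_eq_coord_arrow(1)[OF U(1) _ U(2) r(1)] r q by simp
  then show ?thesis using dilation_arrow[OF p] by (simp add: coord_arrow_def)
qed

lemma coord_arrow_change:
  assumes ch: "(U, \<phi>) \<in> SM" "(V, \<theta>) \<in> SM" "m \<in> U" "m \<in> V"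
    and L: "jet_change m \<phi> \<theta> L Q" and u: "u \<in> tcoord \<phi> ` H m"
  shows "coord_arrow U \<phi> m u w = coord_arrow V \<theta> m (L u) (L w + Q u)" "L u \<in> tcoord \<theta> ` H m"
proof -
  note q = quad_curve[OF ch(1,3), of u w] and p = quad_curve_parabolic[OF ch(1,3) u, of w]
  note j = jet_change_velocity[OF L q(1,2) ch(1,3)]
  show "coord_arrow U \<phi> m u w = coord_arrow V \<theta> m (L u) (L w + Q u)"
    using arrow_eq_coord_arrow(1)[OF ch(2) q(2) ch(4) p] j q by (simp add: coord_arrow_def)
  show "L u \<in> tcoord \<theta> ` H m" using arrow_eq_coord_arrow(2)[OF ch(2) q(2) ch(4) p] j q by simp
qed

text \<open>In an \<open>H\<close>-chart the Taylor coordinates \<open>(h, n)\<close> belong to velocity \<open>h\<close> and acceleration \<open>2 n\<close>.\<close>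

lemma taylor_arrow_eq:
  assumes "H_chart M I H m (U, \<phi>)"
  shows "taylor_arrow M I H (U, \<phi>) a = coord_arrow U \<phi> m (hor_part I a) (2 *\<^sub>R hor_part (- I) a)"
proof -
  have "\<phi> m = 0" using assms by (simp add: H_chart_def)
  then have "quad_curve U \<phi> m (hor_part I a) (2 *\<^sub>R hor_part (- I) a) =
    (\<lambda>t. inv_into U \<phi> (\<chi> i. if i \<in> I then t * a $ i else t\<^sup>2 * a $ i))"
    by (auto simp: quad_curve_def fun_eq_iff vec_eq_iff intro!: arg_cong[of _ _ "inv_into U \<phi>"])
  then show ?thesis by (simp add: taylor_arrow_def coord_arrow_def)
qed

lemma H_chartD: "H_chart M I H m (U, \<phi>) \<Longrightarrow> (U, \<phi>) \<in> SM \<and> m \<in> U \<and> tcoord \<phi> ` H m = horizontal I"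
  by (simp add: H_chart_def)

lemma taylor_coord_coord_arrow:
  assumes h: "H_chart M I H m (U, \<phi>)" and u: "u \<in> horizontal I"
  shows "taylor_coord M I H (U, \<phi>) (coord_arrow U \<phi> m u w) = u + (1 / 2) *\<^sub>R hor_part (- I) w"
proof -
  have U: "(U, \<phi>) \<in> SM" "m \<in> U" "tcoord \<phi> ` H m = horizontal I" using H_chartD[OF h] by auto
  have "inj (taylor_arrow M I H (U, \<phi>))"
  proof (rule injI)
    fix a b assume "taylor_arrow M I H (U, \<phi>) a = taylor_arrow M I H (U, \<phi>) b"
    then have e: "coord_arrow U \<phi> m (hor_part I a) (2 *\<^sub>R hor_part (- I) a) =
        coord_arrow U \<phi> m (hor_part I b) (2 *\<^sub>R hor_part (- I) b)" by (simp add: taylor_arrow_eq[OF h])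
    have hh: "hor_part I x \<in> tcoord \<phi> ` H m" for x using U(3) hor_part_in_horizontal by simp
    from e[unfolded coord_arrow_eq_iff[OF U(1,2) hh hh]] U(3)
    have 1: "hor_part I a = hor_part I b" and 2: "2 *\<^sub>R hor_part (- I) a - 2 *\<^sub>R hor_part (- I) b \<in> horizontal I"
      by simp_all
    have "a $ i = b $ i" for i
    proof (cases "i \<in> I")
      case True
      then show ?thesis using arg_cong[OF 1, of "\<lambda>v. v $ i"] by simp
    next
      case False
      then show ?thesis using 2[unfolded horizontal_iff, rule_format, OF False] by simp
    qed
    then show "a = b" by (simp add: vec_eq_iff)
  qed
  moreover have "taylor_arrow M I H (U, \<phi>) (u + (1 / 2) *\<^sub>R hor_part (- I) w) = coord_arrow U \<phi> m u w"
  proof -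
    have "hor_part I (u + (1 / 2) *\<^sub>R hor_part (- I) w) = u" using u by (auto simp: vec_eq_iff horizontal_iff)
    moreover have "2 *\<^sub>R hor_part (- I) (u + (1 / 2) *\<^sub>R hor_part (- I) w) - w \<in> horizontal I"
      using u by (auto simp: horizontal_iff)
    ultimately show ?thesis using coord_arrow_eq_iff[OF U(1,2)] U(3) u by (simp add: taylor_arrow_eq[OF h])
  qed
  ultimately show ?thesis unfolding taylor_coord_def by (metis inv_f_f)
qed

section \<open>Composition of parabolic flows\<close>

text \<open>The derivative at \<open>m\<close>, in direction \<open>u\<close>, of the vector field with constant components \<open>a\<close> with respect to
  the frame.  For horizontal \<open>a\<close> and modulo \<open>H\<close>, this is the bilinear term of the group law.\<close>

definition frame_derivative ::
  "'m set \<Rightarrow> ('m \<Rightarrow> real ^ 'd) \<Rightarrow> ('d \<Rightarrow> 'm \<Rightarrow> real ^ 'd) \<Rightarrow> 'm \<Rightarrow> real ^ 'd \<Rightarrow> real ^ 'd \<Rightarrow> real ^ 'd" where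
  "frame_derivative U \<phi> F m a =
     frechet_derivative (\<lambda>x. frame_map (\<lambda>i. F i (inv_into U \<phi> x)) a) (at (\<phi> m))"

lemma frame_map_smooth:
  assumes "(U, \<phi>) \<in> SM" "adapted_frame I H (U, \<phi>) F"
  shows "open_smooth (\<phi> ` U) (\<lambda>x. frame_map (\<lambda>i. F i (inv_into U \<phi> x)) a)"
  unfolding frame_map_def
  by (intro open_smooth_sum open_smooth_scaleR open_smooth_const chart_image_open[OF assms(1)]
      adapted_frameD(3)[OF assms])

lemma frame_map_inverse_smooth:
  assumes "(U, \<phi>) \<in> SM" "adapted_frame I H (U, \<phi>) F"
  shows "open_smooth (\<phi> ` U) (\<lambda>x. inv (frame_map (\<lambda>i. F i (inv_into U \<phi> x))) v)"
proof (rule open_smooth_inverse_linear_family[OF chart_image_open[OF assms(1)] linear_frame_map])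
  fix x assume "x \<in> \<phi> ` U"
  then have "inv_into U \<phi> x \<in> U" by (rule inv_into_into)
  then show "inj (frame_map (\<lambda>i. F i (inv_into U \<phi> x)))" by (rule adapted_frameD(1)[OF assms])
qed (rule frame_map_smooth[OF assms])

lemma frame_derivative_scale:
  assumes "(U, \<phi>) \<in> SM" "adapted_frame I H (U, \<phi>) F" "m \<in> U"
  shows "frame_derivative U \<phi> F m (s *\<^sub>R a) (t *\<^sub>R u) = (s * t) *\<^sub>R frame_derivative U \<phi> F m a u"
proof -
  let ?X = "\<lambda>a x. frame_map (\<lambda>i. F i (inv_into U \<phi> x)) a"
  have m: "\<phi> m \<in> \<phi> ` U" using assms by simp
  have d: "(?X a has_derivative frame_derivative U \<phi> F m a) (at (\<phi> m))" for a
    unfolding frame_derivative_def by (rule open_smooth_has_derivative[OF frame_map_smooth[OF assms(1,2)] m])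
  have "((\<lambda>x. s *\<^sub>R ?X a x) has_derivative (\<lambda>u. s *\<^sub>R frame_derivative U \<phi> F m a u)) (at (\<phi> m))"
    by (rule has_derivative_scaleR_right[OF d])
  then have "(?X (s *\<^sub>R a) has_derivative (\<lambda>u. s *\<^sub>R frame_derivative U \<phi> F m a u)) (at (\<phi> m))"
    by (simp add: linear_scale[OF linear_frame_map])
  then have "frame_derivative U \<phi> F m (s *\<^sub>R a) = (\<lambda>u. s *\<^sub>R frame_derivative U \<phi> F m a u)"
    using d has_derivative_unique by blast
  moreover have "linear (frame_derivative U \<phi> F m a)" using d has_derivative_linear by blast
  ultimately show ?thesis by (simp add: linear_scale)
qed

text \<open>Differentiating a section \<open>Z\<close> of \<open>H\<close> at a zero gives a vector of \<open>H\<close>: the normal components of \<open>Z\<close>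
  with respect to an adapted frame vanish identically, and at a zero of \<open>Z\<close> the derivatives of the components are
  the components of the derivative, because the terms in which the frame is differentiated contain the factor
  \<open>Z\<close>.\<close>

lemma horizontal_derivative:
  assumes U: "(U, \<phi>) \<in> SM" "m \<in> U" and F: "adapted_frame I H (U, \<phi>) F"
    and Z: "(Z has_derivative Z') (at (\<phi> m))" "Z (\<phi> m) = 0"
    and B: "open B" "\<phi> m \<in> B" "\<And>z. z \<in> U \<Longrightarrow> \<phi> z \<in> B \<Longrightarrow> Z (\<phi> z) \<in> tcoord \<phi> ` H z"
  shows "Z' u \<in> tcoord \<phi> ` H m"
proof -
  define A where "A x = frame_map (\<lambda>i. F i (inv_into U \<phi> x))" for x
  have Aphi: "A (\<phi> z) = frame_map (\<lambda>i. F i z)" if "z \<in> U" for z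
    using that chart_inj[OF U(1)] by (simp add: A_def)
  have inj: "inj (A (\<phi> z))" if "z \<in> U" for z using Aphi[OF that] adapted_frameD(1)[OF U(1) F that] by simp
  have lin: "linear (A x)" for x by (simp add: A_def linear_frame_map)
  note inv' = inverse_linear[OF lin inj]
  have o: "open (\<phi> ` U)" by (rule chart_image_open[OF U(1)])
  have cont: "isCont (\<lambda>x. inv (A x) v) (\<phi> m)" for v
    using open_smooth_continuous_on[OF frame_map_inverse_smooth[OF U(1) F]] U o
    by (simp add: A_def continuous_on_eq_continuous_at)
  \<comment> \<open>The components of \<open>Z\<close> with respect to the frame.\<close>
  define y where "y x = (\<Sum>b\<in>Basis. (Z x \<bullet> b) *\<^sub>R inv (A x) b)" for x
  have yA: "y (\<phi> z) = inv (A (\<phi> z)) (Z (\<phi> z))" if "z \<in> U" for z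
    unfolding y_def by (rule linear_Basis_expand[OF inv'(1)[OF that], symmetric])
  have dy: "(y has_derivative (\<lambda>u. \<Sum>b\<in>Basis. (Z' u \<bullet> b) *\<^sub>R inv (A (\<phi> m)) b)) (at (\<phi> m))"
    unfolding y_def
  proof (rule has_derivative_sum)
    fix b
    show "((\<lambda>x. (Z x \<bullet> b) *\<^sub>R inv (A x) b) has_derivative (\<lambda>u. (Z' u \<bullet> b) *\<^sub>R inv (A (\<phi> m)) b)) (at (\<phi> m))"
      by (rule has_derivative_scaleR_vanishing[OF has_derivative_inner_left[OF Z(1)] _ cont]) (simp add: Z(2))
  qed
  have hor: "y x \<in> horizontal I" if x: "x \<in> \<phi> ` U \<inter> B" for x
  proof -
    obtain z where z: "z \<in> U" "x = \<phi> z" "\<phi> z \<in> B" using x by blast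
    have "Z (\<phi> z) \<in> A (\<phi> z) ` horizontal I"
      using B(3)[OF z(1,3)] adapted_frameD(2)[OF U(1) F z(1)] Aphi[OF z(1)] by simp
    then show ?thesis using yA[OF z(1)] inv'(3)[OF z(1)] z by auto
  qed
  have "inv (A (\<phi> m)) (Z' u) $ i = 0" if i: "i \<notin> I" for i
  proof -
    have "((\<lambda>x. y x $ i) has_derivative (\<lambda>u. (\<Sum>b\<in>Basis. (Z' u \<bullet> b) *\<^sub>R inv (A (\<phi> m)) b) $ i)) (at (\<phi> m))"
      by (rule bounded_linear.has_derivative[OF bounded_linear_vec_nth dy])
    moreover have "((\<lambda>x. y x $ i) has_derivative (\<lambda>u. 0)) (at (\<phi> m))"
      by (rule has_derivative_transform_within_open[OF has_derivative_const[of 0], of "\<phi> ` U \<inter> B"])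
        (use o B U hor i in \<open>auto simp: horizontal_iff\<close>)
    ultimately have "(\<lambda>u. (\<Sum>b\<in>Basis. (Z' u \<bullet> b) *\<^sub>R inv (A (\<phi> m)) b) $ i) = (\<lambda>u. 0)"
      by (rule has_derivative_unique)
    then have "(\<Sum>b\<in>Basis. (Z' u \<bullet> b) *\<^sub>R inv (A (\<phi> m)) b) $ i = 0" by metis
    then show ?thesis using linear_Basis_expand[OF inv'(1)[OF U(2)], of "Z' u"] by simp
  qed
  then have "inv (A (\<phi> m)) (Z' u) \<in> horizontal I" by (simp add: horizontal_iff)
  then have "A (\<phi> m) (inv (A (\<phi> m)) (Z' u)) \<in> tcoord \<phi> ` H m"
    using adapted_frameD(2)[OF U(1) F U(2)] Aphi[OF U(2)] by simp
  then show ?thesis using inv'(2)[OF U(2)] by simp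
qed

lemma prod_line_atlas: "smooth_atlas UNIV (prod_atlas SM (interval_atlas (UNIV :: real set)))"
  using smooth_atlas_prod[OF atlas_SM smooth_atlas_interval[of UNIV "UNIV :: real set"]] by simp

lemma prod_line_atlas_M: "smooth_atlas UNIV (prod_atlas M (interval_atlas (UNIV :: real set)))"
  using smooth_atlas_prod[OF atlas_M smooth_atlas_interval[of UNIV "UNIV :: real set"]] by simp

lemma prod_line_chart: "(U, \<phi>) \<in> A \<Longrightarrow> (U \<times> UNIV, map_prod \<phi> (\<lambda>t. t)) \<in> prod_atlas A (interval_atlas UNIV)"
  unfolding prod_atlas_def interval_atlas_def by blast

lemma prod_line_atlas_mono: "prod_atlas M (interval_atlas UNIV) \<subseteq> prod_atlas SM (interval_atlas UNIV)"
  unfolding prod_atlas_def using M_SM by blast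

lemma flow_coords:
  assumes \<Phi>: "parabolic_flow M H \<Phi>" and U: "(U, \<phi>) \<in> SM" "m \<in> U"
  obtains B r G where "open B" "\<phi> m \<in> B" "B \<subseteq> \<phi> ` U" "r > 0" "open_smooth (B \<times> {-r<..<r}) G"
    "\<forall>z\<in>U. \<phi> z \<in> B \<longrightarrow> (\<forall>t\<in>{-r<..<r}. \<Phi> t z \<in> U \<and> \<phi> (\<Phi> t z) = G (\<phi> z, t))"
proof -
  let ?A = "prod_atlas M (interval_atlas (UNIV :: real set))"
  let ?f = "\<lambda>(m, t). \<Phi> t m"
  have mM: "m \<in> points M" using U chart_points by blast
  have \<Phi>0: "\<Phi> 0 m = m" using \<Phi> mM by (simp add: parabolic_flow_def)
  obtain D where D: "openin (atlas_topology UNIV ?A) D" "points M \<times> {0} \<subseteq> D"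
    "smooth_map UNIV (sub_atlas ?A D) UNIV M ?f"
    using \<Phi> unfolding parabolic_flow_def Let_def by blast
  have pD: "(m, 0) \<in> D" using D(2) mM by blast
  have sA: "smooth_atlas UNIV (sub_atlas ?A D)" by (rule smooth_atlas_sub_atlas[OF prod_line_atlas_M D(1)])
  have "(m, 0) \<in> points (sub_atlas ?A D)"
    using pD mM by (simp add: points_sub_atlas points_prod_atlas points_interval)
  then obtain c d where cd: "c \<in> sub_atlas ?A D" "d \<in> M" "smooth_near UNIV c d ?f (m, 0)"
    using D(3) unfolding smooth_map_iff(1)[OF sA atlas_M] by blast
  obtain a where a: "a \<in> ?A" "c = (fst a \<inter> D, snd a)" using cd(1) unfolding sub_atlas_iff by blast
  have n1: "smooth_near UNIV a d ?f (m, 0)"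
    using cd(3) smooth_near_restrict_source[OF prod_line_atlas_M D(1) a(1) pD, of d ?f] a(2) by simp
  have n: "smooth_near UNIV (U \<times> UNIV, map_prod \<phi> (\<lambda>t::real. t)) (U, \<phi>) ?f (m, 0)"
    by (rule smooth_near_change_charts[OF prod_line_atlas atlas_SM n1 subsetD[OF prod_line_atlas_mono a(1)]
          subsetD[OF M_SM cd(2)] prod_line_chart[OF U(1)] U(1)]) (use U \<Phi>0 in auto)
  have "\<exists>S h. open_smooth S h \<and> (\<phi> m, 0) \<in> S \<and> S \<subseteq> \<phi> ` U \<times> UNIV \<and>
    (\<forall>z\<in>U. \<forall>t. (\<phi> z, t) \<in> S \<longrightarrow> \<Phi> t z \<in> U \<and> \<phi> (\<Phi> t z) = h (\<phi> z, t))"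
  proof (rule smooth_nearE[OF n])
    fix S h
    assume *: "open_smooth S h" "snd (U \<times> UNIV, map_prod \<phi> (\<lambda>t::real. t)) (m, 0) \<in> S"
      "UNIV \<inter> S \<subseteq> snd (U \<times> UNIV, map_prod \<phi> (\<lambda>t::real. t)) ` fst (U \<times> UNIV, map_prod \<phi> (\<lambda>t::real. t))"
      "\<And>z. z \<in> fst (U \<times> UNIV, map_prod \<phi> (\<lambda>t::real. t)) \<Longrightarrow> snd (U \<times> UNIV, map_prod \<phi> (\<lambda>t::real. t)) z \<in> S \<Longrightarrow>
        ?f z \<in> fst (U, \<phi>) \<and> snd (U, \<phi>) (?f z) = h (snd (U \<times> UNIV, map_prod \<phi> (\<lambda>t::real. t)) z)"
    have "\<Phi> t z \<in> U \<and> \<phi> (\<Phi> t z) = h (\<phi> z, t)" if "z \<in> U" "(\<phi> z, t) \<in> S" for z t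
      using *(4)[of "(z, t)"] that by simp
    moreover have "S \<subseteq> \<phi> ` U \<times> UNIV" using *(3) by auto
    ultimately show ?thesis using *(1,2) by (intro exI[of _ S] exI[of _ h]) simp
  qed
  then obtain S h where S: "open_smooth S h" "(\<phi> m, 0) \<in> S" "S \<subseteq> \<phi> ` U \<times> UNIV"
    "\<forall>z\<in>U. \<forall>t. (\<phi> z, t) \<in> S \<longrightarrow> \<Phi> t z \<in> U \<and> \<phi> (\<Phi> t z) = h (\<phi> z, t)"
    by (elim exE conjE)
  obtain B J where BJ0: "open B" "open J" "(\<phi> m, 0) \<in> B \<times> J" "B \<times> J \<subseteq> S"
    by (rule open_prod_elim[OF open_smooth_open[OF S(1)] S(2)])
  then have BJ: "open B" "open J" "\<phi> m \<in> B" "0 \<in> J" "B \<times> J \<subseteq> S" by simp_all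
  obtain r where r: "r > 0" "ball 0 r \<subseteq> J" by (rule openE[OF BJ(2,4)])
  then have rJ: "{-r<..<r} \<subseteq> J" by (simp add: ball_eq_greaterThanLessThan)
  have sub: "B \<times> {-r<..<r} \<subseteq> S" using BJ(5) rJ by blast
  show ?thesis
  proof (rule that[OF BJ(1,3) _ r(1), of h])
    show "B \<subseteq> \<phi> ` U" using BJ(4,5) S(3) by blast
    show "open_smooth (B \<times> {-r<..<r}) h"
      by (rule open_smooth_subset[OF S(1) _ sub]) (intro open_Times BJ open_greaterThanLessThan)
    show "\<forall>z\<in>U. \<phi> z \<in> B \<longrightarrow> (\<forall>t\<in>{-r<..<r}. \<Phi> t z \<in> U \<and> \<phi> (\<Phi> t z) = h (\<phi> z, t))"
      using S(4) sub by blast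
  qed
qed

text \<open>Dividing \<open>\<Phi>\<^sub>t - id\<close> by \<open>t\<close>.  At \<open>t = 0\<close> the quotient \<open>g\<close> is the section of \<open>H\<close> that generates the flow.\<close>

lemma flow_expansion:
  assumes \<Phi>: "parabolic_flow M H \<Phi>" and U: "(U, \<phi>) \<in> SM" "m \<in> U"
  obtains B r g where "open B" "\<phi> m \<in> B" "B \<subseteq> \<phi> ` U" "r > 0" "open_smooth (B \<times> {-r<..<r}) g"
    "\<forall>z\<in>U. \<phi> z \<in> B \<longrightarrow> (\<forall>t\<in>{-r<..<r}. \<Phi> t z \<in> U \<and> \<phi> (\<Phi> t z) = \<phi> z + t *\<^sub>R g (\<phi> z, t))"
    "\<forall>z\<in>U. \<phi> z \<in> B \<longrightarrow> smooth_curve M (\<lambda>t. \<Phi> t z) \<and> g (\<phi> z, 0) \<in> tcoord \<phi> ` H z"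
proof -
  obtain B r G where B: "open B" "\<phi> m \<in> B" "B \<subseteq> \<phi> ` U" "r > 0" and G: "open_smooth (B \<times> {-r<..<r}) G"
    and \<Phi>G: "\<forall>z\<in>U. \<phi> z \<in> B \<longrightarrow> (\<forall>t\<in>{-r<..<r}. \<Phi> t z \<in> U \<and> \<phi> (\<Phi> t z) = G (\<phi> z, t))"
    by (rule flow_coords[OF \<Phi> U])
  have UM: "U \<subseteq> points M" by (rule chart_points[OF U(1)])
  have \<Phi>0: "\<Phi> 0 z = z" "tangent_vector M (\<lambda>t. \<Phi> t z) \<in> H z" if "z \<in> U" for z
    using \<Phi> that UM by (auto simp: parabolic_flow_def)
  have o: "open (B \<times> {-r<..<r})" by (intro open_Times B open_greaterThanLessThan)
  have Gd: "open_smooth (B \<times> {-r<..<r}) (\<lambda>p. G p - fst p)"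
    by (intro open_smooth_diff G open_smooth_fst open_smooth_ident o)
  have G0: "\<forall>x\<in>B. G (x, 0) - fst (x, 0::real) = 0"
  proof
    fix x assume x: "x \<in> B"
    obtain z where z: "z \<in> U" "x = \<phi> z" using x B(3) by blast
    have "\<phi> (\<Phi> 0 z) = G (\<phi> z, 0)" using \<Phi>G z x B(4) by auto
    then show "G (x, 0) - fst (x, 0::real) = 0" using \<Phi>0(1)[OF z(1)] z by simp
  qed
  obtain g where g: "open_smooth (B \<times> {-r<..<r}) g"
    and gG: "\<forall>x\<in>B. \<forall>t\<in>{-r<..<r}. G (x, t) - fst (x, t) = t *\<^sub>R g (x, t)"
    by (rule open_smooth_divide_by_variable[OF Gd B(1) G0])
  have eq: "\<Phi> t z \<in> U \<and> \<phi> (\<Phi> t z) = \<phi> z + t *\<^sub>R g (\<phi> z, t)" if "z \<in> U" "\<phi> z \<in> B" "t \<in> {-r<..<r}" for z t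
  proof -
    have "G (\<phi> z, t) - \<phi> z = t *\<^sub>R g (\<phi> z, t)" using gG that(2,3) by auto
    moreover have "\<Phi> t z \<in> U \<and> \<phi> (\<Phi> t z) = G (\<phi> z, t)" using \<Phi>G that by blast
    ultimately show ?thesis by (simp add: algebra_simps)
  qed
  have curve: "smooth_curve M (\<lambda>t. \<Phi> t z) \<and> g (\<phi> z, 0) \<in> tcoord \<phi> ` H z" if z: "z \<in> U" "\<phi> z \<in> B" for z
  proof -
    have zero: "0 \<in> {-r<..<r}" using B(4) by simp
    have oi: "open {-r<..<r}" by simp
    have gz: "open_smooth {-r<..<r} (\<lambda>t. g (\<phi> z, t))"
      by (rule open_smooth_compose[OF _ g]) (use z in \<open>auto intro!: open_smooth_Pair open_smooth_const open_smooth_ident\<close>)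
    have p: "open_smooth {-r<..<r} (\<lambda>t. \<phi> z + t *\<^sub>R g (\<phi> z, t))"
      by (intro open_smooth_add open_smooth_const open_smooth_scaleR open_smooth_ident gz oi)
    have sn: "smooth_near UNIV line_chart (U, \<phi>) (\<lambda>t. \<Phi> t z) 0"
      by (rule smooth_nearI[OF _ p]) (use zero eq[OF z] in auto)
    have sc: "smooth_curve M (\<lambda>t. \<Phi> t z)" by (rule smooth_curveI[OF U(1) sn])
    obtain u w where uw: "has_jet (\<lambda>t. g (\<phi> z, t)) u w" using has_jet_smooth[OF gz zero] by blast
    have j1: "has_jet (\<lambda>t. \<phi> z + t *\<^sub>R g (\<phi> z, t)) (g (\<phi> z, 0)) (2 *\<^sub>R u)"
      using has_jet_add[OF has_jet_const has_jet_scaleR_variable[OF uw], of "\<phi> z"] by simp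
    have j: "has_jet (\<phi> \<circ> (\<lambda>t. \<Phi> t z)) (g (\<phi> z, 0)) (2 *\<^sub>R u)"
      by (rule has_jet_cong[OF j1 oi zero]) (use eq[OF z] in simp)
    have z0: "(\<lambda>t. \<Phi> t z) 0 \<in> U" using \<Phi>0 z by simp
    have "parabolic_curve M H (\<lambda>t. \<Phi> t z)" using sc \<Phi>0[OF z(1)] by (simp add: parabolic_curve_def)
    then have "velocity \<phi> (\<lambda>t. \<Phi> t z) \<in> tcoord \<phi> ` H z"
      using parabolic_curve_iff[where c = "\<lambda>t. \<Phi> t z", OF U(1) z0] \<Phi>0(1)[OF z(1)] by simp
    then show ?thesis using sc jet_velocity[OF j] by simp
  qed
  show ?thesis
  proof (rule that[OF B g]; intro ballI impI)
    fix z assume z: "z \<in> U" "\<phi> z \<in> B"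
    show "smooth_curve M (\<lambda>t. \<Phi> t z) \<and> g (\<phi> z, 0) \<in> tcoord \<phi> ` H z" by (rule curve[OF z])
    fix t assume "t \<in> {-r<..<r}"
    then show "\<Phi> t z \<in> U \<and> \<phi> (\<Phi> t z) = \<phi> z + t *\<^sub>R g (\<phi> z, t)" by (rule eq[OF z])
  qed
qed

text \<open>With \<open>\<Phi>\<^sub>t(x) = x + t g(x, t)\<close> in coordinates, the acceleration of \<open>\<Phi>\<^sub>t(\<Psi>\<^sub>t(m))\<close> exceeds the sum of the
  accelerations by twice the derivative of \<open>x \<mapsto> g(x, 0)\<close> at \<open>m\<close> in the direction of the velocity of \<open>\<Psi>\<close>.
  That vector field is a section of \<open>H\<close>, and by \<open>horizontal_derivative\<close> its derivative depends modulo \<open>H\<close> only on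
  its value at \<open>m\<close>; so it may be replaced by a field with constant components.\<close>

lemma flow_composition:
  assumes \<Phi>: "parabolic_flow M H \<Phi>" and \<Psi>: "parabolic_flow M H \<Psi>"
    and U: "(U, \<phi>) \<in> SM" "m \<in> U" and F: "adapted_frame I H (U, \<phi>) F"
    and a: "a \<in> horizontal I" "velocity \<phi> (\<lambda>t. \<Phi> t m) = frame_map (\<lambda>i. F i m) a"
  shows "parabolic_curve M H (\<lambda>t. \<Phi> t (\<Psi> t m))"
    "velocity \<phi> (\<lambda>t. \<Phi> t (\<Psi> t m)) = velocity \<phi> (\<lambda>t. \<Phi> t m) + velocity \<phi> (\<lambda>t. \<Psi> t m)"
    "acceleration \<phi> (\<lambda>t. \<Phi> t (\<Psi> t m)) - (acceleration \<phi> (\<lambda>t. \<Phi> t m) + acceleration \<phi> (\<lambda>t. \<Psi> t m)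
       + 2 *\<^sub>R frame_derivative U \<phi> F m a (velocity \<phi> (\<lambda>t. \<Psi> t m))) \<in> tcoord \<phi> ` H m"
proof -
  have mM: "m \<in> points M" using U chart_points by blast
  have \<Psi>0: "\<Psi> 0 m = m" and \<Phi>0: "\<Phi> 0 m = m" using \<Phi> \<Psi> mM by (auto simp: parabolic_flow_def)
  obtain B r g where B: "open B" "\<phi> m \<in> B" "B \<subseteq> \<phi> ` U" "r > 0" and g: "open_smooth (B \<times> {-r<..<r}) g"
    and gt: "\<forall>z\<in>U. \<phi> z \<in> B \<longrightarrow> (\<forall>t\<in>{-r<..<r}. \<Phi> t z \<in> U \<and> \<phi> (\<Phi> t z) = \<phi> z + t *\<^sub>R g (\<phi> z, t))"
    and gH: "\<forall>z\<in>U. \<phi> z \<in> B \<longrightarrow> smooth_curve M (\<lambda>t. \<Phi> t z) \<and> g (\<phi> z, 0) \<in> tcoord \<phi> ` H z"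
    by (rule flow_expansion[OF \<Phi> U])
  obtain B' r' g' where "open B'" and B': "\<phi> m \<in> B'" and "B' \<subseteq> \<phi> ` U" "r' > 0" "open_smooth (B' \<times> {-r'<..<r'}) g'"
    and "\<forall>z\<in>U. \<phi> z \<in> B' \<longrightarrow> (\<forall>t\<in>{-r'<..<r'}. \<Psi> t z \<in> U \<and> \<phi> (\<Psi> t z) = \<phi> z + t *\<^sub>R g' (\<phi> z, t))"
    and gH': "\<forall>z\<in>U. \<phi> z \<in> B' \<longrightarrow> smooth_curve M (\<lambda>t. \<Psi> t z) \<and> g' (\<phi> z, 0) \<in> tcoord \<phi> ` H z"
    by (rule flow_expansion[OF \<Psi> U])
  have sc\<Phi>: "smooth_curve M (\<lambda>t. \<Phi> t m)" using gH U B by blast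
  have sc: "smooth_curve M (\<lambda>t. \<Psi> t m)" using gH' U B' by blast
  have pc\<Psi>: "parabolic_curve M H (\<lambda>t. \<Psi> t m)" using sc \<Psi> mM by (simp add: parabolic_curve_def parabolic_flow_def)
  have zero: "0 \<in> {-r<..<r}" and oi: "open {-r<..<r}" using B(4) by auto
  have zg: "(\<phi> m, 0) \<in> B \<times> {-r<..<r}" using B zero by simp
  have U0: "(\<lambda>t. \<Psi> t m) 0 \<in> U" using \<Psi>0 U by simp
  obtain S p where S: "open_smooth S p" "0 \<in> S" "\<forall>t\<in>S. \<Psi> t m \<in> U \<and> \<phi> (\<Psi> t m) = p t"
    by (rule smooth_curve_coords[OF sc U(1) U0])
  have p0: "p 0 = \<phi> m" using S \<Psi>0 by auto
  define N where "N = {-r<..<r} \<inter> (S \<inter> p -` B)"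
  have oN: "open N" unfolding N_def using open_smooth_preimage[OF S(1) B(1)] oi by blast
  have N0: "0 \<in> N" using zero S B p0 by (simp add: N_def)
  have pN: "open_smooth N p" by (rule open_smooth_subset[OF S(1) oN]) (auto simp: N_def)
  have comp: "\<Phi> t (\<Psi> t m) \<in> U \<and> \<phi> (\<Phi> t (\<Psi> t m)) = p t + t *\<^sub>R g (p t, t)" if "t \<in> N" for t
    using that S(3) gt by (auto simp: N_def)
  have gN: "open_smooth N (\<lambda>t. g (p t, t))"
    by (rule open_smooth_compose[OF open_smooth_Pair[OF pN open_smooth_ident[OF oN]] g]) (auto simp: N_def)
  have "open_smooth N (\<lambda>t. p t + t *\<^sub>R g (p t, t))"
    by (intro open_smooth_add pN open_smooth_scaleR open_smooth_ident oN gN)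
  then have sn: "smooth_near UNIV line_chart (U, \<phi>) (\<lambda>t. \<Phi> t (\<Psi> t m)) 0"
    by (rule smooth_nearI[rotated]) (use N0 comp in auto)
  have sc2: "smooth_curve M (\<lambda>t. \<Phi> t (\<Psi> t m))" by (rule smooth_curveI[OF U(1) sn])
  define u2 where "u2 = velocity \<phi> (\<lambda>t. \<Psi> t m)"
  define w2 where "w2 = acceleration \<phi> (\<lambda>t. \<Psi> t m)"
  have "has_jet (\<phi> \<circ> (\<lambda>t. \<Psi> t m)) u2 w2" unfolding u2_def w2_def by (rule smooth_curve_jet[OF sc U(1) U0])
  then have jp: "has_jet p u2 w2"
    by (rule has_jet_cong[OF _ open_smooth_open[OF S(1)] S(2)]) (use S(3) in auto)
  define Dg where "Dg = frechet_derivative g (at (\<phi> m, 0))"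
  have dg: "(g has_derivative Dg) (at (\<phi> m, 0))" unfolding Dg_def by (rule open_smooth_has_derivative[OF g zg])
  have lin: "linear Dg" using dg has_derivative_linear by blast
  have jet_gen: "has_jet (\<lambda>t. q t + t *\<^sub>R g (q t, t)) (u + g (\<phi> m, 0)) (w + 2 *\<^sub>R Dg (u, 1))"
    if "has_jet q u w" "q 0 = \<phi> m" for q u w
  proof -
    have "has_jet (\<lambda>t. g ((\<lambda>t. (q t, t)) t)) (frechet_derivative g (at ((\<lambda>t. (q t, t)) 0)) (u, 1))
      (frechet_derivative g (at ((\<lambda>t. (q t, t)) 0)) (w, 0) + second_derivative g ((\<lambda>t. (q t, t)) 0) (u, 1))"
      by (rule has_jet_compose[OF g has_jet_Pair_ident[OF that(1)]]) (use zg that in simp)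
    then have "has_jet (\<lambda>t. g (q t, t)) (Dg (u, 1)) (Dg (w, 0) + second_derivative g (\<phi> m, 0) (u, 1))"
      using that(2) by (simp add: Dg_def)
    from has_jet_add[OF that(1) has_jet_scaleR_variable[OF this]] show ?thesis using that(2) by simp
  qed
  have j1: "has_jet (\<phi> \<circ> (\<lambda>t. \<Phi> t m)) (0 + g (\<phi> m, 0)) (0 + 2 *\<^sub>R Dg (0, 1))"
    by (rule has_jet_cong[OF jet_gen[OF has_jet_const refl] oi zero]) (use gt U B in auto)
  have j2: "has_jet (\<phi> \<circ> (\<lambda>t. \<Phi> t (\<Psi> t m))) (u2 + g (\<phi> m, 0)) (w2 + 2 *\<^sub>R Dg (u2, 1))"
    by (rule has_jet_cong[OF jet_gen[OF jp p0] oN N0]) (use comp in auto)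
  note v1 = jet_velocity[OF j1] and v2 = jet_velocity[OF j2]
  show vel: "velocity \<phi> (\<lambda>t. \<Phi> t (\<Psi> t m)) = velocity \<phi> (\<lambda>t. \<Phi> t m) + velocity \<phi> (\<lambda>t. \<Psi> t m)"
    using v1 v2 by (simp add: u2_def)
  have gmH: "g (\<phi> m, 0) \<in> tcoord \<phi> ` H m" using gH U B by blast
  have u2H: "u2 \<in> tcoord \<phi> ` H m"
    using parabolic_curve_iff[where c = "\<lambda>t. \<Psi> t m", OF U(1) U0] pc\<Psi> \<Psi>0 by (simp add: u2_def)
  have U00: "(\<lambda>t. \<Phi> t (\<Psi> t m)) 0 \<in> U" using \<Phi>0 \<Psi>0 U by simp
  show "parabolic_curve M H (\<lambda>t. \<Phi> t (\<Psi> t m))"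
    using parabolic_curve_iff[where c = "\<lambda>t. \<Phi> t (\<Psi> t m)", OF U(1) U00] sc2 v2 \<Phi>0 \<Psi>0
      subspace_add[OF subspace_H[OF U] u2H gmH] by simp
  define X where "X x = frame_map (\<lambda>i. F i (inv_into U \<phi> x)) a" for x
  have Xphi: "X (\<phi> z) = frame_map (\<lambda>i. F i z) a" if "z \<in> U" for z
    using that chart_inj[OF U(1)] by (simp add: X_def)
  have dX: "(X has_derivative frame_derivative U \<phi> F m a) (at (\<phi> m))"
    unfolding frame_derivative_def X_def
    by (rule open_smooth_has_derivative[OF frame_map_smooth[OF U(1) F]]) (use U in simp)
  have "((\<lambda>x. g (x, 0)) has_derivative (\<lambda>v. Dg (v, 0))) (at (\<phi> m))"
    by (rule has_derivative_compose[of "\<lambda>x. (x, 0)" "\<lambda>v. (v, 0)" "\<phi> m" UNIV g Dg])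
      (use dg in \<open>auto intro!: has_derivative_Pair\<close>)
  from has_derivative_diff[OF this dX]
  have "(\<lambda>v. Dg (v, 0) - frame_derivative U \<phi> F m a v) u2 \<in> tcoord \<phi> ` H m"
  proof (rule horizontal_derivative[OF U F _ _ B(1,2)])
    show "g (\<phi> m, 0) - X (\<phi> m) = 0" using a(2) v1 Xphi[OF U(2)] by simp
    fix z assume z: "z \<in> U" "\<phi> z \<in> B"
    have "X (\<phi> z) \<in> tcoord \<phi> ` H z" using Xphi[OF z(1)] frame_map_mem_H_iff[OF U(1) F z(1)] a(1) by simp
    moreover have "g (\<phi> z, 0) \<in> tcoord \<phi> ` H z" using gH z by blast
    ultimately show "g (\<phi> z, 0) - X (\<phi> z) \<in> tcoord \<phi> ` H z"
      using subspace_diff[OF subspace_H[OF U(1) z(1)]] by blast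
  qed
  then have "2 *\<^sub>R (Dg (u2, 0) - frame_derivative U \<phi> F m a u2) \<in> tcoord \<phi> ` H m"
    using subspace_scale[OF subspace_H[OF U]] by blast
  moreover have "Dg (u2, 1) = Dg (u2, 0) + Dg (0, 1)" using linear_add[OF lin, of "(u2, 0)" "(0, 1)"] by simp
  ultimately show "acceleration \<phi> (\<lambda>t. \<Phi> t (\<Psi> t m)) - (acceleration \<phi> (\<lambda>t. \<Phi> t m) + acceleration \<phi> (\<lambda>t. \<Psi> t m)
       + 2 *\<^sub>R frame_derivative U \<phi> F m a (velocity \<phi> (\<lambda>t. \<Psi> t m))) \<in> tcoord \<phi> ` H m"
    using v1 v2 by (simp add: u2_def[symmetric] w2_def[symmetric] algebra_simps)
qed

section \<open>Existence of parabolic flows\<close>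

lemma constant_parabolic: assumes "y \<in> points M" shows "parabolic_curve M H (\<lambda>t. y)"
proof -
  obtain U \<phi> where U: "(U, \<phi>) \<in> SM" "y \<in> U" by (rule chart_at[OF assms])
  have "smooth_near UNIV line_chart (U, \<phi>) (\<lambda>t. y) 0"
    by (rule smooth_nearI[OF _ open_smooth_const[OF open_UNIV, of "\<phi> y"]]) (use U in auto)
  then have sc: "smooth_curve M (\<lambda>t. y)" by (rule smooth_curveI[OF U(1)])
  have "has_jet (\<phi> \<circ> (\<lambda>t. y)) 0 0" using has_jet_const[of "\<phi> y"] by (simp add: o_def)
  then have "velocity \<phi> (\<lambda>t. y) = 0" by (rule jet_velocity[THEN conjunct1])
  then show ?thesis
    using parabolic_curve_iff[where c = "\<lambda>t. y", OF U] sc subspace_0[OF subspace_H[OF U]] by simp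
qed

lemma atlas_topology_SM: "atlas_topology UNIV SM = atlas_topology UNIV M"
  by (rule openin_atlas_extend[OF atlas_SM M_SM points_SM[symmetric], symmetric])

text \<open>Here the Hausdorff property of \<open>M\<close> enters: a compact subset of a chart domain is closed in \<open>M\<close>.\<close>

lemma closedin_chart_compact:
  assumes U: "(U, \<phi>) \<in> SM" and C: "compact C" "C \<subseteq> \<phi> ` U"
  shows "openin (atlas_topology UNIV M) (points M - inv_into U \<phi> ` C)"
proof -
  let ?T = "atlas_topology UNIV M"
  have "continuous_map (top_of_set (\<phi> ` U)) ?T (inv_into U \<phi>)"
    unfolding continuous_map_def
  proof (intro conjI allI impI)
    show "inv_into U \<phi> \<in> topspace (top_of_set (\<phi> ` U)) \<rightarrow> topspace ?T"
      using chart_points[OF U] by (auto simp: topspace_atlas[OF atlas_M] inv_into_into subset_iff)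
    fix T assume "openin ?T T"
    then have T: "openin (atlas_topology UNIV SM) T" by (simp add: atlas_topology_SM)
    obtain T' where T': "open T'" "snd (U, \<phi>) ` (fst (U, \<phi>) \<inter> T) = UNIV \<inter> T'"
      by (rule openin_chart_image[OF atlas_SM T U])
    have "{x \<in> topspace (top_of_set (\<phi> ` U)). inv_into U \<phi> x \<in> T} = \<phi> ` (U \<inter> T)"
      using chart_inj[OF U] by (auto simp: f_inv_into_f inv_into_into intro!: image_eqI)
    then have "{x \<in> topspace (top_of_set (\<phi> ` U)). inv_into U \<phi> x \<in> T} = \<phi> ` U \<inter> T'" using T'(2) by auto
    then show "openin (top_of_set (\<phi> ` U)) {x \<in> topspace (top_of_set (\<phi> ` U)). inv_into U \<phi> x \<in> T}"
      using T'(1) by auto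
  qed
  moreover have "compactin (top_of_set (\<phi> ` U)) C" using C by (simp add: compactin_subtopology)
  ultimately have "compactin ?T (inv_into U \<phi> ` C)" by (rule image_compactin[rotated])
  moreover have "Hausdorff_space ?T" using manifold by (simp add: smooth_manifold_def)
  ultimately have "closedin ?T (inv_into U \<phi> ` C)" by (rule compactin_imp_closedin[rotated])
  then show ?thesis by (simp add: closedin_def topspace_atlas[OF atlas_M])
qed

text \<open>Every second-order jet with velocity in \<open>H\<close> extends to a parabolic flow: move each point along a parabola in
  the coordinates, with a velocity that is a section of \<open>H\<close>, and cut off by a bump function, so that the flow is
  the identity outside a compact subset of the chart domain.\<close>

lemma flow_exists:
  assumes U: "(U, \<phi>) \<in> SM" "m \<in> U" and F: "adapted_frame I H (U, \<phi>) F" and u: "u \<in> tcoord \<phi> ` H m"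
  obtains \<Phi> where "parabolic_flow M H \<Phi>" "(\<lambda>t. \<Phi> t m) = quad_curve U \<phi> m u w"
proof -
  have oU: "open (\<phi> ` U)" and inj: "inj_on \<phi> U" using chart_image_open[OF U(1)] chart_inj[OF U(1)] .
  obtain r where r: "r > 0" "cball (\<phi> m) r \<subseteq> \<phi> ` U" using open_contains_cball oU U(2) by (metis imageI)
  obtain \<rho> :: "real ^ 'd \<Rightarrow> real" where \<rho>: "open_smooth UNIV \<rho>" "\<rho> (\<phi> m) = 1"
    and \<rho>0: "\<And>x. x \<notin> ball (\<phi> m) r \<Longrightarrow> \<rho> x = 0" by (fact bump_function[OF r(1)])
  obtain a where a: "a \<in> horizontal I" "u = frame_map (\<lambda>i. F i m) a"
    using u adapted_frameD(2)[OF U(1) F U(2)] by auto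
  define X where "X x = frame_map (\<lambda>i. F i (inv_into U \<phi> x)) a" for x
  have X: "open_smooth (\<phi> ` U) X" unfolding X_def by (rule frame_map_smooth[OF U(1) F])
  have Xphi: "X (\<phi> z) = frame_map (\<lambda>i. F i z) a" if "z \<in> U" for z using that inj by (simp add: X_def)
  \<comment> \<open>The cut-off factor multiplies the displacement, so it does not destroy tangency to \<open>H\<close> at \<open>t = 0\<close>.\<close>
  define E where "E p = fst p + snd p *\<^sub>R (\<rho> (fst p) *\<^sub>R X (fst p)) + ((snd p)\<^sup>2 / 2) *\<^sub>R (\<rho> (fst p) *\<^sub>R w)" for p
  define \<Phi> where "\<Phi> t y = (if y \<in> U then inv_into U \<phi> (E (\<phi> y, t)) else y)" for t y
  have quad: "\<Phi> t y = quad_curve U \<phi> y (\<rho> (\<phi> y) *\<^sub>R X (\<phi> y)) (\<rho> (\<phi> y) *\<^sub>R w) t" if "y \<in> U" for t y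
    using that by (simp add: \<Phi>_def E_def quad_curve_def)
  have oUU: "open (\<phi> ` U \<times> (UNIV :: real set))" using oU by (intro open_Times) auto
  have fstUU: "open_smooth (\<phi> ` U \<times> UNIV) (\<lambda>p :: (real ^ 'd) \<times> real. fst p)"
    by (intro open_smooth_fst open_smooth_ident oUU)
  have sndUU: "open_smooth (\<phi> ` U \<times> UNIV) (\<lambda>p :: (real ^ 'd) \<times> real. snd p)"
    by (intro open_smooth_snd open_smooth_ident oUU)
  have \<rho>UU: "open_smooth (\<phi> ` U \<times> UNIV) (\<lambda>p :: (real ^ 'd) \<times> real. \<rho> (fst p))"
    by (rule open_smooth_compose[OF fstUU \<rho>(1)]) simp
  have XUU: "open_smooth (\<phi> ` U \<times> UNIV) (\<lambda>p :: (real ^ 'd) \<times> real. X (fst p))"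
    by (rule open_smooth_compose[OF fstUU X]) auto
  have sq: "open_smooth (\<phi> ` U \<times> UNIV) (\<lambda>p :: (real ^ 'd) \<times> real. (snd p)\<^sup>2 / 2)"
    using open_smooth_mult[OF open_smooth_power[OF sndUU, of 2] open_smooth_const[OF oUU, of "1 / 2"]] by simp
  have E: "open_smooth (\<phi> ` U \<times> UNIV) E"
    unfolding E_def
    by (intro open_smooth_add open_smooth_scaleR fstUU sndUU \<rho>UU XUU sq open_smooth_const[OF oUU])
  define T where "T = (\<phi> ` U \<times> UNIV) \<inter> E -` (\<phi> ` U)"
  have oT: "open T" unfolding T_def by (rule open_smooth_preimage[OF E oU])
  have ET: "open_smooth T E" by (rule open_smooth_subset[OF E oT]) (simp add: T_def)
  define K where "K = inv_into U \<phi> ` cball (\<phi> m) r"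
  have oK: "openin (atlas_topology UNIV M) (points M - K)"
    unfolding K_def by (rule closedin_chart_compact[OF U(1) compact_cball r(2)])
  have KU: "K \<subseteq> U" using r(2) by (auto simp: K_def inv_into_into)
  have out: "\<Phi> t y = y \<and> (y \<in> U \<longrightarrow> E (\<phi> y, t) \<in> \<phi> ` U)" if y: "y \<notin> K" for t y
  proof (cases "y \<in> U")
    case True
    have "\<phi> y \<notin> ball (\<phi> m) r"
    proof
      assume "\<phi> y \<in> ball (\<phi> m) r"
      then have "inv_into U \<phi> (\<phi> y) \<in> K" by (auto simp: K_def)
      then show False using y True inj by simp
    qed
    then have "E (\<phi> y, t) = \<phi> y" using \<rho>0 by (simp add: E_def)
    then show ?thesis using True inj by (simp add: \<Phi>_def)
  qed (simp add: \<Phi>_def)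
  let ?A = "prod_atlas M (interval_atlas (UNIV :: real set))"
  let ?AS = "prod_atlas SM (interval_atlas (UNIV :: real set))"
  let ?f = "\<lambda>(m, t). \<Phi> t m"
  \<comment> \<open>The flow is smooth wherever the parabola has not left the chart image; outside \<open>K\<close> it never does.\<close>
  define D where "D = {(y, t). y \<in> points M \<and> (y \<in> U \<longrightarrow> E (\<phi> y, t) \<in> \<phi> ` U)}"
  have UM: "U \<subseteq> points M" by (rule chart_points[OF U(1)])
  have local: "\<exists>c\<in>?AS. \<exists>d\<in>SM. smooth_near UNIV c d ?f p \<and> chart_nbhd c D p" if "p \<in> D" for p
  proof -
    obtain y t where p: "p = (y, t)" by fastforce
    have y: "y \<in> points M" "y \<in> U \<Longrightarrow> E (\<phi> y, t) \<in> \<phi> ` U" using that p by (auto simp: D_def)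
    show ?thesis
    proof (cases "y \<in> U")
      case True
      let ?c = "(U \<times> UNIV, map_prod \<phi> (\<lambda>t::real. t))"
      have "smooth_near UNIV ?c (U, \<phi>) ?f p"
      proof (rule smooth_nearI[OF _ ET])
        show "?f z \<in> fst (U, \<phi>) \<and> snd (U, \<phi>) (?f z) = E (snd ?c z)"
          if "z \<in> fst ?c" "snd ?c z \<in> T" for z
          using that by (auto simp: T_def \<Phi>_def inv_into_into f_inv_into_f)
      qed (use True y p in \<open>auto simp: T_def map_prod_image\<close>)
      moreover have "chart_nbhd ?c D p"
        unfolding chart_nbhd_def
        by (intro conjI exI[of _ T]) (use True y p oT UM in \<open>auto simp: T_def D_def\<close>)
      ultimately show ?thesis using prod_line_chart[OF U(1)] U(1) by blast
    next
      case False
      then have yK: "y \<in> points M - K" using KU y by blast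
      obtain c0 where c0: "c0 \<in> M" "chart_nbhd c0 (points M - K) y"
        using oK yK openin_atlas_iff(1)[OF atlas_M] by blast
      obtain T0 where T0: "y \<in> fst c0" "open T0" "snd c0 y \<in> T0"
        "\<forall>z\<in>fst c0. snd c0 z \<in> T0 \<longrightarrow> z \<in> points M - K" using c0(2) unfolding chart_nbhd_def by blast
      have oc: "open (snd c0 ` fst c0)" using smooth_atlasD(1)[OF atlas_M c0(1)] by (simp add: is_chart_simps)
      let ?S = "(snd c0 ` fst c0 \<inter> T0) \<times> (UNIV :: real set)"
      have oS: "open ?S" using oc T0(2) by (intro open_Times) auto
      let ?c = "(fst c0 \<times> UNIV, map_prod (snd c0) (\<lambda>t::real. t))"
      have "smooth_near UNIV ?c c0 ?f p"
      proof (rule smooth_nearI[OF _ open_smooth_fst[OF open_smooth_ident[OF oS]]])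
        show "?f z \<in> fst c0 \<and> snd c0 (?f z) = fst (snd ?c z)" if z: "z \<in> fst ?c" "snd ?c z \<in> ?S" for z
        proof -
          obtain q s where q: "z = (q, s)" by fastforce
          have "q \<notin> K" using T0(4) z q by auto
          from out[OF this, of s] show ?thesis using z q by auto
        qed
      qed (use T0 p in \<open>auto simp: map_prod_image\<close>)
      moreover have "chart_nbhd ?c D p"
        unfolding chart_nbhd_def
      proof (intro conjI exI[of _ ?S] ballI impI oS)
        show "p \<in> fst ?c" "snd ?c p \<in> ?S" using T0 p by auto
        fix z assume z: "z \<in> fst ?c" "snd ?c z \<in> ?S"
        obtain q s where q: "z = (q, s)" by fastforce
        have qK: "q \<in> points M - K" using T0(4) z q by auto
        then show "z \<in> D" using out[of q s] q by (simp add: D_def)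
      qed
      moreover have "?c \<in> ?AS"
        using prod_line_chart[of "fst c0" "snd c0" SM] c0(1) M_SM by auto
      ultimately show ?thesis using c0(1) M_SM by blast
    qed
  qed
  have ptsA: "points ?A = points ?AS" by (simp add: points_prod_atlas points_SM)
  have oD: "openin (atlas_topology UNIV ?A) D"
    unfolding openin_atlas_extend[OF prod_line_atlas prod_line_atlas_mono ptsA]
      openin_atlas_iff(1)[OF prod_line_atlas] using local by blast
  have sm: "smooth_map UNIV (sub_atlas ?A D) UNIV M ?f"
    unfolding smooth_map_iff(1)[OF smooth_atlas_sub_atlas[OF prod_line_atlas_M oD] atlas_M] Bex_sub_atlas
  proof
    fix p assume "p \<in> points (sub_atlas ?A D)"
    then have pA: "p \<in> points ?A" and pD: "p \<in> D" by (auto simp: points_sub_atlas)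
    obtain c d where cd: "c \<in> ?AS" "d \<in> SM" "smooth_near UNIV c d ?f p" using local[OF pD] by blast
    obtain a where a: "a \<in> ?A" "p \<in> fst a" using pA unfolding points_iff by blast
    have "?f p \<in> points SM" using cd smooth_near_mem[OF cd(3)] unfolding points_iff by blast
    then have "?f p \<in> points M" by (simp add: points_SM)
    then obtain b where b: "b \<in> M" "?f p \<in> fst b" unfolding points_iff by blast
    have "smooth_near UNIV a b ?f p"
      by (rule smooth_near_change_charts[OF prod_line_atlas atlas_SM cd(3) cd(1,2)
          subsetD[OF prod_line_atlas_mono a(1)] subsetD[OF M_SM b(1)] a(2) b(2)])
    then have "smooth_near UNIV (fst a \<inter> D, snd a) b ?f p"
      using smooth_near_restrict_source[OF prod_line_atlas_M oD a(1) pD] by blast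
    then show "\<exists>a\<in>?A. \<exists>d\<in>M. smooth_near UNIV (fst a \<inter> D, snd a) d ?f p" using a(1) b(1) by blast
  qed
  have par: "\<Phi> 0 y = y \<and> tangent_vector M (\<lambda>t. \<Phi> t y) \<in> H y" if y: "y \<in> points M" for y
  proof (cases "y \<in> U")
    case True
    have e: "(\<lambda>t. \<Phi> t y) = quad_curve U \<phi> y (\<rho> (\<phi> y) *\<^sub>R X (\<phi> y)) (\<rho> (\<phi> y) *\<^sub>R w)"
      using quad[OF True] by blast
    have "X (\<phi> y) \<in> tcoord \<phi> ` H y" using Xphi[OF True] frame_map_mem_H_iff[OF U(1) F True] a(1) by simp
    then have "parabolic_curve M H (\<lambda>t. \<Phi> t y)"
      unfolding e by (intro quad_curve_parabolic U(1) True subspace_scale[OF subspace_H[OF U(1) True]])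
    moreover have "\<Phi> 0 y = y" using quad_curve(2)[OF U(1) True] quad[OF True] by simp
    ultimately show ?thesis by (simp add: parabolic_curve_def)
  next
    case False
    then have "(\<lambda>t. \<Phi> t y) = (\<lambda>t. y)" by (simp add: \<Phi>_def)
    then show ?thesis using constant_parabolic[OF y] by (simp add: parabolic_curve_def fun_eq_iff)
  qed
  have D0: "points M \<times> {0} \<subseteq> D" by (auto simp: D_def E_def)
  show ?thesis
  proof (rule that[of \<Phi>])
    show "parabolic_flow M H \<Phi>"
      unfolding parabolic_flow_def Let_def using oD D0 sm par by blast
    show "(\<lambda>t. \<Phi> t m) = quad_curve U \<phi> m u w"
      using quad[OF U(2)] \<rho>(2) Xphi[OF U(2)] a(2) by (simp add: fun_eq_iff)
  qed
qed

text \<open>By \<open>flow_composition\<close> the arrow of the composite depends only on the arrows of the two flows, so the description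
  that defines the product is satisfied by exactly one arrow; flows representing the factors exist by
  \<open>flow_exists\<close>.\<close>

lemma arrow_mult_coord_arrow:
  assumes U: "(U, \<phi>) \<in> SM" "m \<in> U" and F: "adapted_frame I H (U, \<phi>) F"
    and a: "a \<in> horizontal I" and u2: "u2 \<in> tcoord \<phi> ` H m"
  shows "arrow_mult M I H m (coord_arrow U \<phi> m (frame_map (\<lambda>i. F i m) a) w1) (coord_arrow U \<phi> m u2 w2) =
    coord_arrow U \<phi> m (frame_map (\<lambda>i. F i m) a + u2) (w1 + w2 + 2 *\<^sub>R frame_derivative U \<phi> F m a u2)"
proof -
  let ?u1 = "frame_map (\<lambda>i. F i m) a"
  let ?v = "coord_arrow U \<phi> m ?u1 w1" and ?w = "coord_arrow U \<phi> m u2 w2"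
  let ?R = "coord_arrow U \<phi> m (?u1 + u2) (w1 + w2 + 2 *\<^sub>R frame_derivative U \<phi> F m a u2)"
  have mM: "m \<in> points M" using U chart_points by blast
  note sub = subspace_H[OF U]
  have u1: "?u1 \<in> tcoord \<phi> ` H m" using frame_map_mem_H_iff[OF U(1) F U(2)] a by simp
  have u12: "?u1 + u2 \<in> tcoord \<phi> ` H m" by (rule subspace_add[OF sub u1 u2])
  have main: "arrow M I H (\<lambda>t. \<Phi> t (\<Psi> t m)) = ?R"
    if \<Phi>: "parabolic_flow M H \<Phi>" and \<Psi>: "parabolic_flow M H \<Psi>"
      and v: "?v = arrow M I H (\<lambda>t. \<Phi> t m)" and w: "?w = arrow M I H (\<lambda>t. \<Psi> t m)" for \<Phi> \<Psi>
  proof -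
    have 0: "\<Phi> 0 m = m" "\<Psi> 0 m = m" and p: "parabolic_flow M H \<Theta> \<Longrightarrow> tangent_vector M (\<lambda>t. \<Theta> t m) \<in> H m" for \<Theta>
      using \<Phi> \<Psi> mM by (auto simp: parabolic_flow_def)
    have pc: "parabolic_curve M H (\<lambda>t. \<Theta> t m)" if \<Theta>: "parabolic_flow M H \<Theta>" for \<Theta>
    proof -
      have t0: "\<Theta> 0 m = m" using \<Theta> mM by (auto simp: parabolic_flow_def)
      obtain B r g where "open B" "\<phi> m \<in> B" and "B \<subseteq> \<phi> ` U" "r > 0" "open_smooth (B \<times> {-r<..<r}) g"
        and "\<forall>z\<in>U. \<phi> z \<in> B \<longrightarrow> (\<forall>t\<in>{-r<..<r}. \<Theta> t z \<in> U \<and> \<phi> (\<Theta> t z) = \<phi> z + t *\<^sub>R g (\<phi> z, t))"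
        and "\<forall>z\<in>U. \<phi> z \<in> B \<longrightarrow> smooth_curve M (\<lambda>t. \<Theta> t z) \<and> g (\<phi> z, 0) \<in> tcoord \<phi> ` H z"
        by (rule flow_expansion[OF \<Theta> U])
      then have "smooth_curve M (\<lambda>t. \<Theta> t m)" using U(2) by blast
      then show ?thesis using p[OF \<Theta>] t0 by (simp add: parabolic_curve_def)
    qed
    have e1: "arrow M I H (\<lambda>t. \<Phi> t m) = coord_arrow U \<phi> m (velocity \<phi> (\<lambda>t. \<Phi> t m)) (acceleration \<phi> (\<lambda>t. \<Phi> t m))"
      "velocity \<phi> (\<lambda>t. \<Phi> t m) \<in> tcoord \<phi> ` H m"
      using arrow_eq_coord_arrow[where c = "\<lambda>t. \<Phi> t m", OF U(1) 0(1) U(2) pc[OF \<Phi>]] by auto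
    have e2: "arrow M I H (\<lambda>t. \<Psi> t m) = coord_arrow U \<phi> m (velocity \<phi> (\<lambda>t. \<Psi> t m)) (acceleration \<phi> (\<lambda>t. \<Psi> t m))"
      "velocity \<phi> (\<lambda>t. \<Psi> t m) \<in> tcoord \<phi> ` H m"
      using arrow_eq_coord_arrow[where c = "\<lambda>t. \<Psi> t m", OF U(1) 0(2) U(2) pc[OF \<Psi>]] by auto
    have v1: "?u1 = velocity \<phi> (\<lambda>t. \<Phi> t m)" "w1 - acceleration \<phi> (\<lambda>t. \<Phi> t m) \<in> tcoord \<phi> ` H m"
      using v e1 coord_arrow_eq_iff[OF U u1 e1(2)] by auto
    have v2: "u2 = velocity \<phi> (\<lambda>t. \<Psi> t m)" "w2 - acceleration \<phi> (\<lambda>t. \<Psi> t m) \<in> tcoord \<phi> ` H m"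
      using w e2 coord_arrow_eq_iff[OF U u2 e2(2)] by auto
    note fc = flow_composition[OF \<Phi> \<Psi> U F a v1(1)[symmetric]]
    have e3: "arrow M I H (\<lambda>t. \<Phi> t (\<Psi> t m)) = coord_arrow U \<phi> m (?u1 + u2) (acceleration \<phi> (\<lambda>t. \<Phi> t (\<Psi> t m)))"
      using arrow_eq_coord_arrow(1)[where c = "\<lambda>t. \<Phi> t (\<Psi> t m)", OF U(1) _ U(2) fc(1)] fc(2) 0 v1(1) v2(1) by simp
    have "acceleration \<phi> (\<lambda>t. \<Phi> t (\<Psi> t m)) - (w1 + w2 + 2 *\<^sub>R frame_derivative U \<phi> F m a u2) =
      (acceleration \<phi> (\<lambda>t. \<Phi> t (\<Psi> t m)) - (acceleration \<phi> (\<lambda>t. \<Phi> t m) + acceleration \<phi> (\<lambda>t. \<Psi> t m)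
       + 2 *\<^sub>R frame_derivative U \<phi> F m a (velocity \<phi> (\<lambda>t. \<Psi> t m))))
      - ((w1 - acceleration \<phi> (\<lambda>t. \<Phi> t m)) + (w2 - acceleration \<phi> (\<lambda>t. \<Psi> t m)))"
      using v2(1) by (simp add: algebra_simps)
    also have "\<dots> \<in> tcoord \<phi> ` H m"
      by (intro subspace_diff[OF sub] subspace_add[OF sub] fc(3) v1(2) v2(2))
    finally show ?thesis using e3 coord_arrow_eq_iff[OF U u12 u12] by simp
  qed
  obtain \<Phi> where \<Phi>: "parabolic_flow M H \<Phi>" "(\<lambda>t. \<Phi> t m) = quad_curve U \<phi> m ?u1 w1"
    by (rule flow_exists[OF U F u1])
  obtain \<Psi> where \<Psi>: "parabolic_flow M H \<Psi>" "(\<lambda>t. \<Psi> t m) = quad_curve U \<phi> m u2 w2"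
    by (rule flow_exists[OF U F u2])
  have ev: "?v = arrow M I H (\<lambda>t. \<Phi> t m)" "?w = arrow M I H (\<lambda>t. \<Psi> t m)"
    using \<Phi>(2) \<Psi>(2) by (simp_all add: coord_arrow_def)
  show ?thesis unfolding arrow_mult_def
  proof (rule the_equality)
    show "\<exists>\<Phi> \<Psi>. parabolic_flow M H \<Phi> \<and> parabolic_flow M H \<Psi> \<and> ?v = arrow M I H (\<lambda>t. \<Phi> t m) \<and>
      ?w = arrow M I H (\<lambda>t. \<Psi> t m) \<and> ?R = arrow M I H (\<lambda>t. \<Phi> t (\<Psi> t m))"
      using \<Phi>(1) \<Psi>(1) ev main[OF \<Phi>(1) \<Psi>(1) ev] by (intro exI[of _ \<Phi>] exI[of _ \<Psi>]) simp
    fix x assume "\<exists>\<Phi> \<Psi>. parabolic_flow M H \<Phi> \<and> parabolic_flow M H \<Psi> \<and> ?v = arrow M I H (\<lambda>t. \<Phi> t m) \<and>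
      ?w = arrow M I H (\<lambda>t. \<Psi> t m) \<and> x = arrow M I H (\<lambda>t. \<Phi> t (\<Psi> t m))"
    then obtain \<Phi>' \<Psi>' where "parabolic_flow M H \<Phi>'" "parabolic_flow M H \<Psi>'" "?v = arrow M I H (\<lambda>t. \<Phi>' t m)"
      "?w = arrow M I H (\<lambda>t. \<Psi>' t m)" "x = arrow M I H (\<lambda>t. \<Phi>' t (\<Psi>' t m))" by (elim exE conjE)
    then show "x = ?R" using main by simp
  qed
qed

section \<open>Linear coordinates on the Lie algebra\<close>

text \<open>An element of \<open>N\<^sub>m\<close> as a coset of \<open>H\<^sub>m\<close>, in an arbitrary chart.\<close>

lemma normal_spaceE:
  assumes Y: "Y \<in> normal_space M H m" and U: "(U, \<phi>) \<in> SM" "m \<in> U"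
  obtains Z0 where "Z0 \<in> tangent_space M m"
    "Y = {Z \<in> tangent_space M m. tcoord \<phi> Z0 - tcoord \<phi> Z \<in> tcoord \<phi> ` H m}"
proof -
  have eq: "tcoord \<theta> Z0 - tcoord \<theta> Z \<in> tcoord \<theta> ` H m \<longleftrightarrow> tcoord \<phi> Z0 - tcoord \<phi> Z \<in> tcoord \<phi> ` H m"
    if Z: "Z0 \<in> tangent_space M m" "Z \<in> tangent_space M m" and V: "(V, \<theta>) \<in> SM" "m \<in> V" for Z0 Z V \<theta>
  proof -
    obtain L Q where L: "jet_change m \<phi> \<theta> L Q" by (rule change_of_chart[OF U(1) V(1) U(2) V(2)])
    have "tcoord \<theta> Z0 - tcoord \<theta> Z = L (tcoord \<phi> Z0 - tcoord \<phi> Z)"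
      using tcoord_change[OF U(1) V(1) U(2) V(2) L] Z by (simp add: linear_diff[OF jet_changeD(1)[OF L]])
    then show ?thesis
      using tcoord_H_change[OF U(1) V(1) U(2) V(2) L] jet_change_inj[OF U(1) V(1) U(2) V(2) L]
      by (simp add: inj_image_mem_iff)
  qed
  have "m \<in> points M" using U chart_points by blast
  then obtain a where a: "a \<in> M" "m \<in> fst a" unfolding points_iff by blast
  obtain Z0 where Z0: "Z0 \<in> tangent_space M m"
    "Y = {(X, Y). X \<in> tangent_space M m \<and> Y \<in> tangent_space M m \<and>
        (\<exists>(U, \<phi>)\<in>M. m \<in> U \<and> tcoord \<phi> X - tcoord \<phi> Y \<in> tcoord \<phi> ` H m)} `` {Z0}"
    using Y unfolding normal_space_def quotient_def by blast
  have iff: "(\<exists>(V, \<theta>)\<in>M. m \<in> V \<and> tcoord \<theta> Z0 - tcoord \<theta> Z \<in> tcoord \<theta> ` H m) \<longleftrightarrow>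
      tcoord \<phi> Z0 - tcoord \<phi> Z \<in> tcoord \<phi> ` H m" if Z: "Z \<in> tangent_space M m" for Z
  proof
    assume "\<exists>(V, \<theta>)\<in>M. m \<in> V \<and> tcoord \<theta> Z0 - tcoord \<theta> Z \<in> tcoord \<theta> ` H m"
    then obtain V \<theta> where "(V, \<theta>) \<in> M" "m \<in> V" "tcoord \<theta> Z0 - tcoord \<theta> Z \<in> tcoord \<theta> ` H m" by blast
    then show "tcoord \<phi> Z0 - tcoord \<phi> Z \<in> tcoord \<phi> ` H m" using eq[OF Z0(1) Z] M_SM by blast
  next
    assume h: "tcoord \<phi> Z0 - tcoord \<phi> Z \<in> tcoord \<phi> ` H m"
    have "tcoord (snd a) Z0 - tcoord (snd a) Z \<in> tcoord (snd a) ` H m"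
      using eq[OF Z0(1) Z, of "fst a" "snd a"] a M_SM h by auto
    then show "\<exists>(V, \<theta>)\<in>M. m \<in> V \<and> tcoord \<theta> Z0 - tcoord \<theta> Z \<in> tcoord \<theta> ` H m"
      using a by (intro bexI[of _ a]) (auto simp: case_prod_unfold)
  qed
  have "Y = {Z. Z \<in> tangent_space M m \<and>
      (\<exists>(V, \<theta>)\<in>M. m \<in> V \<and> tcoord \<theta> Z0 - tcoord \<theta> Z \<in> tcoord \<theta> ` H m)}"
    unfolding Z0(2) using Z0(1) by (simp add: Image_singleton)
  also have "\<dots> = {Z. Z \<in> tangent_space M m \<and> tcoord \<phi> Z0 - tcoord \<phi> Z \<in> tcoord \<phi> ` H m}"
    by (rule Collect_cong, rule conj_cong[OF refl iff])
  finally have "Y = {Z \<in> tangent_space M m. tcoord \<phi> Z0 - tcoord \<phi> Z \<in> tcoord \<phi> ` H m}" .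
  with Z0(1) show ?thesis by (rule that)
qed

lemma HN_coord_iff:
  assumes U: "(U, \<phi>) \<in> SM" "m \<in> U" and b: "inj (frame_map b)" "tcoord \<phi> ` H m = frame_map b ` horizontal I"
    and X: "X \<in> H m" and Y: "Y \<in> normal_space M H m"
  shows "HN_coord I \<phi> b (X, Y) = a \<longleftrightarrow> tcoord \<phi> X = frame_map b (hor_part I a) \<and>
    (\<exists>Z\<in>Y. tcoord \<phi> Z = frame_map b (hor_part (- I) a))"
proof -
  define P where "P a \<longleftrightarrow> tcoord \<phi> X = frame_map b (hor_part I a) \<and>
    (\<exists>Z\<in>Y. tcoord \<phi> Z = frame_map b (hor_part (- I) a))" for a
  obtain Z0 where Z0: "Z0 \<in> tangent_space M m"
    "Y = {Z \<in> tangent_space M m. tcoord \<phi> Z0 - tcoord \<phi> Z \<in> tcoord \<phi> ` H m}" by (rule normal_spaceE[OF Y U])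
  note lin = linear_frame_map[of b]
  obtain ah where ah: "ah \<in> horizontal I" "tcoord \<phi> X = frame_map b ah" using X b(2) by blast
  obtain z where z: "tcoord \<phi> Z0 = frame_map b z"
    using inverse_linear(2)[OF lin b(1), of "tcoord \<phi> Z0"] by metis
  obtain Z where Z: "Z \<in> tangent_space M m" "tcoord \<phi> Z = frame_map b (hor_part (- I) z)"
    by (rule tcoord_surj[OF U])
  have "tcoord \<phi> Z0 - tcoord \<phi> Z = frame_map b (hor_part I z)"
    unfolding z Z(2) using linear_diff[OF lin] hor_part_split[of I z] by (metis add_diff_cancel_right')
  then have "tcoord \<phi> Z0 - tcoord \<phi> Z \<in> tcoord \<phi> ` H m"
    unfolding b(2) using imageI[OF hor_part_in_horizontal] by simp
  then have "Z \<in> Y" using Z0(2) Z(1) by simp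
  moreover have "hor_part I (ah + hor_part (- I) z) = ah" "hor_part (- I) (ah + hor_part (- I) z) = hor_part (- I) z"
    using ah(1) by (auto simp: vec_eq_iff horizontal_iff)
  ultimately have ex: "P (ah + hor_part (- I) z)" using ah Z(2) unfolding P_def by auto
  have un: "a = a'" if Pa: "P a" "P a'" for a a'
  proof -
    have h: "hor_part I a = hor_part I a'" using Pa b(1) unfolding P_def by (metis injD)
    obtain Z1 Z2 where Z12: "Z1 \<in> Y" "tcoord \<phi> Z1 = frame_map b (hor_part (- I) a)"
       "Z2 \<in> Y" "tcoord \<phi> Z2 = frame_map b (hor_part (- I) a')" using Pa unfolding P_def by blast
    have "(tcoord \<phi> Z0 - tcoord \<phi> Z2) - (tcoord \<phi> Z0 - tcoord \<phi> Z1) \<in> tcoord \<phi> ` H m"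
      by (rule subspace_diff[OF subspace_H[OF U]]) (use Z12 Z0(2) in auto)
    then have "frame_map b (hor_part (- I) a - hor_part (- I) a') \<in> frame_map b ` horizontal I"
      using Z12 b(2) by (simp add: linear_diff[OF lin])
    then have "hor_part (- I) a - hor_part (- I) a' \<in> horizontal I" using b(1) by (simp add: inj_image_mem_iff)
    then have "hor_part (- I) a = hor_part (- I) a'"
      by (auto simp: horizontal_iff vec_eq_iff)
    then show ?thesis using h hor_part_split by metis
  qed
  have "HN_coord I \<phi> b (X, Y) = (THE a. P a)"
    unfolding HN_coord_def P_def frame_map_hor_part by simp
  moreover have "P (THE a. P a)" by (rule theI[where P = P, OF ex]) (use un ex in blast)
  ultimately show ?thesis using un unfolding P_def[symmetric] by metis
qed

lemma HN_coord_H_chart_iff: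
  assumes h: "H_chart M I H m (U, \<phi>)" and X: "X \<in> H m" and Y: "Y \<in> normal_space M H m"
  shows "HN_coord I \<phi> (\<lambda>i. axis i 1) (X, Y) = a \<longleftrightarrow> tcoord \<phi> X = hor_part I a \<and>
    (\<exists>Z\<in>Y. tcoord \<phi> Z = hor_part (- I) a)"
  using HN_coord_iff[of U \<phi> m "\<lambda>i. axis i 1", OF _ _ _ _ X Y] H_chartD[OF h]
  by (simp add: frame_map_axis_id inj_on_def)

section \<open>The Lie exponential\<close>

lemma coord_arrow_restrict:
  assumes "(U, \<phi>) \<in> SM" "(V, \<phi>) \<in> SM" "m \<in> U" "m \<in> V" "u \<in> tcoord \<phi> ` H m"
  shows "coord_arrow U \<phi> m u w = coord_arrow V \<phi> m u w"
proof -
  note q = quad_curve[OF assms(1,3), of u w] and p = quad_curve_parabolic[OF assms(1,3,5), of w]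
  show ?thesis using arrow_eq_coord_arrow(1)[OF assms(2) q(2) assms(4) p] q(4,5) by (simp add: coord_arrow_def)
qed

definition one_parameter_subgroup ::
  "'m \<Rightarrow> 'm set \<times> ('m \<Rightarrow> real ^ 'd) \<Rightarrow> (real \<Rightarrow> 'm arrow) \<Rightarrow> real ^ 'd \<Rightarrow> bool" where
  "one_parameter_subgroup m c \<gamma> p \<longleftrightarrow> (\<forall>s. \<gamma> s \<in> THM_at M I H m) \<and>
     (\<forall>s t. \<gamma> (s + t) = arrow_mult M I H m (\<gamma> s) (\<gamma> t)) \<and>
     smooth_on UNIV (taylor_coord M I H c \<circ> \<gamma>) \<and> vector_derivative (taylor_coord M I H c \<circ> \<gamma>) (at 0) = p"

text \<open>Let \<open>x\<close> and \<open>y\<close> be the horizontal and the normal part of the Taylor coordinates along the subgroup.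
  By the group law \<open>x\<close> is additive, hence linear, and \<open>y(s + t) = y(s) + y(t) + s t b\<close> with a constant vector
  \<open>b\<close>, the normal part of \<open>\<beta>\<close> below; so \<open>y(s) - s\<^sup>2 b / 2\<close> is additive and thus linear as well.  Their derivatives at \<open>0\<close> are prescribed.\<close>

lemma one_parameter_subgroup_unique:
  assumes h: "H_chart M I H m (U, \<phi>)" and g: "one_parameter_subgroup m (U, \<phi>) \<gamma> p"
    and g': "one_parameter_subgroup m (U, \<phi>) \<gamma>' p"
  shows "\<gamma> 1 = \<gamma>' 1"
proof -
  have U: "(U, \<phi>) \<in> SM" "m \<in> U" "tcoord \<phi> ` H m = horizontal I" using H_chartD[OF h] by auto
  obtain T F where T: "open T" "\<phi> m \<in> T" "T \<subseteq> \<phi> ` U" "adapted_frame I H ({z \<in> U. \<phi> z \<in> T}, \<phi>) F"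
    by (rule adapted_frame_exists[OF U(1,2)])
  let ?V = "{z \<in> U. \<phi> z \<in> T}"
  have V: "(?V, \<phi>) \<in> SM" "m \<in> ?V" using restrict_chart[OF U(1) T(1)] U(2) T(2) by auto
  let ?B = "frame_map (\<lambda>i. F i m)"
  have hh: "hor_part I x \<in> tcoord \<phi> ` H m" for x using U(3) hor_part_in_horizontal by simp
  obtain a0 where a0: "a0 \<in> horizontal I" "hor_part I p = ?B a0"
    using hh[of p] adapted_frameD(2)[OF V(1) T(4) V(2)] by auto
  define \<beta> where "\<beta> = frame_derivative ?V \<phi> F m a0 (hor_part I p)"
  have main: "\<gamma> 1 = coord_arrow ?V \<phi> m (hor_part I p) (2 *\<^sub>R hor_part (- I) p + hor_part (- I) \<beta>)"
    if g: "one_parameter_subgroup m (U, \<phi>) \<gamma> p" for \<gamma>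
  proof -
    define \<tau> where "\<tau> s = taylor_coord M I H (U, \<phi>) (\<gamma> s)" for s
    define x where "x s = hor_part I (\<tau> s)" for s
    define y where "y s = hor_part (- I) (\<tau> s)" for s
    have "smooth_on UNIV \<tau>" and dp: "vector_derivative \<tau> (at 0) = p"
      using g by (auto simp: one_parameter_subgroup_def \<tau>_def[abs_def] o_def)
    then have "open_smooth UNIV \<tau>" by (simp add: smooth_on_open_iff)
    then have "(\<tau> has_derivative frechet_derivative \<tau> (at 0)) (at 0)" by (rule open_smooth_has_derivative) simp
    then have d: "(\<tau> has_vector_derivative p) (at 0)"
      using dp vector_derivative_works differentiable_def by metis
    have dx: "(x has_vector_derivative hor_part I p) (at 0)"
      unfolding x_def by (rule bounded_linear.has_vector_derivative[OF bounded_linear_hor_part d])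
    have dy: "(y has_vector_derivative hor_part (- I) p) (at 0)"
      unfolding y_def by (rule bounded_linear.has_vector_derivative[OF bounded_linear_hor_part d])
    have xH: "x s \<in> tcoord \<phi> ` H m" for s using hh by (simp add: x_def)
    have \<gamma>: "\<gamma> s = coord_arrow ?V \<phi> m (x s) (2 *\<^sub>R y s)" for s
    proof -
      have "\<gamma> s \<in> THM_at M I H m" using g by (simp add: one_parameter_subgroup_def)
      from this[unfolded THM_at_iff[OF U(1,2)]]
      obtain u w where u: "u \<in> tcoord \<phi> ` H m" "\<gamma> s = coord_arrow U \<phi> m u w" by (elim bexE exE)
      have uh: "u \<in> horizontal I" using u(1) U(3) by simp
      have t: "\<tau> s = u + (1 / 2) *\<^sub>R hor_part (- I) w"
        unfolding \<tau>_def u(2) by (rule taylor_coord_coord_arrow[OF h uh])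
      have "x s = u" unfolding x_def t using uh by (auto simp: vec_eq_iff horizontal_iff)
      moreover have "w - 2 *\<^sub>R y s \<in> horizontal I" unfolding y_def t using uh by (auto simp: horizontal_iff)
      ultimately have "\<gamma> s = coord_arrow U \<phi> m (x s) (2 *\<^sub>R y s)"
        using coord_arrow_eq_iff[OF U(1,2) u(1) u(1)] u(2) U(3) by simp
      then show ?thesis using coord_arrow_restrict[OF U(1) V(1) U(2) V(2) xH] by simp
    qed
    have mult: "x (s + t) = x s + x t \<and>
       2 *\<^sub>R y (s + t) - (2 *\<^sub>R y s + 2 *\<^sub>R y t + 2 *\<^sub>R frame_derivative ?V \<phi> F m a (x t)) \<in> horizontal I"
      if a: "a \<in> horizontal I" "x s = ?B a" for s t a
    proof -
      have "coord_arrow ?V \<phi> m (x (s + t)) (2 *\<^sub>R y (s + t)) = arrow_mult M I H m (\<gamma> s) (\<gamma> t)"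
        using g \<gamma> by (simp add: one_parameter_subgroup_def)
      also have "\<dots> = coord_arrow ?V \<phi> m (x s + x t) (2 *\<^sub>R y s + 2 *\<^sub>R y t + 2 *\<^sub>R frame_derivative ?V \<phi> F m a (x t))"
        unfolding \<gamma> a(2) by (rule arrow_mult_coord_arrow[OF V T(4) a(1) xH])
      finally show ?thesis
        using coord_arrow_eq_iff[OF V xH subspace_add[OF subspace_H[OF V] xH xH]] U(3) by simp
    qed
    have "x (s + t) = x s + x t" for s t
    proof -
      obtain a where "a \<in> horizontal I" "x s = ?B a"
        using xH[of s] adapted_frameD(2)[OF V(1) T(4) V(2)] by auto
      then show ?thesis using mult by blast
    qed
    then have xs: "x s = s *\<^sub>R hor_part I p" for s by (rule additive_differentiable_linear[OF _ dx])
    have ys: "y (s + t) = y s + y t + (s * t) *\<^sub>R hor_part (- I) \<beta>" for s t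
    proof -
      have "s *\<^sub>R a0 \<in> horizontal I" using a0(1) subspace_scale[OF subspace_horizontal] by blast
      moreover have "x s = ?B (s *\<^sub>R a0)" using xs a0(2) by (simp add: linear_scale[OF linear_frame_map])
      ultimately have "2 *\<^sub>R y (s + t) - (2 *\<^sub>R y s + 2 *\<^sub>R y t + 2 *\<^sub>R frame_derivative ?V \<phi> F m (s *\<^sub>R a0) (x t)) \<in> horizontal I"
        using mult by blast
      moreover have "frame_derivative ?V \<phi> F m (s *\<^sub>R a0) (x t) = (s * t) *\<^sub>R \<beta>"
        unfolding xs \<beta>_def by (rule frame_derivative_scale[OF V(1) T(4) V(2)])
      ultimately have out: "2 * (y (s + t) $ i) - (2 * y s $ i + 2 * y t $ i + 2 * (s * t * \<beta> $ i)) = 0" if "i \<notin> I" for i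
        using that by (simp add: horizontal_iff)
      have "y (s + t) $ i = (y s + y t + (s * t) *\<^sub>R hor_part (- I) \<beta>) $ i" for i
      proof (cases "i \<in> I")
        case True
        then show ?thesis by (simp add: y_def)
      next
        case False
        then have "y (s + t) $ i = y s $ i + y t $ i + s * t * \<beta> $ i" using out[OF False] by linarith
        then show ?thesis using False by simp
      qed
      then show ?thesis by (simp add: vec_eq_iff)
    qed
    \<comment> \<open>Subtracting the quadratic term makes the normal part additive.\<close>
    define k where "k s = y s - (s\<^sup>2 / 2) *\<^sub>R hor_part (- I) \<beta>" for s
    have "k (s + t) = k s + k t" for s t
      unfolding k_def ys by (simp add: vec_eq_iff power2_eq_square field_simps)
    moreover have "(k has_vector_derivative hor_part (- I) p) (at 0)"
    proof -
      have "((\<lambda>s. (s\<^sup>2 / 2) *\<^sub>R hor_part (- I) \<beta>) has_vector_derivative 0) (at 0)"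
        by (auto intro!: derivative_eq_intros simp: has_vector_derivative_def)
      from has_vector_derivative_diff[OF dy this] show ?thesis by (simp add: k_def[abs_def])
    qed
    ultimately have "k 1 = 1 *\<^sub>R hor_part (- I) p" by (rule additive_differentiable_linear)
    then have "2 *\<^sub>R y 1 = 2 *\<^sub>R hor_part (- I) p + hor_part (- I) \<beta>" by (simp add: k_def vec_eq_iff field_simps)
    then show ?thesis using \<gamma>[of 1] xs[of 1] by simp
  qed
  show ?thesis using main[OF g] main[OF g'] by simp
qed

text \<open>The value at \<open>1\<close> of the one-parameter subgroup with initial vector \<open>a\<close>, whose components are taken with
  respect to the frame.  The derivative of the frame in the acceleration plays the role of the constant \<open>\<beta>\<close> in the proof of
  \<open>one_parameter_subgroup_unique\<close>.\<close>

definition exp_arrow ::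
  "'m set \<Rightarrow> ('m \<Rightarrow> real ^ 'd) \<Rightarrow> ('d \<Rightarrow> 'm \<Rightarrow> real ^ 'd) \<Rightarrow> 'm \<Rightarrow> real ^ 'd \<Rightarrow> 'm arrow" where
  "exp_arrow U \<phi> F m a = coord_arrow U \<phi> m (frame_map (\<lambda>i. F i m) (hor_part I a))
     (2 *\<^sub>R frame_map (\<lambda>i. F i m) (hor_part (- I) a) +
      frame_derivative U \<phi> F m (hor_part I a) (frame_map (\<lambda>i. F i m) (hor_part I a)))"

text \<open>The subgroup property is verified in the given chart, where the group law is known, whereas
  the derivative at \<open>0\<close> refers to the Taylor coordinates of an \<open>H\<close>-chart.  The curve is quadratic in the parameter
  there, too.\<close>

lemma one_parameter_subgroup_exists:
  assumes U: "(U, \<phi>) \<in> SM" "m \<in> U" and F: "adapted_frame I H (U, \<phi>) F"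
    and X: "X \<in> H m" and Y: "Y \<in> normal_space M H m" and a: "HN_coord I \<phi> (\<lambda>i. F i m) (X, Y) = a"
    and h: "H_chart M I H m (V, \<theta>)"
  shows "one_parameter_subgroup m (V, \<theta>) (\<lambda>s. exp_arrow U \<phi> F m (s *\<^sub>R a)) (HN_coord I \<theta> (\<lambda>i. axis i 1) (X, Y))"
proof -
  let ?B = "frame_map (\<lambda>i. F i m)"
  let ?u = "?B (hor_part I a)" and ?n = "?B (hor_part (- I) a)"
  let ?\<beta> = "frame_derivative U \<phi> F m (hor_part I a) ?u"
  let ?\<gamma> = "\<lambda>s. exp_arrow U \<phi> F m (s *\<^sub>R a)"
  have V: "(V, \<theta>) \<in> SM" "m \<in> V" "tcoord \<theta> ` H m = horizontal I" using H_chartD[OF h] by auto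
  have hs: "hor_part J (s *\<^sub>R a) = s *\<^sub>R hor_part J a" for J s by (simp add: vec_eq_iff)
  have ha: "s *\<^sub>R hor_part I a \<in> horizontal I" for s by (simp add: horizontal_iff)
  have \<gamma>: "?\<gamma> s = coord_arrow U \<phi> m (?B (s *\<^sub>R hor_part I a)) ((2 * s) *\<^sub>R ?n + (s\<^sup>2) *\<^sub>R ?\<beta>)" for s
    using frame_derivative_scale[OF U(1) F U(2), of s "hor_part I a" s ?u]
    by (simp add: exp_arrow_def hs linear_scale[OF linear_frame_map] power2_eq_square)
  have uH: "?B (s *\<^sub>R hor_part I a) \<in> tcoord \<phi> ` H m" for s
    using frame_map_mem_H_iff[OF U(1) F U(2)] ha by simp
  have 1: "?\<gamma> s \<in> THM_at M I H m" for s
    unfolding \<gamma> THM_at_iff[OF U] by (rule bexI[OF exI uH]) (rule refl)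
  have 2: "?\<gamma> (s + t) = arrow_mult M I H m (?\<gamma> s) (?\<gamma> t)" for s t
  proof -
    have "arrow_mult M I H m (?\<gamma> s) (?\<gamma> t) = coord_arrow U \<phi> m (?B (s *\<^sub>R hor_part I a) + ?B (t *\<^sub>R hor_part I a))
      (((2 * s) *\<^sub>R ?n + (s\<^sup>2) *\<^sub>R ?\<beta>) + ((2 * t) *\<^sub>R ?n + (t\<^sup>2) *\<^sub>R ?\<beta>) +
       2 *\<^sub>R frame_derivative U \<phi> F m (s *\<^sub>R hor_part I a) (?B (t *\<^sub>R hor_part I a)))"
      unfolding \<gamma> by (rule arrow_mult_coord_arrow[OF U F ha uH])
    also have "\<dots> = ?\<gamma> (s + t)"
      unfolding \<gamma> using frame_derivative_scale[OF U(1) F U(2), of s "hor_part I a" t ?u]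
      by (simp add: linear_scale[OF linear_frame_map] linear_add[OF linear_frame_map] power2_eq_square algebra_simps)
    finally show ?thesis by simp
  qed
  obtain L Q where L: "jet_change m \<phi> \<theta> L Q" by (rule change_of_chart[OF U(1) V(1) U(2) V(2)])
  note linL = jet_changeD(1)[OF L]
  define p where "p = L ?u + hor_part (- I) (L ?n)"
  define q where "q = (1 / 2) *\<^sub>R hor_part (- I) (L ?\<beta> + Q ?u)"
  have Lu: "L ?u \<in> horizontal I"
    using coord_arrow_change(2)[OF U(1) V(1) U(2) V(2) L uH[of 1]] V(3) by simp
  have tay: "taylor_coord M I H (V, \<theta>) (?\<gamma> s) = s *\<^sub>R p + s\<^sup>2 *\<^sub>R q" for s
  proof -
    have B: "?B (s *\<^sub>R hor_part I a) = s *\<^sub>R ?u" by (simp add: linear_scale[OF linear_frame_map])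
    have hu: "L (s *\<^sub>R ?u) \<in> horizontal I"
      using Lu subspace_scale[OF subspace_horizontal] by (simp add: linear_scale[OF linL])
    have e: "?\<gamma> s = coord_arrow V \<theta> m (L (s *\<^sub>R ?u)) (L ((2 * s) *\<^sub>R ?n + (s\<^sup>2) *\<^sub>R ?\<beta>) + Q (s *\<^sub>R ?u))"
      unfolding \<gamma> B by (rule coord_arrow_change(1)[OF U(1) V(1) U(2) V(2) L uH[of s, unfolded B]])
    have "taylor_coord M I H (V, \<theta>) (?\<gamma> s) =
      L (s *\<^sub>R ?u) + (1 / 2) *\<^sub>R hor_part (- I) (L ((2 * s) *\<^sub>R ?n + (s\<^sup>2) *\<^sub>R ?\<beta>) + Q (s *\<^sub>R ?u))"
      unfolding e by (rule taylor_coord_coord_arrow[OF h hu])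
    also have "\<dots> = s *\<^sub>R p + s\<^sup>2 *\<^sub>R q"
      by (simp add: p_def q_def linear_add[OF linL] linear_scale[OF linL] jet_changeD(2)[OF L] vec_eq_iff algebra_simps)
    finally show ?thesis .
  qed
  have 3: "smooth_on UNIV (taylor_coord M I H (V, \<theta>) \<circ> ?\<gamma>)"
  proof -
    have "open_smooth UNIV (\<lambda>s::real. s *\<^sub>R p + s\<^sup>2 *\<^sub>R q)" by (intro open_smooth_intros open_UNIV)
    then show ?thesis by (simp add: smooth_on_open_iff o_def tay)
  qed
  have 4: "vector_derivative (taylor_coord M I H (V, \<theta>) \<circ> ?\<gamma>) (at 0) = p"
  proof (rule vector_derivative_at)
    have "((\<lambda>s::real. s *\<^sub>R p + s\<^sup>2 *\<^sub>R q) has_vector_derivative p) (at 0)"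
      by (auto intro!: derivative_eq_intros simp: has_vector_derivative_def)
    then show "(taylor_coord M I H (V, \<theta>) \<circ> ?\<gamma> has_vector_derivative p) (at 0)" by (simp add: o_def tay)
  qed
  have HNF: "tcoord \<phi> X = ?u" and exZ: "\<exists>Z\<in>Y. tcoord \<phi> Z = ?n"
    using HN_coord_iff[OF U adapted_frameD(1)[OF U(1) F U(2)] adapted_frameD(2)[OF U(1) F U(2)] X Y, of a] a by auto
  obtain Z1 where Z1: "Z1 \<in> Y" "tcoord \<phi> Z1 = ?n" using exZ by blast
  obtain Z0 where Z0: "Z0 \<in> tangent_space M m"
    "Y = {Z \<in> tangent_space M m. tcoord \<theta> Z0 - tcoord \<theta> Z \<in> tcoord \<theta> ` H m}" by (rule normal_spaceE[OF Y V(1,2)])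
  have Z1T: "Z1 \<in> tangent_space M m" using Z1(1) Z0(2) by blast
  have tZ1: "tcoord \<theta> Z1 = L ?n" using tcoord_change[OF U(1) V(1) U(2) V(2) L Z1T] Z1(2) by simp
  obtain Z where Z: "Z \<in> tangent_space M m" "tcoord \<theta> Z = hor_part (- I) (L ?n)" by (rule tcoord_surj[OF V(1,2)])
  have e1: "tcoord \<theta> Z0 - tcoord \<theta> Z = (tcoord \<theta> Z0 - tcoord \<theta> Z1) + hor_part I (L ?n)"
    unfolding Z(2) tZ1 using hor_part_split[of I "L ?n"] by (simp add: hor_part_Compl)
  have e2: "tcoord \<theta> Z0 - tcoord \<theta> Z1 \<in> horizontal I" using Z1(1) Z0(2) V(3) by blast
  have "tcoord \<theta> Z0 - tcoord \<theta> Z \<in> tcoord \<theta> ` H m"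
    unfolding e1 V(3) by (rule subspace_add[OF subspace_horizontal e2 hor_part_in_horizontal])
  then have ZY: "Z \<in> Y" using Z(1) Z0(2) by blast
  have "X \<in> tangent_space M m" using X H_tangent U chart_points by blast
  then have tX: "tcoord \<theta> X = L ?u" using tcoord_change[OF U(1) V(1) U(2) V(2) L] HNF by simp
  have hp: "hor_part I p = L ?u" "hor_part (- I) p = hor_part (- I) (L ?n)"
    using Lu by (auto simp: p_def vec_eq_iff horizontal_iff)
  have "HN_coord I \<theta> (\<lambda>i. axis i 1) (X, Y) = p"
    unfolding HN_coord_H_chart_iff[OF h X Y] hp using tX ZY Z(2) by auto
  then show ?thesis unfolding one_parameter_subgroup_def using 1 2 3 4 by blast
qed

text \<open>One and the same subgroup has the required derivative in all \<open>H\<close>-charts at \<open>m\<close>, so the value is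
  independent of the \<open>H\<close>-chart.\<close>

lemma lie_exp_eq:
  assumes U: "(U, \<phi>) \<in> SM" "m \<in> U" and F: "adapted_frame I H (U, \<phi>) F"
    and X: "X \<in> H m" and Y: "Y \<in> normal_space M H m"
  shows "lie_exp M I H (m, X, Y) = exp_arrow U \<phi> F m (HN_coord I \<phi> (\<lambda>i. F i m) (X, Y))"
proof -
  let ?a = "HN_coord I \<phi> (\<lambda>i. F i m) (X, Y)"
  have e: "lie_exp M I H (m, X, Y) = (THE v. \<exists>\<gamma> V \<theta>. H_chart M I H m (V, \<theta>) \<and>
      one_parameter_subgroup m (V, \<theta>) \<gamma> (HN_coord I \<theta> (\<lambda>i. axis i 1) (X, Y)) \<and> v = \<gamma> 1)"
    unfolding lie_exp_def one_parameter_subgroup_def by (simp add: conj_assoc)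
  note ex = one_parameter_subgroup_exists[OF U F X Y refl]
  have "m \<in> points M" using U chart_points by blast
  then obtain V0 \<theta>0 where h0: "H_chart M I H m (V0, \<theta>0)" by (rule H_chart_exists)
  show ?thesis unfolding e
  proof (rule the_equality)
    show "\<exists>\<gamma> V \<theta>. H_chart M I H m (V, \<theta>) \<and>
      one_parameter_subgroup m (V, \<theta>) \<gamma> (HN_coord I \<theta> (\<lambda>i. axis i 1) (X, Y)) \<and> exp_arrow U \<phi> F m ?a = \<gamma> 1"
      by (intro exI[of _ "\<lambda>s. exp_arrow U \<phi> F m (s *\<^sub>R ?a)"] exI[of _ V0] exI[of _ \<theta>0] conjI h0 ex[OF h0]) simp
    fix v assume "\<exists>\<gamma> V \<theta>. H_chart M I H m (V, \<theta>) \<and>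
      one_parameter_subgroup m (V, \<theta>) \<gamma> (HN_coord I \<theta> (\<lambda>i. axis i 1) (X, Y)) \<and> v = \<gamma> 1"
    then obtain \<gamma> V \<theta> where g: "H_chart M I H m (V, \<theta>)"
      "one_parameter_subgroup m (V, \<theta>) \<gamma> (HN_coord I \<theta> (\<lambda>i. axis i 1) (X, Y))" "v = \<gamma> 1" by (elim exE conjE)
    show "v = exp_arrow U \<phi> F m ?a"
      using one_parameter_subgroup_unique[OF g(1,2) ex[OF g(1)]] g(3) by simp
  qed
qed

section \<open>The smooth structure on the bundle of parabolic arrows\<close>

lemma exp_arrow_THM:
  assumes U: "(U, \<phi>) \<in> SM" "m \<in> U" and F: "adapted_frame I H (U, \<phi>) F"
  shows "exp_arrow U \<phi> F m a \<in> THM_at M I H m" "base_point (exp_arrow U \<phi> F m a) = m"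
    "exp_arrow U \<phi> F m a \<in> THM M I H"
proof -
  have hH: "frame_map (\<lambda>i. F i m) (hor_part I a) \<in> tcoord \<phi> ` H m"
    using frame_map_mem_H_iff[OF U(1) F U(2)] hor_part_in_horizontal by simp
  show 1: "exp_arrow U \<phi> F m a \<in> THM_at M I H m"
    unfolding exp_arrow_def THM_at_iff[OF U] by (rule bexI[OF _ hH], rule exI, rule refl)
  then show "base_point (exp_arrow U \<phi> F m a) = m" by (rule base_point_THM_at)
  then show "exp_arrow U \<phi> F m a \<in> THM M I H" using 1 THM_iff by simp
qed

lemma exp_arrow_inj:
  assumes U: "(U, \<phi>) \<in> SM" "m \<in> U" and F: "adapted_frame I H (U, \<phi>) F"
    and e: "exp_arrow U \<phi> F m a = exp_arrow U \<phi> F m b"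
  shows "a = b"
proof -
  let ?B = "frame_map (\<lambda>i. F i m)"
  have hH: "?B (hor_part I a) \<in> tcoord \<phi> ` H m" for a
    using frame_map_mem_H_iff[OF U(1) F U(2)] hor_part_in_horizontal by simp
  note inj = adapted_frameD(1)[OF U(1) F U(2)]
  from e[unfolded exp_arrow_def coord_arrow_eq_iff[OF U hH hH]]
  have 1: "?B (hor_part I a) = ?B (hor_part I b)" and
    2: "2 *\<^sub>R ?B (hor_part (- I) a) + frame_derivative U \<phi> F m (hor_part I a) (?B (hor_part I a)) -
      (2 *\<^sub>R ?B (hor_part (- I) b) + frame_derivative U \<phi> F m (hor_part I b) (?B (hor_part I b))) \<in> tcoord \<phi> ` H m"
    by auto
  have h: "hor_part I a = hor_part I b" using 1 inj by (rule injD[rotated])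
  have "?B (2 *\<^sub>R (hor_part (- I) a - hor_part (- I) b)) \<in> tcoord \<phi> ` H m"
    using 2 unfolding h by (simp add: linear_scale[OF linear_frame_map] linear_diff[OF linear_frame_map] scaleR_diff_right)
  then have "2 *\<^sub>R (hor_part (- I) a - hor_part (- I) b) \<in> horizontal I"
    using frame_map_mem_H_iff[OF U(1) F U(2)] by blast
  then have "hor_part (- I) a = hor_part (- I) b" by (auto simp: horizontal_iff vec_eq_iff)
  then show ?thesis using h hor_part_split by metis
qed

lemma exp_arrow_surj:
  assumes U: "(U, \<phi>) \<in> SM" "m \<in> U" and F: "adapted_frame I H (U, \<phi>) F" and v: "v \<in> THM_at M I H m"
  obtains a where "v = exp_arrow U \<phi> F m a"
proof -
  let ?B = "frame_map (\<lambda>i. F i m)"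
  note B = inverse_linear[OF linear_frame_map adapted_frameD(1)[OF U(1) F U(2)]]
  obtain u w where u: "u \<in> tcoord \<phi> ` H m" "v = coord_arrow U \<phi> m u w"
    using v[unfolded THM_at_iff[OF U]] by (elim bexE exE)
  obtain h where h: "h \<in> horizontal I" "u = ?B h" using u(1) adapted_frameD(2)[OF U(1) F U(2)] by auto
  \<comment> \<open>The acceleration determines the normal part of \<open>a\<close> once the quadratic term is subtracted; the factor
    \<open>1 / 2\<close> undoes the \<open>2\<close> in \<open>exp_arrow\<close>.\<close>
  define z where "z = inv ?B (w - frame_derivative U \<phi> F m h u)"
  define a where "a = h + (1 / 2) *\<^sub>R hor_part (- I) z"
  have ha: "hor_part I a = h" "hor_part (- I) a = (1 / 2) *\<^sub>R hor_part (- I) z"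
    using h(1) by (auto simp: a_def vec_eq_iff horizontal_iff)
  have "w - (2 *\<^sub>R ?B (hor_part (- I) a) + frame_derivative U \<phi> F m h u) = ?B z - ?B (hor_part (- I) z)"
    unfolding ha(2) z_def B(2) by (simp add: linear_scale[OF linear_frame_map] algebra_simps)
  also have "\<dots> = ?B (hor_part I z)"
    by (subst hor_part_split[of I z, symmetric], subst linear_add[OF linear_frame_map]) simp
  also have "\<dots> \<in> tcoord \<phi> ` H m" using frame_map_mem_H_iff[OF U(1) F U(2)] hor_part_in_horizontal by simp
  finally have "v = exp_arrow U \<phi> F m a"
    unfolding exp_arrow_def ha(1) u(2) h(2)[symmetric] coord_arrow_eq_iff[OF U u(1) u(1)] by simp
  then show ?thesis by (rule that)
qed

lemma dilation_exp_arrow: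
  assumes U: "(U, \<phi>) \<in> SM" "m \<in> U" and F: "adapted_frame I H (U, \<phi>) F"
  shows "dilation M I H t (exp_arrow U \<phi> F m a) = exp_arrow U \<phi> F m (parabolic_dilation I t a)"
proof -
  let ?B = "frame_map (\<lambda>i. F i m)"
  have hH: "?B (hor_part I a) \<in> tcoord \<phi> ` H m"
    using frame_map_mem_H_iff[OF U(1) F U(2)] hor_part_in_horizontal by simp
  have d: "frame_derivative U \<phi> F m (t *\<^sub>R hor_part I a) (t *\<^sub>R ?B (hor_part I a)) =
      (t * t) *\<^sub>R frame_derivative U \<phi> F m (hor_part I a) (?B (hor_part I a))"
    by (rule frame_derivative_scale[OF U(1) F U(2)])
  show ?thesis
    unfolding exp_arrow_def dilation_coord_arrow[OF U hH]
    by (simp add: hor_part_dilation linear_scale[OF linear_frame_map] d power2_eq_square scaleR_add_right mult.commute)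
qed

lemma HN_coord_surj:
  assumes U: "(U, \<phi>) \<in> SM" "m \<in> U" and F: "adapted_frame I H (U, \<phi>) F"
  obtains X Y where "X \<in> H m" "Y \<in> normal_space M H m" "HN_coord I \<phi> (\<lambda>i. F i m) (X, Y) = a"
proof -
  let ?B = "frame_map (\<lambda>i. F i m)"
  have "?B (hor_part I a) \<in> tcoord \<phi> ` H m"
    using frame_map_mem_H_iff[OF U(1) F U(2)] hor_part_in_horizontal by simp
  then obtain X where X: "X \<in> H m" "tcoord \<phi> X = ?B (hor_part I a)" by auto
  obtain Z where Z: "Z \<in> tangent_space M m" "tcoord \<phi> Z = ?B (hor_part (- I) a)" by (rule tcoord_surj[OF U])
  have "m \<in> points M" using U chart_points by blast
  then obtain c where c: "c \<in> M" "m \<in> fst c" unfolding points_iff by blast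
  let ?R = "{(X, Y). X \<in> tangent_space M m \<and> Y \<in> tangent_space M m \<and>
        (\<exists>(U, \<phi>)\<in>M. m \<in> U \<and> tcoord \<phi> X - tcoord \<phi> Y \<in> tcoord \<phi> ` H m)}"
  have Y: "?R `` {Z} \<in> normal_space M H m"
    unfolding normal_space_def using Z(1) by (rule quotientI)
  have "(fst c, snd c) \<in> SM" using c M_SM by auto
  then have "0 \<in> tcoord (snd c) ` H m" using subspace_0[OF subspace_H[OF _ c(2)]] by blast
  then have "(Z, Z) \<in> ?R" using Z(1) c by (auto intro!: bexI[of _ c] simp: case_prod_unfold)
  then have ZY: "Z \<in> ?R `` {Z}" by blast
  have "HN_coord I \<phi> (\<lambda>i. F i m) (X, ?R `` {Z}) = a"
    unfolding HN_coord_iff[OF U adapted_frameD(1,2)[OF U(1) F U(2)] X(1) Y]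
    using X(2) Z(2) ZY by (intro conjI bexI[of _ Z])
  then show ?thesis using that[OF X(1) Y] by blast
qed

lemma HN_coord_inj:
  assumes U: "(U, \<phi>) \<in> SM" "m \<in> U" and F: "adapted_frame I H (U, \<phi>) F"
    and X: "X \<in> H m" "X' \<in> H m" and Y: "Y \<in> normal_space M H m" "Y' \<in> normal_space M H m"
    and e: "HN_coord I \<phi> (\<lambda>i. F i m) (X, Y) = HN_coord I \<phi> (\<lambda>i. F i m) (X', Y')"
  shows "X = X' \<and> Y = Y'"
proof -
  let ?B = "frame_map (\<lambda>i. F i m)" and ?a = "HN_coord I \<phi> (\<lambda>i. F i m) (X', Y')"
  note iff = HN_coord_iff[OF U adapted_frameD(1,2)[OF U(1) F U(2)]]
  have 1: "tcoord \<phi> X = ?B (hor_part I ?a)" "\<exists>Z\<in>Y. tcoord \<phi> Z = ?B (hor_part (- I) ?a)"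
    using iff[OF X(1) Y(1), of ?a] e by auto
  have 2: "tcoord \<phi> X' = ?B (hor_part I ?a)" "\<exists>Z\<in>Y'. tcoord \<phi> Z = ?B (hor_part (- I) ?a)"
    using iff[OF X(2) Y(2), of ?a] by auto
  have HT: "H m \<subseteq> tangent_space M m" using H_tangent U chart_points by blast
  have "X = X'" by (rule tcoord_inj[OF U]) (use X HT 1 2 in auto)
  obtain Z Z' where Z: "Z \<in> Y" "Z' \<in> Y'" "tcoord \<phi> Z = tcoord \<phi> Z'" using 1(2) 2(2) by auto
  obtain Z0 where Z0: "Z0 \<in> tangent_space M m"
    "Y = {Z \<in> tangent_space M m. tcoord \<phi> Z0 - tcoord \<phi> Z \<in> tcoord \<phi> ` H m}" by (rule normal_spaceE[OF Y(1) U])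
  obtain Z0' where Z0': "Z0' \<in> tangent_space M m"
    "Y' = {Z \<in> tangent_space M m. tcoord \<phi> Z0' - tcoord \<phi> Z \<in> tcoord \<phi> ` H m}" by (rule normal_spaceE[OF Y(2) U])
  note sub = subspace_H[OF U]
  have d1: "tcoord \<phi> Z0 - tcoord \<phi> Z \<in> tcoord \<phi> ` H m" using Z(1) Z0(2) by blast
  have d2: "tcoord \<phi> Z0' - tcoord \<phi> Z' \<in> tcoord \<phi> ` H m" using Z(2) Z0'(2) by blast
  have d: "tcoord \<phi> Z0 - tcoord \<phi> Z0' \<in> tcoord \<phi> ` H m" using subspace_diff[OF sub d1 d2] Z(3) by simp
  have "tcoord \<phi> Z0 - tcoord \<phi> W \<in> tcoord \<phi> ` H m \<longleftrightarrow> tcoord \<phi> Z0' - tcoord \<phi> W \<in> tcoord \<phi> ` H m" for W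
  proof
    assume "tcoord \<phi> Z0 - tcoord \<phi> W \<in> tcoord \<phi> ` H m"
    from subspace_diff[OF sub this d] show "tcoord \<phi> Z0' - tcoord \<phi> W \<in> tcoord \<phi> ` H m" by simp
  next
    assume "tcoord \<phi> Z0' - tcoord \<phi> W \<in> tcoord \<phi> ` H m"
    from subspace_add[OF sub this d] show "tcoord \<phi> Z0 - tcoord \<phi> W \<in> tcoord \<phi> ` H m" by simp
  qed
  then have "Y = Y'" using Z0(2) Z0'(2) by simp
  with \<open>X = X'\<close> show ?thesis by blast
qed

text \<open>Both sides are the Lie exponential of the same element of \<open>H\<^sub>m \<oplus> N\<^sub>m\<close>, whose coordinates change by the
  maps that \<open>R\<close> induces on \<open>H\<^sub>m\<close> and on \<open>N\<^sub>m\<close>; no quadratic terms have to be compared.\<close>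

lemma exp_arrow_change:
  assumes ch: "(U, \<phi>) \<in> SM" "(V, \<theta>) \<in> SM" "m \<in> U" "m \<in> V"
    and F: "adapted_frame I H (U, \<phi>) F" and G: "adapted_frame I H (V, \<theta>) G" and L: "jet_change m \<phi> \<theta> L Q"
  shows "exp_arrow U \<phi> F m a = exp_arrow V \<theta> G m
    (let R = (\<lambda>a. inv (frame_map (\<lambda>i. G i m)) (L (frame_map (\<lambda>i. F i m) a)))
     in hor_part I (R (hor_part I a)) + hor_part (- I) (R (hor_part (- I) a)))"
proof -
  let ?B = "frame_map (\<lambda>i. F i m)" and ?B' = "frame_map (\<lambda>i. G i m)"
  define R where "R a = inv ?B' (L (?B a))" for a
  define a' where "a' = hor_part I (R (hor_part I a)) + hor_part (- I) (R (hor_part (- I) a))"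
  note B' = inverse_linear[OF linear_frame_map adapted_frameD(1)[OF ch(2) G ch(4)]]
  have BR: "?B' (R x) = L (?B x)" for x by (simp add: R_def B'(2))
  have ha': "hor_part I a' = hor_part I (R (hor_part I a))" "hor_part (- I) a' = hor_part (- I) (R (hor_part (- I) a))"
    by (simp_all add: a'_def vec_eq_iff)
  obtain X Y where XY: "X \<in> H m" "Y \<in> normal_space M H m" "HN_coord I \<phi> (\<lambda>i. F i m) (X, Y) = a"
    by (rule HN_coord_surj[OF ch(1,3) F])
  have c1: "tcoord \<phi> X = ?B (hor_part I a)" "\<exists>Z\<in>Y. tcoord \<phi> Z = ?B (hor_part (- I) a)"
    using HN_coord_iff[OF ch(1,3) adapted_frameD(1,2)[OF ch(1) F ch(3)] XY(1,2), of a] XY(3) by auto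
  have HT: "H m \<subseteq> tangent_space M m" using H_tangent ch chart_points by blast
  have tX: "tcoord \<theta> X = ?B' (R (hor_part I a))"
    using tcoord_change[OF ch L subsetD[OF HT XY(1)]] c1(1) BR by simp
  have Rh: "R (hor_part I a) \<in> horizontal I"
    using imageI[OF XY(1), of "tcoord \<theta>"] frame_map_mem_H_iff[OF ch(2) G ch(4)] unfolding tX by blast
  obtain Z where Z: "Z \<in> Y" "tcoord \<phi> Z = ?B (hor_part (- I) a)" using c1(2) by blast
  obtain Z0 where Z0: "Z0 \<in> tangent_space M m"
    "Y = {Z \<in> tangent_space M m. tcoord \<theta> Z0 - tcoord \<theta> Z \<in> tcoord \<theta> ` H m}" by (rule normal_spaceE[OF XY(2) ch(2,4)])
  have ZT: "Z \<in> tangent_space M m" and Z0Z: "tcoord \<theta> Z0 - tcoord \<theta> Z \<in> tcoord \<theta> ` H m"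
    using Z(1) Z0(2) by blast+
  have tZ: "tcoord \<theta> Z = ?B' (R (hor_part (- I) a))" using tcoord_change[OF ch L ZT] Z(2) BR by simp
  obtain Z' where Z': "Z' \<in> tangent_space M m" "tcoord \<theta> Z' = ?B' (hor_part (- I) a')"
    by (rule tcoord_surj[OF ch(2,4)])
  have e: "tcoord \<theta> Z0 - tcoord \<theta> Z' = (tcoord \<theta> Z0 - tcoord \<theta> Z) + ?B' (hor_part I (R (hor_part (- I) a)))"
  proof -
    have "?B' (R (hor_part (- I) a)) = ?B' (hor_part I (R (hor_part (- I) a))) + ?B' (hor_part (- I) (R (hor_part (- I) a)))"
      by (subst hor_part_split[of I "R (hor_part (- I) a)", symmetric], rule linear_add[OF linear_frame_map])
    then show ?thesis unfolding Z'(2) tZ ha'(2) by simp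
  qed
  have "?B' (hor_part I (R (hor_part (- I) a))) \<in> tcoord \<theta> ` H m"
    using frame_map_mem_H_iff[OF ch(2) G ch(4)] hor_part_in_horizontal by simp
  then have "tcoord \<theta> Z0 - tcoord \<theta> Z' \<in> tcoord \<theta> ` H m"
    unfolding e by (rule subspace_add[OF subspace_H[OF ch(2,4)] Z0Z])
  then have ZY: "Z' \<in> Y" using Z'(1) Z0(2) by blast
  have "hor_part I a' = R (hor_part I a)" using Rh unfolding ha'(1) hor_part_horizontal .
  then have "HN_coord I \<theta> (\<lambda>i. G i m) (X, Y) = a'"
    unfolding HN_coord_iff[OF ch(2,4) adapted_frameD(1,2)[OF ch(2) G ch(4)] XY(1,2)]
    using tX ZY Z'(2) by auto
  then have "exp_arrow U \<phi> F m a = exp_arrow V \<theta> G m a'"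
    using lie_exp_eq[OF ch(1,3) F XY(1,2)] lie_exp_eq[OF ch(2,4) G XY(1,2)] XY(3) by simp
  then show ?thesis by (simp add: a'_def R_def Let_def)
qed

text \<open>The charts of \<open>T\<^sub>HM\<close>: coordinates \<open>(\<phi> m, a)\<close> for the Lie exponential of the element of
  \<open>H\<^sub>m \<oplus> N\<^sub>m\<close> with coordinates \<open>a\<close>.\<close>

definition arrow_chart ::
  "'m set \<Rightarrow> ('m \<Rightarrow> real ^ 'd) \<Rightarrow> ('d \<Rightarrow> 'm \<Rightarrow> real ^ 'd) \<Rightarrow> ('m arrow, (real ^ 'd) \<times> (real ^ 'd)) chart \<Rightarrow> bool" where
  "arrow_chart U \<phi> F c \<longleftrightarrow> (U, \<phi>) \<in> SM \<and> adapted_frame I H (U, \<phi>) F \<and>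
     fst c = {v \<in> THM M I H. base_point v \<in> U} \<and> (\<forall>m\<in>U. \<forall>a. snd c (exp_arrow U \<phi> F m a) = (\<phi> m, a))"

lemma HN_chart_transport:
  assumes U: "(U, \<phi>) \<in> SM" and F: "adapted_frame I H (U, \<phi>) F"
  defines "W \<equiv> {(m, X, Y). m \<in> U \<and> X \<in> H m \<and> Y \<in> normal_space M H m}"
    and "\<kappa> \<equiv> \<lambda>(m, X, Y). (\<phi> m, HN_coord I \<phi> (\<lambda>i. F i m) (X, Y))"
  shows "arrow_chart U \<phi> F (lie_exp M I H ` W, \<kappa> \<circ> inv_into W (lie_exp M I H))"
proof -
  have le: "lie_exp M I H (m, X, Y) = exp_arrow U \<phi> F m (HN_coord I \<phi> (\<lambda>i. F i m) (X, Y))"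
    if "(m, X, Y) \<in> W" for m X Y using that lie_exp_eq[OF U _ F] by (simp add: W_def)
  have inj: "inj_on (lie_exp M I H) W"
  proof (rule inj_onI)
    fix x y assume x: "x \<in> W" and y: "y \<in> W" and e: "lie_exp M I H x = lie_exp M I H y"
    obtain m X Y where xx: "x = (m, X, Y)" by (cases x)
    obtain m' X' Y' where yy: "y = (m', X', Y')" by (cases y)
    have mx: "m \<in> U" "X \<in> H m" "Y \<in> normal_space M H m" using x by (auto simp: xx W_def)
    have my: "m' \<in> U" "X' \<in> H m'" "Y' \<in> normal_space M H m'" using y by (auto simp: yy W_def)
    have e': "exp_arrow U \<phi> F m (HN_coord I \<phi> (\<lambda>i. F i m) (X, Y)) = exp_arrow U \<phi> F m' (HN_coord I \<phi> (\<lambda>i. F i m') (X', Y'))"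
      using e le[of m X Y] le[of m' X' Y'] x y by (simp add: xx yy)
    have mm: "m = m'" using exp_arrow_THM(2)[OF U mx(1) F] exp_arrow_THM(2)[OF U my(1) F] e' by metis
    have "HN_coord I \<phi> (\<lambda>i. F i m) (X, Y) = HN_coord I \<phi> (\<lambda>i. F i m) (X', Y')"
      using exp_arrow_inj[OF U mx(1) F] e' mm by simp
    from HN_coord_inj[OF U mx(1) F mx(2) _ mx(3) _ this] my mm show "x = y" by (simp add: xx yy)
  qed
  have im: "exp_arrow U \<phi> F m a \<in> lie_exp M I H ` W \<and> (\<kappa> \<circ> inv_into W (lie_exp M I H)) (exp_arrow U \<phi> F m a) = (\<phi> m, a)"
    if m: "m \<in> U" for m a
  proof -
    obtain X Y where XY: "X \<in> H m" "Y \<in> normal_space M H m" "HN_coord I \<phi> (\<lambda>i. F i m) (X, Y) = a"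
      by (rule HN_coord_surj[OF U m F])
    have w: "(m, X, Y) \<in> W" using XY m by (simp add: W_def)
    have e: "lie_exp M I H (m, X, Y) = exp_arrow U \<phi> F m a" using le[OF w] XY(3) by simp
    have "inv_into W (lie_exp M I H) (exp_arrow U \<phi> F m a) = (m, X, Y)"
      unfolding e[symmetric] by (rule inv_into_f_f[OF inj w])
    then show ?thesis using w e XY(3) by (auto simp: \<kappa>_def image_iff intro!: bexI[of _ "(m, X, Y)"])
  qed
  have "lie_exp M I H ` W = {v \<in> THM M I H. base_point v \<in> U}"
  proof (intro set_eqI iffI)
    fix v assume "v \<in> lie_exp M I H ` W"
    then obtain m X Y where w: "(m, X, Y) \<in> W" "v = lie_exp M I H (m, X, Y)" by auto
    then have m: "m \<in> U" by (simp add: W_def)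
    show "v \<in> {v \<in> THM M I H. base_point v \<in> U}" using w(2) le[OF w(1)] exp_arrow_THM[OF U m F] m by simp
  next
    fix v assume v: "v \<in> {v \<in> THM M I H. base_point v \<in> U}"
    then have "v \<in> THM_at M I H (base_point v)" using THM_iff by blast
    then obtain a where "v = exp_arrow U \<phi> F (base_point v) a" using exp_arrow_surj[OF U _ F] v by blast
    then show "v \<in> lie_exp M I H ` W" using im[of "base_point v" a] v by simp
  qed
  then show ?thesis using U F im by (simp add: arrow_chart_def)
qed

lemma THM_atlas_chart:
  assumes "c \<in> THM_atlas M I H" obtains U \<phi> F where "arrow_chart U \<phi> F c"
proof -
  obtain a where a: "a \<in> HN_atlas M I H" "c = (lie_exp M I H ` fst a, snd a \<circ> inv_into (fst a) (lie_exp M I H))"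
    using assms unfolding THM_atlas_def transport_iff by blast
  obtain U \<phi> F where UF: "(U, \<phi>) \<in> SM" "adapted_frame I H (U, \<phi>) F"
    and aa: "a = ({(m, X, Y). m \<in> U \<and> X \<in> H m \<and> Y \<in> normal_space M H m},
       \<lambda>(m, X, Y). (\<phi> m, HN_coord I \<phi> (\<lambda>i. F i m) (X, Y)))"
    using a(1) unfolding HN_atlas_def by blast
  have "arrow_chart U \<phi> F c"
    unfolding a(2) aa fst_conv snd_conv by (rule HN_chart_transport[OF UF])
  then show ?thesis by (rule that)
qed

lemma arrow_chart_exists:
  assumes "(U, \<phi>) \<in> SM" "adapted_frame I H (U, \<phi>) F"
  obtains c where "c \<in> THM_atlas M I H" "arrow_chart U \<phi> F c"
proof -
  let ?a = "({(m, X, Y). m \<in> U \<and> X \<in> H m \<and> Y \<in> normal_space M H m},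
       \<lambda>(m, X, Y). (\<phi> m, HN_coord I \<phi> (\<lambda>i. F i m) (X, Y)))"
  have "?a \<in> HN_atlas M I H" unfolding HN_atlas_def using assms by blast
  then have "(lie_exp M I H ` fst ?a, snd ?a \<circ> inv_into (fst ?a) (lie_exp M I H)) \<in> THM_atlas M I H"
    unfolding THM_atlas_def transport_iff by blast
  moreover have "arrow_chart U \<phi> F (lie_exp M I H ` fst ?a, snd ?a \<circ> inv_into (fst ?a) (lie_exp M I H))"
    using HN_chart_transport[OF assms] by simp
  ultimately show ?thesis by (rule that)
qed

lemma arrow_chartD:
  assumes "arrow_chart U \<phi> F c"
  shows "(U, \<phi>) \<in> SM" "adapted_frame I H (U, \<phi>) F" "v \<in> fst c \<longleftrightarrow> v \<in> THM M I H \<and> base_point v \<in> U"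
    "m \<in> U \<Longrightarrow> snd c (exp_arrow U \<phi> F m a) = (\<phi> m, a)" "m \<in> U \<Longrightarrow> exp_arrow U \<phi> F m a \<in> fst c"
    "snd c ` fst c = \<phi> ` U \<times> UNIV"
proof -
  show U: "(U, \<phi>) \<in> SM" and F: "adapted_frame I H (U, \<phi>) F"
    and d: "v \<in> fst c \<longleftrightarrow> v \<in> THM M I H \<and> base_point v \<in> U" for v
    using assms unfolding arrow_chart_def by auto
  show s: "m \<in> U \<Longrightarrow> snd c (exp_arrow U \<phi> F m a) = (\<phi> m, a)" for m a
    using assms unfolding arrow_chart_def by auto
  show e: "m \<in> U \<Longrightarrow> exp_arrow U \<phi> F m a \<in> fst c" for m a
    using d exp_arrow_THM[OF U _ F] by simp
  show "snd c ` fst c = \<phi> ` U \<times> UNIV"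
  proof (intro set_eqI iffI)
    fix x assume "x \<in> snd c ` fst c"
    then obtain v where v: "v \<in> fst c" "x = snd c v" by blast
    then have "v \<in> THM_at M I H (base_point v)" "base_point v \<in> U" using d THM_iff by auto
    then obtain a where "v = exp_arrow U \<phi> F (base_point v) a" using exp_arrow_surj[OF U _ F] by blast
    then show "x \<in> \<phi> ` U \<times> UNIV" using v s[of "base_point v" a] \<open>base_point v \<in> U\<close> by auto
  next
    fix x assume "x \<in> \<phi> ` U \<times> (UNIV :: (real ^ 'd) set)"
    then obtain m a where m: "m \<in> U" "x = (\<phi> m, a)" by auto
    then show "x \<in> snd c ` fst c" using s[OF m(1), of a] e[OF m(1), of a] by (metis imageI)
  qed
qed

lemma arrow_chart_cases:
  assumes c: "arrow_chart U \<phi> F c" and v: "v \<in> fst c"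
  obtains m a where "m \<in> U" "v = exp_arrow U \<phi> F m a" "base_point v = m" "snd c v = (\<phi> m, a)"
proof -
  note C = arrow_chartD[OF c]
  have "v \<in> THM_at M I H (base_point v)" and b: "base_point v \<in> U" using v C(3) THM_iff by auto
  then obtain a where a: "v = exp_arrow U \<phi> F (base_point v) a" using exp_arrow_surj[OF C(1) _ C(2)] by blast
  show ?thesis by (rule that[OF b a refl]) (subst a, rule C(4)[OF b])
qed

lemma is_chart_arrow_chart: assumes c: "arrow_chart U \<phi> F c" shows "is_chart UNIV c"
proof -
  note C = arrow_chartD[OF c]
  have "inj_on (snd c) (fst c)"
  proof (rule inj_onI)
    fix v w assume vw: "v \<in> fst c" "w \<in> fst c" and e: "snd c v = snd c w"
    obtain m a where m: "m \<in> U" "v = exp_arrow U \<phi> F m a" "base_point v = m" "snd c v = (\<phi> m, a)"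
      by (rule arrow_chart_cases[OF c vw(1)])
    obtain m' a' where m': "m' \<in> U" "w = exp_arrow U \<phi> F m' a'" "base_point w = m'" "snd c w = (\<phi> m', a')"
      by (rule arrow_chart_cases[OF c vw(2)])
    have "\<phi> m = \<phi> m'" "a = a'" using e m(4) m'(4) by auto
    then have "m = m'" using chart_inj[OF C(1)] m(1) m'(1) by (auto dest: inj_onD)
    then show "v = w" using m(2) m'(2) \<open>a = a'\<close> by simp
  qed
  moreover have "open (snd c ` fst c)" unfolding C(6) using chart_image_open[OF C(1)] by (intro open_Times) auto
  ultimately show ?thesis by (simp add: is_chart_simps)
qed

text \<open>By \<open>exp_arrow_change\<close> the transition functions are linear in the fibres, with coefficients built from the
  transition function of \<open>M\<close> and the two frames.\<close>

lemma smooth_near_arrow_charts: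
  assumes c: "arrow_chart U \<phi> F c" and d: "arrow_chart V \<theta> G d" and v: "v \<in> fst c" "v \<in> fst d"
  shows "smooth_near UNIV c d (\<lambda>z. z) v"
proof -
  note C = arrow_chartD[OF c] and D = arrow_chartD[OF d]
  obtain m a where m: "m \<in> U" "v = exp_arrow U \<phi> F m a" "base_point v = m" "snd c v = (\<phi> m, a)"
    by (rule arrow_chart_cases[OF c v(1)])
  have mV: "m \<in> V" using v(2) D(3) m(3) by blast
  obtain S h where S: "open_smooth S h" "\<phi> m \<in> S" "S \<subseteq> \<phi> ` U"
    "\<forall>z\<in>U. \<phi> z \<in> S \<longrightarrow> z \<in> V \<and> \<theta> z = h (\<phi> z)" by (rule chart_transition[OF C(1) D(1) m(1) mV])
  have oS: "open S" by (rule open_smooth_open[OF S(1)])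
  have hV: "h ` S \<subseteq> \<theta> ` V" using S(3,4) by force
  define L where "L x = frechet_derivative h (at x)" for x
  define A where "A x = frame_map (\<lambda>i. F i (inv_into U \<phi> x))" for x
  define A' where "A' x = frame_map (\<lambda>i. G i (inv_into V \<theta> x))" for x
  define R where "R x b = inv (A' (h x)) (L x (A x b))" for x b
  have A: "open_smooth S (\<lambda>x. A x b)" for b
    unfolding A_def by (rule open_smooth_subset[OF frame_map_smooth[OF C(1,2)] oS S(3)])
  have LA: "open_smooth S (\<lambda>x. L x (A x b))" for b
    by (rule open_smooth_linear_family_apply[OF _ _ A])
      (auto simp: L_def intro: open_smooth_derivative_linear[OF S(1)] open_smooth_derivative[OF S(1)])
  have A'lin: "linear (inv (A' (h x)))" if "x \<in> S" for x
  proof -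
    have "inv_into V \<theta> (h x) \<in> V" using hV that by (auto intro!: inv_into_into)
    then show ?thesis unfolding A'_def by (intro inverse_linear(1) linear_frame_map adapted_frameD(1)[OF D(1,2)])
  qed
  have A's: "open_smooth S (\<lambda>x. inv (A' (h x)) b)" for b
    unfolding A'_def by (rule open_smooth_compose[OF S(1) frame_map_inverse_smooth[OF D(1,2)] hV])
  have R: "open_smooth S (\<lambda>x. R x b)" for b
    unfolding R_def by (rule open_smooth_linear_family_apply[OF A'lin A's LA])
  have Rlin: "linear (R x)" if "x \<in> S" for x
  proof -
    have "R x = inv (A' (h x)) \<circ> (L x \<circ> A x)" by (auto simp: R_def)
    moreover have "linear (L x)" unfolding L_def by (rule open_smooth_derivative_linear[OF S(1) that])
    ultimately show ?thesis using A'lin[OF that] linear_compose linear_frame_map by (metis A_def)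
  qed
  let ?S = "S \<times> (UNIV :: (real ^ 'd) set)"
  have oSS: "open ?S" using oS by (intro open_Times) auto
  have fS: "open_smooth ?S fst" and sS: "open_smooth ?S snd"
    using open_smooth_fst[OF open_smooth_ident[OF oSS]] open_smooth_snd[OF open_smooth_ident[OF oSS]] by simp_all
  have hor: "open_smooth ?S (\<lambda>p. hor_part J (snd p))" for J
    by (rule open_smooth_linear_compose[OF bounded_linear_hor_part sS])
  have RS: "open_smooth ?S (\<lambda>p. R (fst p) (hor_part J (snd p)))" for J
    by (rule open_smooth_linear_family_apply[OF _ _ hor])
      (use Rlin open_smooth_compose[OF fS R] in auto)
  define k where "k p = (h (fst p), hor_part I (R (fst p) (hor_part I (snd p))) + hor_part (- I) (R (fst p) (hor_part (- I) (snd p))))" for p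
  have k: "open_smooth ?S k"
    unfolding k_def
    by (intro open_smooth_Pair open_smooth_add open_smooth_linear_compose[OF bounded_linear_hor_part] RS)
       (rule open_smooth_compose[OF fS S(1)], auto)
  show ?thesis
  proof (rule smooth_nearI[OF v(1) k])
    show "snd c v \<in> ?S" using m(4) S(2) by simp
    show "UNIV \<inter> ?S \<subseteq> snd c ` fst c" unfolding C(6) using S(3) by auto
    fix w assume w: "w \<in> fst c" "snd c w \<in> ?S"
    obtain n b where n: "n \<in> U" "w = exp_arrow U \<phi> F n b" "base_point w = n" "snd c w = (\<phi> n, b)"
      by (rule arrow_chart_cases[OF c w(1)])
    have nS: "\<phi> n \<in> S" using w(2) n(4) by simp
    then have nV: "n \<in> V" "\<theta> n = h (\<phi> n)" using S(4) n(1) by auto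
    have An: "A (\<phi> n) = frame_map (\<lambda>i. F i n)" using chart_inj[OF C(1)] n(1) by (simp add: A_def)
    have An': "A' (h (\<phi> n)) = frame_map (\<lambda>i. G i n)" unfolding nV(2)[symmetric] using chart_inj[OF D(1)] nV(1) by (simp add: A'_def)
    have e: "w = exp_arrow V \<theta> G n (snd (k (\<phi> n, b)))"
      unfolding n(2) k_def snd_conv fst_conv R_def An An' L_def
      using exp_arrow_change[OF C(1) D(1) n(1) nV(1) C(2) D(2) chart_transition_jet[OF C(1) n(1) S(1) nS S(4)], of b]
      by (simp add: Let_def)
    have "snd d w = (\<theta> n, snd (k (\<phi> n, b)))" by (subst e, rule D(4)[OF nV(1)])
    then show "w \<in> fst d \<and> snd d w = k (snd c w)"
      using D(3) n(3,4) nV w(1) C(3) by (simp add: k_def)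
  qed
qed

lemma smooth_atlas_THM: "smooth_atlas UNIV (THM_atlas M I H)"
proof (rule smooth_atlasI)
  show "is_chart UNIV c" if "c \<in> THM_atlas M I H" for c
    by (rule THM_atlas_chart[OF that]) (rule is_chart_arrow_chart)
  show "smooth_near UNIV c d (\<lambda>z. z) v" if cd: "c \<in> THM_atlas M I H" "d \<in> THM_atlas M I H" "v \<in> fst c" "v \<in> fst d" for c d v
  proof -
    obtain U \<phi> F where c: "arrow_chart U \<phi> F c" by (rule THM_atlas_chart[OF cd(1)])
    obtain V \<theta> G where d: "arrow_chart V \<theta> G d" by (rule THM_atlas_chart[OF cd(2)])
    show ?thesis by (rule smooth_near_arrow_charts[OF c d cd(3,4)])
  qed
qed

lemma arrow_chart_at:
  assumes "m \<in> points M"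
  obtains U \<phi> F c where "c \<in> THM_atlas M I H" "arrow_chart U \<phi> F c" "m \<in> U"
proof -
  obtain V \<theta> where V: "(V, \<theta>) \<in> SM" "m \<in> V" by (rule chart_at[OF assms])
  obtain T F where T: "open T" "\<theta> m \<in> T" "T \<subseteq> \<theta> ` V" "adapted_frame I H ({z \<in> V. \<theta> z \<in> T}, \<theta>) F"
    by (rule adapted_frame_exists[OF V])
  obtain c where "c \<in> THM_atlas M I H" "arrow_chart {z \<in> V. \<theta> z \<in> T} \<theta> F c"
    by (rule arrow_chart_exists[OF restrict_chart[OF V(1) T(1)] T(4)])
  then show ?thesis by (rule that) (use V T in simp)
qed

lemma base_point_points: "v \<in> THM M I H \<Longrightarrow> base_point v \<in> points M"
  using THM_iff THM_at_points by blast

lemma points_THM: "points (THM_atlas M I H) = THM M I H"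
proof (intro set_eqI iffI)
  fix v assume "v \<in> points (THM_atlas M I H)"
  then obtain c where c: "c \<in> THM_atlas M I H" "v \<in> fst c" unfolding points_iff by blast
  obtain U \<phi> F where "arrow_chart U \<phi> F c" by (rule THM_atlas_chart[OF c(1)])
  then show "v \<in> THM M I H" using arrow_chartD(3)[of U \<phi> F c v] c(2) by simp
next
  fix v assume v: "v \<in> THM M I H"
  obtain U \<phi> F c where c: "c \<in> THM_atlas M I H" "arrow_chart U \<phi> F c" "base_point v \<in> U"
    by (rule arrow_chart_at[OF base_point_points[OF v]])
  then have "v \<in> fst c" using arrow_chartD(3)[OF c(2)] v by blast
  then show "v \<in> points (THM_atlas M I H)" unfolding points_iff using c(1) by blast
qed

lemma smooth_near_base_point:
  assumes c: "arrow_chart U \<phi> F c" and v: "v \<in> fst c"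
  shows "smooth_near UNIV c (U, \<phi>) base_point v"
proof -
  note C = arrow_chartD[OF c]
  have o: "open (\<phi> ` U \<times> (UNIV :: (real ^ 'd) set))" using chart_image_open[OF C(1)] by (intro open_Times) auto
  show ?thesis
  proof (rule smooth_nearI[OF v open_smooth_fst[OF open_smooth_ident[OF o]]])
    show "snd c v \<in> \<phi> ` U \<times> UNIV" using C(6) v by blast
    show "UNIV \<inter> \<phi> ` U \<times> UNIV \<subseteq> snd c ` fst c" unfolding C(6) by auto
    fix w assume "w \<in> fst c"
    then obtain m a where m: "m \<in> U" "base_point w = m" "snd c w = (\<phi> m, a)" by (rule arrow_chart_cases[OF c])
    show "base_point w \<in> fst (U, \<phi>) \<and> snd (U, \<phi>) (base_point w) = fst (snd c w)" using m by simp
  qed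
qed

text \<open>Arrows at the same point lie in a common chart, and arrows at different points are separated by their base
  points.\<close>

lemma Hausdorff_THM: "Hausdorff_space (atlas_topology UNIV (THM_atlas M I H))"
proof (rule Hausdorff_atlasI[OF smooth_atlas_THM])
  fix v w assume vw: "v \<in> points (THM_atlas M I H)" "w \<in> points (THM_atlas M I H)" "v \<noteq> w"
  then have T: "v \<in> THM M I H" "w \<in> THM M I H" by (simp_all add: points_THM)
  let ?T = "atlas_topology UNIV (THM_atlas M I H)"
  show "(\<exists>c\<in>THM_atlas M I H. v \<in> fst c \<and> w \<in> fst c) \<or>
     (\<exists>S T. openin ?T S \<and> openin ?T T \<and> v \<in> S \<and> w \<in> T \<and> disjnt S T)"
  proof (cases "base_point v = base_point w")
    case True
    obtain U \<phi> F c where c: "c \<in> THM_atlas M I H" "arrow_chart U \<phi> F c" "base_point v \<in> U"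
      by (rule arrow_chart_at[OF base_point_points[OF T(1)]])
    then have "v \<in> fst c \<and> w \<in> fst c" using arrow_chartD(3)[OF c(2)] T True by auto
    then show ?thesis using c(1) by blast
  next
    case False
    have o: "openin ?T {v \<in> THM M I H. base_point v \<in> S}" if S: "openin (atlas_topology UNIV M) S" for S
      unfolding openin_atlas_iff(1)[OF smooth_atlas_THM]
    proof
      fix x assume x: "x \<in> {v \<in> THM M I H. base_point v \<in> S}"
      then have xT: "x \<in> THM M I H" by simp
      obtain U \<phi> F c where c: "c \<in> THM_atlas M I H" "arrow_chart U \<phi> F c" "base_point x \<in> U"
        by (rule arrow_chart_at[OF base_point_points[OF xT]])
      have xc: "x \<in> fst c" using arrow_chartD(3)[OF c(2)] xT c(3) by blast
      have S': "openin (atlas_topology UNIV SM) S" using S by (simp add: atlas_topology_SM)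
      have "chart_nbhd (U, \<phi>) S (base_point x)"
        by (rule openin_atlas_iff(2)[OF atlas_SM S' arrow_chartD(1)[OF c(2)]]) (use x c in auto)
      from chart_nbhd_near[OF smooth_near_base_point[OF c(2) xc] this]
      have "chart_nbhd c {z \<in> fst c. base_point z \<in> S} x" .
      then have "chart_nbhd c {v \<in> THM M I H. base_point v \<in> S} x"
        by (rule chart_nbhd_mono) (use arrow_chartD(3)[OF c(2)] in blast)
      then show "\<exists>c\<in>THM_atlas M I H. chart_nbhd c {v \<in> THM M I H. base_point v \<in> S} x" using c(1) by blast
    qed
    have hM: "Hausdorff_space (atlas_topology UNIV M)" using manifold by (simp add: smooth_manifold_def)
    obtain S T' where S: "openin (atlas_topology UNIV M) S" "openin (atlas_topology UNIV M) T'"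
      "base_point v \<in> S" "base_point w \<in> T'" "disjnt S T'"
      by (rule Hausdorff_atlasE[OF atlas_M hM base_point_points[OF T(1)] base_point_points[OF T(2)] False])
    have "disjnt {v \<in> THM M I H. base_point v \<in> S} {v \<in> THM M I H. base_point v \<in> T'}"
      using S(5) by (auto simp: disjnt_def)
    then show ?thesis using o[OF S(1)] o[OF S(2)] S(3,4) T by blast
  qed
qed

lemma countably_covered_M: "countably_covered M"
  using countably_covered_second_countable[OF atlas_M] manifold by (simp add: smooth_manifold_def)

lemma countably_covered_THM: "countably_covered (THM_atlas M I H)"
proof -
  define \<U> where "\<U> = {U. \<exists>\<phi> F. \<exists>c\<in>THM_atlas M I H. arrow_chart U \<phi> F c}"
  have op: "openin (atlas_topology UNIV M) U" if U: "U \<in> \<U>" for U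
  proof -
    from U have "\<exists>\<phi> F. \<exists>c\<in>THM_atlas M I H. arrow_chart U \<phi> F c" unfolding \<U>_def by simp
    then obtain \<phi> F c where "arrow_chart U \<phi> F c" by (elim exE bexE)
    then have "(U, \<phi>) \<in> SM" by (rule arrow_chartD(1))
    from openin_chart_domain[OF atlas_SM this] show ?thesis by (simp add: atlas_topology_SM)
  qed
  have cov: "points M \<subseteq> \<Union>\<U>"
  proof
    fix m assume "m \<in> points M"
    then obtain U \<phi> F c where "c \<in> THM_atlas M I H" "arrow_chart U \<phi> F c" "m \<in> U" by (rule arrow_chart_at)
    then have "U \<in> \<U>" unfolding \<U>_def by (intro CollectI exI[of _ \<phi>] exI[of _ F] bexI[of _ c])
    then show "m \<in> \<Union>\<U>" using \<open>m \<in> U\<close> by blast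
  qed
  have sc: "second_countable (atlas_topology UNIV M)" using manifold by (simp add: smooth_manifold_def)
  obtain \<V> where V: "countable \<V>" "\<V> \<subseteq> \<U>" "points M \<subseteq> \<Union>\<V>"
    by (rule countable_subcover[OF atlas_M sc op cov])
  have "\<forall>U\<in>\<V>. \<exists>c. c \<in> THM_atlas M I H \<and> (\<exists>\<phi> F. arrow_chart U \<phi> F c)"
  proof
    fix U assume "U \<in> \<V>"
    then have "U \<in> \<U>" using V(2) by blast
    then show "\<exists>c. c \<in> THM_atlas M I H \<and> (\<exists>\<phi> F. arrow_chart U \<phi> F c)" unfolding \<U>_def by auto
  qed
  from bchoice[OF this]
  obtain g where g: "\<forall>U\<in>\<V>. g U \<in> THM_atlas M I H \<and> (\<exists>\<phi> F. arrow_chart U \<phi> F (g U))" by (elim exE)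
  have "points (THM_atlas M I H) \<subseteq> points (g ` \<V>)"
  proof
    fix v assume "v \<in> points (THM_atlas M I H)"
    then have v: "v \<in> THM M I H" by (simp add: points_THM)
    then obtain U where U: "U \<in> \<V>" "base_point v \<in> U" using V(3) base_point_points by blast
    from bspec[OF g U(1)] obtain \<phi> F where "arrow_chart U \<phi> F (g U)" by (elim conjE exE)
    then have "v \<in> fst (g U)" using arrow_chartD(3)[of U \<phi> F "g U"] v U(2) by simp
    then show "v \<in> points (g ` \<V>)" unfolding points_iff using U(1) by blast
  qed
  then show ?thesis unfolding countably_covered_def using g V(1) by (intro exI[of _ "g ` \<V>"]) auto
qed

section \<open>Adapted exponential maps in coordinates\<close>

lemma adapted_exp_curve:
  assumes e: "adapted_exp M I H e" and v: "v \<in> THM_at M I H m"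
  shows "parabolic_curve M H (\<lambda>t. e (dilation M I H t v))" "e (dilation M I H 0 v) = m"
    "arrow M I H (\<lambda>t. e (dilation M I H t v)) = v"
proof -
  have b: "base_point v = m" by (rule base_point_THM_at[OF v])
  have "v \<in> THM M I H" using v b THM_iff by simp
  then show a: "arrow M I H (\<lambda>t. e (dilation M I H t v)) = v" using e by (simp add: adapted_exp_def)
  obtain c where c: "parabolic_curve M H c" "v = arrow M I H c" using v unfolding THM_at_def by blast
  then have "c \<in> arrow M I H (\<lambda>t. e (dilation M I H t v))" using arrow_self a by simp
  then show p: "parabolic_curve M H (\<lambda>t. e (dilation M I H t v))" by (simp add: arrow_def arrow_equiv_def)
  show "e (dilation M I H 0 v) = m" using base_point_arrow[OF p] a b by simp
qed

lemma adapted_exp_zero: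
  assumes "adapted_exp M I H e" "(U, \<phi>) \<in> SM" "m \<in> U" "adapted_frame I H (U, \<phi>) F"
  shows "e (exp_arrow U \<phi> F m 0) = m"
  using adapted_exp_curve(2)[OF assms(1) exp_arrow_THM(1)[OF assms(2-4)], of 0] dilation_exp_arrow[OF assms(2-4), of 0 0]
  by simp

lemma adapted_exp_coords:
  assumes e: "adapted_exp M I H e" and c: "c \<in> THM_atlas M I H" "arrow_chart U \<phi> F c"
    and m: "m \<in> U" and V: "(V, \<theta>) \<in> SM" "m \<in> V"
  obtains S h where "open_smooth S h" "(\<phi> m, 0) \<in> S" "S \<subseteq> \<phi> ` U \<times> UNIV"
    "\<forall>z\<in>U. \<forall>a. (\<phi> z, a) \<in> S \<longrightarrow> e (exp_arrow U \<phi> F z a) \<in> V \<and> \<theta> (e (exp_arrow U \<phi> F z a)) = h (\<phi> z, a)"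
proof -
  note C = arrow_chartD[OF c(2)]
  let ?v = "exp_arrow U \<phi> F m 0"
  have ev: "e ?v = m" by (rule adapted_exp_zero[OF e C(1) m C(2)])
  have vc: "?v \<in> fst c" by (rule C(5)[OF m])
  have "m \<in> points M" using m C(1) chart_points by blast
  then obtain d where d: "d \<in> M" "m \<in> fst d" unfolding points_iff by blast
  have sm: "smooth_map UNIV (THM_atlas M I H) UNIV M e" using e by (simp add: adapted_exp_def)
  have 1: "smooth_near UNIV c d e ?v"
    by (rule smooth_map_iff(2)[OF smooth_atlas_THM atlas_M sm c(1) d(1) vc]) (use ev d in simp)
  have 2: "smooth_near UNIV d (V, \<theta>) (\<lambda>z. z) (e ?v)"
    by (rule smooth_atlasD(2)[OF atlas_SM subsetD[OF M_SM d(1)] V(1)]) (use ev d V in auto)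
  show ?thesis
  proof (rule smooth_nearE[OF smooth_near_compose[OF 1 2]])
    fix S h
    assume S: "open_smooth S h" "snd c ?v \<in> S" "UNIV \<inter> S \<subseteq> snd c ` fst c"
      and h: "\<And>z. z \<in> fst c \<Longrightarrow> snd c z \<in> S \<Longrightarrow> e z \<in> fst (V, \<theta>) \<and> snd (V, \<theta>) (e z) = h (snd c z)"
    show ?thesis
    proof (rule that[OF S(1)])
      show "(\<phi> m, 0) \<in> S" using S(2) C(4)[OF m] by simp
      show "S \<subseteq> \<phi> ` U \<times> UNIV" using S(3) C(6) by simp
      show "\<forall>z\<in>U. \<forall>a. (\<phi> z, a) \<in> S \<longrightarrow> e (exp_arrow U \<phi> F z a) \<in> V \<and> \<theta> (e (exp_arrow U \<phi> F z a)) = h (\<phi> z, a)"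
      proof (intro ballI allI impI)
        fix z a assume z: "z \<in> U" "(\<phi> z, a) \<in> S"
        show "e (exp_arrow U \<phi> F z a) \<in> V \<and> \<theta> (e (exp_arrow U \<phi> F z a)) = h (\<phi> z, a)"
          using h[OF C(5)[OF z(1)], of a] C(4)[OF z(1), of a] z(2) by simp
      qed
    qed
  qed
qed

definition fibre_derivative :: "((real ^ 'd) \<times> (real ^ 'd) \<Rightarrow> real ^ 'd) \<Rightarrow> real ^ 'd \<Rightarrow> real ^ 'd \<Rightarrow> real ^ 'd" where
  "fibre_derivative h x a = frechet_derivative h (at (x, 0)) (0, a)"

lemma linear_fibre_derivative:
  assumes "open_smooth S h" "(x, 0) \<in> S" shows "linear (fibre_derivative h x)"
proof -
  have "linear (frechet_derivative h (at (x, 0)))" by (rule open_smooth_derivative_linear[OF assms])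
  moreover have "linear (\<lambda>a::real ^ 'd. (0::real ^ 'd, a))" by (simp add: linear_iff)
  ultimately have "linear (frechet_derivative h (at (x, 0)) \<circ> (\<lambda>a. (0, a)))" by (rule linear_compose[rotated])
  then show ?thesis by (simp add: fibre_derivative_def[abs_def] o_def)
qed

lemma fibre_jet:
  assumes "open_smooth S h" "(x, 0) \<in> S" "has_jet g u w" "g 0 = 0"
  shows "has_jet (\<lambda>t. h (x, g t)) (fibre_derivative h x u) (fibre_derivative h x w + second_derivative h (x, 0) (0, u))"
proof -
  have "has_jet (\<lambda>t. h ((\<lambda>t. (x, g t)) t)) (frechet_derivative h (at ((\<lambda>t. (x, g t)) 0)) (0, u))
    (frechet_derivative h (at ((\<lambda>t. (x, g t)) 0)) (0, w) + second_derivative h ((\<lambda>t. (x, g t)) 0) (0, u))"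
    by (rule has_jet_compose[OF assms(1) has_jet_const_Pair[OF assms(3)]]) (use assms in simp)
  then show ?thesis using assms(4) by (simp add: fibre_derivative_def)
qed

text \<open>The defining property of an adapted exponential map expresses an arrow by the derivatives of the map
  along the fibre.\<close>

lemma adapted_exp_arrow:
  assumes e: "adapted_exp M I H e" and c: "arrow_chart U \<phi> F c" and m: "m \<in> U" and V: "(V, \<theta>) \<in> SM" "m \<in> V"
    and S: "open_smooth S h" "(\<phi> m, 0) \<in> S"
    "\<forall>z\<in>U. \<forall>a. (\<phi> z, a) \<in> S \<longrightarrow> e (exp_arrow U \<phi> F z a) \<in> V \<and> \<theta> (e (exp_arrow U \<phi> F z a)) = h (\<phi> z, a)"
  shows "exp_arrow U \<phi> F m a = coord_arrow V \<theta> m (fibre_derivative h (\<phi> m) (hor_part I a))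
      (fibre_derivative h (\<phi> m) (2 *\<^sub>R hor_part (- I) a) + second_derivative h (\<phi> m, 0) (0, hor_part I a))"
    "fibre_derivative h (\<phi> m) (hor_part I a) \<in> tcoord \<theta> ` H m"
proof -
  note C = arrow_chartD[OF c]
  let ?v = "exp_arrow U \<phi> F m a"
  let ?c = "\<lambda>t. e (dilation M I H t ?v)"
  let ?g = "\<lambda>t. parabolic_dilation I t a"
  note v = exp_arrow_THM(1)[OF C(1) m C(2), of a]
  note ec = adapted_exp_curve[OF e v]
  have j: "has_jet (\<lambda>t. h (\<phi> m, ?g t)) (fibre_derivative h (\<phi> m) (hor_part I a))
     (fibre_derivative h (\<phi> m) (2 *\<^sub>R hor_part (- I) a) + second_derivative h (\<phi> m, 0) (0, hor_part I a))"
    by (rule fibre_jet[OF S(1,2) has_jet_dilation]) simp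
  obtain N where N: "open N" "0 \<in> N" "\<forall>t\<in>N. (\<phi> m, ?g t) \<in> S"
    by (rule has_jet_continuous[OF has_jet_const_Pair[OF has_jet_dilation] open_smooth_open[OF S(1)], of "\<phi> m" I a])
      (use S(2) in auto)
  have j': "has_jet (\<theta> \<circ> ?c) (fibre_derivative h (\<phi> m) (hor_part I a))
     (fibre_derivative h (\<phi> m) (2 *\<^sub>R hor_part (- I) a) + second_derivative h (\<phi> m, 0) (0, hor_part I a))"
  proof (rule has_jet_cong[OF j N(1,2)])
    fix t assume "t \<in> N"
    then have "\<theta> (e (exp_arrow U \<phi> F m (?g t))) = h (\<phi> m, ?g t)" using S(3) N(3) m by blast
    then show "h (\<phi> m, ?g t) = (\<theta> \<circ> ?c) t" using dilation_exp_arrow[OF C(1) m C(2)] by simp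
  qed
  note vel = jet_velocity[OF j']
  show "?v = coord_arrow V \<theta> m (fibre_derivative h (\<phi> m) (hor_part I a))
      (fibre_derivative h (\<phi> m) (2 *\<^sub>R hor_part (- I) a) + second_derivative h (\<phi> m, 0) (0, hor_part I a))"
    using arrow_eq_coord_arrow(1)[where c = ?c, OF V(1) ec(2) V(2) ec(1)] vel ec(3) by simp
  show "fibre_derivative h (\<phi> m) (hor_part I a) \<in> tcoord \<theta> ` H m"
    using arrow_eq_coord_arrow(2)[where c = ?c, OF V(1) ec(2) V(2) ec(1)] vel by simp
qed

text \<open>If the derivative mapped a normal vector \<open>a\<close> into \<open>H\<close>, then the arrow with coordinates \<open>a\<close> would have velocity
  \<open>0\<close> and acceleration in \<open>H\<close>, and so be trivial.  Hence vectors that are mapped into \<open>H\<close> are horizontal, in particular those in the kernel, and on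
  horizontal vectors the derivative yields the velocities of the corresponding arrows, which determine them.\<close>

lemma fibre_derivative_horizontal:
  assumes e: "adapted_exp M I H e" and c: "arrow_chart U \<phi> F c" and m: "m \<in> U" and V: "(V, \<theta>) \<in> SM" "m \<in> V"
    and S: "open_smooth S h" "(\<phi> m, 0) \<in> S"
    "\<forall>z\<in>U. \<forall>a. (\<phi> z, a) \<in> S \<longrightarrow> e (exp_arrow U \<phi> F z a) \<in> V \<and> \<theta> (e (exp_arrow U \<phi> F z a)) = h (\<phi> z, a)"
  shows "fibre_derivative h (\<phi> m) a \<in> tcoord \<theta> ` H m \<Longrightarrow> a \<in> horizontal I"
    "inj (fibre_derivative h (\<phi> m))"
proof -
  note C = arrow_chartD[OF c]
  let ?L = "fibre_derivative h (\<phi> m)"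
  note lin = linear_fibre_derivative[OF S(1,2)]
  note sub = subspace_H[OF V]
  note A = adapted_exp_arrow[OF e c m V S]
  have q0: "second_derivative h (\<phi> m, 0) (0, 0) = 0"
    using second_derivative_scale[OF S(1,2), of 0 "(0, 0)"] by simp
  show hz: "a \<in> horizontal I" if a: "?L a \<in> tcoord \<theta> ` H m" for a
  proof -
    have "?L (hor_part (- I) a) = ?L a - ?L (hor_part I a)"
      using linear_diff[OF lin] by (simp add: hor_part_Compl)
    then have "?L (hor_part (- I) a) \<in> tcoord \<theta> ` H m"
      using subspace_diff[OF sub a A(2)] by simp
    from subspace_scale[OF sub this, of 2]
    have vH: "?L (2 *\<^sub>R hor_part (- I) a) \<in> tcoord \<theta> ` H m" by (simp add: linear_scale[OF lin])
    have z: "hor_part I (hor_part (- I) a) = 0" "hor_part I 0 = 0" "hor_part (- I) 0 = 0"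
      "hor_part (- I) (hor_part (- I) a) = hor_part (- I) a" by (simp_all add: vec_eq_iff)
    have 1: "exp_arrow U \<phi> F m (hor_part (- I) a) = coord_arrow V \<theta> m 0 (?L (2 *\<^sub>R hor_part (- I) a))"
      using A(1)[of "hor_part (- I) a"] by (simp only: z) (simp add: q0 linear_0[OF lin])
    have 2: "exp_arrow U \<phi> F m 0 = coord_arrow V \<theta> m 0 0"
      using A(1)[of 0] by (simp only: z) (simp add: q0 linear_0[OF lin])
    have "exp_arrow U \<phi> F m (hor_part (- I) a) = exp_arrow U \<phi> F m 0"
      unfolding 1 2 coord_arrow_eq_iff[OF V subspace_0[OF sub] subspace_0[OF sub]] using vH by simp
    then have "hor_part (- I) a = 0" by (rule exp_arrow_inj[OF C(1) m C(2)])
    then show ?thesis by (simp add: hor_part_Compl_eq_0_iff)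
  qed
  have "a = 0" if a: "?L a = 0" for a
  proof -
    have ah: "hor_part I a = a" using hz[of a] a subspace_0[OF sub] hor_part_horizontal by auto
    let ?B = "frame_map (\<lambda>i. F i m)"
    obtain L Q where L: "jet_change m \<phi> \<theta> L Q" by (rule change_of_chart[OF C(1) V(1) m V(2)])
    have bH: "?B (hor_part I a) \<in> tcoord \<phi> ` H m"
      using frame_map_mem_H_iff[OF C(1,2) m] hor_part_in_horizontal by simp
    note cc = coord_arrow_change[OF C(1) V(1) m V(2) L bH]
    have "L (?B (hor_part I a)) = ?L (hor_part I a)"
      using A(1)[of a] unfolding exp_arrow_def cc(1) coord_arrow_eq_iff[OF V cc(2) A(2)] by blast
    moreover have "?B 0 = 0" by (rule linear_0[OF linear_frame_map])
    moreover have "L 0 = 0" by (rule linear_0[OF jet_changeD(1)[OF L]])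
    ultimately have "L (?B a) = L (?B 0)" by (simp only: a ah)
    then have "?B a = ?B 0" using jet_change_inj[OF C(1) V(1) m V(2) L] by (rule injD[rotated])
    then show ?thesis using adapted_frameD(1)[OF C(1,2) m] by (rule injD[rotated])
  qed
  then show "inj ?L" using linear_injective_0[OF lin] by blast
qed

section \<open>The transition function near zero\<close>

text \<open>The function \<open>\<nu>\<close> is the fibre component of the transition function near the point \<open>(exp_arrow U \<phi> F m0 a0, 0)\<close>.
  It solves \<open>e2 (\<delta>\<^sub>t \<nu>) = e1 (\<delta>\<^sub>t a)\<close> on a two-sided interval around \<open>t = 0\<close>.\<close>

lemma exp_transition:
  assumes e1: "adapted_exp M I H e1" and e2: "adapted_exp M I H e2"
    and c: "c \<in> THM_atlas M I H" "arrow_chart U \<phi> F c" and m0: "m0 \<in> U"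
  obtains B r \<nu> where "open B" "(\<phi> m0, a0) \<in> B" "B \<subseteq> \<phi> ` U \<times> UNIV" "r > 0" "open_smooth (B \<times> {-r<..<r}) \<nu>"
    "\<forall>m\<in>U. \<forall>a. (\<phi> m, a) \<in> B \<longrightarrow> \<nu> ((\<phi> m, a), 0) = a"
    "\<forall>m\<in>U. \<forall>a. (\<phi> m, a) \<in> B \<longrightarrow> (\<forall>t\<in>{-r<..<r}.
       e2 (dilation M I H t (exp_arrow U \<phi> F m (\<nu> ((\<phi> m, a), t)))) = e1 (dilation M I H t (exp_arrow U \<phi> F m a)))"
proof -
  note C = arrow_chartD[OF c(2)]
  have inj\<phi>: "inj_on \<phi> U" by (rule chart_inj[OF C(1)])
  have "m0 \<in> points M" using m0 C(1) chart_points by blast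
  then obtain V \<theta> where V: "(V, \<theta>) \<in> SM" "m0 \<in> V" by (rule chart_at)
  have inj\<theta>: "inj_on \<theta> V" by (rule chart_inj[OF V(1)])
  obtain S1 h1 where S1: "open_smooth S1 h1" "(\<phi> m0, 0) \<in> S1" "S1 \<subseteq> \<phi> ` U \<times> UNIV" and
    h1: "\<forall>z\<in>U. \<forall>a. (\<phi> z, a) \<in> S1 \<longrightarrow> e1 (exp_arrow U \<phi> F z a) \<in> V \<and> \<theta> (e1 (exp_arrow U \<phi> F z a)) = h1 (\<phi> z, a)"
    by (rule adapted_exp_coords[OF e1 c m0 V])
  obtain S2 h2 where S2: "open_smooth S2 h2" "(\<phi> m0, 0) \<in> S2" "S2 \<subseteq> \<phi> ` U \<times> UNIV" and
    h2: "\<forall>z\<in>U. \<forall>a. (\<phi> z, a) \<in> S2 \<longrightarrow> e2 (exp_arrow U \<phi> F z a) \<in> V \<and> \<theta> (e2 (exp_arrow U \<phi> F z a)) = h2 (\<phi> z, a)"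
    by (rule adapted_exp_coords[OF e2 c m0 V])
  have base: "m \<in> V \<and> h1 (\<phi> m, 0) = \<theta> m \<and> h2 (\<phi> m, 0) = \<theta> m"
    if "m \<in> U" "(\<phi> m, 0) \<in> S1" "(\<phi> m, 0) \<in> S2" for m
  proof -
    have "e1 (exp_arrow U \<phi> F m 0) = m" "e2 (exp_arrow U \<phi> F m 0) = m"
      using adapted_exp_zero[OF e1 C(1) that(1) C(2)] adapted_exp_zero[OF e2 C(1) that(1) C(2)] .
    moreover have "e1 (exp_arrow U \<phi> F m 0) \<in> V \<and> \<theta> (e1 (exp_arrow U \<phi> F m 0)) = h1 (\<phi> m, 0)" using h1 that by blast
    moreover have "\<theta> (e2 (exp_arrow U \<phi> F m 0)) = h2 (\<phi> m, 0)" using h2 that by blast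
    ultimately show ?thesis by simp
  qed
  \<comment> \<open>Adding the base point as a component inverts all fibres at once, smoothly in the base point.\<close>
  define G where "G p = (fst p, h2 p)" for p
  have G: "open_smooth S2 G" unfolding G_def
    by (intro open_smooth_Pair S2(1) open_smooth_fst open_smooth_ident open_smooth_open[OF S2(1)])
  have injG: "inj (frechet_derivative G (at (\<phi> m0, 0)))"
  proof -
    let ?D = "frechet_derivative h2 (at (\<phi> m0, 0))"
    have "(G has_derivative (\<lambda>q. (fst q, ?D q))) (at (\<phi> m0, 0))"
      unfolding G_def by (intro has_derivative_Pair has_derivative_fst has_derivative_ident open_smooth_has_derivative[OF S2(1,2)])
    then have D: "frechet_derivative G (at (\<phi> m0, 0)) = (\<lambda>q. (fst q, ?D q))" by (rule frechet_derivative_at[symmetric])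
    have "q = 0" if "(fst q, ?D q) = 0" for q
    proof -
      have "fst q = 0" "?D q = 0" using that by (simp_all add: prod_eq_iff)
      then have "fibre_derivative h2 (\<phi> m0) (snd q) = fibre_derivative h2 (\<phi> m0) 0"
        using linear_0[OF linear_fibre_derivative[OF S2(1,2)]] unfolding fibre_derivative_def by (metis prod.collapse)
      then have "snd q = 0" by (rule injD[OF fibre_derivative_horizontal(2)[OF e2 c(2) m0 V S2(1,2) h2]])
      then show ?thesis using \<open>fst q = 0\<close> by (simp add: prod_eq_iff)
    qed
    moreover have "linear (frechet_derivative G (at (\<phi> m0, 0)))" by (rule open_smooth_derivative_linear[OF G S2(2)])
    ultimately show ?thesis using linear_injective_0 unfolding D by blast
  qed
  obtain U' V' g where U': "open U'" "U' \<subseteq> S2" "(\<phi> m0, 0) \<in> U'" and V': "G (\<phi> m0, 0) \<in> V'" and g: "open_smooth V' g"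
    and gG: "\<And>x. x \<in> U' \<Longrightarrow> G x \<in> V' \<and> g (G x) = x" and Gg: "\<And>y. y \<in> V' \<Longrightarrow> g y \<in> U' \<and> G (g y) = y"
    by (fact smooth_inverse_function_theorem[OF G S2(2) injG])
  define \<delta> where "\<delta> p = (fst (fst p), parabolic_dilation I (snd p) (snd (fst p)))" for p :: "((real ^ 'd) \<times> (real ^ 'd)) \<times> real"
  have \<delta>: "open_smooth UNIV \<delta>" unfolding \<delta>_def
    by (intro open_smooth_Pair open_smooth_dilation open_smooth_fst open_smooth_ident open_UNIV)
  define k where "k p = (fst (fst p), h1 (\<delta> p))" for p
  define P1 where "P1 = \<delta> -` S1"
  have oP1: "open P1" using open_smooth_preimage[OF \<delta> open_smooth_open[OF S1(1)]] by (simp add: P1_def)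
  have k: "open_smooth P1 k" unfolding k_def
    by (intro open_smooth_Pair open_smooth_fst open_smooth_ident oP1
        open_smooth_compose[OF open_smooth_subset[OF \<delta> oP1] S1(1)]) (auto simp: P1_def)
  define z0 where "z0 p = (fst (fst p), 0::real ^ 'd)" for p :: "((real ^ 'd) \<times> (real ^ 'd)) \<times> real"
  have z0: "open_smooth UNIV z0" unfolding z0_def by (intro open_smooth_Pair open_smooth_fst open_smooth_ident open_smooth_const open_UNIV)
  \<comment> \<open>The last condition keeps the zero vectors over the region in the domains of both maps, so that \<open>f\<close> can be
    computed at \<open>t = 0\<close>.\<close>
  define P where "P = (P1 \<inter> k -` V') \<inter> (z0 -` (U' \<inter> S1))"
  have oP: "open P"
  proof -
    have "open (z0 -` (U' \<inter> S1))" using open_smooth_preimage[OF z0, of "U' \<inter> S1"] U'(1) open_smooth_open[OF S1(1)] by auto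
    moreover have "open (P1 \<inter> k -` V')" by (rule open_smooth_preimage[OF k open_smooth_open[OF g]])
    ultimately show ?thesis unfolding P_def by blast
  qed
  have b0: "h1 (\<phi> m0, 0) = h2 (\<phi> m0, 0)" using base[OF m0 S1(2) S2(2)] by simp
  have p0: "((\<phi> m0, a0), 0) \<in> P"
    using S1(2) U'(3) V' b0 by (simp add: P_def P1_def k_def \<delta>_def z0_def G_def)
  obtain B J where BJ0: "open B" "open J" "((\<phi> m0, a0), 0) \<in> B \<times> J" "B \<times> J \<subseteq> P"
    by (rule open_prod_elim[OF oP p0])
  then have BJ: "(\<phi> m0, a0) \<in> B" "0 \<in> J" by simp_all
  obtain r where r: "r > 0" "ball 0 r \<subseteq> J" by (rule openE[OF BJ0(2) BJ(2)])
  then have rJ: "{-r<..<r} \<subseteq> J" by (simp add: ball_eq_greaterThanLessThan)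
  have BrP: "B \<times> {-r<..<r} \<subseteq> P" using BJ0(4) rJ by blast
  have oi: "open {-r<..<r}" and zero: "0 \<in> {-r<..<r}" using r by auto
  have oB: "open (B \<times> {-r<..<r})" by (intro open_Times BJ0(1) oi)
  have BU: "B \<subseteq> \<phi> ` U \<times> UNIV"
  proof
    fix z assume "z \<in> B"
    then have "(z, 0) \<in> P" using BrP zero by blast
    then have "(fst z, 0) \<in> S1" by (simp add: P_def z0_def)
    then show "z \<in> \<phi> ` U \<times> UNIV" using S1(3) by (auto simp: mem_Times_iff)
  qed
  \<comment> \<open>The solution of \<open>h2 (x, f) = h1 (x, \<delta>\<^sub>t a)\<close>.\<close>
  define f where "f p = snd (g (k p))" for p
  have f: "open_smooth (B \<times> {-r<..<r}) f"
    unfolding f_def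
    by (intro open_smooth_snd open_smooth_compose[OF open_smooth_subset[OF k oB] g]) (use BrP in \<open>auto simp: P_def\<close>)
  have fk: "g (k p) = (fst (fst p), f p) \<and> (fst (fst p), f p) \<in> U' \<and> h2 (fst (fst p), f p) = h1 (\<delta> p)"
    if "p \<in> P" for p
  proof -
    have kV: "k p \<in> V'" using that by (simp add: P_def)
    have G1: "g (k p) \<in> U'" "G (g (k p)) = k p" using Gg[OF kV] by auto
    have "fst (g (k p)) = fst (fst p)" "h2 (g (k p)) = h1 (\<delta> p)" using G1(2) by (simp_all add: G_def k_def)
    then have e: "g (k p) = (fst (fst p), f p)" by (simp add: f_def prod_eq_iff)
    then show ?thesis using G1(1) \<open>h2 (g (k p)) = h1 (\<delta> p)\<close> by simp
  qed
  have Bm: "(\<phi> m, 0) \<in> S1 \<and> (\<phi> m, 0) \<in> U' \<and> (\<phi> m, 0) \<in> S2" if "(\<phi> m, a) \<in> B" for m a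
  proof -
    have "((\<phi> m, a), 0) \<in> P" using BrP that zero by blast
    then show ?thesis using U'(2) by (auto simp: P_def z0_def)
  qed
  have f0: "\<forall>z\<in>B. f (z, 0) = 0"
  proof
    fix z assume z: "z \<in> B"
    obtain m a where m: "m \<in> U" "z = (\<phi> m, a)" using BU z by blast
    have b: "(\<phi> m, 0) \<in> S1" "(\<phi> m, 0) \<in> U'" "(\<phi> m, 0) \<in> S2" using Bm z m(2) by blast+
    have "k (z, 0) = G (\<phi> m, 0)" using base[OF m(1) b(1,3)] m(2) by (simp add: k_def \<delta>_def G_def)
    then show "f (z, 0) = 0" using gG[OF b(2)] by (simp add: f_def)
  qed
  obtain g1 where g1: "open_smooth (B \<times> {-r<..<r}) g1" and fg1: "\<forall>z\<in>B. \<forall>t\<in>{-r<..<r}. f (z, t) = t *\<^sub>R g1 (z, t)"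
    by (rule open_smooth_divide_by_variable[OF f BJ0(1) f0])
  have jets: "\<exists>u w. has_jet (\<lambda>t. q (z, t)) u w" if "open_smooth (B \<times> {-r<..<r}) q" "z \<in> B" for q :: "((real ^ 'd) \<times> (real ^ 'd)) \<times> real \<Rightarrow> real ^ 'd" and z
  proof -
    have "open_smooth {-r<..<r} (\<lambda>t. q (z, t))"
      by (rule open_smooth_compose[OF _ that(1)]) (use that(2) in \<open>auto intro!: open_smooth_Pair open_smooth_const open_smooth_ident\<close>)
    then show ?thesis using has_jet_smooth zero by blast
  qed
  \<comment> \<open>The equation for \<open>f\<close> expresses its jet by the derivatives of \<open>h1\<close> and \<open>h2\<close>, and these are related, in second
    order modulo \<open>H\<close>, because both exponential maps represent the arrow with coordinates \<open>a\<close>.  Together this gives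
    \<open>f / t\<close> at \<open>t = 0\<close> and the normal part of its derivative.\<close>
  have main: "g1 (z, 0) = hor_part I a \<and> hor_part (- I) u = hor_part (- I) a"
    if m: "m \<in> U" and z: "z = (\<phi> m, a)" "z \<in> B" and u: "has_jet (\<lambda>t. g1 (z, t)) u w" for m a z u w
  proof -
    have b: "(\<phi> m, 0) \<in> S1" "(\<phi> m, 0) \<in> U'" "(\<phi> m, 0) \<in> S2" using Bm z by blast+
    have mV: "m \<in> V" using base[OF m b(1,3)] by simp
    let ?L1 = "fibre_derivative h1 (\<phi> m)" and ?L2 = "fibre_derivative h2 (\<phi> m)"
    let ?p = "g1 (z, 0)" and ?q = "2 *\<^sub>R u"
    have jf: "has_jet (\<lambda>t. f (z, t)) ?p ?q"
      by (rule has_jet_cong[OF has_jet_scaleR_variable[OF u] oi zero]) (use fg1 z in simp)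
    have j2: "has_jet (\<lambda>t. h2 (\<phi> m, f (z, t))) (?L2 ?p) (?L2 ?q + second_derivative h2 (\<phi> m, 0) (0, ?p))"
      by (rule fibre_jet[OF S2(1) b(3) jf]) (use f0 z in simp)
    have j1: "has_jet (\<lambda>t. h1 (\<phi> m, parabolic_dilation I t a)) (?L1 (hor_part I a))
      (?L1 (2 *\<^sub>R hor_part (- I) a) + second_derivative h1 (\<phi> m, 0) (0, hor_part I a))"
      by (rule fibre_jet[OF S1(1) b(1) has_jet_dilation]) simp
    have "has_jet (\<lambda>t. h2 (\<phi> m, f (z, t))) (?L1 (hor_part I a))
      (?L1 (2 *\<^sub>R hor_part (- I) a) + second_derivative h1 (\<phi> m, 0) (0, hor_part I a))"
    proof (rule has_jet_cong[OF j1 oi zero])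
      fix t assume "t \<in> {-r<..<r}"
      then have "(z, t) \<in> P" using BrP z(2) by blast
      from fk[OF this] show "h1 (\<phi> m, parabolic_dilation I t a) = h2 (\<phi> m, f (z, t))" by (simp add: z(1) \<delta>_def)
    qed
    from has_jet_unique[OF j2 this]
    have E1: "?L2 ?p = ?L1 (hor_part I a)" and
      E2: "?L2 ?q + second_derivative h2 (\<phi> m, 0) (0, ?p) =
        ?L1 (2 *\<^sub>R hor_part (- I) a) + second_derivative h1 (\<phi> m, 0) (0, hor_part I a)" by auto
    note A1 = adapted_exp_arrow[OF e1 c(2) m V(1) mV S1(1) b(1) h1, of a]
    note A2 = adapted_exp_arrow[OF e2 c(2) m V(1) mV S2(1) b(3) h2, of a]
    note Z2 = fibre_derivative_horizontal[OF e2 c(2) m V(1) mV S2(1) b(3) h2]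
    note lin2 = linear_fibre_derivative[OF S2(1) b(3)]
    from A1(1)[unfolded A2(1) coord_arrow_eq_iff[OF V(1) mV A2(2) A1(2)]]
    have K1: "?L2 (hor_part I a) = ?L1 (hor_part I a)" and
      K2: "?L2 (2 *\<^sub>R hor_part (- I) a) + second_derivative h2 (\<phi> m, 0) (0, hor_part I a) -
       (?L1 (2 *\<^sub>R hor_part (- I) a) + second_derivative h1 (\<phi> m, 0) (0, hor_part I a)) \<in> tcoord \<theta> ` H m"
      by auto
    have p: "?p = hor_part I a" by (rule injD[OF Z2(2)]) (use E1 K1 in simp)
    have "?L2 (2 *\<^sub>R hor_part (- I) a - ?q) = ?L2 (2 *\<^sub>R hor_part (- I) a) + second_derivative h2 (\<phi> m, 0) (0, hor_part I a) -
       (?L1 (2 *\<^sub>R hor_part (- I) a) + second_derivative h1 (\<phi> m, 0) (0, hor_part I a))"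
      using E2 unfolding p by (simp add: linear_diff[OF lin2] algebra_simps)
    then have "?L2 (2 *\<^sub>R hor_part (- I) a - ?q) \<in> tcoord \<theta> ` H m" using K2 by simp
    then have "2 *\<^sub>R hor_part (- I) a - ?q \<in> horizontal I" by (rule Z2(1))
    then have "hor_part (- I) u = hor_part (- I) a" by (auto simp: horizontal_iff vec_eq_iff)
    with p show ?thesis by simp
  qed
  \<comment> \<open>The normal part of \<open>f / t\<close> vanishes at \<open>t = 0\<close> and can be divided by \<open>t\<close> again.\<close>
  define gN where "gN p = hor_part (- I) (g1 p)" for p
  have gN: "open_smooth (B \<times> {-r<..<r}) gN" unfolding gN_def by (rule open_smooth_linear_compose[OF bounded_linear_hor_part g1])
  have gN0: "\<forall>z\<in>B. gN (z, 0) = 0"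
  proof
    fix z assume z: "z \<in> B"
    obtain m a where m: "m \<in> U" "z = (\<phi> m, a)" using BU z by blast
    obtain u w where "has_jet (\<lambda>t. g1 (z, t)) u w" using jets[OF g1 z] by blast
    from main[OF m z this] show "gN (z, 0) = 0" by (simp add: gN_def)
  qed
  obtain g2 where g2: "open_smooth (B \<times> {-r<..<r}) g2" and gNg2: "\<forall>z\<in>B. \<forall>t\<in>{-r<..<r}. gN (z, t) = t *\<^sub>R g2 (z, t)"
    by (rule open_smooth_divide_by_variable[OF gN BJ0(1) gN0])
  have g20: "g2 (z, 0) = hor_part (- I) a" if m: "m \<in> U" and z: "z = (\<phi> m, a)" "z \<in> B" for m a z
  proof -
    obtain u w where u: "has_jet (\<lambda>t. g1 (z, t)) u w" using jets[OF g1 z(2)] by blast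
    obtain u2 w2 where u2: "has_jet (\<lambda>t. g2 (z, t)) u2 w2" using jets[OF g2 z(2)] by blast
    have "has_jet (\<lambda>t. gN (z, t)) (hor_part (- I) u) (hor_part (- I) w)"
      unfolding gN_def by (rule has_jet_linear[OF bounded_linear_hor_part u])
    moreover have "has_jet (\<lambda>t. gN (z, t)) (g2 (z, 0)) (2 *\<^sub>R u2)"
      by (rule has_jet_cong[OF has_jet_scaleR_variable[OF u2] oi zero]) (use gNg2 z in simp)
    ultimately have "g2 (z, 0) = hor_part (- I) u" using has_jet_unique by blast
    then show ?thesis using main[OF m z u] by simp
  qed
  define \<nu> where "\<nu> p = hor_part I (g1 p) + hor_part (- I) (g2 p)" for p
  have \<nu>: "open_smooth (B \<times> {-r<..<r}) \<nu>" unfolding \<nu>_def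
    by (intro open_smooth_add open_smooth_linear_compose[OF bounded_linear_hor_part] g1 g2)
  have \<nu>0: "\<nu> ((\<phi> m, a), 0) = a" if m: "m \<in> U" "(\<phi> m, a) \<in> B" for m a
  proof -
    obtain u w where u: "has_jet (\<lambda>t. g1 ((\<phi> m, a), t)) u w" using jets[OF g1 m(2)] by blast
    show ?thesis using main[OF m(1) refl m(2) u] g20[OF m(1) refl m(2)] by (simp add: \<nu>_def vec_eq_iff)
  qed
  have \<nu>f: "parabolic_dilation I t (\<nu> (z, t)) = f (z, t)" if z: "z \<in> B" "t \<in> {-r<..<r}" for z t
  proof -
    have n: "gN (z, t) = t *\<^sub>R g2 (z, t)" "f (z, t) = t *\<^sub>R g1 (z, t)" using gNg2 fg1 z by blast+
    have "parabolic_dilation I t (\<nu> (z, t)) = t *\<^sub>R hor_part I (g1 (z, t)) + t *\<^sub>R hor_part (- I) (t *\<^sub>R g2 (z, t))"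
      by (simp add: parabolic_dilation_def \<nu>_def vec_eq_iff power2_eq_square)
    also have "\<dots> = t *\<^sub>R (hor_part I (g1 (z, t)) + hor_part (- I) (g1 (z, t)))"
      unfolding n(1)[symmetric] gN_def by (simp add: vec_eq_iff)
    finally show ?thesis using n(2) by (simp add: hor_part_split)
  qed
  have trans: "e2 (dilation M I H t (exp_arrow U \<phi> F m (\<nu> ((\<phi> m, a), t)))) = e1 (dilation M I H t (exp_arrow U \<phi> F m a))"
    if m: "m \<in> U" "(\<phi> m, a) \<in> B" "t \<in> {-r<..<r}" for m a t
  proof -
    let ?p = "((\<phi> m, a), t)"
    have pP: "?p \<in> P" using BrP m by blast
    have F1: "(\<phi> m, f ?p) \<in> U'" "h2 (\<phi> m, f ?p) = h1 (\<phi> m, parabolic_dilation I t a)"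
      using fk[OF pP] by (simp_all add: \<delta>_def)
    have d1: "(\<phi> m, parabolic_dilation I t a) \<in> S1" using pP by (simp add: P_def P1_def \<delta>_def)
    have d2: "(\<phi> m, f ?p) \<in> S2" using F1(1) U'(2) by blast
    have x1: "e1 (exp_arrow U \<phi> F m (parabolic_dilation I t a)) \<in> V \<and>
       \<theta> (e1 (exp_arrow U \<phi> F m (parabolic_dilation I t a))) = h1 (\<phi> m, parabolic_dilation I t a)" using h1 m(1) d1 by blast
    have x2: "e2 (exp_arrow U \<phi> F m (f ?p)) \<in> V \<and> \<theta> (e2 (exp_arrow U \<phi> F m (f ?p))) = h2 (\<phi> m, f ?p)"
      using h2 m(1) d2 by blast
    have "e2 (exp_arrow U \<phi> F m (f ?p)) = e1 (exp_arrow U \<phi> F m (parabolic_dilation I t a))"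
      by (rule inj_onD[OF inj\<theta>]) (use x1 x2 F1(2) in auto)
    then show ?thesis by (simp add: dilation_exp_arrow[OF C(1) m(1) C(2)] \<nu>f[OF m(2,3)])
  qed
  show ?thesis
    by (rule that[OF BJ0(1) BJ(1) BU r(1) \<nu>]; intro ballI allI impI; (rule \<nu>0 | rule trans); assumption)
qed

section \<open>The parabolic tangent groupoid\<close>

abbreviation (input) TI where "TI \<equiv> THM_interval M I H"

abbreviation (input) PI where "PI \<equiv> pair_interval M"

lemma smooth_atlas_TI: "smooth_atlas bd_model TI"
  unfolding THM_interval_def by (rule smooth_atlas_prod[OF smooth_atlas_THM smooth_atlas_interval]) simp

lemma openin_interval: "openin (top_of_set {0..1}) {0<..1::real}"
proof -
  have "{0<..1::real} = {0..1} \<inter> {0<..}" by auto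
  then show ?thesis by (simp add: openin_open_Int)
qed

lemma smooth_atlas_PI: "smooth_atlas bd_model PI"
  unfolding pair_interval_def UNIV_Times_UNIV[symmetric]
  by (rule smooth_atlas_prod[OF smooth_atlas_prod[OF atlas_M atlas_M] smooth_atlas_interval[OF openin_interval]])

lemma points_TI: "points TI = THM M I H \<times> {0..1}"
  by (simp add: THM_interval_def points_prod_atlas points_THM points_interval)

lemma points_PI: "points PI = (points M \<times> points M) \<times> {0<..1}"
  by (simp add: pair_interval_def points_prod_atlas points_interval)

lemma Hausdorff_TI: "Hausdorff_space (atlas_topology bd_model TI)"
  unfolding THM_interval_def
  by (rule Hausdorff_prod_atlas[OF smooth_atlas_THM Hausdorff_THM smooth_atlas_interval Hausdorff_interval]) simp_all

lemma Hausdorff_PI: "Hausdorff_space (atlas_topology bd_model PI)"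
proof -
  have hM: "Hausdorff_space (atlas_topology UNIV M)" using manifold by (simp add: smooth_manifold_def)
  show ?thesis
    unfolding pair_interval_def UNIV_Times_UNIV[symmetric]
    by (rule Hausdorff_prod_atlas[OF smooth_atlas_prod[OF atlas_M atlas_M] Hausdorff_prod_atlas[OF atlas_M hM atlas_M hM]
      smooth_atlas_interval[OF openin_interval] Hausdorff_interval[OF openin_interval]])
qed

lemma openin_TI_param:
  assumes "open J" shows "openin (atlas_topology bd_model TI) {x \<in> points TI. snd x \<in> J}"
proof -
  have "openin (atlas_topology {0..1} (interval_atlas {0..1::real})) ({0..1} \<inter> J)"
    using openin_chart_preimage[OF smooth_atlas_interval, of "{0..1}" "{0..1}" "({0..1}, \<lambda>t. t)" J] assms
    by (simp add: interval_atlas_def Int_def)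
  from openin_prod_atlas[OF smooth_atlas_THM smooth_atlas_interval openin_points[OF smooth_atlas_THM] this]
  have "openin (atlas_topology bd_model TI) (points (THM_atlas M I H) \<times> ({0..1} \<inter> J))"
    by (simp add: THM_interval_def)
  moreover have "points (THM_atlas M I H) \<times> ({0..1} \<inter> J) = {x \<in> points TI. snd x \<in> J}"
    by (auto simp: points_TI points_THM)
  ultimately show ?thesis by simp
qed

lemma openin_PI_param:
  assumes "open J" shows "openin (atlas_topology bd_model PI) {x \<in> points PI. snd x \<in> J}"
proof -
  have "openin (atlas_topology {0..1} (interval_atlas {0<..1::real})) ({0<..1} \<inter> J)"
    using openin_chart_preimage[OF smooth_atlas_interval[OF openin_interval], of "({0<..1}, \<lambda>t. t)" J] assms
    by (simp add: interval_atlas_def Int_def)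
  from openin_prod_atlas[OF smooth_atlas_prod[OF atlas_M atlas_M] smooth_atlas_interval[OF openin_interval]
    openin_points[OF smooth_atlas_prod[OF atlas_M atlas_M]] this]
  have "openin (atlas_topology bd_model PI) (points (prod_atlas M M) \<times> ({0<..1} \<inter> J))"
    by (simp add: pair_interval_def)
  moreover have "points (prod_atlas M M) \<times> ({0<..1} \<inter> J) = {x \<in> points PI. snd x \<in> J}"
    by (auto simp: points_PI points_prod_atlas)
  ultimately show ?thesis by simp
qed

text \<open>At \<open>t = 0\<close> the transition function is the one of \<open>exp_transition\<close>: the arrows with coordinates \<open>a\<close> and
  \<open>\<nu>\<close> have the same image in the groupoid.\<close>

lemma glued_near_zero:
  assumes e1: "adapted_exp M I H e1" and e2: "adapted_exp M I H e2"
    and W1: "openin (atlas_topology bd_model TI) W1" "THM M I H \<times> {0} \<subseteq> W1"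
    and W2: "openin (atlas_topology bd_model TI) W2" "THM M I H \<times> {0} \<subseteq> W2"
    and v0: "v0 \<in> THM M I H"
  shows "glued_at bd_model TI W1 (psi M I H e1) TI W2 (psi M I H e2) (v0, 0)"
proof -
  obtain U \<phi> F c where c: "c \<in> THM_atlas M I H" "arrow_chart U \<phi> F c" "base_point v0 \<in> U"
    by (rule arrow_chart_at[OF base_point_points[OF v0]])
  note C = arrow_chartD[OF c(2)]
  have v0c: "v0 \<in> fst c" using C(3) v0 c(3) by blast
  obtain m0 a0 where m0: "m0 \<in> U" "v0 = exp_arrow U \<phi> F m0 a0" "base_point v0 = m0" "snd c v0 = (\<phi> m0, a0)"
    by (rule arrow_chart_cases[OF c(2) v0c])
  obtain B r \<nu> where B: "open B" "(\<phi> m0, a0) \<in> B" "B \<subseteq> \<phi> ` U \<times> UNIV" "r > 0"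
    "open_smooth (B \<times> {-r<..<r}) \<nu>" and
    \<nu>0: "\<forall>m\<in>U. \<forall>a. (\<phi> m, a) \<in> B \<longrightarrow> \<nu> ((\<phi> m, a), 0) = a" and
    trans: "\<forall>m\<in>U. \<forall>a. (\<phi> m, a) \<in> B \<longrightarrow> (\<forall>t\<in>{-r<..<r}.
       e2 (dilation M I H t (exp_arrow U \<phi> F m (\<nu> ((\<phi> m, a), t)))) = e1 (dilation M I H t (exp_arrow U \<phi> F m a)))"
    by (fact exp_transition[OF e1 e2 c(1,2) m0(1)])
  define C where "C = (fst c \<times> {0..1::real}, map_prod (snd c) (\<lambda>t::real. t))"
  have CTI: "C \<in> TI"
    unfolding C_def THM_interval_def prod_atlas_iff interval_atlas_def using c(1) by auto
  have fC: "fst C = fst c \<times> {0..1}" and sC: "snd C (v, t) = (snd c v, t)" for v t by (simp_all add: C_def)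
  define S where "S = B \<times> {-r<..<r}"
  \<comment> \<open>The transition function and, below it, its coordinate expression.\<close>
  define g where "g x = (exp_arrow U \<phi> F (base_point (fst x)) (\<nu> (snd c (fst x), snd x)), snd x)" for x
  define k where "k y = ((fst (fst y), \<nu> y), snd y)" for y :: "((real ^ 'd) \<times> (real ^ 'd)) \<times> real"
  have oS: "open S" unfolding S_def by (intro open_Times B(1)) simp
  have \<nu>S: "open_smooth S \<nu>" unfolding S_def by (rule B(5))
  have kS: "open_smooth S k" unfolding k_def
    by (intro open_smooth_Pair \<nu>S open_smooth_fst open_smooth_snd open_smooth_ident oS)
  have p: "(v0, 0::real) \<in> fst C" using v0c by (simp add: fC)
  have pS: "snd C (v0, 0) \<in> S" using B(2,4) by (simp add: sC m0(4) S_def)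
  have near_g: "smooth_near bd_model C C g (v0, 0)"
  proof (rule smooth_nearI[OF p kS pS])
    show "bd_model \<inter> S \<subseteq> snd C ` fst C"
    proof
      fix y assume y: "y \<in> bd_model \<inter> S"
      then have "fst y \<in> snd c ` fst c" "snd y \<in> {0..1}" unfolding C(6) using B(3) by (auto simp: S_def)
      then obtain v where "v \<in> fst c" "fst y = snd c v" by (elim imageE)
      then show "y \<in> snd C ` fst C" using \<open>snd y \<in> {0..1}\<close>
        by (intro image_eqI[of _ _ "(v, snd y)"]) (simp_all add: fC sC prod_eq_iff)
    qed
    fix x assume x: "x \<in> fst C" "snd C x \<in> S"
    obtain v t where vt: "x = (v, t)" by fastforce
    have v: "v \<in> fst c" and t: "t \<in> {0..1}" using x(1) by (simp_all add: vt fC)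
    obtain m a where m: "m \<in> U" "v = exp_arrow U \<phi> F m a" "base_point v = m" "snd c v = (\<phi> m, a)"
      by (rule arrow_chart_cases[OF c(2) v])
    show "g x \<in> fst C \<and> snd C (g x) = k (snd C x)"
      using C(4,5)[OF m(1)] t by (simp add: vt g_def m(3,4) fC sC k_def)
  qed
  have key: "psi M I H e2 (g x) = psi M I H e1 x" if x: "x \<in> fst C" "snd C x \<in> S" for x
  proof -
    obtain v t where vt: "x = (v, t)" by fastforce
    have v: "v \<in> fst c" using x(1) by (simp add: vt fC)
    obtain m a where m: "m \<in> U" "v = exp_arrow U \<phi> F m a" "base_point v = m" "snd c v = (\<phi> m, a)"
      by (rule arrow_chart_cases[OF c(2) v])
    have B': "(\<phi> m, a) \<in> B" "t \<in> {-r<..<r}" using x(2) by (simp_all add: vt sC m(4) S_def)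
    have gx: "g x = (exp_arrow U \<phi> F m (\<nu> ((\<phi> m, a), t)), t)" by (simp add: g_def vt m(3,4))
    show ?thesis
    proof (cases "t = 0")
      case True
      then show ?thesis unfolding gx using \<nu>0 m(1) B'(1) by (simp add: vt psi_def m(2))
    next
      case False
      have "base_point (exp_arrow U \<phi> F m (\<nu> ((\<phi> m, a), t))) = base_point v"
        using exp_arrow_THM(2)[OF C(1) m(1) C(2)] m(3) by simp
      moreover have "e2 (dilation M I H t (exp_arrow U \<phi> F m (\<nu> ((\<phi> m, a), t)))) = e1 (dilation M I H t v)"
        using trans m(1) B' by (simp add: m(2))
      ultimately show ?thesis unfolding gx using False by (simp add: vt psi_def psi_pos_def)
    qed
  qed
  have g0: "g (v0, 0) = (v0, 0)" using \<nu>0 m0(1) B(2) by (simp add: g_def m0(3,4)) (simp add: m0(2))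
  have 0: "(v0, 0) \<in> W1" "(v0, 0) \<in> W2" using W1(2) W2(2) v0 by auto
  have n1: "chart_nbhd C W1 (v0, 0)" by (rule openin_atlas_iff(2)[OF smooth_atlas_TI W1(1) CTI 0(1) p])
  have n2: "chart_nbhd C W2 (g (v0, 0))" unfolding g0 by (rule openin_atlas_iff(2)[OF smooth_atlas_TI W2(1) CTI 0(2) p])
  have n3: "chart_nbhd C {x \<in> fst C. psi M I H e2 (g x) = psi M I H e1 x} (v0, 0)"
    unfolding chart_nbhd_def using p oS pS key by (intro conjI exI[of _ S]) auto
  show ?thesis
  proof (rule glued_atI[OF CTI CTI near_g])
    show "chart_nbhd C {z \<in> W1. g z \<in> W2 \<and> psi M I H e2 (g z) = psi M I H e1 z} (v0, 0)"
      by (rule chart_nbhd_mono[OF chart_nbhd_Int[OF n1 chart_nbhd_Int[OF chart_nbhd_near[OF near_g n2] n3]]]) auto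
  qed
qed

lemma psi_domainD:
  assumes "psi_domain M I H e W"
  defines "W' \<equiv> {(v, t) \<in> W. t > 0}"
  shows "openin (atlas_topology bd_model TI) W" "THM M I H \<times> {0} \<subseteq> W" "inj_on (psi M I H e) W"
    "openin (atlas_topology bd_model PI) (psi_pos M I H e ` W')"
    "diffeomorphism bd_model (sub_atlas TI W') bd_model (sub_atlas PI (psi_pos M I H e ` W')) (psi_pos M I H e)"
    "W \<subseteq> THM M I H \<times> {0..1}" "openin (atlas_topology bd_model TI) W'" "points (sub_atlas TI W') = W'"
proof -
  show o: "openin (atlas_topology bd_model TI) W" "THM M I H \<times> {0} \<subseteq> W" "inj_on (psi M I H e) W"
    "openin (atlas_topology bd_model PI) (psi_pos M I H e ` W')"
    "diffeomorphism bd_model (sub_atlas TI W') bd_model (sub_atlas PI (psi_pos M I H e ` W')) (psi_pos M I H e)"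
    using assms(1) unfolding psi_domain_def Let_def W'_def by simp_all
  show W: "W \<subseteq> THM M I H \<times> {0..1}"
    using openin_subset[OF o(1)] unfolding topspace_atlas[OF smooth_atlas_TI] points_TI .
  have W': "W' = W \<inter> {x \<in> points TI. snd x \<in> {0<..}}" unfolding W'_def points_TI using W by auto
  show "openin (atlas_topology bd_model TI) W'"
    unfolding W' by (intro openin_Int o(1) openin_TI_param) simp
  show "points (sub_atlas TI W') = W'" unfolding points_sub_atlas W' by blast
qed

text \<open>The overlap with \<open>M \<times> M \<times> (0,1]\<close> is the part \<open>t > 0\<close> of \<open>W\<close>, where \<open>\<psi>\<close> is a diffeomorphism by the choice
  of \<open>W\<close>.\<close>

lemma gluing_psi_pairs:
  assumes W: "psi_domain M I H e W"
  shows "gluing bd_model TI W (psi M I H e) PI (points PI) Inr"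
    "gluing bd_model PI (points PI) Inr TI W (psi M I H e)"
proof -
  note D = psi_domainD[OF W]
  let ?W = "{(v, t) \<in> W. t > 0}"
  let ?V = "psi_pos M I H e ` ?W"
  let ?g = "inv_into ?W (psi_pos M I H e)"
  have iI: "inj_on (Inr :: _ \<Rightarrow> 'm arrow + ('m \<times> 'm) \<times> real) (points PI)" by simp
  have oP: "openin (atlas_topology bd_model PI) (points PI)" by (rule openin_points[OF smooth_atlas_PI])
  have VP: "?V \<subseteq> points PI" using openin_subset[OF D(4)] unfolding topspace_atlas[OF smooth_atlas_PI] .
  have sm: "smooth_map bd_model (sub_atlas TI ?W) bd_model (sub_atlas PI ?V) (psi_pos M I H e)"
    "smooth_map bd_model (sub_atlas PI ?V) bd_model (sub_atlas TI ?W) ?g"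
    using D(5) unfolding diffeomorphism_def D(8) by blast+
  note sm1 = sm(1)[unfolded smooth_map_sub_atlas_iff(1)[OF smooth_atlas_TI D(7) smooth_atlas_PI D(4)]]
  note sm2 = sm(2)[unfolded smooth_map_sub_atlas_iff(1)[OF smooth_atlas_PI D(4) smooth_atlas_TI D(7)]]
  have psi_W: "psi M I H e x = Inr (psi_pos M I H e x)" if "x \<in> ?W" for x
    using that by (auto simp: psi_def)
  show "gluing bd_model TI W (psi M I H e) PI (points PI) Inr"
  proof (unfold_locales; (rule smooth_atlas_TI D(1,3) smooth_atlas_PI oP iI)?)
    fix p assume p: "p \<in> W" "psi M I H e p \<in> Inr ` points PI"
    have pW: "p \<in> ?W" using p D(6) by (auto simp: psi_def split: if_splits)
    obtain c d where c: "c \<in> TI" "d \<in> PI" "smooth_near bd_model c d (psi_pos M I H e) p"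
      using sm1 pW by blast
    have pc: "p \<in> fst c" using smooth_near_mem[OF c(3)] by simp
    show "glued_at bd_model TI W (psi M I H e) PI (points PI) Inr p"
    proof (rule glued_atI[OF c], rule chart_nbhd_mono[OF openin_atlas_iff(2)[OF smooth_atlas_TI D(7) c(1) pW pc]], rule subsetI)
      fix z assume z: "z \<in> ?W"
      have "z \<in> W" "psi_pos M I H e z \<in> points PI" using z VP by auto
      then show "z \<in> {z \<in> W. psi_pos M I H e z \<in> points PI \<and> Inr (psi_pos M I H e z) = psi M I H e z}"
        using psi_W[OF z] by simp
    qed
  qed
  show "gluing bd_model PI (points PI) Inr TI W (psi M I H e)"
  proof (unfold_locales; (rule smooth_atlas_TI D(1,3) smooth_atlas_PI oP iI)?)
    fix p assume p: "p \<in> points PI" "Inr p \<in> psi M I H e ` W"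
    have pV: "p \<in> ?V" 
    proof -
      obtain x where x: "x \<in> W" "Inr p = psi M I H e x" using p(2) by blast
      then have "x \<in> ?W" "p = psi_pos M I H e x" using D(6) by (auto simp: psi_def split: if_splits)
      then show ?thesis by blast
    qed
    obtain c d where c: "c \<in> PI" "d \<in> TI" "smooth_near bd_model c d ?g p"
      using sm2 pV by blast
    have pc: "p \<in> fst c" using smooth_near_mem[OF c(3)] by simp
    show "glued_at bd_model PI (points PI) Inr TI W (psi M I H e) p"
    proof (rule glued_atI[OF c], rule chart_nbhd_mono[OF openin_atlas_iff(2)[OF smooth_atlas_PI D(4) c(1) pV pc]], rule subsetI)
      fix z assume z: "z \<in> ?V"
      have 1: "?g z \<in> ?W" "psi_pos M I H e (?g z) = z" using inv_into_into[OF z] f_inv_into_f[OF z] by auto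
      have "?g z \<in> W" "z \<in> points PI" using 1(1) z VP by auto
      then show "z \<in> {z \<in> points PI. ?g z \<in> W \<and> psi M I H e (?g z) = Inr z}"
        using psi_W[OF 1(1)] 1(2) by simp
    qed
  qed
qed

lemma gluing_psi_psi:
  assumes e1: "adapted_exp M I H e1" and e2: "adapted_exp M I H e2"
    and W1: "psi_domain M I H e1 W1" and W2: "psi_domain M I H e2 W2"
  shows "gluing bd_model TI W1 (psi M I H e1) TI W2 (psi M I H e2)"
proof -
  note D1 = psi_domainD[OF W1] and D2 = psi_domainD[OF W2]
  interpret a: gluing bd_model TI W1 "psi M I H e1" PI "points PI" Inr by (rule gluing_psi_pairs(1)[OF W1])
  interpret b: gluing bd_model PI "points PI" Inr TI W2 "psi M I H e2" by (rule gluing_psi_pairs(2)[OF W2])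
  show ?thesis
  proof (unfold_locales; (rule smooth_atlas_TI D1(1,3) D2(1,3))?)
    fix p assume p: "p \<in> W1" "psi M I H e1 p \<in> psi M I H e2 ` W2"
    obtain v t where vt: "p = (v, t)" by fastforce
    have v: "v \<in> THM M I H" "t \<in> {0..1}" using p(1) D1(6) by (auto simp: vt)
    show "glued_at bd_model TI W1 (psi M I H e1) TI W2 (psi M I H e2) p"
    proof (cases "t = 0")
      case True
      then show ?thesis unfolding vt using glued_near_zero[OF e1 e2 D1(1,2) D2(1,2) v(1)] by simp
    next
      case False
      then have pW: "p \<in> {(v, t) \<in> W1. t > 0}" using p(1) v(2) by (simp add: vt)
      have "psi_pos M I H e1 p \<in> points PI"
        using openin_subset[OF D1(4)] imageI[OF pW, of "psi_pos M I H e1"] unfolding topspace_atlas[OF smooth_atlas_PI] by blast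
      moreover have 1: "psi M I H e1 p = Inr (psi_pos M I H e1 p)" using False by (simp add: vt psi_def)
      ultimately have "glued_at bd_model TI W1 (psi M I H e1) PI (points PI) Inr p"
        by (intro a.glued p(1)) simp
      then show ?thesis
      proof (rule glued_at_trans[OF smooth_atlas_PI _ _ smooth_atlas_TI])
        fix q :: "('m \<times> 'm) \<times> real" assume q: "q \<in> points PI" "Inr q = psi M I H e1 p"
        show "glued_at bd_model PI (points PI) Inr TI W2 (psi M I H e2) q"
          by (rule b.glued[OF q(1)]) (use p(2) q(2) in simp)
      qed
    qed
  qed
qed

text \<open>Writing \<open>M \<times> M \<times> (0,1]\<close> as an open subset of itself puts both parts of the atlas in the same form.\<close>

lemma groupoid_atlas_eq:
  "groupoid_atlas M I H e W =
    transport (psi M I H e) (sub_atlas TI W) \<union> transport Inr (sub_atlas PI (points PI))"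
  by (simp add: groupoid_atlas_def sub_atlas_points Un_commute)

lemma smooth_atlas_groupoid:
  assumes "psi_domain M I H e W" shows "smooth_atlas bd_model (groupoid_atlas M I H e W)"
  unfolding groupoid_atlas_eq by (rule smooth_atlas_glue[OF gluing_psi_pairs[OF assms]])

lemma smooth_structure_groupoid:
  assumes e1: "adapted_exp M I H e1" and e2: "adapted_exp M I H e2"
    and W1: "psi_domain M I H e1 W1" and W2: "psi_domain M I H e2 W2"
    and pts: "points (groupoid_atlas M I H e1 W1) = points (groupoid_atlas M I H e2 W2)"
  shows "smooth_structure bd_model (groupoid_atlas M I H e1 W1) = smooth_structure bd_model (groupoid_atlas M I H e2 W2)"
proof (rule smooth_structure_eq[OF _ pts])
  have "smooth_atlas bd_model (transport (psi M I H e1) (sub_atlas TI W1) \<union> transport (psi M I H e2) (sub_atlas TI W2)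
     \<union> transport Inr (sub_atlas PI (points PI)))"
    by (rule smooth_atlas_Un_pairwise[OF smooth_atlas_glue[OF gluing_psi_psi[OF e1 e2 W1 W2] gluing_psi_psi[OF e2 e1 W2 W1]]
      smooth_atlas_glue[OF gluing_psi_pairs[OF W1]] smooth_atlas_glue[OF gluing_psi_pairs[OF W2]]])
  then show "smooth_atlas bd_model (groupoid_atlas M I H e1 W1 \<union> groupoid_atlas M I H e2 W2)"
    unfolding groupoid_atlas_eq by (simp add: Un_ac)
qed

lemma points_groupoid:
  assumes W: "psi_domain M I H e W"
  shows "points (groupoid_atlas M I H e W) = tangent_groupoid M I H"
proof -
  note D = psi_domainD[OF W]
  have pW: "points (sub_atlas TI W) = W" using D(6) by (auto simp: points_sub_atlas points_TI)
  have pts: "points (groupoid_atlas M I H e W) = psi M I H e ` W \<union> Inr ` points PI"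
    unfolding groupoid_atlas_eq points_Un points_transport pW by (simp add: points_sub_atlas)
  have VP: "psi_pos M I H e ` {(v, t) \<in> W. t > 0} \<subseteq> points PI"
    using openin_subset[OF D(4)] unfolding topspace_atlas[OF smooth_atlas_PI] .
  have "psi M I H e x \<in> tangent_groupoid M I H" if x: "x \<in> W" for x
  proof -
    obtain v t where vt: "x = (v, t)" by fastforce
    have v: "v \<in> THM M I H" "t \<in> {0..1}" using x D(6) by (auto simp: vt)
    show ?thesis
    proof (cases "t = 0")
      case True then show ?thesis using v by (simp add: vt psi_def tangent_groupoid_def InlI)
    next
      case False
      then have "x \<in> {(v, t) \<in> W. t > 0}" using x v(2) by (simp add: vt)
      then have "psi_pos M I H e x \<in> points PI" using VP by blast
      then show ?thesis using False by (simp add: vt psi_def tangent_groupoid_def points_PI InrI)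
    qed
  qed
  moreover have "Inl v \<in> psi M I H e ` W" if v: "v \<in> THM M I H" for v
  proof (rule image_eqI[of _ _ "(v, 0)"])
    show "(v, 0) \<in> W" using D(2) v by blast
  qed (simp add: psi_def)
  ultimately show ?thesis
    unfolding pts tangent_groupoid_def points_PI[symmetric] Plus_def by blast
qed

lemma second_countable_groupoid:
  assumes W: "psi_domain M I H e W"
  shows "second_countable (atlas_topology bd_model (groupoid_atlas M I H e W))"
proof (rule second_countable_covered[OF smooth_atlas_groupoid[OF W]])
  have "countably_covered TI" unfolding THM_interval_def
    by (intro countably_covered_prod countably_covered_interval countably_covered_THM)
  moreover have "countably_covered PI" unfolding pair_interval_def
    by (intro countably_covered_prod countably_covered_interval countably_covered_M)
  ultimately show "countably_covered (groupoid_atlas M I H e W)" unfolding groupoid_atlas_eq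
    by (intro countably_covered_Un countably_covered_transport countably_covered_sub)
qed

text \<open>The two open parts of the groupoid are Hausdorff; the new case is that of an arrow and a pair at time
  \<open>t > 0\<close>, which are separated by the open sets of points with parameter below and above \<open>t / 2\<close>.\<close>

lemma Hausdorff_groupoid:
  assumes W: "psi_domain M I H e W"
  shows "Hausdorff_space (atlas_topology bd_model (groupoid_atlas M I H e W))"
proof (rule Hausdorff_atlasI[OF smooth_atlas_groupoid[OF W]])
  note D = psi_domainD[OF W]
  let ?G = "groupoid_atlas M I H e W"
  let ?T = "atlas_topology bd_model ?G" and ?\<psi> = "psi M I H e"
  fix x y assume x: "x \<in> points ?G" and y: "y \<in> points ?G" and ne: "x \<noteq> y"
  have oP: "openin (atlas_topology bd_model PI) (points PI)" by (rule openin_points[OF smooth_atlas_PI])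
  have o1: "openin ?T (?\<psi> ` S)" if "openin (atlas_topology bd_model TI) S" "S \<subseteq> W" for S
    by (rule openin_transport_image[OF smooth_atlas_TI D(1,3) smooth_atlas_groupoid[OF W] _ that])
      (simp add: groupoid_atlas_eq)
  have o2: "openin ?T (Inr ` S)" if "openin (atlas_topology bd_model PI) S" "S \<subseteq> points PI" for S
    by (rule openin_transport_image[OF smooth_atlas_PI oP _ smooth_atlas_groupoid[OF W] _ that])
      (simp_all add: groupoid_atlas_eq)
  have zero: "(v, 0) \<in> W \<and> ?\<psi> (v, 0) = Inl v" if "v \<in> THM M I H" for v
    using D(2) that by (auto simp: psi_def)
  have mixed: "\<exists>S T. openin ?T S \<and> openin ?T T \<and> Inl v \<in> S \<and> Inr q \<in> T \<and> disjnt S T"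
    if v: "v \<in> THM M I H" and q: "q \<in> points PI" for v q
  proof -
    let ?t = "snd q / 2"
    have t: "?t > 0" using q by (auto simp: points_PI)
    let ?A = "W \<inter> {x \<in> points TI. snd x \<in> {..<?t}}" and ?B = "{x \<in> points PI. snd x \<in> {?t<..}}"
    have 1: "openin ?T (?\<psi> ` ?A)" by (rule o1[OF openin_Int[OF D(1) openin_TI_param]]) auto
    have 2: "openin ?T (Inr ` ?B)" by (rule o2[OF openin_PI_param]) auto
    have 3: "Inl v \<in> ?\<psi> ` ?A"
      by (rule image_eqI[of _ _ "(v, 0)"]) (use zero[OF v] t v in \<open>simp_all add: points_TI\<close>)
    have 4: "Inr q \<in> Inr ` ?B" using q t by simp
    have 5: "disjnt (?\<psi> ` ?A) (Inr ` ?B)"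
      by (auto simp: disjnt_iff psi_def psi_pos_def split: if_splits)
    show ?thesis by (rule exI[of _ "?\<psi> ` ?A"], rule exI[of _ "Inr ` ?B"]) (use 1 2 3 4 5 in simp)
  qed
  have xy: "x \<in> Inl ` THM M I H \<or> x \<in> Inr ` points PI" "y \<in> Inl ` THM M I H \<or> y \<in> Inr ` points PI"
    using x y unfolding points_groupoid[OF W] tangent_groupoid_def points_PI[symmetric] Plus_def by blast+
  have "\<exists>S T. openin ?T S \<and> openin ?T T \<and> x \<in> S \<and> y \<in> T \<and> disjnt S T"
    using xy
  proof (elim disjE imageE)
    fix v w assume v: "x = Inl v" "v \<in> THM M I H" "y = Inl w" "w \<in> THM M I H"
    have vw: "(v, 0) \<in> points TI" "(w, 0) \<in> points TI" "(v, 0::real) \<noteq> (w, 0)"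
      using v ne by (simp_all add: points_TI)
    obtain S T where S: "openin (atlas_topology bd_model TI) S" "openin (atlas_topology bd_model TI) T"
      "(v, 0) \<in> S" "(w, 0) \<in> T" "disjnt S T" by (rule Hausdorff_atlasE[OF smooth_atlas_TI Hausdorff_TI vw])
    have 1: "openin ?T (?\<psi> ` (W \<inter> S))" "openin ?T (?\<psi> ` (W \<inter> T))"
      using o1[OF openin_Int[OF D(1) S(1)]] o1[OF openin_Int[OF D(1) S(2)]] by auto
    have 2: "x \<in> ?\<psi> ` (W \<inter> S)" "y \<in> ?\<psi> ` (W \<inter> T)"
      using zero[OF v(2)] zero[OF v(4)] S(3,4) v(1,3) by (metis IntI imageI)+
    have 3: "disjnt (?\<psi> ` (W \<inter> S)) (?\<psi> ` (W \<inter> T))"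
      using inj_on_image_Int[OF D(3), of "W \<inter> S" "W \<inter> T"] S(5) by (auto simp: disjnt_def)
    show ?thesis by (rule exI[of _ "?\<psi> ` (W \<inter> S)"], rule exI[of _ "?\<psi> ` (W \<inter> T)"]) (use 1 2 3 in simp)
  next
    fix v q assume v: "x = Inl v" "v \<in> THM M I H" "y = Inr q" "q \<in> points PI"
    then show ?thesis using mixed by simp
  next
    fix q v assume v: "x = Inr q" "q \<in> points PI" "y = Inl v" "v \<in> THM M I H"
    obtain S T where "openin ?T S" "openin ?T T" "Inl v \<in> S" "Inr q \<in> T" "disjnt S T"
      using mixed[OF v(4,2)] by (elim exE conjE)
    then show ?thesis using v(1,3) by (intro exI[of _ T] exI[of _ S]) (simp add: disjnt_sym)
  next
    fix p q assume v: "x = Inr p" "p \<in> points PI" "y = Inr q" "q \<in> points PI"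
    have pq: "p \<noteq> q" using ne v by simp
    obtain S T where S: "openin (atlas_topology bd_model PI) S" "openin (atlas_topology bd_model PI) T"
      "p \<in> S" "q \<in> T" "disjnt S T" by (rule Hausdorff_atlasE[OF smooth_atlas_PI Hausdorff_PI v(2,4) pq])
    have sub: "S \<subseteq> points PI" "T \<subseteq> points PI"
      using openin_subset[OF S(1)] openin_subset[OF S(2)] unfolding topspace_atlas[OF smooth_atlas_PI] .
    have 3: "disjnt (Inr ` S :: ('m arrow + ('m \<times> 'm) \<times> real) set) (Inr ` T)" using S(5) by (auto simp: disjnt_def)
    show ?thesis by (rule exI[of _ "Inr ` S"], rule exI[of _ "Inr ` T"])
      (use o2[OF S(1) sub(1)] o2[OF S(2) sub(2)] S(3,4) v 3 in simp)
  qed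
  then show "(\<exists>c\<in>?G. x \<in> fst c \<and> y \<in> fst c) \<or>
     (\<exists>S T. openin ?T S \<and> openin ?T T \<and> x \<in> S \<and> y \<in> T \<and> disjnt S T)" by (rule disjI2)
qed

lemma smooth_manifold_groupoid:
  "psi_domain M I H e W \<Longrightarrow> smooth_manifold bd_model (groupoid_atlas M I H e W)"
  unfolding smooth_manifold_def
  using smooth_atlas_groupoid Hausdorff_groupoid second_countable_groupoid by blast

end

theorem proposition21:
  fixes M :: "('m, real ^ 'd) atlas" and I :: "'d set" and H :: "'m \<Rightarrow> 'm tvector set"
    and e1 e2 :: "'m arrow \<Rightarrow> 'm" and W1 W2 :: "('m arrow \<times> real) set"
  assumes "smooth_manifold UNIV M" and "distribution M I H"
    and "adapted_exp M I H e1" and "adapted_exp M I H e2"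
    and "psi_domain M I H e1 W1" and "psi_domain M I H e2 W2"
  shows "(let A = THM_interval M I H; \<psi>1 = psi M I H e1; \<psi>2 = psi M I H e2;
           D1 = {x \<in> W1. \<psi>1 x \<in> \<psi>2 ` W2}; D2 = {x \<in> W2. \<psi>2 x \<in> \<psi>1 ` W1} in
         openin (atlas_topology bd_model A) D1 \<and> openin (atlas_topology bd_model A) D2 \<and>
         diffeomorphism bd_model (sub_atlas A D1) bd_model (sub_atlas A D2)
           (inv_into W2 \<psi>2 \<circ> \<psi>1)) \<and>
      (\<forall>(e, W) \<in> {(e1, W1), (e2, W2)}.
         points (groupoid_atlas M I H e W) = tangent_groupoid M I H \<and>
         smooth_manifold bd_model (groupoid_atlas M I H e W)) \<and>
      smooth_structure bd_model (groupoid_atlas M I H e1 W1) =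
        smooth_structure bd_model (groupoid_atlas M I H e2 W2)"
proof -
  interpret distributed_manifold M I H by unfold_locales (fact assms)+
  note pts = points_groupoid[OF assms(5)] points_groupoid[OF assms(6)]
  have g: "gluing bd_model (THM_interval M I H) W1 (psi M I H e1) (THM_interval M I H) W2 (psi M I H e2)"
    "gluing bd_model (THM_interval M I H) W2 (psi M I H e2) (THM_interval M I H) W1 (psi M I H e1)"
    by (rule gluing_psi_psi[OF assms(3-6)], rule gluing_psi_psi[OF assms(4,3,6,5)])
  show ?thesis unfolding Let_def
  proof (intro conjI)
    show "\<forall>(e, W)\<in>{(e1, W1), (e2, W2)}. points (groupoid_atlas M I H e W) = tangent_groupoid M I H \<and>
        smooth_manifold bd_model (groupoid_atlas M I H e W)"
      using pts smooth_manifold_groupoid[OF assms(5)] smooth_manifold_groupoid[OF assms(6)] by simp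
    show "smooth_structure bd_model (groupoid_atlas M I H e1 W1) = smooth_structure bd_model (groupoid_atlas M I H e2 W2)"
      by (rule smooth_structure_groupoid[OF assms(3-6)]) (simp add: pts)
  qed (rule gluing.openin_overlap[OF g(1)] gluing.openin_overlap[OF g(2)] diffeomorphism_glue[OF g])+
qed

end
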